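(* Let $S,\kappa,\varepsilon,\varrho,\xi,\mu_i,M,N,T,\varphi_m,Y$ be as in the context. Let $y=(y_1,\dots,y_M)\in T^M$ with $P(Y=y)>0$, and let $\{(t^k,\boldsymbol u_M^{*,k})\}_{k=1}^\infty$ be independent weighted simulations (each constructed from $y$ as in the context), with corresponding total weights $V_k$. Then, almost surely, in the sense of weak convergence of Borel probability measures on $M_1^M$, $$\mathcal L(\boldsymbol\mu_M\mid Y=y)=\lim_{K\to\infty}\frac{\sum_{k=1}^K V_k\,\delta(\boldsymbol u_M^{*,k})}{\sum_{k=1}^K V_k},$$ where $\boldsymbol\mu_M=(\mu_1,\dots,\mu_M)$ and $\delta(\boldsymbol u_M^{*,k})$ is the point mass on $M_1^M$ at $\boldsymbol u_M^{*,k}$. Consequently, if $\Phi$ is a measurable function on $M_1^M$ taking values in a metric space, and $P(\boldsymbol\mu_M\in D^c\mid Y=y)=1$, where $D\subseteq M_1^M$ is the set of discontinuities of $\Phi$, then, almost surely and in the sense of weak convergence, $$\mathcal L(\Phi(\boldsymbol\mu_M)\mid Y=y)=\lim_{K\to\infty}\frac{\sum_{k=1}^K V_k\,\delta(\Phi(\boldsymbol u_M^{*,k}))}{\sum_{k=1}^K V_k}.$$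
   Context: $S$ is a complete separable metric space with Borel $\sigma$-algebra $\mathcal S$; $M_1=M_1(S)$ is the set of Borel probability measures on $S$ with the Prohorov metric (a complete separable metric space). For a nonzero finite measure $\alpha$ on a complete separable metric space, $\mathcal D(\alpha)$ is the law of a Dirichlet process with parameter $\alpha$, i.e. of a random probability measure $\lambda$ with $(\lambda(B_0),\dots,\lambda(B_d))\sim\mathrm{Dir}(\alpha(B_0),\dots,\alpha(B_d))$ for every measurable partition $\{B_0,\dots,B_d\}$. $\mathcal L(X)$ and $\mathcal L(X\mid\cdot)$ denote law and (regular) conditional law. Nested Dirichlet process: fix $\kappa,\varepsilon>0$ and a Borel probability measure $\varrho$ on $S$. Let $\varpi$ be a random probability measure on $M_1$ with $\varpi\sim\mathcal D(\kappa\,\mathcal D(\varepsilon\varrho))$. Given $\varpi$, the random measures $\mu_1,\mu_2,\dots$ are i.i.d. with law $\varpi$. The array $\xi=\{\xi_{ij}\}_{i,j\in\mathbb N}$ of $S$-valued random variables is such that, given $\varpi$ and $\mu=\{\mu_i\}$, all entries are independent with $\xi_{ij}\sim\mu_i$. Put $X_{in}=(\xi_{i1},\dots,\xi_{in})$ and $\varrho_n=\mathcal L(X_{in})$, a probability measure on $S^n$ (not depending on $i$). Observations: fix $M,N\in\mathbb N$, a countable set $T$ (with the discrete $\sigma$-algebra), and measurable $\varphi_m:S^N\to T$, $1\le m\le M$. Let $Y_m=\varphi_m(X_{mN})$ and $Y=(Y_1,\dots,Y_M)$. For $y_m\in T$ let $A_m=\varphi_m^{-1}(\{y_m\})\subseteq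 S^N$ and, when $\varrho_N(A_m)>0$, let $\varrho_N(\cdot\mid A_m)=\varrho_N(\cdot\cap A_m)/\varrho_N(A_m)$. Weighted simulation: given $y=(y_1,\dots,y_M)\in T^M$ with $P(Y=y)>0$, a weighted simulation is a pair $(t,\boldsymbol u_M^* )$, independent of $Y$, where $t=\{t_{mi}:1\le m\le M,1\le i\le m\}$ are $[0,\infty)$-valued random variables and $\boldsymbol u_M^*=(u_1^*,\dots,u_M^* )$ are $M_1$-valued random variables, constructed recursively in $m$ by $$t_{mi}=(u_i^* )^N(A_m)\ \ (1\le i<m),\qquad t_{mm}=\kappa\,\varrho_N(A_m),$$ where $(u_i^* )^N$ is the $N$-fold product measure, and, with $\boldsymbol u_{m-1}^*=(u_1^*,\dots,u_{m-1}^* )$, $$\mathcal L(u_m^*\mid\boldsymbol u_{m-1}^* )=\frac{1}{\sum_{i=1}^m t_{mi}}\Big(t_{mm}\int_{S^N}\mathcal D\Big(\varepsilon\varrho+\sum_{n=1}^N\delta_{x_n}\Big)\,\varrho_N(dx\mid A_m)+\sum_{i=1}^{m-1}t_{mi}\,\delta_{u_i^*}\Big).$$ Its total weight is $V=\prod_{m=1}^M\frac{1}{\kappa+m-1}\sum_{i=1}^m t_{mi}$. *)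

theory Defs
  imports "HOL-Probability.Probability"
begin

section \<open>Finite sums of measures\<close>

definition measure_sum :: "'a measure \<Rightarrow> 'i set \<Rightarrow> ('i \<Rightarrow> 'a measure) \<Rightarrow> 'a measure" where
  "measure_sum L I Q = measure_of (space L) (sets L) (\<lambda>B. \<Sum>i\<in>I. emeasure (Q i) B)"

definition measure_plus :: "'a measure \<Rightarrow> 'a measure \<Rightarrow> 'a measure" where
  "measure_plus P Q = measure_of (space P) (sets P) (\<lambda>B. emeasure P B + emeasure Q B)"

lemma space_measure_sum [simp]: "space (measure_sum L I Q) = space L"
  and sets_measure_sum [simp, measurable_cong]: "sets (measure_sum L I Q) = sets L"
  and space_measure_plus [simp]: "space (measure_plus P P') = space P"
  and sets_measure_plus [simp, measurable_cong]: "sets (measure_plus P P') = sets P"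
  by (simp_all add: measure_sum_def measure_plus_def)

lemma emeasure_measure_sum:
  assumes "\<And>i. i \<in> I \<Longrightarrow> sets (Q i) = sets L" "B \<in> sets L"
  shows "emeasure (measure_sum L I Q) B = (\<Sum>i\<in>I. emeasure (Q i) B)"
proof (rule emeasure_measure_of[OF measure_sum_def])
  show "countably_additive (sets (measure_sum L I Q)) (\<lambda>B. \<Sum>i\<in>I. emeasure (Q i) B)"
  proof (rule countably_additiveI)
    fix C :: "nat \<Rightarrow> _" assume C: "range C \<subseteq> sets (measure_sum L I Q)" "disjoint_family C"
    have "(\<Sum>n. \<Sum>i\<in>I. emeasure (Q i) (C n)) = (\<Sum>i\<in>I. \<Sum>n. emeasure (Q i) (C n))"
      by (rule suminf_sum) auto
    also have "\<dots> = (\<Sum>i\<in>I. emeasure (Q i) (\<Union>n. C n))"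
      using C assms by (intro sum.cong refl suminf_emeasure) auto
    finally show "(\<Sum>n. \<Sum>i\<in>I. emeasure (Q i) (C n)) = (\<Sum>i\<in>I. emeasure (Q i) (\<Union>n. C n))" .
  qed
qed (use assms in \<open>auto simp: positive_def dest: sets.sets_into_space\<close>)

lemma emeasure_measure_plus:
  assumes "sets Q = sets P" "B \<in> sets P"
  shows "emeasure (measure_plus P Q) B = emeasure P B + emeasure Q B"
proof (rule emeasure_measure_of[OF measure_plus_def])
  show "countably_additive (sets (measure_plus P Q)) (\<lambda>B. emeasure P B + emeasure Q B)"
  proof (rule countably_additiveI)
    fix C :: "nat \<Rightarrow> _" assume C: "range C \<subseteq> sets (measure_plus P Q)" "disjoint_family C"
    have "(\<Sum>n. emeasure P (C n) + emeasure Q (C n))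
        = (\<Sum>n. emeasure P (C n)) + (\<Sum>n. emeasure Q (C n))"
      by (rule suminf_add[symmetric]) auto
    then show "(\<Sum>n. emeasure P (C n) + emeasure Q (C n))
        = emeasure P (\<Union>n. C n) + emeasure Q (\<Union>n. C n)"
      using C assms by (simp add: suminf_emeasure)
  qed
qed (use assms in \<open>auto simp: positive_def dest: sets.sets_into_space\<close>)

section \<open>The space of Borel probability measures with the Prohorov metric\<close>

text \<open>
  As a measurable space, the set \<open>M\<^sub>1(S)\<close> is the library's \<^term>\<open>prob_algebra borel\<close>, whose
  \<open>\<sigma>\<close>-algebra is generated by the evaluations \<open>p \<mapsto> p B\<close>; for separable \<open>S\<close> it
  coincides with the Borel \<open>\<sigma>\<close>-algebra of the Prohorov metric.
\<close>

definition prohorov :: "'s::metric_space measure \<Rightarrow> 's measure \<Rightarrow> real" where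
  "prohorov p q =
    (if p \<in> space (prob_algebra borel) \<and> q \<in> space (prob_algebra borel)
     then Inf {e. 0 < e \<and> (\<forall>A\<in>sets borel.
            measure p A \<le> measure q (\<Union>a\<in>A. ball a e) + e \<and>
            measure q A \<le> measure p (\<Union>a\<in>A. ball a e) + e)}
     else 0)"

definition prohorov_topology :: "'s::metric_space measure topology" where
  "prohorov_topology = Metric_space.mtopology (space (prob_algebra borel)) prohorov"

context
begin

private definition feas :: "'s::metric_space measure \<Rightarrow> 's measure \<Rightarrow> real set" where
  "feas p q = {e. 0 < e \<and> (\<forall>A\<in>sets borel.
            measure p A \<le> measure q (\<Union>a\<in>A. ball a e) + e \<and>
            measure q A \<le> measure p (\<Union>a\<in>A. ball a e) + e)}"

private lemma nbhd_sets [simp, intro]: "(\<Union>a\<in>A. ball a e) \<in> sets borel"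
  by (intro borel_open open_UN) auto

private lemma feas_ge1:
  assumes "p \<in> space (prob_algebra borel)" "q \<in> space (prob_algebra borel)" "1 \<le> e"
  shows "e \<in> feas p q"
proof -
  interpret p: prob_space p using assms by (simp add: space_prob_algebra)
  interpret q: prob_space q using assms by (simp add: space_prob_algebra)
  have "measure p A \<le> measure q B + e" "measure q A \<le> measure p B + e" for A B
    using assms(3) p.prob_le_1[of A] q.prob_le_1[of A] measure_nonneg[of q B] measure_nonneg[of p B]
    by linarith+
  then show ?thesis using assms(3) by (auto simp: feas_def)
qed

private lemma feas_bdd: "bdd_below (feas p q)"
  by (rule bdd_belowI[of _ 0]) (auto simp: feas_def)

private lemma feas_mono:
  assumes "p \<in> space (prob_algebra borel)" "q \<in> space (prob_algebra borel)" "e \<in> feas p q" "e \<le> e'"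
  shows "e' \<in> feas p q"
proof -
  interpret p: prob_space p using assms by (simp add: space_prob_algebra)
  interpret q: prob_space q using assms by (simp add: space_prob_algebra)
  have s: "sets p = sets borel" "sets q = sets borel" using assms by (simp_all add: space_prob_algebra)
  have sub: "(\<Union>a\<in>A. ball a e) \<subseteq> (\<Union>a\<in>A. ball a e')" for A :: "'a set"
    using assms(4) by (intro UN_mono subset_refl subset_ball)
  have "measure p A \<le> measure q (\<Union>a\<in>A. ball a e') + e' \<and>
      measure q A \<le> measure p (\<Union>a\<in>A. ball a e') + e'" if A: "A \<in> sets borel" for A
  proof -
    have "measure p (\<Union>a\<in>A. ball a e) \<le> measure p (\<Union>a\<in>A. ball a e')"
      by (rule p.finite_measure_mono[OF sub]) (simp add: s)
    moreover have "measure q (\<Union>a\<in>A. ball a e) \<le> measure q (\<Union>a\<in>A. ball a e')"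
      by (rule q.finite_measure_mono[OF sub]) (simp add: s)
    moreover have "measure p A \<le> measure q (\<Union>a\<in>A. ball a e) + e"
        "measure q A \<le> measure p (\<Union>a\<in>A. ball a e) + e"
      using assms(3) A unfolding feas_def by blast+
    ultimately show ?thesis using assms(4) by linarith
  qed
  moreover have "0 < e'" using assms(3,4) by (auto simp: feas_def)
  ultimately show ?thesis by (simp add: feas_def)
qed

private lemma feas_gt:
  assumes "p \<in> space (prob_algebra borel)" "q \<in> space (prob_algebra borel)" "Inf (feas p q) < e"
  shows "e \<in> feas p q"
proof -
  have "feas p q \<noteq> {}" using feas_ge1[OF assms(1,2), of 1] by auto
  then obtain d where "d \<in> feas p q" "d < e"
    using assms(3) cInf_less_iff[OF _ feas_bdd] by blast
  then show ?thesis using feas_mono[OF assms(1,2)] by auto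
qed

private lemma feas_zero_le:
  assumes P: "p \<in> space (prob_algebra borel)" "q \<in> space (prob_algebra borel)"
    and z: "Inf (feas p q) = 0" and A: "closed A"
  shows "measure p A \<le> measure q A"
proof -
  interpret q: prob_space q using P by (simp add: space_prob_algebra)
  have s: "sets q = sets borel" using P by (simp add: space_prob_algebra)
  define B where "B n = (\<Union>a\<in>A. ball a (inverse (real (Suc n))))" for n
  have "(\<Inter>n. B n) = A"
  proof
    show "(\<Inter>n. B n) \<subseteq> A"
    proof
      fix x assume x: "x \<in> (\<Inter>n. B n)"
      have "\<exists>y\<in>A. dist y x < e" if e: "0 < e" for e
      proof -
        obtain n where n: "inverse (real (Suc n)) < e" using reals_Archimedean[OF e] by blast
        have "x \<in> B n" using x by blast
        then obtain a where "a \<in> A" "dist a x < inverse (real (Suc n))" by (auto simp: B_def)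
        then show ?thesis using n by (intro bexI[of _ a]) linarith+
      qed
      then have "x \<in> closure A" by (auto simp: closure_approachable)
      then show "x \<in> A" using A by simp
    qed
    show "A \<subseteq> (\<Inter>n. B n)"
    proof (intro subsetI INT_I)
      fix x n assume "x \<in> A"
      then show "x \<in> B n" unfolding B_def by (intro UN_I[of x]) auto
    qed
  qed
  moreover have "decseq B"
  proof (rule decseq_SucI)
    fix n
    have "inverse (real (Suc (Suc n))) \<le> inverse (real (Suc n))" by (simp add: field_simps)
    then show "B (Suc n) \<subseteq> B n" unfolding B_def by (intro UN_mono subset_refl subset_ball)
  qed
  ultimately have "(\<lambda>n. measure q (B n)) \<longlonglongrightarrow> measure q A"
    using q.finite_Lim_measure_decseq[of B] s by (auto simp: B_def simp del: UN_simps)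
  then have "(\<lambda>n. measure q (B n) + inverse (real (Suc n))) \<longlonglongrightarrow> measure q A + 0"
    by (intro tendsto_add LIMSEQ_inverse_real_of_nat)
  moreover have "measure p A \<le> measure q (B n) + inverse (real (Suc n))" for n
  proof -
    have "inverse (real (Suc n)) \<in> feas p q" by (rule feas_gt[OF P]) (simp add: z)
    then show ?thesis using borel_closed[OF A] unfolding feas_def B_def by blast
  qed
  ultimately have "measure p A \<le> measure q A + 0"
    by (intro LIMSEQ_le_const) auto
  then show ?thesis by simp
qed

private lemma feas_commute: "feas p q = feas q p"
  by (auto simp: feas_def)

private lemma feas_add:
  assumes P: "p \<in> space (prob_algebra borel)" "q \<in> space (prob_algebra borel)"
      "r \<in> space (prob_algebra borel)" and "d \<in> feas p q" "e \<in> feas q r"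
  shows "d + e \<in> feas p r"
proof -
  have *: "measure p A \<le> measure r (\<Union>a\<in>A. ball a (d + e)) + (d + e)"
    if P: "p \<in> space (prob_algebra borel)" "q \<in> space (prob_algebra borel)"
      "r \<in> space (prob_algebra borel)" and de: "d \<in> feas p q" "e \<in> feas q r" and A: "A \<in> sets borel"
    for p q r :: "'a measure" and d e A
  proof -
    interpret r: prob_space r using P by (simp add: space_prob_algebra)
    have s: "sets r = sets borel" using P by (simp add: space_prob_algebra)
    define C where "C = (\<Union>a\<in>A. ball a d)"
    have "(\<Union>a\<in>C. ball a e) \<subseteq> (\<Union>a\<in>A. ball a (d + e))"
    proof
      fix x assume "x \<in> (\<Union>a\<in>C. ball a e)"
      then obtain a c where ac: "a \<in> A" "dist a c < d" "dist c x < e" by (auto simp: C_def)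
      then have "dist a x < d + e" using dist_triangle[of a x c] by linarith
      then show "x \<in> (\<Union>a\<in>A. ball a (d + e))" using ac(1) by auto
    qed
    then have "measure r (\<Union>a\<in>C. ball a e) \<le> measure r (\<Union>a\<in>A. ball a (d + e))"
      by (rule r.finite_measure_mono) (simp add: s)
    moreover have "measure p A \<le> measure q C + d" using de A unfolding feas_def C_def by blast
    moreover have "measure q C \<le> measure r (\<Union>a\<in>C. ball a e) + e"
    proof -
      have "C \<in> sets borel" unfolding C_def by (rule nbhd_sets)
      then show ?thesis using de unfolding feas_def by blast
    qed
    ultimately show ?thesis by linarith
  qed
  have "measure r A \<le> measure p (\<Union>a\<in>A. ball a (d + e)) + (d + e)" if "A \<in> sets borel" for A
    using *[OF P(3,2,1), of e d A] assms(4,5) that by (simp add: feas_commute[of r q] feas_commute[of q p] add.commute)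
  moreover have "0 < d + e" using assms(4,5) by (simp add: feas_def)
  ultimately show ?thesis
    using *[OF P assms(4,5)] by (simp add: feas_def[of p r])
qed

lemma Metric_space_prohorov:
  "Metric_space (space (prob_algebra (borel :: 's::metric_space measure))) prohorov"
proof -
  let ?M = "space (prob_algebra (borel :: 's measure))"
  have pr: "prohorov p q = Inf (feas p q)" if "p \<in> ?M" "q \<in> ?M" for p q :: "'s measure"
    using that by (simp add: prohorov_def feas_def)
  have nn: "0 \<le> prohorov p q" for p q :: "'s measure"
  proof (cases "p \<in> ?M \<and> q \<in> ?M")
    case True
    then have "feas p q \<noteq> {}" using feas_ge1[of p q 1] by auto
    then show ?thesis using True unfolding pr[OF conjunct1[OF True] conjunct2[OF True]]
      by (intro cInf_greatest) (auto simp: feas_def)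
  next
    case False
    then show ?thesis unfolding prohorov_def by (subst if_not_P) auto
  qed
  show ?thesis
  proof
    fix p q :: "'s measure"
    show "0 \<le> prohorov p q" by (rule nn)
    show "prohorov p q = prohorov q p" by (simp add: prohorov_def conj_commute)
  next
    fix p q :: "'s measure" assume P: "p \<in> ?M" "q \<in> ?M"
    show "prohorov p q = 0 \<longleftrightarrow> p = q"
    proof
      assume "p = q"
      interpret p: prob_space p using P by (simp add: space_prob_algebra)
      have s: "sets p = sets borel" using P by (simp add: space_prob_algebra)
      have "e \<in> feas p p" if "0 < e" for e
      proof -
        have "measure p A \<le> measure p (\<Union>a\<in>A. ball a e) + e" for A
        proof -
          have "measure p A \<le> measure p (\<Union>a\<in>A. ball a e)"
          proof (rule p.finite_measure_mono)
            show "A \<subseteq> (\<Union>a\<in>A. ball a e)"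
            proof
              fix x assume "x \<in> A"
              then show "x \<in> (\<Union>a\<in>A. ball a e)" using that by (intro UN_I[of x]) auto
            qed
          qed (simp add: s)
          then show ?thesis using that by simp
        qed
        then show ?thesis using that by (auto simp: feas_def)
      qed
      then have "Inf (feas p p) \<le> e" if "0 < e" for e
        using that by (intro cInf_lower feas_bdd) auto
      then have "Inf (feas p p) \<le> 0" by (rule field_le_epsilon) simp
      then show "prohorov p q = 0" using nn[of p q] \<open>p = q\<close> P by (simp add: pr)
    next
      assume "prohorov p q = 0"
      then have z: "Inf (feas p q) = 0" "Inf (feas q p) = 0"
        using P by (simp_all add: pr feas_commute[of q p])
      have eq: "measure p A = measure q A" if "closed A" for A
        using feas_zero_le[OF P z(1) that] feas_zero_le[OF P(2,1) z(2) that] by simp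
      interpret p: prob_space p using P by (simp add: space_prob_algebra)
      interpret q: prob_space q using P by (simp add: space_prob_algebra)
      have s: "sets p = sets borel" "sets q = sets borel" using P by (simp_all add: space_prob_algebra)
      have b: "sets (borel :: 's measure) = sigma_sets UNIV (Collect closed)"
        by (subst borel_eq_closed) simp
      show "p = q"
      proof (rule measure_eqI_generator_eq[where E="Collect closed" and \<Omega>=UNIV and A="\<lambda>_. UNIV"])
        show "Int_stable (Collect closed :: 's set set)" by (auto simp: Int_stable_def)
        show "emeasure p X = emeasure q X" if "X \<in> Collect closed" for X
          using eq[of X] that by (simp add: p.emeasure_eq_measure q.emeasure_eq_measure)
      qed (auto simp: s b)
    qed
  next
    fix p q r :: "'s measure" assume P: "p \<in> ?M" "q \<in> ?M" "r \<in> ?M"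
    show "prohorov p r \<le> prohorov p q + prohorov q r"
    proof (rule field_le_epsilon)
      fix e :: real assume "0 < e"
      then have "prohorov p q + e/2 \<in> feas p q" "prohorov q r + e/2 \<in> feas q r"
        using P by (simp_all add: feas_gt pr)
      then have "(prohorov p q + e/2) + (prohorov q r + e/2) \<in> feas p r"
        by (rule feas_add[OF P])
      then have "Inf (feas p r) \<le> (prohorov p q + e/2) + (prohorov q r + e/2)"
        by (rule cInf_lower[OF _ feas_bdd])
      then show "prohorov p r \<le> prohorov p q + prohorov q r + e" using P by (simp add: pr)
    qed
  qed
qed

end

abbreviation M1_power :: "nat \<Rightarrow> (nat \<Rightarrow> 's::metric_space measure) topology" where
  "M1_power M \<equiv> product_topology (\<lambda>_. prohorov_topology) {1..M}"

section \<open>Weak convergence on a topological space\<close>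

definition borel_of :: "'a topology \<Rightarrow> 'a measure" where
  "borel_of X = sigma (topspace X) {U. openin X U}"

text \<open>
  Only eventually are the approximating measures required to be probability measures, since a
  normalised weighted sum is not one as long as its total weight vanishes (for instance the empty
  sum).
\<close>

definition weakly_converges :: "'a topology \<Rightarrow> (nat \<Rightarrow> 'a measure) \<Rightarrow> 'a measure \<Rightarrow> bool" where
  "weakly_converges X Q L \<longleftrightarrow>
     L \<in> space (prob_algebra (borel_of X)) \<and>
     (\<forall>\<^sub>F K in sequentially. Q K \<in> space (prob_algebra (borel_of X))) \<and>
     (\<forall>f. continuous_map X euclideanreal f \<and> bounded (f ` topspace X) \<longrightarrow>
        (\<lambda>K. \<integral>x. f x \<partial>Q K) \<longlonglongrightarrow> (\<integral>x. f x \<partial>L))"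

text \<open>\<open>(\<Sum>k\<le>K. V\<^sub>k \<delta>(z\<^sub>k)) / (\<Sum>k\<le>K. V\<^sub>k)\<close>, as a measure on the measurable space \<open>L\<close>\<close>

definition weighted_empirical :: "'a measure \<Rightarrow> (nat \<Rightarrow> real) \<Rightarrow> (nat \<Rightarrow> 'a) \<Rightarrow> nat \<Rightarrow> 'a measure" where
  "weighted_empirical L V z K =
     scale_measure (ennreal (1 / (\<Sum>k=1..K. V k)))
       (measure_sum L {1..K} (\<lambda>k. scale_measure (ennreal (V k)) (return L (z k))))"

section \<open>Dirichlet processes\<close>

text \<open>
  The Dirichlet distribution is the law of a normalised vector of independent Gamma variables with
  unit scale; the convention \<open>Gamma(0) = \<delta>\<^sub>0\<close> covers partition blocks of \<open>\<alpha>\<close>-measure \<open>0\<close>.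
\<close>

definition gamma_measure :: "real \<Rightarrow> real measure" where
  "gamma_measure a =
     (if a = 0 then return borel 0
      else density lborel (\<lambda>x. ennreal (if 0 < x then x powr (a - 1) * exp (- x) / Gamma a else 0)))"

definition dirichlet_measure :: "'i set \<Rightarrow> ('i \<Rightarrow> real) \<Rightarrow> ('i \<Rightarrow> real) measure" where
  "dirichlet_measure I a =
     distr (\<Pi>\<^sub>M i\<in>I. gamma_measure (a i)) (\<Pi>\<^sub>M i\<in>I. borel) (\<lambda>g. \<lambda>i\<in>I. g i / (\<Sum>j\<in>I. g j))"

definition is_dirichlet_process :: "'a measure \<Rightarrow> 'a measure measure \<Rightarrow> bool" where
  "is_dirichlet_process \<alpha> Q \<longleftrightarrow>
     Q \<in> space (prob_algebra (prob_algebra \<alpha>)) \<and>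
     (\<forall>d (B :: nat \<Rightarrow> 'a set).
        (\<forall>i\<le>d. B i \<in> sets \<alpha>) \<and> disjoint_family_on B {..d} \<and> (\<Union>i\<le>d. B i) = space \<alpha> \<longrightarrow>
        distr Q (\<Pi>\<^sub>M i\<in>{..d}. borel) (\<lambda>l. \<lambda>i\<in>{..d}. measure l (B i))
          = dirichlet_measure {..d} (\<lambda>i. measure \<alpha> (B i)))"

text \<open>For nonzero finite \<open>\<alpha>\<close> there is exactly one such law.\<close>

definition dirichlet_process :: "'a measure \<Rightarrow> 'a measure measure" where
  "dirichlet_process \<alpha> = (THE Q. is_dirichlet_process \<alpha> Q)"

section \<open>Regular conditional laws\<close>

text \<open>\<open>\<L>(X | Z) = \<K>\<close>, where \<open>\<K> \<omega>\<close> is a measure on \<open>L\<close> that depends on \<open>\<omega>\<close> through \<open>Z \<omega>\<close>\<close>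

definition has_cond_law ::
  "'w measure \<Rightarrow> ('w \<Rightarrow> 'a) \<Rightarrow> 'a measure \<Rightarrow> ('w \<Rightarrow> 'b) \<Rightarrow> 'b measure \<Rightarrow> ('w \<Rightarrow> 'a measure) \<Rightarrow> bool"
where
  "has_cond_law \<Omega> X L Z L' \<K> \<longleftrightarrow>
     X \<in> \<Omega> \<rightarrow>\<^sub>M L \<and> Z \<in> \<Omega> \<rightarrow>\<^sub>M L' \<and>
     \<K> \<in> vimage_algebra (space \<Omega>) Z L' \<rightarrow>\<^sub>M prob_algebra L \<and>
     (\<forall>B\<in>sets L. AE \<omega> in \<Omega>.
        real_cond_exp \<Omega> (vimage_algebra (space \<Omega>) Z L') (indicat_real (X -` B \<inter> space \<Omega>)) \<omega>
          = measure (\<K> \<omega>) B)"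

text \<open>The library's \<open>indep_var\<close> is limited to random elements of the same type.\<close>

definition independent_elements ::
  "'w measure \<Rightarrow> ('w \<Rightarrow> 'a) \<Rightarrow> 'a measure \<Rightarrow> ('w \<Rightarrow> 'b) \<Rightarrow> 'b measure \<Rightarrow> bool"
where
  "independent_elements \<Omega> X L Z L' \<longleftrightarrow>
     X \<in> \<Omega> \<rightarrow>\<^sub>M L \<and> Z \<in> \<Omega> \<rightarrow>\<^sub>M L' \<and>
     prob_space.indep_set \<Omega>
       {X -` B \<inter> space \<Omega> | B. B \<in> sets L} {Z -` B \<inter> space \<Omega> | B. B \<in> sets L'}"

section \<open>The nested Dirichlet process and its observations\<close>

text \<open>All indices start at \<open>1\<close>; values of the families at index \<open>0\<close> are irrelevant.\<close>

definition nested_dirichlet_process ::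
  "'w measure \<Rightarrow> real \<Rightarrow> real \<Rightarrow> 's::polish_space measure \<Rightarrow> ('w \<Rightarrow> 's measure measure) \<Rightarrow>
   (nat \<Rightarrow> 'w \<Rightarrow> 's measure) \<Rightarrow> (nat \<Rightarrow> nat \<Rightarrow> 'w \<Rightarrow> 's) \<Rightarrow> bool"
where
  "nested_dirichlet_process \<Omega> \<kappa> \<epsilon> \<rho> \<pi> \<mu> \<xi> \<longleftrightarrow>
     \<pi> \<in> \<Omega> \<rightarrow>\<^sub>M prob_algebra (prob_algebra borel) \<and>
     distr \<Omega> (prob_algebra (prob_algebra borel)) \<pi>
       = dirichlet_process (scale_measure (ennreal \<kappa>)
           (dirichlet_process (scale_measure (ennreal \<epsilon>) \<rho>))) \<and>
     has_cond_law \<Omega>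
       (\<lambda>\<omega>. \<lambda>i\<in>{1..}. \<mu> i \<omega>) (\<Pi>\<^sub>M i\<in>{1..}. prob_algebra borel)
       \<pi> (prob_algebra (prob_algebra borel))
       (\<lambda>\<omega>. \<Pi>\<^sub>M i\<in>{1..}. \<pi> \<omega>) \<and>
     has_cond_law \<Omega>
       (\<lambda>\<omega>. \<lambda>(i, j)\<in>{1..} \<times> {1..}. \<xi> i j \<omega>) (\<Pi>\<^sub>M ij\<in>{1..} \<times> {1..}. borel)
       (\<lambda>\<omega>. (\<pi> \<omega>, \<lambda>i\<in>{1..}. \<mu> i \<omega>))
       (prob_algebra (prob_algebra borel) \<Otimes>\<^sub>M (\<Pi>\<^sub>M i\<in>{1..}. prob_algebra borel))
       (\<lambda>\<omega>. \<Pi>\<^sub>M (i, j)\<in>{1..} \<times> {1..}. \<mu> i \<omega>)"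

definition row :: "(nat \<Rightarrow> nat \<Rightarrow> 'w \<Rightarrow> 's) \<Rightarrow> nat \<Rightarrow> nat \<Rightarrow> 'w \<Rightarrow> nat \<Rightarrow> 's" where
  "row \<xi> i n \<omega> = (\<lambda>j\<in>{1..n}. \<xi> i j \<omega>)"

text \<open>\<open>\<rho>\<^sub>n\<close>, the common law of all rows of length \<open>n\<close>, read off from the first one\<close>

definition row_law ::
  "'w measure \<Rightarrow> (nat \<Rightarrow> nat \<Rightarrow> 'w \<Rightarrow> 's::polish_space) \<Rightarrow> nat \<Rightarrow> (nat \<Rightarrow> 's) measure"
where
  "row_law \<Omega> \<xi> n = distr \<Omega> (\<Pi>\<^sub>M j\<in>{1..n}. borel) (row \<xi> 1 n)"

definition observation ::
  "(nat \<Rightarrow> (nat \<Rightarrow> 's) \<Rightarrow> 't) \<Rightarrow> (nat \<Rightarrow> nat \<Rightarrow> 'w \<Rightarrow> 's) \<Rightarrow> nat \<Rightarrow> nat \<Rightarrow> 'w \<Rightarrow> nat \<Rightarrow> 't"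
where
  "observation \<phi> \<xi> M N \<omega> = (\<lambda>m\<in>{1..M}. \<phi> m (row \<xi> m N \<omega>))"

definition obs_set ::
  "(nat \<Rightarrow> (nat \<Rightarrow> 's::polish_space) \<Rightarrow> 't) \<Rightarrow> nat \<Rightarrow> (nat \<Rightarrow> 't) \<Rightarrow> nat \<Rightarrow> (nat \<Rightarrow> 's) set"
where
  "obs_set \<phi> N y m = \<phi> m -` {y m} \<inter> space (\<Pi>\<^sub>M j\<in>{1..N}. (borel :: 's measure))"

section \<open>Weighted simulations\<close>

text \<open>
  The law \<open>\<L>(u\<^sub>m | u\<^sub>1, \<dots>, u\<^bsub>m-1\<^esub>)\<close> prescribed for the \<open>m\<close>-th step, as a function of the weights
  \<open>t\<^bsub>m1\<^esub>, \<dots>, t\<^bsub>mm\<^esub>\<close>, of \<open>u\<^sub>1, \<dots>, u\<^bsub>m-1\<^esub>\<close> and of \<open>\<nu> = \<rho>\<^sub>N(\<sqdot> | A\<^sub>m)\<close>.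
\<close>

definition simulation_kernel ::
  "real \<Rightarrow> 's::polish_space measure \<Rightarrow> nat \<Rightarrow> (nat \<Rightarrow> 's) measure \<Rightarrow> nat \<Rightarrow>
   (nat \<Rightarrow> real) \<Rightarrow> (nat \<Rightarrow> 's measure) \<Rightarrow> 's measure measure"
where
  "simulation_kernel \<epsilon> \<rho> N \<nu> m t u =
     scale_measure (ennreal (1 / (\<Sum>i=1..m. t i)))
       (measure_plus
         (scale_measure (ennreal (t m))
           (\<nu> \<bind> (\<lambda>x. dirichlet_process
              (measure_plus (scale_measure (ennreal \<epsilon>) \<rho>)
                 (measure_sum borel {1..N} (\<lambda>n. return borel (x n)))))))
         (measure_sum (prob_algebra borel) {1..<m}
           (\<lambda>i. scale_measure (ennreal (t i)) (return (prob_algebra borel) (u i)))))"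

text \<open>The weights as one random element indexed by \<open>{(m, i). 1 \<le> i \<le> m \<le> M}\<close>, paired with \<open>u\<close>\<close>

definition simulation_space ::
  "nat \<Rightarrow> ((nat \<times> nat \<Rightarrow> real) \<times> (nat \<Rightarrow> 's::polish_space measure)) measure"
where
  "simulation_space M =
     (\<Pi>\<^sub>M mi\<in>(SIGMA m:{1..M}. {1..m}). borel) \<Otimes>\<^sub>M (\<Pi>\<^sub>M m\<in>{1..M}. prob_algebra borel)"

definition simulation_pair ::
  "nat \<Rightarrow> (nat \<Rightarrow> nat \<Rightarrow> 'w \<Rightarrow> real) \<Rightarrow> (nat \<Rightarrow> 'w \<Rightarrow> 's measure) \<Rightarrow>
   'w \<Rightarrow> (nat \<times> nat \<Rightarrow> real) \<times> (nat \<Rightarrow> 's measure)"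
where
  "simulation_pair M t u \<omega> =
     (\<lambda>(m, i)\<in>(SIGMA m:{1..M}. {1..m}). t m i \<omega>, \<lambda>m\<in>{1..M}. u m \<omega>)"

definition weighted_simulation ::
  "'w measure \<Rightarrow> real \<Rightarrow> real \<Rightarrow> 's::polish_space measure \<Rightarrow> (nat \<Rightarrow> 's) measure \<Rightarrow>
   (nat \<Rightarrow> (nat \<Rightarrow> 's) set) \<Rightarrow> nat \<Rightarrow> nat \<Rightarrow> ('w \<Rightarrow> nat \<Rightarrow> 't) \<Rightarrow> 't set \<Rightarrow>
   (nat \<Rightarrow> nat \<Rightarrow> 'w \<Rightarrow> real) \<Rightarrow> (nat \<Rightarrow> 'w \<Rightarrow> 's measure) \<Rightarrow> bool"
where
  "weighted_simulation \<Omega> \<kappa> \<epsilon> \<rho> \<rho>N A M N Y T t u \<longleftrightarrow>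
     independent_elements \<Omega>
       (simulation_pair M t u) (simulation_space M) Y (\<Pi>\<^sub>M m\<in>{1..M}. count_space T) \<and>
     (\<forall>m\<in>{1..M}.
        (\<forall>\<omega>\<in>space \<Omega>.
           (\<forall>i\<in>{1..<m}. t m i \<omega> = measure (\<Pi>\<^sub>M j\<in>{1..N}. u i \<omega>) (A m)) \<and>
           t m m \<omega> = \<kappa> * measure \<rho>N (A m)) \<and>
        has_cond_law \<Omega>
          (u m) (prob_algebra borel)
          (\<lambda>\<omega>. \<lambda>i\<in>{1..<m}. u i \<omega>) (\<Pi>\<^sub>M i\<in>{1..<m}. prob_algebra borel)
          (\<lambda>\<omega>. simulation_kernel \<epsilon> \<rho> N (uniform_measure \<rho>N (A m)) m
                 (\<lambda>i. t m i \<omega>) (\<lambda>i. u i \<omega>)))"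

definition total_weight :: "real \<Rightarrow> nat \<Rightarrow> (nat \<Rightarrow> nat \<Rightarrow> 'w \<Rightarrow> real) \<Rightarrow> 'w \<Rightarrow> real" where
  "total_weight \<kappa> M t \<omega> = (\<Prod>m=1..M. 1 / (\<kappa> + real m - 1) * (\<Sum>i=1..m. t m i \<omega>))"

end

theory Submission
  imports Defs
begin

text \<open>
  The total weight \<open>V\<close> is a likelihood ratio: for every measurable \<open>B\<close>,
  \<open>E[V 1\<^sub>B(u\<^sup>*)] = P(\<mu> \<in> B, Y = y)\<close> (\<open>expectation_total_weight\<close>), where
  \<open>\<mu> = (\<mu>\<^sub>1, \<dots>, \<mu>\<^sub>M)\<close> and \<open>u\<^sup>*\<close> is the simulated vector. Granting this, the theorem is the
  law of large numbers. With \<open>B\<close> and with the whole space, the averages of \<open>V\<^sub>k 1\<^sub>B(u\<^sup>*\<^sub>k)\<close> and of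
  \<open>V\<^sub>k\<close> converge almost surely to \<open>P(\<mu> \<in> B, Y = y)\<close> and \<open>P(Y = y) > 0\<close>, so their ratio, the mass that
  the weighted empirical measure gives to \<open>B\<close>, converges to \<open>P(\<mu> \<in> B | Y = y)\<close>. One null set serves
  countably many \<open>B\<close>. Countably many suffice: there is a countable family of measurable sets such that
  each open subset of \<open>M\<^sub>1\<^sup>M\<close> is the union of the members that it contains (\<open>M1_power_basic_sets\<close>).
  Convergence on finite unions of members gives the lower bound for open sets, and the portmanteau argument
  (\<open>weighted_average_tendsto\<close>) turns it into weak convergence. The same argument works for the images
  under \<open>\<Phi>\<close>, because almost every point of the preimage of an open set, being a point of continuity, is
  an interior point of it (\<open>weakly_converges_image\<close>).

  The identity for \<open>V\<close> compares two sequential constructions. Integrating out \<open>\<pi>\<close>, the measures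
  \<open>\<mu>\<^sub>1, \<mu>\<^sub>2, \<dots>\<close> form a Polya urn: given \<open>\<mu>\<^sub>1, \<dots>, \<mu>\<^bsub>m-1\<^esub>\<close>, the next one has law
  \<open>(\<kappa> \<D>(\<epsilon>\<rho>) + \<Sum>\<^bsub>i<m\<^esub> \<delta>(\<mu>\<^sub>i)) / (\<kappa> + m - 1)\<close>. Given all of them, the rows are independent, and the event
  \<open>X\<^sub>m\<^sub>N \<in> A\<^sub>m\<close> has probability \<open>\<mu>\<^sub>m\<^sup>N(A\<^sub>m)\<close>. So \<open>P(\<mu> \<in> \<cdot>, Y = y)\<close> is the law of the urn in which
  the \<open>m\<close>-th step is weighted by \<open>u \<mapsto> u\<^sup>N(A\<^sub>m)\<close>. An atom at an earlier \<open>u\<^sub>i\<close> then receives the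
  weight \<open>u\<^sub>i\<^sup>N(A\<^sub>m) = t\<^sub>m\<^sub>i\<close>. A fresh \<open>u \<sim> \<D>(\<epsilon>\<rho>)\<close>, weighted by \<open>u\<^sup>N(A\<^sub>m)\<close>, is a fresh \<open>u\<close>
  together with a sample \<open>x \<sim> u\<^sup>N\<close> restricted to \<open>x \<in> A\<^sub>m\<close>, and by the posterior formula
  for Dirichlet processes this is \<open>x \<sim> \<rho>\<^sub>N\<close> restricted to \<open>A\<^sub>m\<close> followed by
  \<open>u \<sim> \<D>(\<epsilon>\<rho> + \<Sum>\<delta>(x\<^sub>n))\<close>. Hence a weighted urn step is exactly \<open>\<Sum>\<^sub>i t\<^sub>m\<^sub>i / (\<kappa> + m - 1)\<close> times the
  simulation kernel (\<open>nn_integral_simulation_kernel\<close>), and \<open>nn_integral_partial_weight\<close> multiplies these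
  steps together.

  The facts on Dirichlet processes come from Gamma vectors. The Dirichlet distribution is the law of a
  normalised Gamma vector, and the elementary identities of Gamma laws give its size-biased form
  (\<open>nn_integral_dirichlet_size_bias\<close>) and the stick-breaking equation (\<open>nn_integral_dirichlet_stick\<close>).
  The cell masses of a random measure built by stick breaking solve the same equation, whose solution is unique,
  so that random measure is a Dirichlet process (\<open>distr_cell_masses_stick_law\<close>). Its law is determined by the
  laws of cell masses (\<open>is_dirichlet_process_unique\<close>), and the size-biased form, read on cells, is the posterior
  formula (\<open>dirichlet_process_posterior\<close>). Its iteration gives the formula for samples of size \<open>N\<close> and
  the Polya urn (\<open>nn_integral_sample_law_Suc\<close>).
\<close>

section \<open>Gamma laws\<close>

definition gamma_density :: "real \<Rightarrow> real \<Rightarrow> real" where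
  "gamma_density a x = (if 0 < x then x powr (a - 1) * exp (- x) / Gamma a else 0)"

lemma borel_measurable_gamma_density [measurable]: "gamma_density a \<in> borel_measurable borel"
  unfolding gamma_density_def by measurable

lemma gamma_density_nonneg: "0 < a \<Longrightarrow> 0 \<le> gamma_density a x"
  by (auto simp: gamma_density_def Gamma_real_nonneg)

lemma sets_gamma_measure [simp, measurable_cong]: "sets (gamma_measure a) = sets borel"
  by (simp add: gamma_measure_def)

lemma space_gamma_measure [simp]: "space (gamma_measure a) = UNIV"
  by (simp add: gamma_measure_def)

lemma gamma_measure_0: "gamma_measure 0 = return borel 0"
  by (simp add: gamma_measure_def)

lemma gamma_measure_pos: "0 < a \<Longrightarrow> gamma_measure a = density lborel (\<lambda>x. ennreal (gamma_density a x))"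
  by (simp add: gamma_measure_def gamma_density_def)

lemma nn_integral_gamma_measure:
  assumes "0 < a" and [measurable]: "h \<in> borel_measurable borel"
  shows "(\<integral>\<^sup>+x. h x \<partial>gamma_measure a) = (\<integral>\<^sup>+x. ennreal (gamma_density a x) * h x \<partial>lborel)"
  unfolding gamma_measure_pos[OF assms(1)] by (subst nn_integral_density) auto

lemma prob_space_gamma_measure:
  assumes "0 \<le> a"
  shows "prob_space (gamma_measure a)"
proof (cases "a = 0")
  case True
  then show ?thesis by (simp add: gamma_measure_0 prob_space_return)
next
  case False
  then have a: "0 < a" using assms by simp
  have "emeasure (gamma_measure a) UNIV = (\<integral>\<^sup>+x. indicator UNIV x \<partial>gamma_measure a)"
    by (subst nn_integral_indicator) auto
  also have "\<dots> = (\<integral>\<^sup>+x. ennreal (gamma_density a x) \<partial>lborel)"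
    by (subst nn_integral_gamma_measure[OF a]) auto
  also have "\<dots> = (\<integral>\<^sup>+x. ennreal (indicator {0..} x * x powr (a - 1) / exp x) * ennreal (1 / Gamma a) \<partial>lborel)"
    using a by (intro nn_integral_cong)
      (auto simp: gamma_density_def indicator_def ennreal_mult''[symmetric] exp_minus field_simps Gamma_real_pos)
  also have "\<dots> = (\<integral>\<^sup>+x. ennreal (indicator {0..} x * x powr (a - 1) / exp x) \<partial>lborel) * ennreal (1 / Gamma a)"
    by (rule nn_integral_multc) auto
  also have "\<dots> = 1"
    using Gamma_real_pos[OF a] by (simp add: Gamma_conv_nn_integral_real[OF a, symmetric] ennreal_mult''[symmetric])
  finally show ?thesis by (intro prob_spaceI) simp
qed

text \<open>A factor \<open>x\<close> raises the exponent of \<open>x\<close> in the density by one, and \<open>\<Gamma>(a + 1) = a \<Gamma>(a)\<close> renormalises it.\<close>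
lemma nn_integral_gamma_size_bias:
  assumes "0 \<le> a" and [measurable]: "h \<in> borel_measurable borel"
  shows "(\<integral>\<^sup>+x. ennreal x * h x \<partial>gamma_measure a) = ennreal a * (\<integral>\<^sup>+x. h x \<partial>gamma_measure (a + 1))"
proof (cases "a = 0")
  case True
  then show ?thesis by (simp add: gamma_measure_0 nn_integral_return)
next
  case False
  then have a: "0 < a" using assms by simp
  have "ennreal (gamma_density a x) * (ennreal x * h x) = ennreal a * (ennreal (gamma_density (a + 1) x) * h x)" for x
  proof -
    have "gamma_density a x * x = a * gamma_density (a + 1) x"
      using a Gamma_plus1[of a] Gamma_real_pos[OF a] by (auto simp: gamma_density_def powr_diff field_simps nonpos_Ints_def)
    moreover have "ennreal (gamma_density a x) * (ennreal x * h x) = ennreal (gamma_density a x * x) * h x"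
      using a by (simp add: ennreal_mult' gamma_density_nonneg mult.assoc)
    ultimately show ?thesis
      using a by (simp add: ennreal_mult' gamma_density_nonneg mult.assoc)
  qed
  then show ?thesis
    using a by (simp add: nn_integral_gamma_measure nn_integral_cmult)
qed

text \<open>
  As \<open>exp (- s x)\<close> merges with the factor \<open>exp (- x)\<close> of the density, the tilted law is again a Gamma law,
  on the scale \<open>1 / (1 + s)\<close>. Normalised vectors do not depend on the scale; this is how the
  normalised vector and the total mass of a Gamma vector are separated below.
\<close>
lemma nn_integral_gamma_exponential_tilt:
  assumes "0 \<le> a" "0 \<le> s" and [measurable]: "h \<in> borel_measurable borel"
  shows "(\<integral>\<^sup>+x. ennreal (exp (- s * x)) * h x \<partial>gamma_measure a)
       = ennreal ((1 + s) powr - a) * (\<integral>\<^sup>+x. h (x / (1 + s)) \<partial>gamma_measure a)"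
proof (cases "a = 0")
  case True
  then show ?thesis using assms(2) by (simp add: gamma_measure_0 nn_integral_return)
next
  case False
  then have a: "0 < a" using assms by simp
  have *: "ennreal ((1 + s) powr - a) * (ennreal (1 + s) * (ennreal (gamma_density a ((1 + s) * x)) * h x))
         = ennreal (gamma_density a x) * (ennreal (exp (- s * x)) * h x)" for x
  proof -
    have "(1 + s) powr - a * (1 + s) * gamma_density a ((1 + s) * x) = gamma_density a x * exp (- s * x)"
    proof (cases "0 < x")
      case True
      have "0 < (1 + s) * x" using True assms(2) by simp
      then have "(1 + s) powr - a * (1 + s) * gamma_density a ((1 + s) * x)
          = (1 + s) powr - a * (1 + s) * (((1 + s) powr (a - 1) * x powr (a - 1)) * exp (- x - s * x) / Gamma a)"
        unfolding gamma_density_def if_P[OF \<open>0 < (1 + s) * x\<close>]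
        using True assms(2) by (subst powr_mult) (simp_all add: algebra_simps)
      also have "\<dots> = ((1 + s) powr - a * (1 + s) powr 1 * (1 + s) powr (a - 1)) * (x powr (a - 1) * exp (- x - s * x) / Gamma a)"
        using assms(2) by simp
      also have "(1 + s) powr - a * (1 + s) powr 1 * (1 + s) powr (a - 1) = 1"
        using assms(2) by (simp only: powr_add[symmetric]) simp
      finally show ?thesis
        using True by (simp add: gamma_density_def exp_diff exp_minus field_simps)
    next
      case False
      then have "\<not> 0 < (1 + s) * x" using assms(2) by (simp add: zero_less_mult_iff)
      with False show ?thesis by (simp add: gamma_density_def)
    qed
    then have "ennreal ((1 + s) powr - a * (1 + s) * gamma_density a ((1 + s) * x)) * h x
        = ennreal (gamma_density a x * exp (- s * x)) * h x" by simp
    then show ?thesis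
      using assms(2) a by (simp add: ennreal_mult' gamma_density_nonneg mult.assoc)
  qed
  have "(\<integral>\<^sup>+x. h (x / (1 + s)) \<partial>gamma_measure a) = (\<integral>\<^sup>+x. ennreal (gamma_density a x) * h (x / (1 + s)) \<partial>lborel)"
    by (rule nn_integral_gamma_measure[OF a]) measurable
  also have "\<dots> = ennreal (1 + s) * (\<integral>\<^sup>+x. ennreal (gamma_density a ((1 + s) * x)) * h x \<partial>lborel)"
    using assms(2) by (subst nn_integral_real_affine[where t=0 and c="1 + s"]) auto
  finally have "ennreal ((1 + s) powr - a) * (\<integral>\<^sup>+x. h (x / (1 + s)) \<partial>gamma_measure a)
    = (\<integral>\<^sup>+x. ennreal ((1 + s) powr - a) * (ennreal (1 + s) * (ennreal (gamma_density a ((1 + s) * x)) * h x)) \<partial>lborel)"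
    by (simp add: nn_integral_cmult)
  also have "\<dots> = (\<integral>\<^sup>+x. ennreal (exp (- s * x)) * h x \<partial>gamma_measure a)"
    unfolding * by (rule nn_integral_gamma_measure[OF a, symmetric]) measurable
  finally show ?thesis by simp
qed

lemma gamma_density_1: "gamma_density 1 x = (if 0 < x then exp (- x) else 0)"
  by (simp add: gamma_density_def)

lemma emeasure_gamma_measure_1_Ioi:
  assumes "0 \<le> c"
  shows "emeasure (gamma_measure 1) {c<..} = ennreal (exp (- c))"
proof -
  have "emeasure (gamma_measure 1) {c<..} = (\<integral>\<^sup>+x. indicator {c<..} x \<partial>gamma_measure 1)"
    by simp
  also have "\<dots> = (\<integral>\<^sup>+x. ennreal (gamma_density 1 x) * indicator {c<..} x \<partial>lborel)"
    by (rule nn_integral_gamma_measure) auto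
  also have "\<dots> = (\<integral>\<^sup>+x. ennreal (exp (- x)) * indicator {c..} x \<partial>lborel)"
  proof (rule nn_integral_cong_AE)
    show "AE x in lborel. ennreal (gamma_density 1 x) * indicator {c<..} x = ennreal (exp (- x)) * indicator {c..} x"
      using AE_lborel_singleton[of c] by eventually_elim (use assms in \<open>auto simp: gamma_density_1 indicator_def\<close>)
  qed
  also have "\<dots> = ennreal (0 - (- exp (- c)))"
  proof (rule nn_integral_FTC_atLeast)
    show "DERIV (\<lambda>x. - exp (- x)) x :> exp (- x)" for x :: real
      by (auto intro!: derivative_eq_intros)
    show "((\<lambda>x. - exp (- x)) \<longlongrightarrow> (0::real)) at_top"
      by real_asymp
  qed auto
  finally show ?thesis by simp
qed

lemma AE_gamma_measure_nonneg: "AE x in gamma_measure a. 0 \<le> x"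
proof (cases "a = 0")
  case True
  show ?thesis unfolding True gamma_measure_0 by (subst AE_return) auto
next
  case False
  then show ?thesis
    unfolding gamma_measure_def by (auto simp: AE_density not_less[symmetric] intro!: AE_I2)
qed

lemma AE_gamma_measure_pos: "0 < a \<Longrightarrow> AE x in gamma_measure a. 0 < x"
  unfolding gamma_measure_pos by (auto simp: AE_density gamma_density_def intro!: AE_I2)

lemma nn_integral_powr_Ioo:
  assumes "0 < a" "0 < x"
  shows "(\<integral>\<^sup>+y. ennreal (y powr (a - 1)) * indicator {0<..<x} y \<partial>lborel) = ennreal (x powr a / a)"
proof -
  have "((\<lambda>y. y powr (a - 1)) has_integral (x powr a / a)) {0..x}"
    using has_integral_powr_from_0[of "a - 1" x] assms by simp
  then have "(\<integral>\<^sup>+y. ennreal (indicator {0..x} y * y powr (a - 1)) \<partial>lborel) = ennreal (x powr a / a)"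
    by (intro nn_integral_has_integral_lebesgue) auto
  moreover have "(\<integral>\<^sup>+y. ennreal (indicator {0..x} y * y powr (a - 1)) \<partial>lborel)
      = (\<integral>\<^sup>+y. ennreal (y powr (a - 1)) * indicator {0<..<x} y \<partial>lborel)"
    by (intro nn_integral_cong_AE)
      (use AE_lborel_singleton[of 0] AE_lborel_singleton[of x] in eventually_elim, auto simp: indicator_def)
  ultimately show ?thesis by simp
qed

text \<open>
  The sum of independent variables with parameters \<open>a\<close> and \<open>1\<close> has parameter \<open>a + 1\<close>. As the second one is exponential, the
  factors \<open>exp (- x)\<close> and \<open>exp (- (y - x))\<close> combine to \<open>exp (- y)\<close>, and the convolution integral is that of a power.
\<close>
lemma nn_integral_gamma_convolution:
  assumes "0 \<le> a" and [measurable]: "h \<in> borel_measurable borel"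
  shows "(\<integral>\<^sup>+x. \<integral>\<^sup>+z. h (x + z) \<partial>gamma_measure 1 \<partial>gamma_measure a) = (\<integral>\<^sup>+x. h x \<partial>gamma_measure (a + 1))"
proof (cases "a = 0")
  case True
  interpret G: prob_space "gamma_measure 1" by (rule prob_space_gamma_measure) simp
  have "(\<lambda>x. \<integral>\<^sup>+z. h (x + z) \<partial>gamma_measure 1) \<in> borel_measurable borel"
    by measurable
  then show ?thesis
    using True by (simp add: gamma_measure_0 nn_integral_return)
next
  case False
  then have a: "0 < a" using assms by simp
  interpret G: prob_space "gamma_measure 1" by (rule prob_space_gamma_measure) simp
  have inner: "(\<integral>\<^sup>+z. h (x + z) \<partial>gamma_measure 1) = (\<integral>\<^sup>+y. ennreal (gamma_density 1 (y - x)) * h y \<partial>lborel)" for x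
  proof -
    have "(\<integral>\<^sup>+z. h (x + z) \<partial>gamma_measure 1) = (\<integral>\<^sup>+z. ennreal (gamma_density 1 z) * h (x + z) \<partial>lborel)"
      by (rule nn_integral_gamma_measure) auto
    also have "\<dots> = (\<integral>\<^sup>+y. ennreal (gamma_density 1 (y - x)) * h y \<partial>lborel)"
      by (subst nn_integral_real_affine[where t="-x" and c=1]) auto
    finally show ?thesis .
  qed
  have "(\<integral>\<^sup>+x. \<integral>\<^sup>+z. h (x + z) \<partial>gamma_measure 1 \<partial>gamma_measure a)
      = (\<integral>\<^sup>+x. ennreal (gamma_density a x) * (\<integral>\<^sup>+z. h (x + z) \<partial>gamma_measure 1) \<partial>lborel)"
    by (rule nn_integral_gamma_measure[OF a]) measurable
  also have "\<dots> = (\<integral>\<^sup>+x. \<integral>\<^sup>+y. ennreal (gamma_density a x) * (ennreal (gamma_density 1 (y - x)) * h y) \<partial>lborel \<partial>lborel)"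
    unfolding inner by (intro nn_integral_cong) (simp add: nn_integral_cmult)
  also have "\<dots> = (\<integral>\<^sup>+y. \<integral>\<^sup>+x. ennreal (gamma_density a x) * (ennreal (gamma_density 1 (y - x)) * h y) \<partial>lborel \<partial>lborel)"
    by (rule lborel_pair.Fubini') measurable
  also have "\<dots> = (\<integral>\<^sup>+y. ennreal (gamma_density (a + 1) y) * h y \<partial>lborel)"
  proof (rule nn_integral_cong)
    fix y :: real
    show "(\<integral>\<^sup>+x. ennreal (gamma_density a x) * (ennreal (gamma_density 1 (y - x)) * h y) \<partial>lborel)
        = ennreal (gamma_density (a + 1) y) * h y"
    proof (cases "0 < y")
      case False
      then have "ennreal (gamma_density a x) * (ennreal (gamma_density 1 (y - x)) * h y) = 0" for x
        by (auto simp: gamma_density_def)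
      then have "(\<integral>\<^sup>+x. ennreal (gamma_density a x) * (ennreal (gamma_density 1 (y - x)) * h y) \<partial>lborel)
          = (\<integral>\<^sup>+(x::real). 0 \<partial>lborel)"
        by (intro nn_integral_cong)
      then show ?thesis using False by (simp add: gamma_density_def)
    next
      case y: True
      have "ennreal (gamma_density a x) * (ennreal (gamma_density 1 (y - x)) * h y)
          = ennreal (exp (- y) / Gamma a) * h y * (ennreal (x powr (a - 1)) * indicator {0<..<y} x)" for x
      proof (cases "0 < x \<and> x < y")
        case True
        have "gamma_density a x * gamma_density 1 (y - x) = exp (- y) / Gamma a * x powr (a - 1)"
          using True by (simp add: gamma_density_def exp_add[symmetric])
        then have "ennreal (gamma_density a x) * ennreal (gamma_density 1 (y - x)) = ennreal (exp (- y) / Gamma a) * ennreal (x powr (a - 1))"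
          using a by (simp add: ennreal_mult'[symmetric] gamma_density_nonneg Gamma_real_nonneg)
        then show ?thesis using True by (simp add: mult_ac)
      qed (auto simp: gamma_density_def indicator_def)
      then have "(\<integral>\<^sup>+x. ennreal (gamma_density a x) * (ennreal (gamma_density 1 (y - x)) * h y) \<partial>lborel)
          = ennreal (exp (- y) / Gamma a) * h y * ennreal (y powr a / a)"
        by (simp add: nn_integral_cmult nn_integral_powr_Ioo[OF a y])
      also have "\<dots> = ennreal (exp (- y) / Gamma a * (y powr a / a)) * h y"
        using a by (subst ennreal_mult) (simp_all add: Gamma_real_nonneg mult_ac)
      also have "exp (- y) / Gamma a * (y powr a / a) = gamma_density (a + 1) y"
        using a y Gamma_plus1[of a] Gamma_real_pos[OF a] by (simp add: gamma_density_def field_simps nonpos_Ints_def)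
      finally show ?thesis .
    qed
  qed
  also have "\<dots> = (\<integral>\<^sup>+x. h x \<partial>gamma_measure (a + 1))"
    using a by (simp add: nn_integral_gamma_measure)
  finally show ?thesis .
qed

section \<open>Vectors of independent Gamma variables\<close>

abbreviation gamma_product :: "'i set \<Rightarrow> ('i \<Rightarrow> real) \<Rightarrow> ('i \<Rightarrow> real) measure" where
  "gamma_product I a \<equiv> \<Pi>\<^sub>M i\<in>I. gamma_measure (a i)"

definition normalise :: "'i set \<Rightarrow> ('i \<Rightarrow> real) \<Rightarrow> 'i \<Rightarrow> real" where
  "normalise I g = (\<lambda>i\<in>I. g i / (\<Sum>j\<in>I. g j))"

lemma dirichlet_measure_alt:
  "dirichlet_measure I a = distr (gamma_product I a) (\<Pi>\<^sub>M i\<in>I. borel) (normalise I)"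
  by (simp add: dirichlet_measure_def normalise_def[abs_def])

lemma sets_gamma_product [measurable_cong]: "sets (gamma_product I a) = sets (\<Pi>\<^sub>M i\<in>I. borel)"
  by (intro sets_PiM_cong) auto

lemma sets_dirichlet_measure [simp, measurable_cong]: "sets (dirichlet_measure I a) = sets (\<Pi>\<^sub>M i\<in>I. borel)"
  by (simp add: dirichlet_measure_def)

lemma measurable_normalise [measurable]: "normalise I \<in> (\<Pi>\<^sub>M i\<in>I. borel) \<rightarrow>\<^sub>M (\<Pi>\<^sub>M i\<in>I. borel)"
  unfolding normalise_def by measurable

lemma normalise_scale:
  assumes "c \<noteq> 0"
  shows "normalise I (\<lambda>i\<in>I. g i / c) = normalise I g"
proof -
  have "(\<Sum>j\<in>I. (\<lambda>i\<in>I. g i / c) j) = (\<Sum>j\<in>I. g j) / c"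
    by (simp add: sum_divide_distrib)
  then show ?thesis using assms by (auto simp: normalise_def fun_eq_iff)
qed

lemma measurable_update_PiM_borel [measurable]:
  "(\<lambda>x. (fst x)(i := snd x)) \<in> (\<Pi>\<^sub>M i\<in>I. borel) \<Otimes>\<^sub>M borel \<rightarrow>\<^sub>M (\<Pi>\<^sub>M i\<in>insert i I. borel)"
  using measurable_add_dim[of i I "\<lambda>_. borel"] by (simp add: split_beta')

context
  fixes a :: "'i \<Rightarrow> real"
  assumes a: "\<And>i. 0 \<le> a i"
begin

lemma product_sigma_finite_gamma: "product_sigma_finite (\<lambda>i. gamma_measure (a i))"
  using prob_space_gamma_measure[OF a] by (simp add: product_sigma_finite_def prob_space_imp_sigma_finite)

lemma prob_space_gamma_product: "prob_space (gamma_product J a)"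
  by (intro prob_space_PiM prob_space_gamma_measure a)

lemma prob_space_dirichlet_measure: "prob_space (dirichlet_measure I a)"
  unfolding dirichlet_measure_alt by (intro prob_space.prob_space_distr prob_space_gamma_product) measurable

lemma nn_integral_dirichlet_measure:
  assumes [measurable]: "h \<in> borel_measurable (\<Pi>\<^sub>M i\<in>I. borel)"
  shows "(\<integral>\<^sup>+p. h p \<partial>dirichlet_measure I a) = (\<integral>\<^sup>+g. h (normalise I g) \<partial>gamma_product I a)"
  unfolding dirichlet_measure_alt by (rule nn_integral_distr) measurable

lemma AE_gamma_product_nonneg: "finite I \<Longrightarrow> AE g in gamma_product I a. \<forall>i\<in>I. 0 \<le> g i"
  by (intro AE_finite_allI AE_PiM_component prob_space_gamma_measure a AE_gamma_measure_nonneg)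

lemma AE_gamma_product_sum_pos:
  assumes I: "finite I" and "0 < (\<Sum>i\<in>I. a i)"
  shows "AE g in gamma_product I a. 0 < (\<Sum>i\<in>I. g i)"
proof -
  obtain i where i: "i \<in> I" "0 < a i"
    using assms(2) by (metis a less_eq_real_def less_irrefl sum.neutral)
  have "AE g in gamma_product I a. 0 < g i"
    using i by (intro AE_PiM_component AE_gamma_measure_pos prob_space_gamma_measure a)
  then show ?thesis
    using AE_gamma_product_nonneg[OF I] by eventually_elim (use I i(1) in \<open>auto intro: sum_pos2\<close>)
qed

end

text \<open>Every coordinate is tilted by the same \<open>s\<close>, so all of them are rescaled by the same \<open>1 / (1 + s)\<close>.\<close>
lemma nn_integral_gamma_product_tilt:
  fixes a :: "'i \<Rightarrow> real"
  assumes I: "finite I" and a: "\<And>i. 0 \<le> a i" and s: "0 \<le> s"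
    and h: "h \<in> borel_measurable (\<Pi>\<^sub>M i\<in>I. borel)"
  shows "(\<integral>\<^sup>+g. ennreal (exp (- s * (\<Sum>i\<in>I. g i))) * h g \<partial>gamma_product I a)
       = ennreal ((1 + s) powr - (\<Sum>i\<in>I. a i)) * (\<integral>\<^sup>+g. h (\<lambda>i\<in>I. g i / (1 + s)) \<partial>gamma_product I a)"
  using I h
proof (induction I arbitrary: h rule: finite_induct)
  case empty
  show ?case using s by (simp add: PiM_empty nn_integral_count_space_finite)
next
  case (insert i I)
  interpret Gi: prob_space "gamma_measure (a i)" by (rule prob_space_gamma_measure[OF a])
  interpret product_sigma_finite "\<lambda>i. gamma_measure (a i)" by (rule product_sigma_finite_gamma[OF a])
  note [measurable] = insert.prems
  define h' where "h' g = (\<integral>\<^sup>+y. h (g(i := y / (1 + s))) \<partial>gamma_measure (a i))" for g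
  have [measurable]: "h' \<in> borel_measurable (\<Pi>\<^sub>M i\<in>I. borel)"
    unfolding h'_def
  proof (rule Gi.borel_measurable_nn_integral)
    have "(\<lambda>x. (fst x, snd x / (1 + s))) \<in> (\<Pi>\<^sub>M i\<in>I. (borel :: real measure)) \<Otimes>\<^sub>M borel \<rightarrow>\<^sub>M (\<Pi>\<^sub>M i\<in>I. borel) \<Otimes>\<^sub>M borel"
      by (intro measurable_Pair measurable_fst borel_measurable_divide measurable_snd) auto
    from measurable_compose[OF measurable_compose[OF this measurable_update_PiM_borel] insert.prems]
    show "(\<lambda>(g, y). h (g(i := y / (1 + s)))) \<in> borel_measurable ((\<Pi>\<^sub>M i\<in>I. borel) \<Otimes>\<^sub>M gamma_measure (a i))"
      by (simp add: split_beta')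
  qed
  have sum: "(\<Sum>j\<in>insert i I. (g(i := y)) j) = y + (\<Sum>j\<in>I. g j)" for g :: "'i \<Rightarrow> real" and y
    using insert.hyps by (auto intro!: sum.cong)
  have "(\<integral>\<^sup>+g. ennreal (exp (- s * (\<Sum>i\<in>insert i I. g i))) * h g \<partial>gamma_product (insert i I) a)
     = (\<integral>\<^sup>+g. \<integral>\<^sup>+y. ennreal (exp (- s * (\<Sum>j\<in>insert i I. (g(i := y)) j))) * h (g(i := y)) \<partial>gamma_measure (a i) \<partial>gamma_product I a)"
    by (rule product_nn_integral_insert[OF insert.hyps]) measurable
  also have "\<dots> = (\<integral>\<^sup>+g. \<integral>\<^sup>+y. ennreal (exp (- s * (\<Sum>j\<in>I. g j))) * (ennreal (exp (- s * y)) * h (g(i := y))) \<partial>gamma_measure (a i) \<partial>gamma_product I a)"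
  proof -
    have "ennreal (exp (- s * (y + r))) = ennreal (exp (- s * r)) * ennreal (exp (- s * y))" for y r
      by (simp add: ennreal_mult'[symmetric] exp_add[symmetric] algebra_simps)
    then show ?thesis unfolding sum by (simp only: mult.assoc)
  qed
  also have "\<dots> = (\<integral>\<^sup>+g. ennreal (exp (- s * (\<Sum>j\<in>I. g j))) * (ennreal ((1 + s) powr - a i) * h' g) \<partial>gamma_product I a)"
  proof (rule nn_integral_cong)
    fix g assume g: "g \<in> space (gamma_product I a)"
    have [measurable]: "(\<lambda>y. h (g(i := y))) \<in> borel_measurable borel"
      using measurable_compose[OF measurable_Pair1' measurable_compose[OF measurable_update_PiM_borel insert.prems], of g] g
      by (auto simp: space_PiM)
    show "(\<integral>\<^sup>+y. ennreal (exp (- s * (\<Sum>j\<in>I. g j))) * (ennreal (exp (- s * y)) * h (g(i := y))) \<partial>gamma_measure (a i))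
      = ennreal (exp (- s * (\<Sum>j\<in>I. g j))) * (ennreal ((1 + s) powr - a i) * h' g)"
      unfolding h'_def using nn_integral_gamma_exponential_tilt[OF a s, of "\<lambda>y. h (g(i := y))" i]
      by (subst nn_integral_cmult) auto
  qed
  also have "\<dots> = ennreal ((1 + s) powr - a i) * (\<integral>\<^sup>+g. ennreal (exp (- s * (\<Sum>j\<in>I. g j))) * h' g \<partial>gamma_product I a)"
    by (subst nn_integral_cmult[symmetric]) (auto simp: mult_ac intro!: nn_integral_cong)
  also have "(\<integral>\<^sup>+g. ennreal (exp (- s * (\<Sum>j\<in>I. g j))) * h' g \<partial>gamma_product I a)
     = ennreal ((1 + s) powr - (\<Sum>i\<in>I. a i)) * (\<integral>\<^sup>+g. h' (\<lambda>i\<in>I. g i / (1 + s)) \<partial>gamma_product I a)"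
    by (rule insert.IH) measurable
  also have "(\<integral>\<^sup>+g. h' (\<lambda>i\<in>I. g i / (1 + s)) \<partial>gamma_product I a)
     = (\<integral>\<^sup>+g. \<integral>\<^sup>+y. h (\<lambda>j\<in>insert i I. (g(i := y)) j / (1 + s)) \<partial>gamma_measure (a i) \<partial>gamma_product I a)"
    unfolding h'_def using insert.hyps
    by (intro nn_integral_cong arg_cong[where f=h]) (auto simp: fun_eq_iff)
  also have "\<dots> = (\<integral>\<^sup>+g. h (\<lambda>j\<in>insert i I. g j / (1 + s)) \<partial>gamma_product (insert i I) a)"
    by (rule product_nn_integral_insert[OF insert.hyps, symmetric]) measurable
  also have "ennreal ((1 + s) powr - a i) * (ennreal ((1 + s) powr - (\<Sum>i\<in>I. a i)) * (\<integral>\<^sup>+g. h (\<lambda>j\<in>insert i I. g j / (1 + s)) \<partial>gamma_product (insert i I) a))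
     = ennreal ((1 + s) powr - (\<Sum>i\<in>insert i I. a i)) * (\<integral>\<^sup>+g. h (\<lambda>j\<in>insert i I. g j / (1 + s)) \<partial>gamma_product (insert i I) a)"
    unfolding mult.assoc[symmetric] using insert.hyps s by (simp add: ennreal_mult'[symmetric] powr_add[symmetric])
  finally show ?case .
qed

text \<open>Singling out coordinate \<open>j\<close> as the innermost integral lets the one-dimensional identities act on it.\<close>
lemma nn_integral_gamma_product_coordinate:
  fixes a :: "'i \<Rightarrow> real"
  assumes I: "finite I" and a: "\<And>i. 0 \<le> a i" and j: "j \<in> I" and c: "0 \<le> c"
    and h: "h \<in> borel_measurable (\<Pi>\<^sub>M i\<in>I. borel)"
  shows "(\<integral>\<^sup>+g. h g \<partial>gamma_product I (a(j := c)))
       = (\<integral>\<^sup>+g. \<integral>\<^sup>+y. h (g(j := y)) \<partial>gamma_measure c \<partial>gamma_product (I - {j}) a)"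
proof -
  have a': "0 \<le> (a(j := c)) i" for i using a c by simp
  interpret product_sigma_finite "\<lambda>i. gamma_measure ((a(j := c)) i)" by (rule product_sigma_finite_gamma[OF a'])
  have *: "insert j (I - {j}) = I" using j by auto
  have "(\<integral>\<^sup>+g. h g \<partial>gamma_product (insert j (I - {j})) (a(j := c)))
       = (\<integral>\<^sup>+g. \<integral>\<^sup>+y. h (g(j := y)) \<partial>gamma_measure ((a(j := c)) j) \<partial>gamma_product (I - {j}) (a(j := c)))"
    using I by (intro product_nn_integral_insert) (auto simp: insert_absorb[OF j] h measurable_cong_sets[OF sets_gamma_product refl])
  also have "gamma_product (I - {j}) (a(j := c)) = gamma_product (I - {j}) a"
    by (intro PiM_cong) auto
  finally show ?thesis unfolding * fun_upd_same .
qed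

lemma nn_integral_gamma_product_size_bias:
  fixes a :: "'i \<Rightarrow> real"
  assumes I: "finite I" and a: "\<And>i. 0 \<le> a i" and j: "j \<in> I"
    and h: "h \<in> borel_measurable (\<Pi>\<^sub>M i\<in>I. borel)"
  shows "(\<integral>\<^sup>+g. ennreal (g j) * h g \<partial>gamma_product I a)
       = ennreal (a j) * (\<integral>\<^sup>+g. h g \<partial>gamma_product I (a(j := a j + 1)))"
proof -
  interpret G: prob_space "gamma_measure (a j + 1)" by (rule prob_space_gamma_measure) (simp add: a add_nonneg_nonneg)
  note [measurable] = h
  have *: "insert j (I - {j}) = I" using j by auto
  have up: "(\<lambda>x. h ((fst x)(j := snd x))) \<in> borel_measurable ((\<Pi>\<^sub>M i\<in>I - {j}. borel) \<Otimes>\<^sub>M borel)"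
    using measurable_compose[OF measurable_update_PiM_borel[of j "I - {j}"], of h] h by (simp add: * insert_absorb[OF j])
  have "(\<integral>\<^sup>+g. ennreal (g j) * h g \<partial>gamma_product I a) = (\<integral>\<^sup>+g. ennreal (g j) * h g \<partial>gamma_product I (a(j := a j)))"
    by simp
  also have "\<dots> = (\<integral>\<^sup>+g. \<integral>\<^sup>+y. ennreal ((g(j := y)) j) * h (g(j := y)) \<partial>gamma_measure (a j) \<partial>gamma_product (I - {j}) a)"
    using j by (intro nn_integral_gamma_product_coordinate I a) measurable
  also have "\<dots> = (\<integral>\<^sup>+g. ennreal (a j) * (\<integral>\<^sup>+y. h (g(j := y)) \<partial>gamma_measure (a j + 1)) \<partial>gamma_product (I - {j}) a)"
  proof (rule nn_integral_cong)
    fix g assume g: "g \<in> space (gamma_product (I - {j}) a)"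
    have [measurable]: "(\<lambda>y. h (g(j := y))) \<in> borel_measurable borel"
      using g by (intro measurable_compose[OF _ up, of "\<lambda>y. (g, y)", simplified]) (auto simp: space_PiM)
    show "(\<integral>\<^sup>+y. ennreal ((g(j := y)) j) * h (g(j := y)) \<partial>gamma_measure (a j))
        = ennreal (a j) * (\<integral>\<^sup>+y. h (g(j := y)) \<partial>gamma_measure (a j + 1))"
      using nn_integral_gamma_size_bias[OF a[of j], of "\<lambda>y. h (g(j := y))"] by simp
  qed
  also have "\<dots> = ennreal (a j) * (\<integral>\<^sup>+g. (\<integral>\<^sup>+y. h (g(j := y)) \<partial>gamma_measure (a j + 1)) \<partial>gamma_product (I - {j}) a)"
    by (rule nn_integral_cmult, rule G.borel_measurable_nn_integral) (use up in \<open>simp add: split_beta'\<close>)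
  also have "\<dots> = ennreal (a j) * (\<integral>\<^sup>+g. h g \<partial>gamma_product I (a(j := a j + 1)))"
    by (subst nn_integral_gamma_product_coordinate[OF I a j _ h]) (simp_all add: a add_nonneg_nonneg)
  finally show ?thesis .
qed

lemma nn_integral_gamma_product_convolution:
  fixes a :: "'i \<Rightarrow> real"
  assumes I: "finite I" and a: "\<And>i. 0 \<le> a i" and j: "j \<in> I"
    and h: "h \<in> borel_measurable (\<Pi>\<^sub>M i\<in>I. borel)"
  shows "(\<integral>\<^sup>+g. \<integral>\<^sup>+z. h (g(j := g j + z)) \<partial>gamma_measure 1 \<partial>gamma_product I a)
       = (\<integral>\<^sup>+g. h g \<partial>gamma_product I (a(j := a j + 1)))"
proof -
  interpret G: prob_space "gamma_measure 1" by (rule prob_space_gamma_measure) simp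
  have *: "insert j (I - {j}) = I" using j by auto
  have up: "(\<lambda>x. h ((fst x)(j := snd x))) \<in> borel_measurable ((\<Pi>\<^sub>M i\<in>I - {j}. borel) \<Otimes>\<^sub>M borel)"
    using measurable_compose[OF measurable_update_PiM_borel[of j "I - {j}"], of h] h by (simp add: * insert_absorb[OF j])
  have up': "(\<lambda>x. (fst x)(j := fst x j + snd x)) \<in> (\<Pi>\<^sub>M i\<in>I. (borel :: real measure)) \<Otimes>\<^sub>M borel \<rightarrow>\<^sub>M (\<Pi>\<^sub>M i\<in>I. borel)"
  proof -
    have "(\<lambda>x. (fst x, fst x j + snd x)) \<in> (\<Pi>\<^sub>M i\<in>I. (borel :: real measure)) \<Otimes>\<^sub>M borel \<rightarrow>\<^sub>M (\<Pi>\<^sub>M i\<in>I. borel) \<Otimes>\<^sub>M borel"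
      using measurable_compose[OF measurable_fst measurable_component_singleton[OF j]]
      by (intro measurable_Pair measurable_fst borel_measurable_add measurable_snd) auto
    from measurable_compose[OF this measurable_update_PiM_borel[of j I]] show ?thesis
      by (simp add: insert_absorb[OF j])
  qed
  have "(\<integral>\<^sup>+g. \<integral>\<^sup>+z. h (g(j := g j + z)) \<partial>gamma_measure 1 \<partial>gamma_product I a)
      = (\<integral>\<^sup>+g. \<integral>\<^sup>+z. h (g(j := g j + z)) \<partial>gamma_measure 1 \<partial>gamma_product I (a(j := a j)))"
    by simp
  also have "\<dots> = (\<integral>\<^sup>+g. \<integral>\<^sup>+y. \<integral>\<^sup>+z. h ((g(j := y))(j := (g(j := y)) j + z)) \<partial>gamma_measure 1 \<partial>gamma_measure (a j) \<partial>gamma_product (I - {j}) a)"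
    by (intro nn_integral_gamma_product_coordinate I a j G.borel_measurable_nn_integral)
      (use measurable_compose[OF up' h] in \<open>simp add: split_beta'\<close>)
  also have "\<dots> = (\<integral>\<^sup>+g. \<integral>\<^sup>+y. h (g(j := y)) \<partial>gamma_measure (a j + 1) \<partial>gamma_product (I - {j}) a)"
  proof (rule nn_integral_cong)
    fix g assume g: "g \<in> space (gamma_product (I - {j}) a)"
    have [measurable]: "(\<lambda>y. h (g(j := y))) \<in> borel_measurable borel"
      using g by (intro measurable_compose[OF _ up, of "\<lambda>y. (g, y)", simplified]) (auto simp: space_PiM)
    show "(\<integral>\<^sup>+y. \<integral>\<^sup>+z. h ((g(j := y))(j := (g(j := y)) j + z)) \<partial>gamma_measure 1 \<partial>gamma_measure (a j))
        = (\<integral>\<^sup>+y. h (g(j := y)) \<partial>gamma_measure (a j + 1))"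
      using nn_integral_gamma_convolution[OF a[of j], of "\<lambda>y. h (g(j := y))"] by simp
  qed
  also have "\<dots> = (\<integral>\<^sup>+g. h g \<partial>gamma_product I (a(j := a j + 1)))"
    by (subst nn_integral_gamma_product_coordinate[OF I a j _ h]) (simp_all add: a add_nonneg_nonneg)
  finally show ?thesis .
qed

section \<open>Dirichlet distributions: size bias and stick breaking\<close>

lemma nn_integral_exp_Ici:
  assumes "0 < r"
  shows "(\<integral>\<^sup>+s. ennreal (exp (- s * r)) * indicator {0..} s \<partial>lborel) = ennreal (1 / r)"
proof -
  have "(\<integral>\<^sup>+s. ennreal (exp (- s * r)) * indicator {0..} s \<partial>lborel) = ennreal (0 - (- exp (- 0 * r) / r))"
  proof (rule nn_integral_FTC_atLeast)
    show "DERIV (\<lambda>s. - exp (- s * r) / r) s :> exp (- s * r)" for s :: real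
      using assms by (auto intro!: derivative_eq_intros simp: field_simps)
    show "((\<lambda>s. - exp (- s * r) / r) \<longlongrightarrow> (0::real)) at_top"
      using assms by real_asymp
  qed auto
  then show ?thesis by simp
qed

lemma nn_integral_powr_minus_Ici:
  assumes "0 < r"
  shows "(\<integral>\<^sup>+s. ennreal ((1 + s) powr - (r + 1)) * indicator {0..} s \<partial>lborel) = ennreal (1 / r)"
proof -
  have "(\<integral>\<^sup>+s. ennreal ((1 + s) powr - (r + 1)) * indicator {0..} s \<partial>lborel) = ennreal (0 - (- ((1 + 0) powr (- r) / r)))"
  proof (rule nn_integral_FTC_atLeast)
    show "DERIV (\<lambda>s. - ((1 + s) powr (- r) / r)) s :> (1 + s) powr - (r + 1)" if "0 \<le> s" for s :: real
    proof -
      have "((\<lambda>s. (1 + s) powr - r) has_real_derivative - r * (1 + s) powr (- r - 1) * 1) (at s)"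
        by (rule DERIV_chain2[OF has_real_derivative_powr]) (use that in \<open>auto intro!: derivative_eq_intros\<close>)
      from DERIV_minus[OF DERIV_cdivide[OF this, of r]] show ?thesis
        using assms by (simp add: minus_diff_commute add.commute diff_diff_eq2)
    qed
    show "((\<lambda>s. - ((1 + s) powr (- r) / r)) \<longlongrightarrow> (0::real)) at_top"
      using assms by real_asymp
  qed auto
  then show ?thesis by simp
qed

locale dirichlet_parameters =
  fixes I :: "'i set" and a :: "'i \<Rightarrow> real"
  assumes fin [simp]: "finite I" and nonneg: "0 \<le> a i" and total: "0 < (\<Sum>i\<in>I. a i)"
begin

abbreviation "A \<equiv> \<Sum>i\<in>I. a i"

lemma sum_bump: "j \<in> I \<Longrightarrow> (\<Sum>i\<in>I. (a(j := a j + 1)) i) = A + 1"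
  by (simp add: sum.remove[OF fin, of j] add.commute)

lemma bump: "j \<in> I \<Longrightarrow> dirichlet_parameters I (a(j := a j + 1))"
  using nonneg total by unfold_locales (auto simp: sum_bump simp del: fun_upd_apply, simp add: add_nonneg_nonneg)

text \<open>
  Let \<open>S\<close> be the total of the Gamma vector \<open>g\<close>, so that \<open>p\<^sub>j = g\<^sub>j / S\<close>. The factor \<open>g\<^sub>j\<close> raises the
  parameter of coordinate \<open>j\<close> by one. What remains is to remove \<open>1 / S\<close>: it is \<open>\<integral>\<^sub>0\<^sup>\<infinity> exp (- s S) ds\<close>,
  and each tilt by \<open>s\<close> leaves the law of the normalised vector unchanged and contributes \<open>(1 + s) powr - (A + 1)\<close>,
  with integral \<open>1 / A\<close>.
\<close>
lemma nn_integral_dirichlet_size_bias: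
  assumes j: "j \<in> I" and h [measurable]: "h \<in> borel_measurable (\<Pi>\<^sub>M i\<in>I. borel)"
  shows "(\<integral>\<^sup>+p. ennreal (p j) * h p \<partial>dirichlet_measure I a)
       = ennreal (a j / A) * (\<integral>\<^sup>+p. h p \<partial>dirichlet_measure I (a(j := a j + 1)))"
proof -
  let ?a = "a(j := a j + 1)"
  interpret b: dirichlet_parameters I ?a by (rule bump[OF j])
  interpret G: prob_space "gamma_product I ?a" by (rule prob_space_gamma_product[OF b.nonneg])
  interpret F: pair_sigma_finite lborel "gamma_product I ?a" by unfold_locales
  define k where "k g = h (normalise I g)" for g
  have k [measurable]: "k \<in> borel_measurable (\<Pi>\<^sub>M i\<in>I. borel)" unfolding k_def by measurable
  have S [measurable]: "(\<lambda>g. \<Sum>i\<in>I. g i) \<in> borel_measurable (\<Pi>\<^sub>M i\<in>I. (borel :: real measure))" by measurable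
  have "(\<integral>\<^sup>+p. ennreal (p j) * h p \<partial>dirichlet_measure I a)
      = (\<integral>\<^sup>+g. ennreal (normalise I g j) * k g \<partial>gamma_product I a)"
    unfolding k_def using j by (intro nn_integral_dirichlet_measure nonneg) measurable
  also have "\<dots> = (\<integral>\<^sup>+g. ennreal (g j) * (ennreal (1 / (\<Sum>i\<in>I. g i)) * k g) \<partial>gamma_product I a)"
  proof (rule nn_integral_cong_AE)
    show "AE g in gamma_product I a. ennreal (normalise I g j) * k g = ennreal (g j) * (ennreal (1 / (\<Sum>i\<in>I. g i)) * k g)"
      using AE_gamma_product_nonneg[OF nonneg fin]
      by eventually_elim (use j in \<open>simp add: normalise_def ennreal_mult'[symmetric] mult.assoc[symmetric]\<close>)
  qed
  also have "\<dots> = ennreal (a j) * (\<integral>\<^sup>+g. ennreal (1 / (\<Sum>i\<in>I. g i)) * k g \<partial>gamma_product I ?a)"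
    by (rule nn_integral_gamma_product_size_bias[OF fin nonneg j]) measurable
  also have "(\<integral>\<^sup>+g. ennreal (1 / (\<Sum>i\<in>I. g i)) * k g \<partial>gamma_product I ?a)
      = (\<integral>\<^sup>+g. \<integral>\<^sup>+s. ennreal (exp (- s * (\<Sum>i\<in>I. g i))) * indicator {0..} s * k g \<partial>lborel \<partial>gamma_product I ?a)"
  proof (rule nn_integral_cong_AE)
    \<comment> \<open>A zero total would break the integral formula for the reciprocal; it has probability zero.\<close>
    show "AE g in gamma_product I ?a. ennreal (1 / (\<Sum>i\<in>I. g i)) * k g
       = (\<integral>\<^sup>+s. ennreal (exp (- s * (\<Sum>i\<in>I. g i))) * indicator {0..} s * k g \<partial>lborel)"
      using AE_gamma_product_sum_pos[OF b.nonneg fin b.total]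
      by eventually_elim (simp only: nn_integral_exp_Ici[symmetric], subst nn_integral_multc, simp_all)
  qed
  also have "\<dots> = (\<integral>\<^sup>+s. \<integral>\<^sup>+g. ennreal (exp (- s * (\<Sum>i\<in>I. g i))) * indicator {0..} s * k g \<partial>gamma_product I ?a \<partial>lborel)"
    by (rule F.Fubini') measurable
  also have "\<dots> = (\<integral>\<^sup>+s. (\<integral>\<^sup>+g. k g \<partial>gamma_product I ?a) * (ennreal ((1 + s) powr - (A + 1)) * indicator {0..} s) \<partial>lborel)"
  proof (rule nn_integral_cong)
    fix s :: real
    show "(\<integral>\<^sup>+g. ennreal (exp (- s * (\<Sum>i\<in>I. g i))) * indicator {0..} s * k g \<partial>gamma_product I ?a)
      = (\<integral>\<^sup>+g. k g \<partial>gamma_product I ?a) * (ennreal ((1 + s) powr - (A + 1)) * indicator {0..} s)"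
    proof (cases "0 \<le> s")
      case True
      then have "k (\<lambda>i\<in>I. g i / (1 + s)) = k g" for g
        unfolding k_def by (subst normalise_scale) auto
      then show ?thesis
        using nn_integral_gamma_product_tilt[OF fin, of ?a s k] b.nonneg k True
        by (simp only: sum_bump[OF j] simp_thms) (simp add: mult.commute del: fun_upd_apply)
    qed simp
  qed
  also have "\<dots> = (\<integral>\<^sup>+g. k g \<partial>gamma_product I ?a) * ennreal (1 / A)"
    by (subst nn_integral_cmult) (simp_all only: nn_integral_powr_minus_Ici[OF total], measurable)
  also have "(\<integral>\<^sup>+g. k g \<partial>gamma_product I ?a) = (\<integral>\<^sup>+p. h p \<partial>dirichlet_measure I ?a)"
    unfolding k_def by (intro nn_integral_dirichlet_measure[symmetric] b.nonneg) measurable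
  finally show ?thesis
    using total nonneg by (simp add: divide_inverse ennreal_mult mult_ac less_imp_le)
qed

lemma AE_dirichlet_simplex: "AE p in dirichlet_measure I a. (\<forall>i\<in>I. 0 \<le> p i) \<and> (\<Sum>i\<in>I. p i) = 1"
proof -
  have "AE g in gamma_product I a. (\<forall>i\<in>I. 0 \<le> normalise I g i) \<and> (\<Sum>i\<in>I. normalise I g i) = 1"
    using AE_gamma_product_nonneg[OF nonneg fin] AE_gamma_product_sum_pos[OF nonneg fin total]
    by eventually_elim (auto simp: normalise_def sum_divide_distrib[symmetric] sum_nonneg)
  then show ?thesis
    unfolding dirichlet_measure_alt by (subst AE_distr_iff) (auto simp: measurable_cong_sets[OF sets_gamma_product refl])
qed

text \<open>Since \<open>\<Sum>p\<^sub>j = 1\<close>, the law is the sum of its size-biased forms.\<close>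
lemma nn_integral_dirichlet_mixture:
  assumes h [measurable]: "h \<in> borel_measurable (\<Pi>\<^sub>M i\<in>I. borel)"
  shows "(\<integral>\<^sup>+p. h p \<partial>dirichlet_measure I a)
       = (\<Sum>j\<in>I. ennreal (a j / A) * (\<integral>\<^sup>+p. h p \<partial>dirichlet_measure I (a(j := a j + 1))))"
proof -
  have "(\<integral>\<^sup>+p. h p \<partial>dirichlet_measure I a) = (\<integral>\<^sup>+p. (\<Sum>j\<in>I. ennreal (p j) * h p) \<partial>dirichlet_measure I a)"
  proof (rule nn_integral_cong_AE)
    show "AE p in dirichlet_measure I a. h p = (\<Sum>j\<in>I. ennreal (p j) * h p)"
      using AE_dirichlet_simplex by eventually_elim (simp add: sum_distrib_right[symmetric] sum_ennreal)
  qed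
  also have "\<dots> = (\<Sum>j\<in>I. \<integral>\<^sup>+p. ennreal (p j) * h p \<partial>dirichlet_measure I a)"
    by (rule nn_integral_sum) measurable
  finally show ?thesis by (simp add: nn_integral_dirichlet_size_bias)
qed

end

text \<open>The Beta law with parameters \<open>1\<close> and \<open>A\<close>, as the image of an exponential variable.\<close>
definition stick_measure :: "real \<Rightarrow> real measure" where
  "stick_measure A = distr (gamma_measure 1) borel (\<lambda>z. 1 - exp (- z / A))"

lemma sets_stick_measure [simp, measurable_cong]: "sets (stick_measure A) = sets borel"
  by (simp add: stick_measure_def)

lemma space_stick_measure [simp]: "space (stick_measure A) = UNIV"
  by (simp add: stick_measure_def)

lemma prob_space_stick_measure: "prob_space (stick_measure A)"
  unfolding stick_measure_def by (intro prob_space.prob_space_distr prob_space_gamma_measure) auto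

lemma AE_stick_measure:
  assumes "0 < A"
  shows "AE b in stick_measure A. 0 \<le> b \<and> b < 1"
proof -
  have "AE z in gamma_measure 1. 0 \<le> 1 - exp (- z / A) \<and> 1 - exp (- z / A) < 1"
    using AE_gamma_measure_nonneg[of 1] by eventually_elim (use assms in auto)
  then show ?thesis unfolding stick_measure_def by (subst AE_distr_iff) auto
qed

lemma emeasure_stick_measure:
  assumes "0 < A" "0 \<le> c" "c < 1"
  shows "emeasure (stick_measure A) {c<..} = ennreal ((1 - c) powr A)"
proof -
  have "(\<lambda>z. 1 - exp (- z / A)) -` {c<..} = {- A * ln (1 - c)<..}"
  proof -
    have "c < 1 - exp (- z / A) \<longleftrightarrow> - A * ln (1 - c) < z" for z
    proof -
      have "c < 1 - exp (- z / A) \<longleftrightarrow> exp (- z / A) < exp (ln (1 - c))" using assms by (simp add: less_diff_eq add.commute)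
      also have "\<dots> \<longleftrightarrow> - A * ln (1 - c) < z" using assms unfolding exp_less_cancel_iff by (simp add: field_simps) linarith
      finally show ?thesis .
    qed
    then show ?thesis by auto
  qed
  then have "emeasure (stick_measure A) {c<..} = emeasure (gamma_measure 1) {- A * ln (1 - c)<..}"
    unfolding stick_measure_def by (subst emeasure_distr) auto
  also have "\<dots> = ennreal (exp (A * ln (1 - c)))"
    using assms by (subst emeasure_gamma_measure_1_Ioi) (auto simp: mult_le_0_iff)
  finally show ?thesis using assms by (simp add: powr_def mult.commute)
qed

lemma nn_integral_stick_measure_remainder:
  assumes "0 < A"
  shows "(\<integral>\<^sup>+b. ennreal (1 - b) \<partial>stick_measure A) = ennreal (A / (A + 1))"
proof -
  interpret prob_space "gamma_measure 1" by (rule prob_space_gamma_measure) simp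
  have "(\<integral>\<^sup>+b. ennreal (1 - b) \<partial>stick_measure A) = (\<integral>\<^sup>+z. ennreal (exp (- (1 / A) * z)) * 1 \<partial>gamma_measure 1)"
    unfolding stick_measure_def by (subst nn_integral_distr) auto
  also have "\<dots> = ennreal ((1 + 1 / A) powr - 1)"
    using assms by (subst nn_integral_gamma_exponential_tilt) (auto simp: emeasure_space_1[simplified])
  also have "(1 + 1 / A) powr - 1 = A / (A + 1)"
    using assms by (simp add: powr_minus field_simps)
  finally show ?thesis .
qed

context dirichlet_parameters
begin

lemma normalise_update:
  assumes "j \<in> I" "0 < (\<Sum>i\<in>I. g i)" "0 \<le> z"
  shows "normalise I (g(j := g j + z))
    = (\<lambda>i\<in>I. (1 - z / ((\<Sum>i\<in>I. g i) + z)) * normalise I g i + z / ((\<Sum>i\<in>I. g i) + z) * of_bool (i = j))"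
proof -
  define S where "S = (\<Sum>i\<in>I. g i)"
  have S: "0 < S" "0 < S + z" "S + z \<noteq> 0" "S \<noteq> 0" using assms by (auto simp: S_def)
  have "(\<Sum>i\<in>I. (g(j := g j + z)) i) = S + z"
    using assms(1) by (simp add: sum.remove[OF fin, of j] S_def add_ac)
  then have "normalise I (g(j := g j + z)) = (\<lambda>i\<in>I. (g(j := g j + z)) i / (S + z))"
    by (simp add: normalise_def)
  also have "\<dots> = (\<lambda>i\<in>I. (1 - z / (S + z)) * normalise I g i + z / (S + z) * of_bool (i = j))"
  proof (intro restrict_ext)
    fix i assume i: "i \<in> I"
    have "(1 - z / (S + z)) * normalise I g i = g i / (S + z)"
      using S i by (simp add: normalise_def S_def[symmetric] diff_divide_eq_iff)
    then show "(g(j := g j + z)) i / (S + z) = (1 - z / (S + z)) * normalise I g i + z / (S + z) * of_bool (i = j)"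
      by (simp add: add_divide_distrib)
  qed
  finally show ?thesis unfolding S_def .
qed

text \<open>
  An extra exponential variable \<open>z\<close> satisfies \<open>z / (S + z) > c\<close> if and only if \<open>z > s S\<close> with \<open>s = c / (1 - c)\<close>. Given the
  vector, this has probability \<open>exp (- s S)\<close>, a tilt, which turns into the constant
  \<open>(1 + s) powr - A = (1 - c) powr A\<close> and does not affect the normalised vector.
\<close>
lemma emeasure_gamma_stick_event:
  assumes X [measurable]: "X \<in> sets (\<Pi>\<^sub>M i\<in>I. borel)" and c: "0 \<le> c" "c < 1"
  shows "(\<integral>\<^sup>+g. indicator X (normalise I g) * emeasure (gamma_measure 1) {z. c < z / ((\<Sum>i\<in>I. g i) + z)} \<partial>gamma_product I a)
       = ennreal ((1 - c) powr A) * emeasure (dirichlet_measure I a) X"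
proof -
  define s where "s = c / (1 - c)"
  have s: "0 \<le> s" "1 + s = 1 / (1 - c)" using c by (auto simp: s_def field_simps)
  define k where "k g = (indicator X (normalise I g) :: ennreal)" for g
  have k: "k \<in> borel_measurable (\<Pi>\<^sub>M i\<in>I. borel)" unfolding k_def by measurable
  have "(\<integral>\<^sup>+g. k g * emeasure (gamma_measure 1) {z. c < z / ((\<Sum>i\<in>I. g i) + z)} \<partial>gamma_product I a)
      = (\<integral>\<^sup>+g. ennreal (exp (- s * (\<Sum>i\<in>I. g i))) * k g \<partial>gamma_product I a)"
  proof (rule nn_integral_cong_AE)
    show "AE g in gamma_product I a. k g * emeasure (gamma_measure 1) {z. c < z / ((\<Sum>i\<in>I. g i) + z)}
        = ennreal (exp (- s * (\<Sum>i\<in>I. g i))) * k g"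
      using AE_gamma_product_sum_pos[OF nonneg fin total]
    proof eventually_elim
      fix g :: "'i \<Rightarrow> real" assume S: "0 < (\<Sum>i\<in>I. g i)"
      define S where "S = (\<Sum>i\<in>I. g i)"
      have "emeasure (gamma_measure 1) {z. c < z / (S + z)} = emeasure (gamma_measure 1) {s * S<..}"
      proof (rule emeasure_eq_AE)
        show "AE z in gamma_measure 1. z \<in> {z. c < z / (S + z)} \<longleftrightarrow> z \<in> {s * S<..}"
          using AE_gamma_measure_nonneg[of 1]
        proof eventually_elim
          fix z :: real assume "0 \<le> z"
          then have "0 < S + z" using S by (simp add: S_def)
          then have "c < z / (S + z) \<longleftrightarrow> c * S < z * (1 - c)"
            by (simp add: less_divide_eq algebra_simps)
          also have "\<dots> \<longleftrightarrow> s * S < z" using c by (simp add: s_def divide_less_eq)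
          finally show "z \<in> {z. c < z / (S + z)} \<longleftrightarrow> z \<in> {s * S<..}" by simp
        qed
      qed auto
      then show "k g * emeasure (gamma_measure 1) {z. c < z / ((\<Sum>i\<in>I. g i) + z)}
        = ennreal (exp (- s * (\<Sum>i\<in>I. g i))) * k g"
        using S s(1) by (simp add: S_def emeasure_gamma_measure_1_Ioi mult.commute)
    qed
  qed
  also have "\<dots> = ennreal ((1 + s) powr - A) * (\<integral>\<^sup>+g. k (\<lambda>i\<in>I. g i / (1 + s)) \<partial>gamma_product I a)"
    by (rule nn_integral_gamma_product_tilt[OF fin nonneg s(1) k])
  also have "(\<integral>\<^sup>+g. k (\<lambda>i\<in>I. g i / (1 + s)) \<partial>gamma_product I a) = (\<integral>\<^sup>+g. k g \<partial>gamma_product I a)"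
    unfolding k_def using s(1) by (subst normalise_scale) auto
  also have "\<dots> = (\<integral>\<^sup>+p. indicator X p \<partial>dirichlet_measure I a)"
    unfolding k_def by (intro nn_integral_dirichlet_measure[symmetric] nonneg) measurable
  also have "(1 + s) powr - A = (1 - c) powr A"
    unfolding s(2) using c by (simp add: powr_divide powr_minus)
  finally show ?thesis by (simp add: k_def)
qed

text \<open>
  The fraction \<open>b\<close> taken by an extra exponential variable is independent of the normalised vector: by
  \<open>emeasure_gamma_stick_event\<close> the joint probability of an event for the vector and of \<open>b > c\<close> is a product.
\<close>
lemma distr_normalise_stick:
  "distr (gamma_product I a \<Otimes>\<^sub>M gamma_measure 1) ((\<Pi>\<^sub>M i\<in>I. borel) \<Otimes>\<^sub>M borel)
     (\<lambda>(g, z). (normalise I g, z / ((\<Sum>i\<in>I. g i) + z)))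
   = dirichlet_measure I a \<Otimes>\<^sub>M stick_measure A" (is "distr ?P ?B ?f = ?Q")
proof (rule sym, rule pair_measure_eqI)
  interpret D: prob_space "dirichlet_measure I a" by (rule prob_space_dirichlet_measure[OF nonneg])
  interpret B: prob_space "stick_measure A" by (rule prob_space_stick_measure)
  interpret G: prob_space "gamma_measure 1" by (rule prob_space_gamma_measure) simp
  interpret P: prob_space "gamma_product I a" by (rule prob_space_gamma_product[OF nonneg])
  interpret GP: pair_prob_space "gamma_product I a" "gamma_measure 1" by unfold_locales
  show "sigma_finite_measure (dirichlet_measure I a)" "sigma_finite_measure (stick_measure A)"
    by unfold_locales
  have cg: "gamma_product I a \<Otimes>\<^sub>M gamma_measure 1 \<rightarrow>\<^sub>M L = (\<Pi>\<^sub>M i\<in>I. borel) \<Otimes>\<^sub>M borel \<rightarrow>\<^sub>M L" for L :: "'z measure"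
    by (intro measurable_cong_sets sets_pair_measure_cong sets_gamma_product) auto
  have f1 [measurable]: "(\<lambda>x. snd x / ((\<Sum>i\<in>I. fst x i) + snd x)) \<in> borel_measurable ((\<Pi>\<^sub>M i\<in>I. (borel :: real measure)) \<Otimes>\<^sub>M borel)"
    by measurable
  have f: "?f \<in> ?P \<rightarrow>\<^sub>M ?B"
    unfolding cg split_beta' by measurable
  show "sets (dirichlet_measure I a \<Otimes>\<^sub>M stick_measure A) = sets (distr ?P ?B ?f)"
    by (simp cong: sets_pair_measure_cong)
  fix X Y assume X: "X \<in> sets (dirichlet_measure I a)" and Y: "Y \<in> sets (stick_measure A)"
  then have [measurable]: "X \<in> sets (\<Pi>\<^sub>M i\<in>I. borel)" "Y \<in> sets borel" by simp_all
  \<comment> \<open>For fixed \<open>X\<close>, the law of the fraction on the event that the normalised vector lies in \<open>X\<close>: a measure on the line, determined by half-lines.\<close>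
  define N where "N = distr (density ?P (\<lambda>x. indicator X (normalise I (fst x)))) borel (\<lambda>x. snd x / ((\<Sum>i\<in>I. fst x i) + snd x))"
  have m: "(\<lambda>x. indicator X (normalise I (fst x)) :: ennreal) \<in> borel_measurable ?P"
    unfolding cg by measurable
  have m': "(\<lambda>x. snd x / ((\<Sum>i\<in>I. fst x i) + snd x)) \<in> borel_measurable ?P"
    unfolding cg by measurable
  have N: "emeasure N Z = emeasure (distr ?P ?B ?f) (X \<times> Z)" if [measurable]: "Z \<in> sets borel" for Z
  proof -
    have "emeasure N Z = emeasure (density ?P (\<lambda>x. indicator X (normalise I (fst x)))) ((\<lambda>x. snd x / ((\<Sum>i\<in>I. fst x i) + snd x)) -` Z \<inter> space ?P)"
      unfolding N_def using m' by (subst emeasure_distr) auto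
    also have "\<dots> = (\<integral>\<^sup>+x. indicator X (normalise I (fst x)) * indicator ((\<lambda>x. snd x / ((\<Sum>i\<in>I. fst x i) + snd x)) -` Z \<inter> space ?P) x \<partial>?P)"
      using m m' by (intro emeasure_density measurable_sets[OF _ that])
    also have "\<dots> = (\<integral>\<^sup>+x. indicator (X \<times> Z) (?f x) \<partial>?P)"
      by (intro nn_integral_cong) (auto simp: indicator_def split_beta')
    also have "\<dots> = (\<integral>\<^sup>+x. indicator (X \<times> Z) x \<partial>distr ?P ?B ?f)"
      using f by (intro nn_integral_distr[symmetric]) auto
    finally show ?thesis by simp
  qed
  have "N = scale_measure (emeasure (dirichlet_measure I a) X) (stick_measure A)"
  proof (rule measure_eqI_lessThan)
    fix c :: real
    have N': "emeasure N {c<..} = (\<integral>\<^sup>+g. indicator X (normalise I g) * emeasure (gamma_measure 1) {z. c < z / ((\<Sum>i\<in>I. g i) + z)} \<partial>gamma_product I a)"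
    proof -
      have "emeasure N {c<..} = (\<integral>\<^sup>+x. indicator (X \<times> {c<..}) (?f x) \<partial>?P)"
        using f by (simp add: N nn_integral_distr flip: nn_integral_indicator)
      also have "\<dots> = (\<integral>\<^sup>+g. \<integral>\<^sup>+z. indicator (X \<times> {c<..}) (?f (g, z)) \<partial>gamma_measure 1 \<partial>gamma_product I a)"
        by (intro G.nn_integral_fst[symmetric] measurable_compose[OF f]) simp
      also have "\<dots> = (\<integral>\<^sup>+g. \<integral>\<^sup>+z. indicator X (normalise I g) * indicator {z. c < z / ((\<Sum>i\<in>I. g i) + z)} z \<partial>gamma_measure 1 \<partial>gamma_product I a)"
        by (intro nn_integral_cong) (auto simp: indicator_def)
      finally show ?thesis by (simp add: nn_integral_cmult)
    qed
    show "emeasure N {c<..} = emeasure (scale_measure (emeasure (dirichlet_measure I a) X) (stick_measure A)) {c<..}"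
    proof -
      consider "c < 0" | "0 \<le> c" "c < 1" | "1 \<le> c" by linarith
      then show ?thesis
      proof cases
        case 2
        then show ?thesis
          unfolding N' using total by (subst emeasure_gamma_stick_event) (auto simp: emeasure_stick_measure mult.commute)
      next
        case 1
        have "emeasure (gamma_measure 1) {z. c < z / (S + z)} = 1" if "0 < S" for S
        proof -
          have "AE z in gamma_measure 1. z \<in> {z. c < z / (S + z)}"
            using AE_gamma_measure_nonneg[of 1]
            by eventually_elim (use that 1 in \<open>auto intro!: less_le_trans[OF _ divide_nonneg_pos] add_pos_nonneg\<close>)
          then show ?thesis by (intro G.emeasure_eq_1_AE) auto
        qed
        then have "emeasure N {c<..} = (\<integral>\<^sup>+g. indicator X (normalise I g) \<partial>gamma_product I a)"
          unfolding N' by (intro nn_integral_cong_AE)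
            (use AE_gamma_product_sum_pos[OF nonneg fin total] in eventually_elim, simp)
        also have "\<dots> = emeasure (dirichlet_measure I a) X"
          using nn_integral_dirichlet_measure[of a "indicator X" I] by (simp add: nonneg)
        moreover have "emeasure (stick_measure A) {c<..} = 1"
        proof (rule B.emeasure_eq_1_AE)
          show "AE x in stick_measure A. x \<in> {c<..}"
            using AE_stick_measure[OF total] by eventually_elim (use 1 in auto)
        qed simp
        ultimately show ?thesis by simp
      next
        case 3
        have "emeasure (gamma_measure 1) {z. c < z / (S + z)} = 0" if "0 < S" for S
        proof -
          have "emeasure (gamma_measure 1) {z. c < z / (S + z)} = emeasure (gamma_measure 1) {}"
          proof (rule emeasure_eq_AE)
            show "AE z in gamma_measure 1. z \<in> {z. c < z / (S + z)} \<longleftrightarrow> z \<in> {}"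
              using AE_gamma_measure_nonneg[of 1]
            proof eventually_elim
              fix z :: real assume "0 \<le> z"
              then have "z / (S + z) \<le> 1" using that by simp
              then show "z \<in> {z. c < z / (S + z)} \<longleftrightarrow> z \<in> {}" using 3 by simp
            qed
          qed auto
          then show ?thesis by simp
        qed
        then have "emeasure N {c<..} = (\<integral>\<^sup>+g. 0 \<partial>gamma_product I a)"
          unfolding N' by (intro nn_integral_cong_AE)
            (use AE_gamma_product_sum_pos[OF nonneg fin total] in eventually_elim, simp)
        moreover have "emeasure (stick_measure A) {c<..} = emeasure (stick_measure A) {}"
        proof (rule emeasure_eq_AE)
          show "AE x in stick_measure A. x \<in> {c<..} \<longleftrightarrow> x \<in> {}"
            using AE_stick_measure[OF total] by eventually_elim (use 3 in auto)
        qed auto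
        ultimately show ?thesis by simp
      qed
    qed
    then show "emeasure N {c<..} < \<infinity>"
      by (simp add: D.emeasure_eq_measure B.emeasure_eq_measure ennreal_mult''[symmetric])
  qed (auto simp: N_def)
  then show "emeasure (dirichlet_measure I a) X * emeasure (stick_measure A) Y = emeasure (distr ?P ?B ?f) (X \<times> Y)"
    using N[of Y] by simp
qed

text \<open>
  Adding an independent exponential variable to coordinate \<open>j\<close> of a Gamma vector raises its parameter by one. After normalisation
  the old proportions are shrunk by \<open>1 - b\<close> and coordinate \<open>j\<close> receives the fraction \<open>b\<close>.
\<close>
lemma nn_integral_dirichlet_stick:
  assumes j: "j \<in> I" and h [measurable]: "h \<in> borel_measurable (\<Pi>\<^sub>M i\<in>I. borel)"
  shows "(\<integral>\<^sup>+p. h p \<partial>dirichlet_measure I (a(j := a j + 1)))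
       = (\<integral>\<^sup>+p. \<integral>\<^sup>+b. h (\<lambda>i\<in>I. (1 - b) * p i + b * of_bool (i = j)) \<partial>stick_measure A \<partial>dirichlet_measure I a)"
proof -
  interpret b: dirichlet_parameters I "a(j := a j + 1)" by (rule bump[OF j])
  interpret B: prob_space "stick_measure A" by (rule prob_space_stick_measure)
  interpret G: prob_space "gamma_measure 1" by (rule prob_space_gamma_measure) simp
  define F where "F x = h (\<lambda>i\<in>I. (1 - snd x) * fst x i + snd x * of_bool (i = j))" for x :: "('i \<Rightarrow> real) \<times> real"
  have F [measurable]: "F \<in> borel_measurable ((\<Pi>\<^sub>M i\<in>I. borel) \<Otimes>\<^sub>M borel)"
    unfolding F_def
    by (intro measurable_compose[OF _ h] measurable_restrict borel_measurable_add borel_measurable_times borel_measurable_diff)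
      (auto intro: measurable_compose[OF measurable_fst measurable_component_singleton])
  let ?f = "\<lambda>(g, z). (normalise I g, z / ((\<Sum>i\<in>I. g i) + z))"
  have cg: "gamma_product I a \<Otimes>\<^sub>M gamma_measure 1 \<rightarrow>\<^sub>M L = (\<Pi>\<^sub>M i\<in>I. borel) \<Otimes>\<^sub>M borel \<rightarrow>\<^sub>M L" for L :: "'z measure"
    by (intro measurable_cong_sets sets_pair_measure_cong sets_gamma_product) auto
  have f1 [measurable]: "(\<lambda>x. snd x / ((\<Sum>i\<in>I. fst x i) + snd x)) \<in> borel_measurable ((\<Pi>\<^sub>M i\<in>I. (borel :: real measure)) \<Otimes>\<^sub>M borel)"
    by measurable
  have f: "?f \<in> gamma_product I a \<Otimes>\<^sub>M gamma_measure 1 \<rightarrow>\<^sub>M (\<Pi>\<^sub>M i\<in>I. borel) \<Otimes>\<^sub>M borel"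
    unfolding cg split_beta' by measurable
  have "(\<integral>\<^sup>+p. h p \<partial>dirichlet_measure I (a(j := a j + 1)))
      = (\<integral>\<^sup>+g. h (normalise I g) \<partial>gamma_product I (a(j := a j + 1)))"
    by (rule nn_integral_dirichlet_measure[OF b.nonneg h])
  also have "\<dots> = (\<integral>\<^sup>+g. \<integral>\<^sup>+z. h (normalise I (g(j := g j + z))) \<partial>gamma_measure 1 \<partial>gamma_product I a)"
    by (rule nn_integral_gamma_product_convolution[OF fin nonneg j, symmetric]) measurable
  also have "\<dots> = (\<integral>\<^sup>+g. \<integral>\<^sup>+z. F (?f (g, z)) \<partial>gamma_measure 1 \<partial>gamma_product I a)"
  proof (rule nn_integral_cong_AE)
    show "AE g in gamma_product I a. (\<integral>\<^sup>+z. h (normalise I (g(j := g j + z))) \<partial>gamma_measure 1)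
        = (\<integral>\<^sup>+z. F (?f (g, z)) \<partial>gamma_measure 1)"
      using AE_gamma_product_sum_pos[OF nonneg fin total]
    proof eventually_elim
      fix g :: "'i \<Rightarrow> real" assume S: "0 < (\<Sum>i\<in>I. g i)"
      show "(\<integral>\<^sup>+z. h (normalise I (g(j := g j + z))) \<partial>gamma_measure 1) = (\<integral>\<^sup>+z. F (?f (g, z)) \<partial>gamma_measure 1)"
      proof (rule nn_integral_cong_AE)
        show "AE z in gamma_measure 1. h (normalise I (g(j := g j + z))) = F (?f (g, z))"
          using AE_gamma_measure_nonneg[of 1]
          by eventually_elim (simp add: F_def normalise_update[OF j S])
      qed
    qed
  qed
  also have "\<dots> = (\<integral>\<^sup>+x. F (?f x) \<partial>(gamma_product I a \<Otimes>\<^sub>M gamma_measure 1))"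
    by (rule G.nn_integral_fst, rule measurable_compose[OF f F])
  also have "\<dots> = (\<integral>\<^sup>+x. F x \<partial>(dirichlet_measure I a \<Otimes>\<^sub>M stick_measure A))"
    unfolding distr_normalise_stick[symmetric] by (rule nn_integral_distr[symmetric]) (use f F in simp_all)
  also have "\<dots> = (\<integral>\<^sup>+p. \<integral>\<^sup>+b. F (p, b) \<partial>stick_measure A \<partial>dirichlet_measure I a)"
  proof (rule B.nn_integral_fst[symmetric])
    have "sets (dirichlet_measure I a \<Otimes>\<^sub>M stick_measure A) = sets ((\<Pi>\<^sub>M i\<in>I. borel) \<Otimes>\<^sub>M borel)"
      by (intro sets_pair_measure_cong) simp_all
    from measurable_cong_sets[OF this refl] F show "F \<in> borel_measurable (dirichlet_measure I a \<Otimes>\<^sub>M stick_measure A)"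
      by blast
  qed
  finally show ?thesis by (simp add: F_def)
qed

end

section \<open>Uniqueness for the stick-breaking equation\<close>

lemma sets_PiM_borel_atMost:
  assumes "finite I"
  shows "sets (\<Pi>\<^sub>M i\<in>I. (borel :: real measure)) = sigma_sets (\<Pi>\<^sub>E i\<in>I. UNIV) {\<Pi>\<^sub>E i\<in>I. {..c i} | c. True}"
proof (cases "I = {}")
  case True
  then show ?thesis
    by (auto simp: sets_PiM_empty sigma_sets_empty_eq PiE_empty_domain intro: sigma_sets.intros)
next
  case False
  have "sets (\<Pi>\<^sub>M i\<in>I. sigma UNIV (range (atMost :: real \<Rightarrow> _)))
      = sets (sigma (\<Pi>\<^sub>E i\<in>I. UNIV) {{f\<in>\<Pi>\<^sub>E i\<in>I. UNIV. \<forall>i\<in>j. f i \<in> A i} | A j. j \<in> {I} \<and> A \<in> Pi j (\<lambda>_. range (atMost :: real \<Rightarrow> _))})"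
  proof (rule sets_PiM_sigma)
    show "\<exists>S\<subseteq>range (atMost :: real \<Rightarrow> _). countable S \<and> UNIV = \<Union> S" for i :: 'i
    proof (intro exI[of _ "range (\<lambda>n::nat. {..real n})"] conjI)
      show "UNIV = \<Union> (range (\<lambda>n::nat. {..real n}))"
        using real_arch_simple by auto
    qed auto
  qed (use assms in auto)
  also have "{{f\<in>\<Pi>\<^sub>E i\<in>I. UNIV. \<forall>i\<in>j. f i \<in> A i} | A j. j \<in> {I} \<and> A \<in> Pi j (\<lambda>_. range (atMost :: real \<Rightarrow> _))}
      = {\<Pi>\<^sub>E i\<in>I. {..c i} | c. True}" (is "?L = ?R")
  proof (intro set_eqI iffI)
    fix X assume "X \<in> ?L"
    then obtain A where A: "X = {f\<in>\<Pi>\<^sub>E i\<in>I. UNIV. \<forall>i\<in>I. f i \<in> A i}" and "A \<in> Pi I (\<lambda>_. range (atMost :: real \<Rightarrow> _))" by auto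
    then have "\<forall>i\<in>I. \<exists>c. A i = {..c}" by auto
    note A = A this
    from bchoice[OF A(2)] obtain c where "\<forall>i\<in>I. A i = {..c i}" by blast
    then have "X = (\<Pi>\<^sub>E i\<in>I. {..c i})" using A(1) by (auto simp: PiE_iff extensional_def)
    then show "X \<in> ?R" by blast
  next
    fix X assume "X \<in> ?R"
    then obtain c where "X = (\<Pi>\<^sub>E i\<in>I. {..c i})" by blast
    then have "X = {f\<in>\<Pi>\<^sub>E i\<in>I. UNIV. \<forall>i\<in>I. f i \<in> {..c i}}" by (auto simp: PiE_iff extensional_def)
    then show "X \<in> ?L" by (auto intro!: exI[of _ "\<lambda>i. {..c i}"])
  qed
  also have "(\<Pi>\<^sub>M i\<in>I. sigma UNIV (range (atMost :: real \<Rightarrow> _))) = (\<Pi>\<^sub>M i\<in>I. borel)"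
    by (simp add: borel_eq_atMost)
  finally show ?thesis by (subst (asm) sets_measure_of) auto
qed

text \<open>A Lipschitz function that decreases to the indicator of \<open>{..c}\<close> as \<open>k\<close> grows.\<close>
definition ramp :: "real \<Rightarrow> real \<Rightarrow> real \<Rightarrow> real" where
  "ramp k c x = max 0 (min 1 (1 - k * (x - c)))"

lemma ramp_bounds: "0 \<le> ramp k c x" "ramp k c x \<le> 1"
  by (auto simp: ramp_def)

lemma ramp_lipschitz:
  assumes "0 \<le> k"
  shows "\<bar>ramp k c x - ramp k c y\<bar> \<le> k * \<bar>x - y\<bar>"
proof -
  have "\<bar>ramp k c x - ramp k c y\<bar> \<le> \<bar>k * (x - c) - k * (y - c)\<bar>"
    by (auto simp: ramp_def max_def min_def)
  also have "\<dots> = k * \<bar>x - y\<bar>"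
    using assms by (simp add: right_diff_distrib[symmetric] abs_mult)
  finally show ?thesis .
qed

lemma ramp_tendsto: "(\<lambda>n. ramp (real n) c x) \<longlonglongrightarrow> indicator {..c} x"
proof (cases "x \<le> c")
  case True
  then have "ramp (real n) c x = 1" for n by (simp add: ramp_def mult_nonneg_nonpos)
  then show ?thesis using True by simp
next
  case False
  obtain N :: nat where N: "1 / (x - c) < real N" using reals_Archimedean2 by blast
  have "\<forall>\<^sub>F n in sequentially. ramp (real n) c x = 0"
    using eventually_ge_at_top[of N]
  proof eventually_elim
    fix n assume "N \<le> n"
    then have "1 / (x - c) < real n" using N by linarith
    then have "1 < real n * (x - c)" using False by (simp add: field_simps)
    then show "ramp (real n) c x = 0" by (simp add: ramp_def)
  qed
  then show ?thesis using False by (simp add: tendsto_eventually)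
qed

text \<open>
  Products of ramps are bounded and Lipschitz and converge to the indicators of orthants, which generate
  the \<open>\<sigma>\<close>-algebra.
\<close>
lemma measure_eqI_lipschitz:
  fixes Q1 Q2 :: "('i \<Rightarrow> real) measure"
  assumes I: "finite I" and Q: "prob_space Q1" "prob_space Q2"
    and sets [simp, measurable_cong]: "sets Q1 = sets (\<Pi>\<^sub>M i\<in>I. borel)" "sets Q2 = sets (\<Pi>\<^sub>M i\<in>I. borel)"
    and eq: "\<And>f K. f \<in> borel_measurable (\<Pi>\<^sub>M i\<in>I. borel) \<Longrightarrow> (\<And>p. 0 \<le> f p \<and> f p \<le> 1) \<Longrightarrow>
      (\<And>p q. \<bar>f p - f q\<bar> \<le> K * (\<Sum>i\<in>I. \<bar>p i - q i\<bar>)) \<Longrightarrow> (\<integral>p. f p \<partial>Q1) = (\<integral>p. f p \<partial>Q2)"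
  shows "Q1 = Q2"
proof (rule measure_eqI_generator_eq)
  interpret Q1: prob_space Q1 by fact
  interpret Q2: prob_space Q2 by fact
  let ?E = "{\<Pi>\<^sub>E i\<in>I. {..c i :: real} | c. True}"
  show "sets Q1 = sigma_sets (\<Pi>\<^sub>E i\<in>I. UNIV) ?E" "sets Q2 = sigma_sets (\<Pi>\<^sub>E i\<in>I. UNIV) ?E"
    using sets_PiM_borel_atMost[OF I] by simp_all
  show "Int_stable ?E"
  proof (rule Int_stableI)
    fix X Y assume "X \<in> ?E" "Y \<in> ?E"
    then obtain c d where "X = (\<Pi>\<^sub>E i\<in>I. {..c i})" "Y = (\<Pi>\<^sub>E i\<in>I. {..d i})" by blast
    then have "X \<inter> Y = (\<Pi>\<^sub>E i\<in>I. {..min (c i) (d i)})" by (auto simp: PiE_iff)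
    then show "X \<inter> Y \<in> ?E" by (auto intro!: exI[of _ "\<lambda>i. min (c i) (d i)"])
  qed
  show "?E \<subseteq> Pow (\<Pi>\<^sub>E i\<in>I. UNIV)" by auto
  show "range (\<lambda>n::nat. \<Pi>\<^sub>E i\<in>I. {..real n}) \<subseteq> ?E"
    by (auto intro!: exI[of _ "\<lambda>_. real n" for n])
  show "(\<Union>n::nat. \<Pi>\<^sub>E i\<in>I. {..real n}) = (\<Pi>\<^sub>E i\<in>I. UNIV)"
  proof (intro equalityI subsetI)
    fix p assume p: "p \<in> (\<Pi>\<^sub>E i\<in>I. (UNIV :: real set))"
    obtain n :: nat where n: "(\<Sum>i\<in>I. \<bar>p i\<bar>) \<le> real n" using real_arch_simple by blast
    have "p i \<le> real n" if "i \<in> I" for i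
      using member_le_sum[of i I "\<lambda>i. \<bar>p i\<bar>"] that I n by auto
    then show "p \<in> (\<Union>n::nat. \<Pi>\<^sub>E i\<in>I. {..real n})" using p by (auto simp: PiE_iff)
  qed auto
  show "emeasure Q1 (\<Pi>\<^sub>E i\<in>I. {..real n}) \<noteq> \<infinity>" for n by simp
  fix X assume "X \<in> ?E"
  then obtain c where X: "X = (\<Pi>\<^sub>E i\<in>I. {..c i})" by blast
  define f where "f n p = (\<Prod>i\<in>I. ramp (real n) (c i) (p i))" for n :: nat and p
  have [measurable]: "f n \<in> borel_measurable (\<Pi>\<^sub>M i\<in>I. borel)" for n
    unfolding f_def ramp_def by measurable
  have X' [measurable]: "X \<in> sets (\<Pi>\<^sub>M i\<in>I. borel)" unfolding X using I by (intro sets_PiM_I_finite) auto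
  have b: "0 \<le> f n p \<and> f n p \<le> 1" for n p
    unfolding f_def by (auto intro!: prod_nonneg prod_le_1 simp: ramp_bounds)
  have l: "\<bar>f n p - f n q\<bar> \<le> real n * (\<Sum>i\<in>I. \<bar>p i - q i\<bar>)" for n p q
  proof -
    have "\<bar>f n p - f n q\<bar> \<le> (\<Sum>i\<in>I. \<bar>ramp (real n) (c i) (p i) - ramp (real n) (c i) (q i)\<bar>)"
      using norm_prod_diff[of I "\<lambda>i. ramp (real n) (c i) (p i)" "\<lambda>i. ramp (real n) (c i) (q i)"]
      by (simp add: f_def ramp_bounds)
    also have "\<dots> \<le> (\<Sum>i\<in>I. real n * \<bar>p i - q i\<bar>)"
      by (intro sum_mono ramp_lipschitz) simp
    finally show ?thesis by (simp add: sum_distrib_left)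
  qed
  have lim: "(\<lambda>n. \<integral>p. f n p \<partial>Q) \<longlonglongrightarrow> measure Q X"
    if "prob_space Q" and [simp, measurable_cong]: "sets Q = sets (\<Pi>\<^sub>M i\<in>I. borel)" for Q
  proof -
    interpret Q: prob_space Q by fact
    have "(\<lambda>n. \<integral>p. f n p \<partial>Q) \<longlonglongrightarrow> (\<integral>p. indicator X p \<partial>Q)"
    proof (rule integral_dominated_convergence[where w="\<lambda>_. 1"])
      show "AE p in Q. (\<lambda>n. f n p) \<longlonglongrightarrow> indicator X p"
      proof (rule AE_I2)
        fix p assume "p \<in> space Q"
        then have p: "p \<in> (\<Pi>\<^sub>E i\<in>I. UNIV)" using sets_eq_imp_space_eq[OF that(2)] by (simp add: space_PiM)
        have "(\<lambda>n. f n p) \<longlonglongrightarrow> (\<Prod>i\<in>I. indicator {..c i} (p i))"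
          unfolding f_def by (intro tendsto_prod ramp_tendsto)
        also have "(\<Prod>i\<in>I. indicator {..c i} (p i)) = (indicator X p :: real)"
          using p I by (auto simp: X indicator_def PiE_iff prod_eq_1_iff)
        finally show "(\<lambda>n. f n p) \<longlonglongrightarrow> indicator X p" .
      qed
    qed (use b in auto)
    then show ?thesis using X' by simp
  qed
  have "(\<lambda>n. \<integral>p. f n p \<partial>Q1) = (\<lambda>n. \<integral>p. f n p \<partial>Q2)"
    proof (rule ext)
    show "(\<integral>p. f n p \<partial>Q1) = (\<integral>p. f n p \<partial>Q2)" for n
      by (rule eq[where K="real n"]) (use b l in auto)
  qed
  then have "measure Q1 X = measure Q2 X"
    using LIMSEQ_unique[OF lim[OF Q(1) sets(1)]] lim[OF Q(2) sets(2)] by simp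
  then show "emeasure Q1 X = emeasure Q2 X"
    by (simp add: Q1.emeasure_eq_measure Q2.emeasure_eq_measure)
qed

text \<open>One break of the stick: \<open>fst s\<close> is the broken fraction and \<open>snd s\<close> the index that receives it.\<close>
definition stick_step :: "nat \<Rightarrow> real \<times> nat \<Rightarrow> (nat \<Rightarrow> real) \<Rightarrow> nat \<Rightarrow> real" where
  "stick_step d s p = (\<lambda>i\<in>{..d}. (1 - fst s) * p i + fst s * of_bool (i = snd s))"

lemma measurable_stick_step [measurable]:
  "(\<lambda>(s, p). stick_step d s p) \<in> (borel \<Otimes>\<^sub>M count_space UNIV) \<Otimes>\<^sub>M (\<Pi>\<^sub>M i\<in>{..d}. borel) \<rightarrow>\<^sub>M (\<Pi>\<^sub>M i\<in>{..d}. borel)"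
proof -
  have [measurable]: "(\<lambda>x. snd (fst x)) \<in> (borel \<Otimes>\<^sub>M count_space UNIV) \<Otimes>\<^sub>M L \<rightarrow>\<^sub>M count_space (UNIV :: nat set)" for L :: "'z measure"
    by measurable
  show ?thesis
    unfolding stick_step_def split_beta'
    by (intro measurable_restrict borel_measurable_add borel_measurable_times borel_measurable_diff)
      (auto intro: measurable_compose[OF measurable_snd measurable_component_singleton])
qed

text \<open>
  Coupling two fixed points with the same break \<open>s\<close> contracts distances by \<open>1 - fst s\<close>. So replacing a test function by its
  average after one step multiplies its Lipschitz constant by \<open>1 - fst s\<close>, whose mean is below one. After
  \<open>n\<close> steps the two integrals differ by at most a multiple of the \<open>n\<close>-th power of that mean.
\<close>
lemma stick_fixed_point_unique:
  fixes S :: "(real \<times> nat) measure" and Q1 Q2 :: "(nat \<Rightarrow> real) measure"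
  assumes S: "prob_space S" "AE s in S. 0 \<le> fst s \<and> fst s \<le> 1" "(\<integral>s. 1 - fst s \<partial>S) < 1"
    and sets_S [simp, measurable_cong]: "sets S = sets (borel \<Otimes>\<^sub>M count_space UNIV)"
    and Q: "prob_space Q1" "prob_space Q2"
    and sets [simp, measurable_cong]: "sets Q1 = sets (\<Pi>\<^sub>M i\<in>{..d}. borel)" "sets Q2 = sets (\<Pi>\<^sub>M i\<in>{..d}. borel)"
    and bounded: "AE p in Q1. (\<Sum>i\<le>d. \<bar>p i\<bar>) \<le> 1" "AE p in Q2. (\<Sum>i\<le>d. \<bar>p i\<bar>) \<le> 1"
    and fixed: "distr (S \<Otimes>\<^sub>M Q1) (\<Pi>\<^sub>M i\<in>{..d}. borel) (\<lambda>(s, p). stick_step d s p) = Q1"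
      "distr (S \<Otimes>\<^sub>M Q2) (\<Pi>\<^sub>M i\<in>{..d}. borel) (\<lambda>(s, p). stick_step d s p) = Q2"
  shows "Q1 = Q2"
proof -
  interpret S: prob_space S by fact
  interpret Q1: prob_space Q1 by fact
  interpret Q2: prob_space Q2 by fact
  define r where "r = (\<integral>s. 1 - fst s \<partial>S)"
  have int_r: "integrable S (\<lambda>s. 1 - fst s)"
    by (rule S.integrable_const_bound[where B=1]) (use S(2) in \<open>auto elim: eventually_mono\<close>)
  have r: "0 \<le> r" "r < 1"
    using S(2,3) by (auto simp: r_def intro!: integral_nonneg_AE elim: eventually_mono)
  \<comment> \<open>The test functions, with a Lipschitz constant \<open>K\<close>.\<close>
  define adm where "adm K f \<longleftrightarrow> f \<in> borel_measurable (\<Pi>\<^sub>M i\<in>{..d}. borel) \<and> (\<forall>p. 0 \<le> f p \<and> f p \<le> 1) \<and>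
    (\<forall>p q. \<bar>f p - f q\<bar> \<le> K * (\<Sum>i\<le>d. \<bar>p i - q i\<bar>))" for K and f :: "(nat \<Rightarrow> real) \<Rightarrow> real"
  have adm_int: "integrable Q f" if "adm K f" "prob_space Q" "sets Q = sets (\<Pi>\<^sub>M i\<in>{..d}. borel)" for Q K f
  proof -
    interpret Q: prob_space Q by fact
    show ?thesis
      by (rule Q.integrable_const_bound[where B=1])
        (use that in \<open>auto simp: adm_def measurable_cong_sets[OF that(3) refl]\<close>)
  qed
  have adm_step: "adm (K * (1 - fst s)) (\<lambda>p. f (stick_step d s p))" if f: "adm K f" and s: "0 \<le> fst s \<and> fst s \<le> 1" for K f s
  proof -
    have "(\<lambda>p. (s, p)) \<in> (\<Pi>\<^sub>M i\<in>{..d}. borel) \<rightarrow>\<^sub>M (borel \<Otimes>\<^sub>M count_space UNIV) \<Otimes>\<^sub>M (\<Pi>\<^sub>M i\<in>{..d}. (borel :: real measure))"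
      by (rule measurable_Pair1') (simp add: space_pair_measure)
    from measurable_compose[OF this measurable_stick_step[of d]]
    have "(\<lambda>p. f (stick_step d s p)) \<in> borel_measurable (\<Pi>\<^sub>M i\<in>{..d}. borel)"
      using f by (auto simp: adm_def intro: measurable_compose)
    moreover have "\<bar>f (stick_step d s p) - f (stick_step d s q)\<bar> \<le> K * (1 - fst s) * (\<Sum>i\<le>d. \<bar>p i - q i\<bar>)" for p q
    proof -
      have "\<bar>f (stick_step d s p) - f (stick_step d s q)\<bar> \<le> K * (\<Sum>i\<le>d. \<bar>stick_step d s p i - stick_step d s q i\<bar>)"
        using f by (simp add: adm_def)
      also have "(\<Sum>i\<le>d. \<bar>stick_step d s p i - stick_step d s q i\<bar>) = (\<Sum>i\<le>d. (1 - fst s) * \<bar>p i - q i\<bar>)"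
        using s by (intro sum.cong) (auto simp: stick_step_def abs_mult right_diff_distrib[symmetric])
      finally show ?thesis by (simp add: sum_distrib_left mult_ac)
    qed
    ultimately show ?thesis using f by (auto simp: adm_def)
  qed
  have integral_step: "(\<integral>p. f p \<partial>Q) = (\<integral>s. (\<integral>p. f (stick_step d s p) \<partial>Q) \<partial>S)"
      "integrable S (\<lambda>s. \<integral>p. f (stick_step d s p) \<partial>Q)"
    if f: "adm K f" and Q: "prob_space Q" and [simp, measurable_cong]: "sets Q = sets (\<Pi>\<^sub>M i\<in>{..d}. borel)"
      and fixed: "distr (S \<Otimes>\<^sub>M Q) (\<Pi>\<^sub>M i\<in>{..d}. borel) (\<lambda>(s, p). stick_step d s p) = Q" for f K Q
  proof -
    interpret Q: prob_space Q by fact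
    interpret SQ: pair_prob_space S Q ..
    have m: "(\<lambda>(s, p). stick_step d s p) \<in> S \<Otimes>\<^sub>M Q \<rightarrow>\<^sub>M (\<Pi>\<^sub>M i\<in>{..d}. borel)"
      by measurable
    have f': "f \<in> borel_measurable (\<Pi>\<^sub>M i\<in>{..d}. borel)" "\<And>p. 0 \<le> f p \<and> f p \<le> 1" using f by (auto simp: adm_def)
    have fm: "(\<lambda>x. f (stick_step d (fst x) (snd x))) \<in> borel_measurable (S \<Otimes>\<^sub>M Q)"
      using measurable_compose[OF m f'(1)] by (simp add: split_beta')
    have int: "integrable (S \<Otimes>\<^sub>M Q) (\<lambda>(s, p). f (stick_step d s p))"
      by (rule SQ.integrable_const_bound[where B=1]) (use f' fm in \<open>auto simp: split_beta'\<close>)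
    have "(\<integral>p. f p \<partial>Q) = (\<integral>p. f p \<partial>distr (S \<Otimes>\<^sub>M Q) (\<Pi>\<^sub>M i\<in>{..d}. borel) (\<lambda>(s, p). stick_step d s p))"
      by (simp add: fixed)
    also have "\<dots> = (\<integral>x. (\<lambda>(s, p). f (stick_step d s p)) x \<partial>(S \<Otimes>\<^sub>M Q))"
      using m f'(1) by (subst integral_distr) (auto simp: split_beta')
    also have "\<dots> = (\<integral>s. (\<integral>p. f (stick_step d s p) \<partial>Q) \<partial>S)"
      using SQ.integral_fst'[OF int] by simp
    finally show "(\<integral>p. f p \<partial>Q) = (\<integral>s. (\<integral>p. f (stick_step d s p) \<partial>Q) \<partial>S)" .
    show "integrable S (\<lambda>s. \<integral>p. f (stick_step d s p) \<partial>Q)"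
      using SQ.integrable_fst'[OF int] by simp
  qed
  have base: "\<bar>(\<integral>p. f p \<partial>Q) - f (\<lambda>_. 0)\<bar> \<le> K"
    if f: "adm K f" and K: "0 \<le> K" and Q: "prob_space Q" and s: "sets Q = sets (\<Pi>\<^sub>M i\<in>{..d}. borel)"
      and b: "AE p in Q. (\<Sum>i\<le>d. \<bar>p i\<bar>) \<le> 1" for f K Q
  proof -
    interpret Q: prob_space Q by fact
    have i: "integrable Q f" by (rule adm_int[OF f Q s])
    have "(\<integral>p. f p \<partial>Q) - f (\<lambda>_. 0) = (\<integral>p. f p - f (\<lambda>_. 0) \<partial>Q)"
      using i by (simp add: Q.prob_space)
    also have "\<bar>\<dots>\<bar> \<le> (\<integral>p. \<bar>f p - f (\<lambda>_. 0)\<bar> \<partial>Q)" by (rule integral_abs_bound)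
    also have "\<dots> \<le> (\<integral>p. K \<partial>Q)"
    proof (rule integral_mono_AE)
      show "AE p in Q. \<bar>f p - f (\<lambda>_. 0)\<bar> \<le> K"
        using b
      proof eventually_elim
        fix p assume p: "(\<Sum>i\<le>d. \<bar>p i :: real\<bar>) \<le> 1"
        have "\<bar>f p - f (\<lambda>_. 0)\<bar> \<le> K * (\<Sum>i\<le>d. \<bar>p i - (\<lambda>_. 0) i\<bar>)" using f unfolding adm_def by blast
        also have "\<dots> \<le> K" using mult_left_mono[OF p K] by simp
        finally show "\<bar>f p - f (\<lambda>_. 0)\<bar> \<le> K" .
      qed
    qed (use i in auto)
    finally show ?thesis by (simp add: Q.prob_space)
  qed
  have contraction: "\<bar>(\<integral>p. f p \<partial>Q1) - (\<integral>p. f p \<partial>Q2)\<bar> \<le> 2 * K * r ^ n" if "adm K f" "0 \<le> K" for n K f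
    using that
  proof (induction n arbitrary: K f)
    case 0
    then show ?case
      using base[OF 0 Q(1) sets(1) bounded(1)] base[OF 0 Q(2) sets(2) bounded(2)] by simp
  next
    case (Suc n)
    note i1 = integral_step[OF Suc.prems(1) Q(1) sets(1) fixed(1)] and i2 = integral_step[OF Suc.prems(1) Q(2) sets(2) fixed(2)]
    have "(\<integral>p. f p \<partial>Q1) - (\<integral>p. f p \<partial>Q2) = (\<integral>s. (\<integral>p. f (stick_step d s p) \<partial>Q1) - (\<integral>p. f (stick_step d s p) \<partial>Q2) \<partial>S)"
      using i1 i2 by simp
    also have "\<bar>\<dots>\<bar> \<le> (\<integral>s. \<bar>(\<integral>p. f (stick_step d s p) \<partial>Q1) - (\<integral>p. f (stick_step d s p) \<partial>Q2)\<bar> \<partial>S)"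
      by (rule integral_abs_bound)
    also have "\<dots> \<le> (\<integral>s. 2 * K * r ^ n * (1 - fst s) \<partial>S)"
    proof (rule integral_mono_AE)
      show "AE s in S. \<bar>(\<integral>p. f (stick_step d s p) \<partial>Q1) - (\<integral>p. f (stick_step d s p) \<partial>Q2)\<bar> \<le> 2 * K * r ^ n * (1 - fst s)"
        using S(2)
      proof eventually_elim
        fix s :: "real \<times> nat" assume s: "0 \<le> fst s \<and> fst s \<le> 1"
        have "0 \<le> K * (1 - fst s)" using s Suc.prems by simp
        from Suc.IH[OF adm_step[OF Suc.prems(1) s] this]
        show "\<bar>(\<integral>p. f (stick_step d s p) \<partial>Q1) - (\<integral>p. f (stick_step d s p) \<partial>Q2)\<bar> \<le> 2 * K * r ^ n * (1 - fst s)"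
          by (simp only: mult_ac)
      qed
    qed (use i1 i2 int_r in auto)
    also have "\<dots> = 2 * K * r ^ n * r" using int_r by (simp add: r_def)
    finally show ?case by (simp add: mult_ac)
  qed
  show ?thesis
  proof (rule measure_eqI_lipschitz[OF finite_atMost Q sets])
    fix f and K :: real
    assume f: "f \<in> borel_measurable (\<Pi>\<^sub>M i\<in>{..d}. borel)" "\<And>p. 0 \<le> f p \<and> f p \<le> 1"
      "\<And>p q. \<bar>f p - f q\<bar> \<le> K * (\<Sum>i\<le>d. \<bar>p i - q i\<bar>)"
    have "adm (max 0 K) f"
      using f by (auto simp: adm_def intro!: order_trans[OF f(3)] mult_right_mono sum_nonneg)
    then have "\<bar>(\<integral>p. f p \<partial>Q1) - (\<integral>p. f p \<partial>Q2)\<bar> \<le> 2 * max 0 K * r ^ n" for n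
      by (rule contraction) simp
    moreover have "(\<lambda>n. 2 * max 0 K * r ^ n) \<longlonglongrightarrow> 2 * max 0 K * 0"
      using r by (intro tendsto_mult tendsto_const LIMSEQ_power_zero) auto
    ultimately have "\<bar>(\<integral>p. f p \<partial>Q1) - (\<integral>p. f p \<partial>Q2)\<bar> \<le> 2 * max 0 K * 0"
      by (intro LIMSEQ_le_const) auto
    then show "(\<integral>p. f p \<partial>Q1) = (\<integral>p. f p \<partial>Q2)" by simp
  qed
qed

section \<open>Finite measurable partitions\<close>

text \<open>
  A partition into at most \<open>d + 1\<close> measurable cells is encoded by the map that sends a point to the index of
  its cell. Common refinements then become arithmetic on indices.
\<close>
definition code :: "'a measure \<Rightarrow> nat \<Rightarrow> ('a \<Rightarrow> nat) \<Rightarrow> bool" where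
  "code L d c \<longleftrightarrow> c \<in> L \<rightarrow>\<^sub>M count_space UNIV \<and> (\<forall>x\<in>space L. c x \<le> d)"

definition cell :: "'a measure \<Rightarrow> ('a \<Rightarrow> nat) \<Rightarrow> nat \<Rightarrow> 'a set" where
  "cell L c i = c -` {i} \<inter> space L"

definition cell_masses :: "'a measure \<Rightarrow> ('a \<Rightarrow> nat) \<Rightarrow> nat \<Rightarrow> 'a measure \<Rightarrow> nat \<Rightarrow> real" where
  "cell_masses L c d l = (\<lambda>i\<in>{..d}. measure l (cell L c i))"

lemma sets_cell: "code L d c \<Longrightarrow> cell L c i \<in> sets L"
  unfolding code_def cell_def by (auto intro: measurable_sets)

lemma disjoint_cells: "disjoint_family (cell L c)"
  by (auto simp: disjoint_family_on_def cell_def)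

lemma UN_cell: "code L d c \<Longrightarrow> (\<Union>i\<le>d. cell L c i) = space L"
  by (auto simp: code_def cell_def)

lemma measurable_measure_prob_algebra:
  assumes "B \<in> sets L"
  shows "(\<lambda>l. measure l B) \<in> borel_measurable (prob_algebra L)"
  using measurable_measure_subprob_algebra[OF assms] by (simp add: prob_algebra_def measurable_restrict_space1)

lemma measurable_cell_masses [measurable (raw)]:
  "code L d c \<Longrightarrow> cell_masses L c d \<in> prob_algebra L \<rightarrow>\<^sub>M (\<Pi>\<^sub>M i\<in>{..d}. borel)"
  unfolding cell_masses_def by (intro measurable_restrict measurable_measure_prob_algebra sets_cell)

lemma measure_cells_sum:
  assumes "code L d c" "finite_measure l" "sets l = sets L"
  shows "(\<Sum>i\<le>d. measure l (cell L c i)) = measure l (space L)"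
proof -
  interpret finite_measure l by fact
  have "measure l (\<Union>i\<in>{..d}. cell L c i) = (\<Sum>i\<in>{..d}. measure l (cell L c i))"
    using sets_cell[OF assms(1)] disjoint_cells[of L c] assms(3)
    by (intro finite_measure_finite_Union) (auto simp: disjoint_family_on_def)
  then show ?thesis using UN_cell[OF assms(1)] by simp
qed

text \<open>
  Codes and partitions carry the same information: a partition is recovered as the cells of the code that sends \<open>x\<close>
  to the index of its block.
\<close>
lemma is_dirichlet_process_code:
  "is_dirichlet_process \<alpha> Q \<longleftrightarrow> Q \<in> space (prob_algebra (prob_algebra \<alpha>)) \<and>
    (\<forall>d c. code \<alpha> d c \<longrightarrow> distr Q (\<Pi>\<^sub>M i\<in>{..d}. borel) (cell_masses \<alpha> c d) = dirichlet_measure {..d} (\<lambda>i. measure \<alpha> (cell \<alpha> c i)))"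
proof (intro iffI conjI allI impI; (elim conjE)?)
  assume Q: "is_dirichlet_process \<alpha> Q"
  then show "Q \<in> space (prob_algebra (prob_algebra \<alpha>))" by (simp add: is_dirichlet_process_def)
  fix d c assume c: "code \<alpha> d c"
  have "disjoint_family_on (cell \<alpha> c) {..d}" using disjoint_cells[of \<alpha> c] by (auto simp: disjoint_family_on_def)
  then show "distr Q (\<Pi>\<^sub>M i\<in>{..d}. borel) (cell_masses \<alpha> c d) = dirichlet_measure {..d} (\<lambda>i. measure \<alpha> (cell \<alpha> c i))"
    using Q c UN_cell[OF c] sets_cell[OF c] unfolding is_dirichlet_process_def cell_masses_def[abs_def] by blast
next
  assume Q: "Q \<in> space (prob_algebra (prob_algebra \<alpha>))"
    and *: "\<forall>d c. code \<alpha> d c \<longrightarrow> distr Q (\<Pi>\<^sub>M i\<in>{..d}. borel) (cell_masses \<alpha> c d) = dirichlet_measure {..d} (\<lambda>i. measure \<alpha> (cell \<alpha> c i))"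
  show "is_dirichlet_process \<alpha> Q"
    unfolding is_dirichlet_process_def
  proof (intro conjI allI impI Q, elim conjE)
    fix d and B :: "nat \<Rightarrow> 'a set"
    assume B: "\<forall>i\<le>d. B i \<in> sets \<alpha>" "disjoint_family_on B {..d}" "(\<Union>i\<le>d. B i) = space \<alpha>"
    define c where "c x = (LEAST i. x \<in> B i)" for x
    have eq: "c x = i" if "x \<in> B i" "i \<le> d" for x i
    proof -
      have "x \<in> B (c x)" "c x \<le> i" unfolding c_def using that by (auto intro: LeastI Least_le)
      moreover from this that have "c x \<in> {..d}" "i \<in> {..d}" by auto
      ultimately show ?thesis using B(2) that unfolding disjoint_family_on_def by blast
    qed
    have cell: "cell \<alpha> c i = B i" if i: "i \<le> d" for i
    proof
      show "cell \<alpha> c i \<subseteq> B i"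
      proof
        fix x assume x: "x \<in> cell \<alpha> c i"
        then obtain k where "k \<le> d" "x \<in> B k" using B(3) by (auto simp: cell_def)
        then show "x \<in> B i" using eq[of x k] x by (auto simp: cell_def)
      qed
      show "B i \<subseteq> cell \<alpha> c i" using eq i B by (auto simp: cell_def)
    qed
    have "code \<alpha> d c"
      unfolding code_def
    proof (intro conjI ballI)
      show le: "c x \<le> d" if "x \<in> space \<alpha>" for x
        using that B(3) eq by fastforce
      show "c \<in> \<alpha> \<rightarrow>\<^sub>M count_space UNIV"
      proof (rule measurableI)
        fix A :: "nat set"
        have "c -` A \<inter> space \<alpha> = (\<Union>i\<in>A \<inter> {..d}. cell \<alpha> c i)"
          using le by (auto simp: cell_def)
        also have "\<dots> = (\<Union>i\<in>A \<inter> {..d}. B i)" using cell by auto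
        also have "\<dots> \<in> sets \<alpha>" using B(1) by (intro sets.finite_UN) auto
        finally show "c -` A \<inter> space \<alpha> \<in> sets \<alpha>" .
      qed auto
    qed
    with * have "distr Q (\<Pi>\<^sub>M i\<in>{..d}. borel) (cell_masses \<alpha> c d) = dirichlet_measure {..d} (\<lambda>i. measure \<alpha> (cell \<alpha> c i))"
      by blast
    also have "cell_masses \<alpha> c d = (\<lambda>l. \<lambda>i\<in>{..d}. measure l (B i))"
      using cell by (auto simp: cell_masses_def fun_eq_iff)
    also have "dirichlet_measure {..d} (\<lambda>i. measure \<alpha> (cell \<alpha> c i)) = dirichlet_measure {..d} (\<lambda>i. measure \<alpha> (B i))"
      unfolding dirichlet_measure_def using cell by (intro distr_cong PiM_cong) auto
    finally show "distr Q (\<Pi>\<^sub>M i\<in>{..d}. borel) (\<lambda>l. \<lambda>i\<in>{..d}. measure l (B i)) = dirichlet_measure {..d} (\<lambda>i. measure \<alpha> (B i))" .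
  qed
qed

section \<open>The stick-breaking construction of the Dirichlet process\<close>

text \<open>
  Clipping makes the weights below nonnegative and summable for every sequence, not only almost every one.
\<close>
definition clip :: "real \<Rightarrow> real" where "clip b = max 0 (min 1 b)"

lemma clip_bounds: "0 \<le> clip b" "clip b \<le> 1" by (auto simp: clip_def)

lemma clip_id: "0 \<le> b \<Longrightarrow> b \<le> 1 \<Longrightarrow> clip b = b" by (auto simp: clip_def)

lemma measurable_clip [measurable]: "clip \<in> borel_measurable borel" unfolding clip_def by measurable

text \<open>
  A point \<open>\<omega>\<close> is a sequence of pairs (broken fraction, location); weight \<open>n\<close> is the piece that break \<open>n\<close> takes
  from what its predecessors have left.
\<close>
definition stick_weight :: "(nat \<Rightarrow> real \<times> 'a) \<Rightarrow> nat \<Rightarrow> real" where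
  "stick_weight \<omega> n = clip (fst (\<omega> n)) * (\<Prod>k<n. 1 - clip (fst (\<omega> k)))"

definition stick_sum :: "('a \<Rightarrow> real) \<Rightarrow> (nat \<Rightarrow> real \<times> 'a) \<Rightarrow> real" where
  "stick_sum g \<omega> = (\<Sum>n. stick_weight \<omega> n * g (snd (\<omega> n)))"

lemma stick_weight_nonneg: "0 \<le> stick_weight \<omega> n"
  unfolding stick_weight_def by (intro mult_nonneg_nonneg prod_nonneg) (auto simp: clip_bounds)

lemma sum_stick_weight: "(\<Sum>k<n. stick_weight \<omega> k) = 1 - (\<Prod>k<n. 1 - clip (fst (\<omega> k)))"
  by (induction n) (simp_all add: stick_weight_def algebra_simps)

lemma sum_stick_weight_le_1: "(\<Sum>k<n. stick_weight \<omega> k) \<le> 1"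
  unfolding sum_stick_weight by (auto intro!: prod_nonneg simp: clip_bounds)

lemma summable_stick_weight: "summable (stick_weight \<omega>)"
  using sum_stick_weight_le_1 stick_weight_nonneg by (intro summableI_nonneg_bounded[where x=1]) auto

lemma summable_stick_sum:
  assumes "\<And>x. 0 \<le> g x \<and> g x \<le> (1 :: real)"
  shows "summable (\<lambda>n. stick_weight \<omega> n * g (snd (\<omega> n)))"
  by (rule summable_comparison_test'[OF summable_stick_weight, of 0])
    (use assms in \<open>auto simp: abs_mult stick_weight_nonneg intro: mult_left_le\<close>)

lemma stick_sum_bounds:
  assumes "\<And>x. 0 \<le> g x \<and> g x \<le> (1 :: real)"
  shows "0 \<le> stick_sum g \<omega>" "stick_sum g \<omega> \<le> 1"
proof -
  show "0 \<le> stick_sum g \<omega>"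
    unfolding stick_sum_def using assms by (intro suminf_nonneg summable_stick_sum) (auto simp: stick_weight_nonneg)
  have "stick_sum g \<omega> \<le> (\<Sum>n. stick_weight \<omega> n)"
    unfolding stick_sum_def using assms
    by (intro suminf_le summable_stick_sum summable_stick_weight) (auto simp: stick_weight_nonneg intro: mult_left_le)
  also have "\<dots> \<le> 1"
    using sum_stick_weight_le_1 by (intro suminf_le_const summable_stick_weight) auto
  finally show "stick_sum g \<omega> \<le> 1" .
qed

lemma stick_weight_case_nat:
  "stick_weight (case_nat s \<omega>) 0 = clip (fst s)"
  "stick_weight (case_nat s \<omega>) (Suc n) = (1 - clip (fst s)) * stick_weight \<omega> n"
  by (simp_all add: stick_weight_def prod.lessThan_Suc_shift mult_ac del: prod.lessThan_Suc)

text \<open>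
  The self-similarity of stick breaking: after the first break, the remainder is broken in the same way. This is what
  makes the laws below fixed points of the stick step.
\<close>
lemma stick_sum_case_nat:
  assumes "\<And>x. 0 \<le> g x \<and> g x \<le> (1 :: real)"
  shows "stick_sum g (case_nat s \<omega>) = clip (fst s) * g (snd s) + (1 - clip (fst s)) * stick_sum g \<omega>"
proof -
  have "stick_sum g (case_nat s \<omega>) = clip (fst s) * g (snd s) + (\<Sum>n. (1 - clip (fst s)) * (stick_weight \<omega> n * g (snd (\<omega> n))))"
    unfolding stick_sum_def
    using suminf_split_head[OF summable_stick_sum[where g=g and \<omega>="case_nat s \<omega>", OF assms]]
    by (simp add: stick_weight_case_nat mult.assoc)
  also have "\<dots> = clip (fst s) * g (snd s) + (1 - clip (fst s)) * stick_sum g \<omega>"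
    unfolding stick_sum_def by (subst suminf_mult[OF summable_stick_sum[where g=g, OF assms]]) simp
  finally show ?thesis .
qed

locale dirichlet_base =
  fixes \<alpha> :: "'a measure"
  assumes finite_base: "finite_measure \<alpha>" and base_pos: "0 < measure \<alpha> (space \<alpha>)"
begin

definition "mass = measure \<alpha> (space \<alpha>)"
definition "base = scale_measure (ennreal (1 / mass)) \<alpha>"
definition "stick_space = stick_measure mass \<Otimes>\<^sub>M base"
definition "sticks = (\<Pi>\<^sub>M n\<in>(UNIV :: nat set). stick_space)"

lemma mass_pos: "0 < mass" using base_pos by (simp add: mass_def)

lemma sets_base [simp, measurable_cong]: "sets base = sets \<alpha>" by (simp add: base_def)
lemma space_base [simp]: "space base = space \<alpha>" by (rule sets_eq_imp_space_eq) simp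

lemma emeasure_alpha: "emeasure \<alpha> X = ennreal (measure \<alpha> X)"
  using finite_base by (simp add: finite_measure.emeasure_eq_measure)

lemma emeasure_base: "emeasure base X = ennreal (measure \<alpha> X / mass)"
  using mass_pos by (simp add: base_def emeasure_alpha ennreal_mult'[symmetric] less_imp_le)

lemma prob_space_base: "prob_space base"
  using mass_pos by (intro prob_spaceI) (simp add: emeasure_base flip: mass_def)

lemma prob_space_stick_space: "prob_space stick_space"
proof -
  interpret s: prob_space "stick_measure mass" by (rule prob_space_stick_measure)
  interpret b: prob_space base by (rule prob_space_base)
  interpret pair_prob_space "stick_measure mass" base ..
  show ?thesis unfolding stick_space_def by (rule prob_space_axioms)
qed

lemma prob_space_sticks: "prob_space sticks"
  unfolding sticks_def by (intro prob_space_PiM prob_space_stick_space)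

lemma sets_stick_space [measurable_cong]: "sets stick_space = sets (borel \<Otimes>\<^sub>M \<alpha>)"
  unfolding stick_space_def by (intro sets_pair_measure_cong) simp_all

lemma sticks_shift: "distr (stick_space \<Otimes>\<^sub>M sticks) sticks (\<lambda>(s, \<omega>). case_nat s \<omega>) = sticks"
proof -
  interpret prob_space stick_space by (rule prob_space_stick_space)
  interpret sequence_space stick_space ..
  show ?thesis unfolding sticks_def by (rule PiM_iter)
qed

lemma measurable_stick_coordinate:
  "(\<lambda>\<omega>. fst (\<omega> n)) \<in> borel_measurable sticks" "(\<lambda>\<omega>. snd (\<omega> n)) \<in> sticks \<rightarrow>\<^sub>M \<alpha>"
proof -
  have *: "(\<lambda>\<omega>. \<omega> n) \<in> sticks \<rightarrow>\<^sub>M borel \<Otimes>\<^sub>M \<alpha>"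
    unfolding sticks_def
    using measurable_component_singleton[of n UNIV "\<lambda>_. stick_space"] measurable_cong_sets[OF refl sets_stick_space] by blast
  show "(\<lambda>\<omega>. fst (\<omega> n)) \<in> borel_measurable sticks" "(\<lambda>\<omega>. snd (\<omega> n)) \<in> sticks \<rightarrow>\<^sub>M \<alpha>"
    using measurable_compose[OF * measurable_fst] measurable_compose[OF * measurable_snd] by simp_all
qed

lemma measurable_stick_weight [measurable]: "(\<lambda>\<omega>. stick_weight \<omega> n) \<in> borel_measurable sticks"
  unfolding stick_weight_def
  by (intro borel_measurable_times borel_measurable_prod borel_measurable_diff borel_measurable_const
      measurable_compose[OF measurable_stick_coordinate(1) measurable_clip])

lemma measurable_stick_sum [measurable]:
  assumes "g \<in> borel_measurable \<alpha>"
  shows "stick_sum g \<in> borel_measurable sticks"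
  unfolding stick_sum_def
  by (intro borel_measurable_suminf borel_measurable_times measurable_stick_weight
      measurable_compose[OF measurable_stick_coordinate(2) assms])

lemma AE_stick_space: "AE s in stick_space. 0 \<le> fst s \<and> fst s < 1"
proof -
  interpret s: prob_space "stick_measure mass" by (rule prob_space_stick_measure)
  interpret b: prob_space base by (rule prob_space_base)
  interpret pair_prob_space "stick_measure mass" base ..
  show ?thesis
    unfolding stick_space_def using AE_stick_measure[OF mass_pos]
  proof (intro AE_pair_measure)
    show "{s \<in> space (stick_measure mass \<Otimes>\<^sub>M base). 0 \<le> fst s \<and> fst s < 1} \<in> sets (stick_measure mass \<Otimes>\<^sub>M base)"
      by measurable
  qed (auto elim: eventually_mono)
qed

lemma nn_integral_stick_space:
  assumes "f \<in> borel_measurable (borel \<Otimes>\<^sub>M \<alpha>)"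
  shows "(\<integral>\<^sup>+s. f s \<partial>stick_space) = (\<integral>\<^sup>+x. \<integral>\<^sup>+b. f (b, x) \<partial>stick_measure mass \<partial>base)"
proof -
  interpret s: prob_space "stick_measure mass" by (rule prob_space_stick_measure)
  interpret b: prob_space base by (rule prob_space_base)
  interpret pair_sigma_finite "stick_measure mass" base ..
  show ?thesis unfolding stick_space_def
    using assms by (intro nn_integral_snd[symmetric]) (simp add: measurable_cong_sets[OF sets_stick_space[unfolded stick_space_def] refl])
qed

lemma nn_integral_remaining_stick: "(\<integral>\<^sup>+s. ennreal (1 - fst s) \<partial>stick_space) = ennreal (mass / (mass + 1))"
proof -
  interpret b: prob_space base by (rule prob_space_base)
  show ?thesis
    by (subst nn_integral_stick_space)
      (simp_all add: nn_integral_stick_measure_remainder[OF mass_pos] b.emeasure_space_1[simplified])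
qed

text \<open>
  By self-similarity, the mean \<open>D\<close> of the mass that is never broken off satisfies \<open>D = E(1 - b) D\<close> with
  \<open>E(1 - b) < 1\<close>, hence \<open>D = 0\<close>.
\<close>
lemma AE_stick_sum_1: "AE \<omega> in sticks. stick_sum (\<lambda>_. 1) \<omega> = 1"
proof -
  interpret S: prob_space stick_space by (rule prob_space_stick_space)
  interpret P: prob_space sticks by (rule prob_space_sticks)
  let ?T = "stick_sum (\<lambda>_. 1) :: (nat \<Rightarrow> real \<times> 'a) \<Rightarrow> real"
  define D where "D = (\<integral>\<^sup>+\<omega>. ennreal (1 - ?T \<omega>) \<partial>sticks)"
  have [measurable]: "?T \<in> borel_measurable sticks" by measurable
  have "(\<lambda>(s, \<omega>). case_nat s \<omega>) \<in> stick_space \<Otimes>\<^sub>M sticks \<rightarrow>\<^sub>M sticks"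
    unfolding sticks_def by measurable
  then have shift [measurable]: "(\<lambda>(s, \<omega>). case_nat s \<omega>) \<in> stick_space \<Otimes>\<^sub>M sticks \<rightarrow>\<^sub>M sticks" .
  have T: "0 \<le> ?T \<omega>" "?T \<omega> \<le> 1" for \<omega> using stick_sum_bounds[of "\<lambda>_. 1"] by auto
  have "D = (\<integral>\<^sup>+\<omega>. ennreal (1 - ?T \<omega>) \<partial>distr (stick_space \<Otimes>\<^sub>M sticks) sticks (\<lambda>(s, \<omega>). case_nat s \<omega>))"
    by (simp add: D_def sticks_shift)
  also have "\<dots> = (\<integral>\<^sup>+x. ennreal (1 - ?T (case_nat (fst x) (snd x))) \<partial>(stick_space \<Otimes>\<^sub>M sticks))"
    by (subst nn_integral_distr) (auto simp: split_beta')
  also have "\<dots> = (\<integral>\<^sup>+s. \<integral>\<^sup>+\<omega>. ennreal (1 - ?T (case_nat s \<omega>)) \<partial>sticks \<partial>stick_space)"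
    using shift by (subst P.nn_integral_fst[symmetric]) (auto simp: split_beta')
  also have "\<dots> = (\<integral>\<^sup>+s. ennreal (1 - clip (fst s)) * D \<partial>stick_space)"
  proof (rule nn_integral_cong)
    fix s :: "real \<times> 'a"
    have "ennreal (1 - ?T (case_nat s \<omega>)) = ennreal (1 - clip (fst s)) * ennreal (1 - ?T \<omega>)" for \<omega>
      by (subst stick_sum_case_nat) (auto simp: ennreal_mult'[symmetric] clip_bounds algebra_simps)
    then show "(\<integral>\<^sup>+\<omega>. ennreal (1 - ?T (case_nat s \<omega>)) \<partial>sticks) = ennreal (1 - clip (fst s)) * D"
      unfolding D_def by (simp add: nn_integral_cmult)
  qed
  also have "\<dots> = (\<integral>\<^sup>+s. ennreal (1 - fst s) * D \<partial>stick_space)"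
    by (intro nn_integral_cong_AE) (use AE_stick_space in \<open>eventually_elim, simp add: clip_id\<close>)
  also have "\<dots> = ennreal (mass / (mass + 1)) * D"
    by (subst nn_integral_multc) (simp_all add: nn_integral_remaining_stick)
  finally have D: "D = ennreal (mass / (mass + 1)) * D" .
  have "D \<le> (\<integral>\<^sup>+\<omega>. 1 \<partial>sticks)"
    unfolding D_def using T by (intro nn_integral_mono) (simp add: ennreal_le_1)
  then have "D \<le> 1" by (simp add: P.emeasure_space_1)
  then obtain r where r: "D = ennreal r" "0 \<le> r" by (cases D) (auto simp: top_unique)
  have "r = mass / (mass + 1) * r"
    using D r mass_pos by (simp add: ennreal_mult'[symmetric])
  then have "r = 0" using mass_pos by (simp add: field_simps)
  then have "AE \<omega> in sticks. ennreal (1 - ?T \<omega>) = 0"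
    using r by (subst nn_integral_0_iff_AE[symmetric]) (auto simp: D_def)
  then show ?thesis by eventually_elim (use T in \<open>auto simp: ennreal_eq_0_iff intro!: antisym\<close>)
qed

text \<open>
  On the null set where the weights do not add up to one, the value \<open>base\<close> keeps the function measurable with values
  in the probability measures.
\<close>
definition random_measure :: "(nat \<Rightarrow> real \<times> 'a) \<Rightarrow> 'a measure" where
  "random_measure \<omega> = (if stick_sum (\<lambda>_. 1) \<omega> = 1
     then distr (density (count_space UNIV) (\<lambda>n. ennreal (stick_weight \<omega> n))) \<alpha> (\<lambda>n. snd (\<omega> n))
     else base)"

lemma sets_random_measure [simp]: "sets (random_measure \<omega>) = sets \<alpha>"
  by (simp add: random_measure_def)

lemma emeasure_random_measure:
  assumes "\<omega> \<in> space sticks" "stick_sum (\<lambda>_. 1) \<omega> = 1" "X \<in> sets \<alpha>"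
  shows "emeasure (random_measure \<omega>) X = ennreal (stick_sum (indicator X) \<omega>)"
proof -
  have "snd (\<omega> n) \<in> space \<alpha>" for n
    using measurable_space[OF measurable_stick_coordinate(2) assms(1)] .
  then have "emeasure (random_measure \<omega>) X
      = emeasure (density (count_space UNIV) (\<lambda>n. ennreal (stick_weight \<omega> n))) ((\<lambda>n. snd (\<omega> n)) -` X)"
    using assms by (simp add: random_measure_def emeasure_distr)
  also have "\<dots> = (\<integral>\<^sup>+n. ennreal (stick_weight \<omega> n * indicator X (snd (\<omega> n))) \<partial>count_space UNIV)"
    by (subst emeasure_density) (auto intro!: nn_integral_cong simp: indicator_def)
  also have "\<dots> = (\<Sum>n. ennreal (stick_weight \<omega> n * indicator X (snd (\<omega> n))))"
    by (rule nn_integral_count_space_nat)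
  also have "\<dots> = ennreal (stick_sum (indicator X) \<omega>)"
    unfolding stick_sum_def
    by (intro suminf_ennreal2 summable_stick_sum) (auto simp: stick_weight_nonneg)
  finally show ?thesis .
qed

lemma prob_space_random_measure:
  assumes "\<omega> \<in> space sticks"
  shows "prob_space (random_measure \<omega>)"
proof (cases "stick_sum (\<lambda>_. 1) \<omega> = 1")
  case True
  have "stick_sum (indicator (space \<alpha>)) \<omega> = stick_sum (\<lambda>_. 1) \<omega>"
    unfolding stick_sum_def using measurable_space[OF measurable_stick_coordinate(2) assms] by simp
  then show ?thesis
    using emeasure_random_measure[OF assms True, of "space \<alpha>"] True
    by (intro prob_spaceI) (simp add: sets_eq_imp_space_eq[OF sets_random_measure])
qed (simp add: random_measure_def prob_space_base)

lemma measurable_random_measure [measurable]: "random_measure \<in> sticks \<rightarrow>\<^sub>M prob_algebra \<alpha>"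
proof (rule measurable_prob_algebraI[OF prob_space_random_measure], assumption, rule measurable_subprob_algebra)
  show "subprob_space (random_measure \<omega>)" if "\<omega> \<in> space sticks" for \<omega>
    using prob_space_random_measure[OF that] by (rule prob_space_imp_subprob_space)
  fix X assume X [measurable]: "X \<in> sets \<alpha>"
  have "(\<lambda>\<omega>. emeasure (random_measure \<omega>) X) \<in> borel_measurable sticks \<longleftrightarrow>
    (\<lambda>\<omega>. if stick_sum (\<lambda>_. 1) \<omega> = 1 then ennreal (stick_sum (indicator X) \<omega>) else emeasure base X) \<in> borel_measurable sticks"
    by (intro measurable_cong) (use X in \<open>auto simp: emeasure_random_measure\<close>, simp add: random_measure_def)
  also have "\<dots>" by measurable
  finally show "(\<lambda>\<omega>. emeasure (random_measure \<omega>) X) \<in> borel_measurable sticks" .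
qed simp

definition "stick_law = distr sticks (prob_algebra \<alpha>) random_measure"

lemma stick_law_space: "stick_law \<in> space (prob_algebra (prob_algebra \<alpha>))"
  unfolding stick_law_def space_prob_algebra
  by (simp add: prob_space.prob_space_distr[OF prob_space_sticks measurable_random_measure])

text \<open>
  Both sides are fixed points of the same stick step, with a break that follows \<open>stick_measure mass\<close> and an independent index chosen
  according to the masses of the cells: the left side by self-similarity, the right side because the
  Dirichlet law is a mixture of its size-biased forms, each of which is a broken stick. Fixed points are unique.
\<close>
lemma distr_cell_masses_stick_law:
  assumes c: "code \<alpha> d c"
  shows "distr stick_law (\<Pi>\<^sub>M i\<in>{..d}. borel) (cell_masses \<alpha> c d) = dirichlet_measure {..d} (\<lambda>i. measure \<alpha> (cell \<alpha> c i))"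
proof -
  interpret S: prob_space stick_space by (rule prob_space_stick_space)
  interpret P: prob_space sticks by (rule prob_space_sticks)
  interpret b: prob_space base by (rule prob_space_base)
  interpret sm: prob_space "stick_measure mass" by (rule prob_space_stick_measure)
  interpret \<alpha>: finite_measure \<alpha> by (rule finite_base)
  let ?B = "\<Pi>\<^sub>M i\<in>{..d}. (borel :: real measure)"
  define a where "a i = measure \<alpha> (cell \<alpha> c i)" for i
  have total: "(\<Sum>i\<le>d. a i) = mass"
    unfolding a_def mass_def by (rule measure_cells_sum[OF c finite_base refl])
  interpret a: dirichlet_parameters "{..d}" a
    using mass_pos total by unfold_locales (auto simp: a_def)
  \<comment> \<open>The vector of cell masses, as a function of the stick-breaking sequence.\<close>
  define V where "V \<omega> = (\<lambda>i\<in>{..d}. stick_sum (indicator (cell \<alpha> c i)) \<omega>)" for \<omega>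
  have V [measurable]: "V \<in> sticks \<rightarrow>\<^sub>M ?B"
    unfolding V_def by (intro measurable_restrict measurable_stick_sum borel_measurable_indicator sets_cell[OF c])
  define Q1 where "Q1 = distr sticks ?B V"
  define Q2 where "Q2 = dirichlet_measure {..d} a"
  have ind: "0 \<le> indicat_real X x \<and> indicat_real X x \<le> 1" for X :: "'a set" and x by (auto simp: indicator_def)
  have law: "distr stick_law ?B (cell_masses \<alpha> c d) = Q1"
    unfolding stick_law_def Q1_def
  proof (subst distr_distr)
    show "distr sticks ?B (cell_masses \<alpha> c d \<circ> random_measure) = distr sticks ?B V"
    proof (rule distr_cong_AE[OF refl refl])
      show "AE \<omega> in sticks. (cell_masses \<alpha> c d \<circ> random_measure) \<omega> = V \<omega>"
        using AE_stick_sum_1 AE_space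
      proof eventually_elim
        fix \<omega> assume *: "stick_sum (\<lambda>_. 1) \<omega> = 1" "\<omega> \<in> space sticks"
        have "measure (random_measure \<omega>) (cell \<alpha> c i) = stick_sum (indicator (cell \<alpha> c i)) \<omega>" for i
          unfolding measure_def using emeasure_random_measure[OF *(2,1) sets_cell[OF c]]
              stick_sum_bounds(1)[where g="indicator (cell \<alpha> c i)", OF ind] by simp
        then show "(cell_masses \<alpha> c d \<circ> random_measure) \<omega> = V \<omega>" by (simp add: cell_masses_def V_def)
      qed
    qed (auto intro!: measurable_comp[OF measurable_random_measure measurable_cell_masses[OF c]] V)
  qed (auto intro!: measurable_random_measure measurable_cell_masses[OF c])
  have c' [measurable]: "c \<in> \<alpha> \<rightarrow>\<^sub>M count_space UNIV" using c by (simp add: code_def)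
  define \<phi> where "\<phi> s = (fst s, c (snd s))" for s :: "real \<times> 'a"
  have \<phi> [measurable]: "\<phi> \<in> stick_space \<rightarrow>\<^sub>M borel \<Otimes>\<^sub>M count_space UNIV"
    unfolding \<phi>_def by measurable
  \<comment> \<open>The law of one break together with the cell of its location.\<close>
  define S' where "S' = distr stick_space (borel \<Otimes>\<^sub>M count_space UNIV) \<phi>"
  have S': "prob_space S'" unfolding S'_def by (rule S.prob_space_distr[OF \<phi>])
  have Q1: "prob_space Q1" unfolding Q1_def by (rule P.prob_space_distr[OF V])
  have Q2: "prob_space Q2" unfolding Q2_def by (rule prob_space_dirichlet_measure[OF a.nonneg])
  interpret S': prob_space S' by fact
  interpret Q1: prob_space Q1 by fact
  interpret Q2: prob_space Q2 by fact
  have sets: "sets S' = sets (borel \<Otimes>\<^sub>M count_space UNIV)" "sets Q1 = sets ?B" "sets Q2 = sets ?B"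
    by (simp_all add: S'_def Q1_def Q2_def)
  have step: "(\<lambda>(s, p). stick_step d s p) \<in> S' \<Otimes>\<^sub>M Q \<rightarrow>\<^sub>M ?B" if "sets Q = sets ?B" for Q
    using measurable_stick_step[of d] measurable_cong_sets[OF sets_pair_measure_cong[OF sets(1) that] refl] by blast
  have shift: "(\<lambda>(s, \<omega>). case_nat s \<omega>) \<in> stick_space \<Otimes>\<^sub>M sticks \<rightarrow>\<^sub>M sticks"
    unfolding sticks_def by measurable
  have fixed1: "distr (S' \<Otimes>\<^sub>M Q1) ?B (\<lambda>(s, p). stick_step d s p) = Q1"
  proof -
    have "S' \<Otimes>\<^sub>M Q1 = distr (stick_space \<Otimes>\<^sub>M sticks) ((borel \<Otimes>\<^sub>M count_space UNIV) \<Otimes>\<^sub>M ?B) (\<lambda>(s, \<omega>). (\<phi> s, V \<omega>))"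
      unfolding S'_def Q1_def using Q1.sigma_finite_measure_axioms Q1_def
      by (intro pair_measure_distr \<phi> V) simp
    then have "distr (S' \<Otimes>\<^sub>M Q1) ?B (\<lambda>(s, p). stick_step d s p)
        = distr (stick_space \<Otimes>\<^sub>M sticks) ?B ((\<lambda>(s, p). stick_step d s p) \<circ> (\<lambda>(s, \<omega>). (\<phi> s, V \<omega>)))"
      by (simp add: distr_distr)
    also have "\<dots> = distr (stick_space \<Otimes>\<^sub>M sticks) ?B (V \<circ> (\<lambda>(s, \<omega>). case_nat s \<omega>))"
    proof (rule distr_cong_AE[OF refl refl])
      interpret SP: pair_sigma_finite stick_space sticks ..
      have "AE x in stick_space \<Otimes>\<^sub>M sticks. 0 \<le> fst (fst x) \<and> fst (fst x) < 1"
        by (rule SP.AE_pair_measure) (use AE_stick_space in \<open>auto elim: eventually_mono\<close>)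
      then show "AE x in stick_space \<Otimes>\<^sub>M sticks.
          ((\<lambda>(s, p). stick_step d s p) \<circ> (\<lambda>(s, \<omega>). (\<phi> s, V \<omega>))) x = (V \<circ> (\<lambda>(s, \<omega>). case_nat s \<omega>)) x"
        using AE_space
      proof eventually_elim
        fix x :: "(real \<times> 'a) \<times> (nat \<Rightarrow> real \<times> 'a)"
        assume x: "0 \<le> fst (fst x) \<and> fst (fst x) < 1" "x \<in> space (stick_space \<Otimes>\<^sub>M sticks)"
        have "snd (fst x) \<in> space \<alpha>"
          using x(2) by (auto simp: space_pair_measure stick_space_def)
        then have i: "indicat_real (cell \<alpha> c i) (snd (fst x)) = of_bool (i = c (snd (fst x)))" for i
          by (auto simp: cell_def indicator_def)
        have "V (case_nat (fst x) (snd x)) = stick_step d (\<phi> (fst x)) (V (snd x))"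
          unfolding V_def stick_step_def \<phi>_def
          using x(1) by (intro restrict_ext) (simp add: stick_sum_case_nat[OF ind] clip_id i)
        then show "((\<lambda>(s, p). stick_step d s p) \<circ> (\<lambda>(s, \<omega>). (\<phi> s, V \<omega>))) x = (V \<circ> (\<lambda>(s, \<omega>). case_nat s \<omega>)) x"
          by (simp add: split_beta')
      qed
    qed (use measurable_comp[OF shift V] in \<open>measurable\<close>)
    also have "\<dots> = distr (distr (stick_space \<Otimes>\<^sub>M sticks) sticks (\<lambda>(s, \<omega>). case_nat s \<omega>)) ?B V"
      by (rule distr_distr[OF V shift, symmetric])
    finally show ?thesis by (simp add: sticks_shift Q1_def)
  qed
  have fixed2: "distr (S' \<Otimes>\<^sub>M Q2) ?B (\<lambda>(s, p). stick_step d s p) = Q2"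
  proof (rule measure_eqI)
    fix X assume "X \<in> sets (distr (S' \<Otimes>\<^sub>M Q2) ?B (\<lambda>(s, p). stick_step d s p))"
    then have X [measurable]: "X \<in> sets ?B" by simp
    define h where "h p = (indicator X p :: ennreal)" for p
    have h [measurable]: "h \<in> borel_measurable ?B" unfolding h_def by measurable
    note sQ2 [measurable_cong] = sets(3)
    have m1: "(\<lambda>(s, p). h (stick_step d s p)) \<in> borel_measurable ((borel \<Otimes>\<^sub>M count_space UNIV) \<Otimes>\<^sub>M Q2)"
      using measurable_compose[OF measurable_stick_step h] measurable_cong_sets[OF sets_pair_measure_cong[OF refl sets(3)] refl]
      by (simp add: split_beta')
    define H where "H s = (\<integral>\<^sup>+p. h (stick_step d s p) \<partial>Q2)" for s
    have H [measurable]: "H \<in> borel_measurable (borel \<Otimes>\<^sub>M count_space UNIV)"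
      unfolding H_def by (rule Q2.borel_measurable_nn_integral[OF m1])
    have "emeasure (distr (S' \<Otimes>\<^sub>M Q2) ?B (\<lambda>(s, p). stick_step d s p)) X
        = (\<integral>\<^sup>+x. h x \<partial>distr (S' \<Otimes>\<^sub>M Q2) ?B (\<lambda>(s, p). stick_step d s p))"
      using X by (simp add: h_def)
    also have "\<dots> = (\<integral>\<^sup>+x. h (case x of (s, p) \<Rightarrow> stick_step d s p) \<partial>(S' \<Otimes>\<^sub>M Q2))"
      by (rule nn_integral_distr[OF step[OF sets(3)]]) simp
    also have "\<dots> = (\<integral>\<^sup>+s. H s \<partial>S')"
      unfolding H_def
      by (subst Q2.nn_integral_fst[symmetric]) (use measurable_compose[OF step[OF sets(3)] h] in \<open>auto simp: split_beta'\<close>)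
    also have "\<dots> = (\<integral>\<^sup>+s. H (\<phi> s) \<partial>stick_space)"
      unfolding S'_def by (rule nn_integral_distr[OF \<phi>]) simp
    also have "\<dots> = (\<integral>\<^sup>+x. \<integral>\<^sup>+b. H (b, c x) \<partial>stick_measure mass \<partial>base)"
      unfolding \<phi>_def by (subst nn_integral_stick_space) auto
    also have "\<dots> = (\<integral>\<^sup>+x. (\<Sum>j\<le>d. (\<integral>\<^sup>+b. H (b, j) \<partial>stick_measure mass) * indicator (cell \<alpha> c j) x) \<partial>base)"
    proof (rule nn_integral_cong)
      fix x assume "x \<in> space base"
      then have x: "x \<in> space \<alpha>" "c x \<le> d" using c by (auto simp: code_def)
      have "(\<Sum>j\<le>d. (\<integral>\<^sup>+b. H (b, j) \<partial>stick_measure mass) * indicator (cell \<alpha> c j) x)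
          = (\<Sum>j\<in>{c x}. (\<integral>\<^sup>+b. H (b, j) \<partial>stick_measure mass) * indicator (cell \<alpha> c j) x)"
        using x by (intro sum.mono_neutral_right) (auto simp: cell_def)
      also have "\<dots> = (\<integral>\<^sup>+b. H (b, c x) \<partial>stick_measure mass)"
        using x by (simp add: cell_def)
      finally show "(\<integral>\<^sup>+b. H (b, c x) \<partial>stick_measure mass) = (\<Sum>j\<le>d. (\<integral>\<^sup>+b. H (b, j) \<partial>stick_measure mass) * indicator (cell \<alpha> c j) x)"
        by simp
    qed
    also have "\<dots> = (\<Sum>j\<le>d. (\<integral>\<^sup>+b. H (b, j) \<partial>stick_measure mass) * emeasure base (cell \<alpha> c j))"
      using sets_cell[OF c] by (subst nn_integral_sum) (auto intro!: sum.cong nn_integral_cmult_indicator)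
    also have "\<dots> = (\<Sum>j\<le>d. ennreal (a j / mass) * (\<integral>\<^sup>+p. h p \<partial>dirichlet_measure {..d} (a(j := a j + 1))))"
    proof (rule sum.cong[OF refl])
      fix j assume j: "j \<in> {..d}"
      interpret SQ: pair_sigma_finite "stick_measure mass" Q2 ..
      have "(\<integral>\<^sup>+p. h p \<partial>dirichlet_measure {..d} (a(j := a j + 1)))
          = (\<integral>\<^sup>+p. \<integral>\<^sup>+b. h (stick_step d (b, j) p) \<partial>stick_measure mass \<partial>Q2)"
        using a.nn_integral_dirichlet_stick[OF j h] by (simp add: stick_step_def total Q2_def)
      also have "\<dots> = (\<integral>\<^sup>+b. H (b, j) \<partial>stick_measure mass)"
        unfolding H_def
      proof (rule SQ.Fubini')
        have "(\<lambda>x. ((fst x, j), snd x)) \<in> stick_measure mass \<Otimes>\<^sub>M Q2 \<rightarrow>\<^sub>M (borel \<Otimes>\<^sub>M count_space UNIV) \<Otimes>\<^sub>M Q2"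
          by measurable
        from measurable_compose[OF this m1]
        show "(\<lambda>(b, p). h (stick_step d (b, j) p)) \<in> borel_measurable (stick_measure mass \<Otimes>\<^sub>M Q2)"
          by (simp add: split_beta')
      qed
      finally show "(\<integral>\<^sup>+b. H (b, j) \<partial>stick_measure mass) * emeasure base (cell \<alpha> c j)
          = ennreal (a j / mass) * (\<integral>\<^sup>+p. h p \<partial>dirichlet_measure {..d} (a(j := a j + 1)))"
        by (simp add: emeasure_base a_def mult.commute)
    qed
    also have "\<dots> = (\<integral>\<^sup>+p. h p \<partial>Q2)"
      unfolding Q2_def by (subst a.nn_integral_dirichlet_mixture[OF h]) (simp add: total)
    also have "\<dots> = emeasure Q2 X" using X sets(3) by (simp add: h_def)
    finally show "emeasure (distr (S' \<Otimes>\<^sub>M Q2) ?B (\<lambda>(s, p). stick_step d s p)) X = emeasure Q2 X" .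
  qed (simp add: sets)
  have "Q1 = Q2"
  proof (rule stick_fixed_point_unique[OF S' _ _ sets(1) Q1 Q2 sets(2,3) _ _ fixed1 fixed2])
    show "AE s in S'. 0 \<le> fst s \<and> fst s \<le> 1"
      unfolding S'_def using AE_stick_space by (subst AE_distr_iff[OF \<phi>]) (auto simp: \<phi>_def elim: eventually_mono)
    have "(\<integral>s. 1 - fst s \<partial>S') = (\<integral>s. 1 - fst s \<partial>stick_space)"
      unfolding S'_def by (subst integral_distr[OF \<phi>]) (auto simp: \<phi>_def)
    also have "\<dots> = enn2real (\<integral>\<^sup>+s. ennreal (1 - fst s) \<partial>stick_space)"
      using AE_stick_space by (intro integral_eq_nn_integral) (auto elim: eventually_mono)
    also have "\<dots> = mass / (mass + 1)" using mass_pos by (simp add: nn_integral_remaining_stick)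
    finally show "(\<integral>s. 1 - fst s \<partial>S') < 1" using mass_pos by simp
    have le: "(\<Sum>i\<le>d. \<bar>V \<omega> i\<bar>) \<le> 1" for \<omega>
    proof -
      have "(\<Sum>i\<le>d. \<bar>V \<omega> i\<bar>) = (\<Sum>i\<le>d. \<Sum>n. stick_weight \<omega> n * indicator (cell \<alpha> c i) (snd (\<omega> n)))"
      proof (rule sum.cong[OF refl])
        fix i assume "i \<in> {..d}"
        then show "\<bar>V \<omega> i\<bar> = (\<Sum>n. stick_weight \<omega> n * indicator (cell \<alpha> c i) (snd (\<omega> n)))"
          using stick_sum_bounds(1)[where g="indicator (cell \<alpha> c i)" and \<omega>=\<omega>, OF ind]
          by (simp add: V_def stick_sum_def)
      qed
      also have "\<dots> = (\<Sum>n. \<Sum>i\<le>d. stick_weight \<omega> n * indicator (cell \<alpha> c i) (snd (\<omega> n)))"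
        by (rule suminf_sum[symmetric]) (rule summable_stick_sum[OF ind])
      also have "\<dots> = stick_sum (\<lambda>x. \<Sum>i\<le>d. indicator (cell \<alpha> c i) x) \<omega>"
        by (simp add: stick_sum_def sum_distrib_left)
      also have "\<dots> \<le> 1"
      proof (rule stick_sum_bounds(2))
        fix x
        have "(\<Sum>i\<le>d. indicat_real (cell \<alpha> c i) x) \<le> (\<Sum>i\<le>d. of_bool (i = c x))"
          by (intro sum_mono) (auto simp: cell_def indicator_def)
        also have "\<dots> \<le> 1" by (simp add: of_bool_def)
        finally show "0 \<le> (\<Sum>i\<le>d. indicat_real (cell \<alpha> c i) x) \<and> (\<Sum>i\<le>d. indicat_real (cell \<alpha> c i) x) \<le> 1"
          by (auto intro: sum_nonneg)
      qed
      finally show ?thesis .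
    qed
    then show "AE p in Q1. (\<Sum>i\<le>d. \<bar>p i\<bar>) \<le> 1"
      unfolding Q1_def by (subst AE_distr_iff[OF V]) auto
    show "AE p in Q2. (\<Sum>i\<le>d. \<bar>p i\<bar>) \<le> 1"
      unfolding Q2_def using a.AE_dirichlet_simplex by eventually_elim simp
  qed
  then show ?thesis unfolding law Q2_def a_def .
qed

lemma is_dirichlet_process_stick_law: "is_dirichlet_process \<alpha> stick_law"
  unfolding is_dirichlet_process_code using stick_law_space distr_cell_masses_stick_law by blast

end

section \<open>Uniqueness of the Dirichlet process\<close>

text \<open>
  The masses of the cells of \<open>r \<circ> e\<close>, computed from those of the cells of \<open>e\<close>.
\<close>
definition coarsen :: "(nat \<Rightarrow> nat) \<Rightarrow> nat \<Rightarrow> nat \<Rightarrow> (nat \<Rightarrow> real) \<Rightarrow> nat \<Rightarrow> real" where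
  "coarsen r d D p = (\<lambda>k\<in>{..d}. \<Sum>i\<in>{i. i \<le> D \<and> r i = k}. p i)"

lemma measurable_coarsen [measurable]: "coarsen r d D \<in> (\<Pi>\<^sub>M i\<in>{..D}. borel) \<rightarrow>\<^sub>M (\<Pi>\<^sub>M i\<in>{..d}. borel)"
  unfolding coarsen_def by (intro measurable_restrict borel_measurable_sum measurable_component_singleton) auto

lemma measure_coarse_union:
  assumes e: "code L D e" and l: "finite_measure l" "sets l = sets L"
    and X: "X = {x \<in> space L. R (e x)}"
  shows "measure l X = (\<Sum>i\<in>{i. i \<le> D \<and> R i}. measure l (cell L e i))"
proof -
  interpret finite_measure l by fact
  have "X = (\<Union>i\<in>{i. i \<le> D \<and> R i}. cell L e i)"
    using e by (auto simp: X cell_def code_def)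
  also have "measure l \<dots> = (\<Sum>i\<in>{i. i \<le> D \<and> R i}. measure l (cell L e i))"
    using sets_cell[OF e] disjoint_cells[of L e] l(2)
    by (intro finite_measure_finite_Union) (auto simp: disjoint_family_on_def)
  finally show ?thesis .
qed

lemma cell_masses_coarsen:
  assumes e: "code L D e" and l: "finite_measure l" "sets l = sets L" and r: "\<And>x. x \<in> space L \<Longrightarrow> c x = r (e x)"
  shows "cell_masses L c d l = coarsen r d D (cell_masses L e D l)"
proof -
  have "measure l (cell L c k) = (\<Sum>i\<in>{i. i \<le> D \<and> r i = k}. cell_masses L e D l i)" for k
  proof -
    have "cell L c k = {x \<in> space L. r (e x) = k}" using r by (auto simp: cell_def)
    then show ?thesis using measure_coarse_union[OF e l, of "cell L c k" "\<lambda>i. r i = k"]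
      by (simp add: cell_masses_def)
  qed
  then show ?thesis by (simp add: cell_masses_def[of L c] coarsen_def)
qed

text \<open>
  The common refinement of two partitions: \<open>c\<close> and \<open>c'\<close> are the remainder and the quotient of the joint code by
  \<open>d + 1\<close>.
\<close>
definition join_code :: "nat \<Rightarrow> ('a \<Rightarrow> nat) \<Rightarrow> ('a \<Rightarrow> nat) \<Rightarrow> 'a \<Rightarrow> nat" where
  "join_code d c c' x = c x + (d + 1) * c' x"

lemma code_join:
  assumes "code L d c" "code L d' c'"
  shows "code L (d + (d + 1) * d') (join_code d c c')"
proof -
  have [measurable]: "c \<in> L \<rightarrow>\<^sub>M count_space UNIV" "c' \<in> L \<rightarrow>\<^sub>M count_space UNIV" using assms by (auto simp: code_def)
  have "join_code d c c' \<in> L \<rightarrow>\<^sub>M count_space UNIV" unfolding join_code_def by measurable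
  moreover have "c x + (d + 1) * c' x \<le> d + (d + 1) * d'" if "x \<in> space L" for x
    using assms that unfolding code_def by (intro add_mono mult_le_mono2) auto
  ultimately show ?thesis by (simp add: code_def join_code_def)
qed

lemma join_code_mod: "code L d c \<Longrightarrow> x \<in> space L \<Longrightarrow> c x = join_code d c c' x mod (d + 1)"
  unfolding join_code_def code_def by (subst mod_mult_self2) (auto simp: less_Suc_eq_le)

lemma join_code_div: "code L d c \<Longrightarrow> x \<in> space L \<Longrightarrow> c' x = join_code d c c' x div (d + 1)"
  unfolding join_code_def code_def by (subst div_mult_self2) (auto simp: less_Suc_eq_le)

definition cylinder :: "'a measure \<Rightarrow> nat \<Rightarrow> ('a \<Rightarrow> nat) \<Rightarrow> (nat \<Rightarrow> real) set \<Rightarrow> 'a measure set" where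
  "cylinder L d c H = cell_masses L c d -` H \<inter> space (prob_algebra L)"

definition cylinders :: "'a measure \<Rightarrow> 'a measure set set" where
  "cylinders L = {cylinder L d c H | d c H. code L d c \<and> H \<in> sets (\<Pi>\<^sub>M i\<in>{..d}. borel)}"

lemma cylinder_in_sets: "code L d c \<Longrightarrow> H \<in> sets (\<Pi>\<^sub>M i\<in>{..d}. borel) \<Longrightarrow> cylinder L d c H \<in> sets (prob_algebra L)"
  unfolding cylinder_def by (rule measurable_sets[OF measurable_cell_masses])

lemma prob_algebra_finite: "l \<in> space (prob_algebra L) \<Longrightarrow> finite_measure l \<and> sets l = sets L"
  by (simp add: space_prob_algebra prob_space.finite_measure)

text \<open>
  Two cylinders are cylinders over a common refinement, where both conditions are read off by coarsening.
\<close>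
lemma Int_stable_cylinders: "Int_stable (cylinders L)"
proof (rule Int_stableI)
  fix X Y assume "X \<in> cylinders L" "Y \<in> cylinders L"
  then obtain d c H d' c' H' where X: "X = cylinder L d c H" "code L d c" "H \<in> sets (\<Pi>\<^sub>M i\<in>{..d}. borel)"
    and Y: "Y = cylinder L d' c' H'" "code L d' c'" "H' \<in> sets (\<Pi>\<^sub>M i\<in>{..d'}. borel)"
    unfolding cylinders_def by blast
  define D e where "D = d + (d + 1) * d'" and "e = join_code d c c'"
  have e: "code L D e" unfolding D_def e_def by (rule code_join[OF X(2) Y(2)])
  let ?S = "space (\<Pi>\<^sub>M i\<in>{..D}. (borel :: real measure))"
  define r r' where "r i = i mod (d + 1)" and "r' i = i div (d + 1)" for i
  define H'' where "H'' = (coarsen r d D -` H \<inter> ?S) \<inter> (coarsen r' d' D -` H' \<inter> ?S)"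
  have "H'' \<in> sets (\<Pi>\<^sub>M i\<in>{..D}. borel)"
    unfolding H''_def using X(3) Y(3) by (intro sets.Int measurable_sets[OF measurable_coarsen])
  moreover have "X \<inter> Y = cylinder L D e H''"
  proof -
    have "cell_masses L c d l = coarsen r d D (cell_masses L e D l)"
      "cell_masses L c' d' l = coarsen r' d' D (cell_masses L e D l)"
      "cell_masses L e D l \<in> ?S" if "l \<in> space (prob_algebra L)" for l
    proof -
      have l: "finite_measure l" "sets l = sets L" using prob_algebra_finite[OF that] by auto
      show "cell_masses L c d l = coarsen r d D (cell_masses L e D l)"
        using join_code_mod[OF X(2), of _ c'] unfolding r_def e_def
        by (intro cell_masses_coarsen[OF e[unfolded e_def] l]) simp
      show "cell_masses L c' d' l = coarsen r' d' D (cell_masses L e D l)"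
        using join_code_div[OF X(2), of _ c'] unfolding r'_def e_def
        by (intro cell_masses_coarsen[OF e[unfolded e_def] l]) simp
      show "cell_masses L e D l \<in> ?S"
        using measurable_space[OF measurable_cell_masses[OF e] that] .
    qed
    then show ?thesis unfolding X Y cylinder_def H''_def by auto
  qed
  ultimately show "X \<inter> Y \<in> cylinders L" unfolding cylinders_def using e by blast
qed

lemma code_indicator: "B \<in> sets L \<Longrightarrow> code L 1 (\<lambda>x. if x \<in> B then 1 else 0)"
  unfolding code_def by (auto intro!: measurable_If_set simp: sets.Int_space_eq2)

text \<open>
  The evaluation at \<open>B\<close> is a coordinate of the cell masses for the partition into \<open>B\<close> and its complement.
\<close>
lemma sets_prob_algebra_cylinders: "sets (prob_algebra L) = sigma_sets (space (prob_algebra L)) (cylinders L)"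
proof
  let ?\<Omega> = "space (prob_algebra L)"
  have sub: "cylinders L \<subseteq> sets (prob_algebra L)"
    unfolding cylinders_def using cylinder_in_sets by blast
  then show "sigma_sets ?\<Omega> (cylinders L) \<subseteq> sets (prob_algebra L)"
    by (rule sets.sigma_sets_subset)
  have pow: "cylinders L \<subseteq> Pow ?\<Omega>" by (auto simp: cylinders_def cylinder_def)
  define G where "G = sigma ?\<Omega> (cylinders L)"
  have G: "space G = ?\<Omega>" "sets G = sigma_sets ?\<Omega> (cylinders L)"
    unfolding G_def using pow by (auto simp: space_measure_of sets_measure_of)
  have "(\<lambda>l. l) \<in> G \<rightarrow>\<^sub>M prob_algebra L"
  proof (rule measurable_prob_algebraI)
    show "(\<lambda>l. l) \<in> G \<rightarrow>\<^sub>M subprob_algebra L"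
    proof (rule measurable_subprob_algebra)
      fix B assume B: "B \<in> sets L"
      let ?c = "\<lambda>x. if x \<in> B then 1 else 0 :: nat"
      have c: "code L 1 ?c" by (rule code_indicator[OF B])
      have cell: "cell L ?c 1 = B" using sets.sets_into_space[OF B] by (auto simp: cell_def split: if_splits)
      have "cell_masses L ?c 1 \<in> G \<rightarrow>\<^sub>M (\<Pi>\<^sub>M i\<in>{..1}. borel)"
      proof (rule measurableI)
        show "cell_masses L ?c 1 l \<in> space (\<Pi>\<^sub>M i\<in>{..1}. borel)" if "l \<in> space G" for l
          using that measurable_space[OF measurable_cell_masses[OF c]] by (simp add: G)
        show "cell_masses L ?c 1 -` H \<inter> space G \<in> sets G" if "H \<in> sets (\<Pi>\<^sub>M i\<in>{..1}. borel)" for H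
          using that c unfolding G by (intro sigma_sets.Basic) (auto simp: cylinders_def cylinder_def)
      qed
      then have "(\<lambda>l. cell_masses L ?c 1 l 1) \<in> borel_measurable G"
        by (rule measurable_compose) (rule measurable_component_singleton, simp)
      then have "(\<lambda>l. measure l B) \<in> borel_measurable G"
        using cell by (simp add: cell_masses_def del: One_nat_def)
      moreover have "emeasure l B = ennreal (measure l B)" if "l \<in> space G" for l
        using prob_algebra_finite[of l L] that by (simp add: G finite_measure.emeasure_eq_measure)
      ultimately show "(\<lambda>l. emeasure l B) \<in> borel_measurable G"
        by (subst measurable_cong) auto
    qed (auto simp: G space_prob_algebra prob_space_imp_subprob_space)
  qed (auto simp: G space_prob_algebra)
  show "sets (prob_algebra L) \<subseteq> sigma_sets ?\<Omega> (cylinders L)"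
  proof
    fix X assume X: "X \<in> sets (prob_algebra L)"
    have "(\<lambda>l. l) -` X \<inter> space G \<in> sets G" by (rule measurable_sets[OF \<open>(\<lambda>l. l) \<in> G \<rightarrow>\<^sub>M prob_algebra L\<close> X])
    then show "X \<in> sigma_sets ?\<Omega> (cylinders L)" using sets.sets_into_space[OF X] by (simp add: G Int_absorb2)
  qed
qed

lemma cylinders_Pow: "cylinders L \<subseteq> Pow (space (prob_algebra L))"
  by (auto simp: cylinders_def cylinder_def)

text \<open>
  The total masses are compared separately because the generator is not assumed to contain the whole space.
\<close>
lemma prob_space_eqI_generator:
  assumes G: "Int_stable G" "G \<subseteq> Pow (space N)" "sets N = sigma_sets (space N) G"
    and P: "finite_measure P" "sets P = sets N" "sets Q = sets N"
    and eq: "\<And>X. X \<in> G \<Longrightarrow> emeasure P X = emeasure Q X" "emeasure P (space N) = emeasure Q (space N)"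
  shows "P = Q"
proof (rule measure_eqI_generator_eq[where E="insert (space N) G" and \<Omega>="space N" and A="\<lambda>_. space N"])
  show "Int_stable (insert (space N) G)"
    using G(1,2) by (auto simp: Int_stable_def) (auto simp: Int_absorb1 Int_absorb2)
  have "sigma_sets (space N) (insert (space N) G) = sigma_sets (space N) G"
    by (rule sigma_sets_eqI) (auto intro: sigma_sets.Basic sigma_sets_top)
  then show "sets P = sigma_sets (space N) (insert (space N) G)" "sets Q = sigma_sets (space N) (insert (space N) G)"
    using P(2,3) G(3) by simp_all
  show "emeasure P (space N) \<noteq> \<infinity>" for i :: nat
    using finite_measure.emeasure_finite[OF P(1)] by auto
qed (use G eq in auto)

text \<open>
  The defining property prescribes the probability of every cylinder, and cylinders are an intersection-stable
  generator.
\<close>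
lemma is_dirichlet_process_unique:
  assumes Q: "is_dirichlet_process \<alpha> Q" "is_dirichlet_process \<alpha> Q'"
  shows "Q = Q'"
proof -
  have s: "Q \<in> space (prob_algebra (prob_algebra \<alpha>))" "Q' \<in> space (prob_algebra (prob_algebra \<alpha>))"
    using Q by (auto simp: is_dirichlet_process_def)
  then have sets: "sets Q = sets (prob_algebra \<alpha>)" "sets Q' = sets (prob_algebra \<alpha>)"
    and prob: "prob_space Q" "prob_space Q'" by (auto simp: space_prob_algebra)
  show ?thesis
  proof (rule prob_space_eqI_generator[OF Int_stable_cylinders cylinders_Pow sets_prob_algebra_cylinders _ sets])
    show "finite_measure Q" using prob(1) by (rule prob_space.finite_measure)
    show "emeasure Q (space (prob_algebra \<alpha>)) = emeasure Q' (space (prob_algebra \<alpha>))"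
      using prob_space.emeasure_space_1[OF prob(1)] prob_space.emeasure_space_1[OF prob(2)]
        sets_eq_imp_space_eq[OF sets(1)] sets_eq_imp_space_eq[OF sets(2)] by simp
    fix X assume "X \<in> cylinders \<alpha>"
    then obtain d c H where X: "X = cylinder \<alpha> d c H" and c: "code \<alpha> d c" and H: "H \<in> sets (\<Pi>\<^sub>M i\<in>{..d}. borel)"
      unfolding cylinders_def by blast
    have "emeasure R X = emeasure (distr R (\<Pi>\<^sub>M i\<in>{..d}. borel) (cell_masses \<alpha> c d)) H"
      if "sets R = sets (prob_algebra \<alpha>)" for R
    proof -
      have "cell_masses \<alpha> c d \<in> R \<rightarrow>\<^sub>M (\<Pi>\<^sub>M i\<in>{..d}. borel)"
        using measurable_cell_masses[OF c] measurable_cong_sets[OF that refl] by blast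
      then show ?thesis
        using H by (simp add: emeasure_distr X cylinder_def sets_eq_imp_space_eq[OF that])
    qed
    then show "emeasure Q X = emeasure Q' X"
      using Q sets c unfolding is_dirichlet_process_code by simp
  qed
qed

theorem (in dirichlet_base) is_dirichlet_process_dirichlet_process: "is_dirichlet_process \<alpha> (dirichlet_process \<alpha>)"
  unfolding dirichlet_process_def
  by (rule theI) (rule is_dirichlet_process_stick_law, erule is_dirichlet_process_unique[OF _ is_dirichlet_process_stick_law])

context dirichlet_base
begin

lemma sets_dirichlet_process: "sets (dirichlet_process \<alpha>) = sets (prob_algebra \<alpha>)"
  and prob_space_dirichlet_process: "prob_space (dirichlet_process \<alpha>)"
  using is_dirichlet_process_dirichlet_process by (auto simp: is_dirichlet_process_def space_prob_algebra)

lemma emeasure_dirichlet_process_cylinder: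
  assumes c: "code \<alpha> d c" and H: "H \<in> sets (\<Pi>\<^sub>M i\<in>{..d}. borel)"
  shows "emeasure (dirichlet_process \<alpha>) (cylinder \<alpha> d c H) = emeasure (dirichlet_measure {..d} (\<lambda>i. measure \<alpha> (cell \<alpha> c i))) H"
proof -
  have "distr (dirichlet_process \<alpha>) (\<Pi>\<^sub>M i\<in>{..d}. borel) (cell_masses \<alpha> c d) = dirichlet_measure {..d} (\<lambda>i. measure \<alpha> (cell \<alpha> c i))"
    using is_dirichlet_process_dirichlet_process c unfolding is_dirichlet_process_code by blast
  then show ?thesis
    using emeasure_distr[of "cell_masses \<alpha> c d" "dirichlet_process \<alpha>" "\<Pi>\<^sub>M i\<in>{..d}. borel" H]
      measurable_cell_masses[OF c] H
      measurable_cong_sets[OF sets_dirichlet_process refl, of "\<Pi>\<^sub>M i\<in>{..d}. (borel :: real measure)"]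
    by (simp add: cylinder_def sets_eq_imp_space_eq[OF sets_dirichlet_process])
qed

lemma nn_integral_dirichlet_process_cells:
  assumes c: "code \<alpha> d c" and h: "h \<in> borel_measurable (\<Pi>\<^sub>M i\<in>{..d}. borel)"
  shows "(\<integral>\<^sup>+l. h (cell_masses \<alpha> c d l) \<partial>dirichlet_process \<alpha>) = (\<integral>\<^sup>+p. h p \<partial>dirichlet_measure {..d} (\<lambda>i. measure \<alpha> (cell \<alpha> c i)))"
proof -
  have "distr (dirichlet_process \<alpha>) (\<Pi>\<^sub>M i\<in>{..d}. borel) (cell_masses \<alpha> c d) = dirichlet_measure {..d} (\<lambda>i. measure \<alpha> (cell \<alpha> c i))"
    using is_dirichlet_process_dirichlet_process c unfolding is_dirichlet_process_code by blast
  then show ?thesis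
    using nn_integral_distr[of "cell_masses \<alpha> c d" "dirichlet_process \<alpha>" "\<Pi>\<^sub>M i\<in>{..d}. borel" h]
      measurable_cell_masses[OF c] h
      measurable_cong_sets[OF sets_dirichlet_process refl, of "\<Pi>\<^sub>M i\<in>{..d}. (borel :: real measure)"]
    by simp
qed

end

section \<open>Kernels and joint laws\<close>

definition joint_law :: "'a measure \<Rightarrow> 'b measure \<Rightarrow> ('a \<Rightarrow> 'b measure) \<Rightarrow> ('a \<times> 'b) measure" where
  "joint_law M N K = M \<bind> (\<lambda>x. distr (K x) (M \<Otimes>\<^sub>M N) (Pair x))"

lemma measurable_prob_algebra_subprob: "K \<in> M \<rightarrow>\<^sub>M prob_algebra N \<Longrightarrow> K \<in> M \<rightarrow>\<^sub>M subprob_algebra N"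
  by (simp add: measurable_prob_algebraD)

lemma borel_measurable_kernel_integral:
  assumes "(\<lambda>(x, y). f x y) \<in> borel_measurable (M \<Otimes>\<^sub>M N)" "K \<in> M \<rightarrow>\<^sub>M prob_algebra N"
  shows "(\<lambda>x. \<integral>\<^sup>+y. f x y \<partial>K x) \<in> borel_measurable M"
  by (rule nn_integral_measurable_subprob_algebra2[OF assms(1) measurable_prob_algebra_subprob[OF assms(2)]])

context
  fixes M :: "'a measure" and N :: "'b measure" and K :: "'a \<Rightarrow> 'b measure"
  assumes M: "prob_space M" and K: "K \<in> M \<rightarrow>\<^sub>M prob_algebra N"
begin

lemma kernel_sets: "x \<in> space M \<Longrightarrow> sets (K x) = sets N"
  and kernel_prob_space: "x \<in> space M \<Longrightarrow> prob_space (K x)"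
  using measurable_space[OF K] by (auto simp: space_prob_algebra)

lemma joint_kernel: "(\<lambda>x. distr (K x) (M \<Otimes>\<^sub>M N) (Pair x)) \<in> M \<rightarrow>\<^sub>M prob_algebra (M \<Otimes>\<^sub>M N)"
proof (rule measurable_prob_algebraI)
  show "prob_space (distr (K x) (M \<Otimes>\<^sub>M N) (Pair x))" if "x \<in> space M" for x
  proof (rule prob_space.prob_space_distr[OF kernel_prob_space[OF that]])
    show "Pair x \<in> K x \<rightarrow>\<^sub>M M \<Otimes>\<^sub>M N"
      using measurable_Pair1'[OF that, of N] measurable_cong_sets[OF kernel_sets[OF that] refl] by blast
  qed
  show "(\<lambda>x. distr (K x) (M \<Otimes>\<^sub>M N) (Pair x)) \<in> M \<rightarrow>\<^sub>M subprob_algebra (M \<Otimes>\<^sub>M N)"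
    by (rule measurable_distr2[OF _ measurable_prob_algebra_subprob[OF K]]) simp
qed

lemma sets_joint_law: "sets (joint_law M N K) = sets (M \<Otimes>\<^sub>M N)"
  unfolding joint_law_def using prob_space.not_empty[OF M] by (intro sets_bind) auto

lemma nn_integral_joint_law:
  assumes f: "f \<in> borel_measurable (M \<Otimes>\<^sub>M N)"
  shows "(\<integral>\<^sup>+z. f z \<partial>joint_law M N K) = (\<integral>\<^sup>+x. \<integral>\<^sup>+y. f (x, y) \<partial>K x \<partial>M)"
  unfolding joint_law_def nn_integral_bind[OF f measurable_prob_algebra_subprob[OF joint_kernel]]
proof (rule nn_integral_cong)
  fix x assume x: "x \<in> space M"
  have "Pair x \<in> K x \<rightarrow>\<^sub>M M \<Otimes>\<^sub>M N"
    using measurable_Pair1'[OF x, of N] measurable_cong_sets[OF kernel_sets[OF x] refl] by blast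
  then show "(\<integral>\<^sup>+z. f z \<partial>distr (K x) (M \<Otimes>\<^sub>M N) (Pair x)) = (\<integral>\<^sup>+y. f (x, y) \<partial>K x)"
    using f by (subst nn_integral_distr) simp_all
qed

lemma prob_space_joint_law: "prob_space (joint_law M N K)"
proof (rule prob_spaceI)
  have sp: "space (joint_law M N K) = space (M \<Otimes>\<^sub>M N)" by (rule sets_eq_imp_space_eq[OF sets_joint_law])
  have "emeasure (joint_law M N K) (space (M \<Otimes>\<^sub>M N)) = (\<integral>\<^sup>+z. indicator (space (M \<Otimes>\<^sub>M N)) z \<partial>joint_law M N K)"
    by (simp add: sets_joint_law)
  also have "\<dots> = (\<integral>\<^sup>+x. \<integral>\<^sup>+y. indicator (space (M \<Otimes>\<^sub>M N)) (x, y) \<partial>K x \<partial>M)"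
    by (rule nn_integral_joint_law) simp
  also have "\<dots> = (\<integral>\<^sup>+x. 1 \<partial>M)"
  proof (rule nn_integral_cong)
    fix x assume x: "x \<in> space M"
    have "(\<integral>\<^sup>+y. indicator (space (M \<Otimes>\<^sub>M N)) (x, y) \<partial>K x) = (\<integral>\<^sup>+y. 1 \<partial>K x)"
      using x sets_eq_imp_space_eq[OF kernel_sets[OF x]]
      by (intro nn_integral_cong) (auto simp: space_pair_measure indicator_def)
    then show "(\<integral>\<^sup>+y. indicator (space (M \<Otimes>\<^sub>M N)) (x, y) \<partial>K x) = 1"
      using prob_space.emeasure_space_1[OF kernel_prob_space[OF x]] by simp
  qed
  finally show "emeasure (joint_law M N K) (space (joint_law M N K)) = 1"
    using prob_space.emeasure_space_1[OF M] sp by simp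
qed

end

text \<open>
  Once the first side \<open>X\<close> is fixed, both measures of \<open>X \<times> B\<close> are finite measures in \<open>B\<close>, so sides from a
  generator suffice.
\<close>
lemma measure_eqI_rectangles:
  assumes P: "prob_space P" "prob_space Q" "sets P = sets (M \<Otimes>\<^sub>M N)" "sets Q = sets (M \<Otimes>\<^sub>M N)"
    and G: "Int_stable G" "G \<subseteq> Pow (space N)" "sets N = sigma_sets (space N) G" "space N \<in> G"
    and eq: "\<And>X Y. X \<in> sets M \<Longrightarrow> Y \<in> G \<Longrightarrow> emeasure P (X \<times> Y) = emeasure Q (X \<times> Y)"
  shows "P = Q"
proof (rule measure_eqI_generator_eq[OF Int_stable_pair_measure_generator[of M N] pair_measure_closed])
  let ?R = "{a \<times> b |a b. a \<in> sets M \<and> b \<in> sets N}"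
  show "sets P = sigma_sets (space M \<times> space N) ?R" "sets Q = sigma_sets (space M \<times> space N) ?R"
    using P(3,4) by (simp_all add: sets_pair_measure)
  show "range (\<lambda>_::nat. space M \<times> space N) \<subseteq> ?R" by auto
  show "emeasure P (space M \<times> space N) \<noteq> \<infinity>" for i :: nat
    using finite_measure.emeasure_finite[OF prob_space.finite_measure[OF P(1)]] by simp
  fix Z assume "Z \<in> ?R"
  then obtain X Y where Z: "Z = X \<times> Y" and X: "X \<in> sets M" and Y: "Y \<in> sets N" by blast
  define D where "D R = distr (density R (indicator (X \<times> space N))) N snd" for R :: "('a \<times> 'b) measure"
  have D: "emeasure (D R) B = emeasure R (X \<times> B)" if R: "sets R = sets (M \<Otimes>\<^sub>M N)" and B: "B \<in> sets N" for R B
  proof -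
    have snd: "snd \<in> density R (indicator (X \<times> space N)) \<rightarrow>\<^sub>M N"
      using measurable_cong_sets[OF R refl, of N] measurable_snd[of M N] by simp
    have sp: "space R = space M \<times> space N" using sets_eq_imp_space_eq[OF R] by (simp add: space_pair_measure)
    have XN: "X \<times> space N \<in> sets R" "space M \<times> B \<in> sets R" using R X B by auto
    have "snd -` B \<inter> space R = space M \<times> B" using sets.sets_into_space[OF B] by (auto simp: sp)
    then have "emeasure (D R) B = emeasure (density R (indicator (X \<times> space N))) (space M \<times> B)"
      unfolding D_def using B by (simp add: emeasure_distr[OF snd])
    also have "\<dots> = (\<integral>\<^sup>+z. indicator (X \<times> space N) z * indicator (space M \<times> B) z \<partial>R)"
      using XN by (intro emeasure_density) auto
    also have "\<dots> = (\<integral>\<^sup>+z. indicator (X \<times> B) z \<partial>R)"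
      using sets.sets_into_space[OF B] sets.sets_into_space[OF X] by (intro nn_integral_cong) (auto simp: indicator_def)
    also have "\<dots> = emeasure R (X \<times> B)" using R X B by simp
    finally show ?thesis .
  qed
  have space_D: "space (D R) = space N" for R by (simp add: D_def)
  have "D P = D Q"
  proof (rule prob_space_eqI_generator[OF G(1-3)])
    show "finite_measure (D P)"
      using finite_measure.emeasure_finite[OF prob_space.finite_measure[OF P(1)]]
        D[OF P(3) sets.top] space_D[of P]
      by (intro finite_measureI) simp
    show "emeasure (D P) B = emeasure (D Q) B" if "B \<in> G" for B
      using eq[OF X that] that G(3) by (simp add: D P sigma_sets.Basic)
    show "emeasure (D P) (space N) = emeasure (D Q) (space N)"
      using eq[OF X G(4)] by (simp add: D P)
  qed (simp_all add: D_def)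
  then show "emeasure P Z = emeasure Q Z" using D[OF P(3) Y] D[OF P(4) Y] Z by simp
qed auto

lemma prob_algebra_cong: "sets M = sets N \<Longrightarrow> prob_algebra M = prob_algebra N"
  by (simp add: prob_algebra_def cong: subprob_algebra_cong)

lemma measurable_ennreal_coordinate:
  "i \<in> I \<Longrightarrow> (\<lambda>p. ennreal (p i)) \<in> borel_measurable (\<Pi>\<^sub>M i\<in>I. borel)"
  by measurable

section \<open>Posterior laws of the Dirichlet process\<close>

definition add_atom :: "'a measure \<Rightarrow> 'a \<Rightarrow> 'a measure" where
  "add_atom \<alpha> x = measure_plus \<alpha> (return \<alpha> x)"

definition add_atoms :: "'a measure \<Rightarrow> 'i set \<Rightarrow> ('i \<Rightarrow> 'a) \<Rightarrow> 'a measure" where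
  "add_atoms \<alpha> I x = measure_plus \<alpha> (measure_sum \<alpha> I (\<lambda>n. return \<alpha> (x n)))"

lemma sets_add_atom [simp, measurable_cong]: "sets (add_atom \<alpha> x) = sets \<alpha>"
  and space_add_atom [simp]: "space (add_atom \<alpha> x) = space \<alpha>"
  and sets_add_atoms [simp, measurable_cong]: "sets (add_atoms \<alpha> I x') = sets \<alpha>"
  and space_add_atoms [simp]: "space (add_atoms \<alpha> I x') = space \<alpha>"
  by (simp_all add: add_atom_def add_atoms_def)

lemma emeasure_add_atom:
  "B \<in> sets \<alpha> \<Longrightarrow> emeasure (add_atom \<alpha> x) B = emeasure \<alpha> B + indicator B x"
  by (simp add: add_atom_def emeasure_measure_plus)

lemma emeasure_add_atoms:
  "B \<in> sets \<alpha> \<Longrightarrow> emeasure (add_atoms \<alpha> I x) B = emeasure \<alpha> B + (\<Sum>n\<in>I. indicator B (x n))"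
  by (simp add: add_atoms_def emeasure_measure_plus emeasure_measure_sum)

lemma add_atoms_insert:
  assumes "finite I" "i \<notin> I"
  shows "add_atoms \<alpha> (insert i I) (x(i := z)) = add_atom (add_atoms \<alpha> I x) z"
proof (rule measure_eqI)
  fix B assume "B \<in> sets (add_atoms \<alpha> (insert i I) (x(i := z)))"
  then have B: "B \<in> sets \<alpha>" by simp
  have "(\<Sum>n\<in>I. indicator B ((x(i := z)) n) :: ennreal) = (\<Sum>n\<in>I. indicator B (x n))"
    using assms by (intro sum.cong) auto
  then show "emeasure (add_atoms \<alpha> (insert i I) (x(i := z))) B = emeasure (add_atom (add_atoms \<alpha> I x) z) B"
    using assms B by (simp add: emeasure_add_atom emeasure_add_atoms add_ac del: fun_upd_apply) (simp add: add_ac)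
qed simp

lemma add_atoms_empty: "add_atoms \<alpha> {} x = \<alpha>"
  by (rule measure_eqI) (simp_all add: emeasure_add_atoms)

context dirichlet_base
begin

lemma dirichlet_base_add_atoms:
  assumes "finite I"
  shows "dirichlet_base (add_atoms \<alpha> I x)"
proof (rule dirichlet_base.intro)
  have e: "emeasure (add_atoms \<alpha> I x) (space \<alpha>) = emeasure \<alpha> (space \<alpha>) + (\<Sum>n\<in>I. indicator (space \<alpha>) (x n))"
    by (rule emeasure_add_atoms) simp
  have "(\<Sum>n\<in>I. indicator (space \<alpha>) (x n) :: ennreal) = ennreal (\<Sum>n\<in>I. indicator (space \<alpha>) (x n))"
    by (simp add: sum_ennreal[symmetric] ennreal_indicator del: sum_ennreal)
  with e have e': "emeasure (add_atoms \<alpha> I x) (space \<alpha>) = ennreal (mass + (\<Sum>n\<in>I. indicator (space \<alpha>) (x n)))"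
    using mass_pos by (simp add: emeasure_alpha mass_def[symmetric] sum_nonneg flip: ennreal_plus)
  then show "finite_measure (add_atoms \<alpha> I x)" by (intro finite_measureI) simp
  show "0 < measure (add_atoms \<alpha> I x) (space (add_atoms \<alpha> I x))"
    using measure_eq_emeasure_eq_ennreal[OF _ e'] mass_pos by (simp add: sum_nonneg add_pos_nonneg)
qed

lemma measure_add_atoms:
  assumes "finite I" "B \<in> sets \<alpha>"
  shows "measure (add_atoms \<alpha> I x) B = measure \<alpha> B + (\<Sum>n\<in>I. indicator B (x n))"
proof -
  have "(\<Sum>n\<in>I. indicator B (x n) :: ennreal) = ennreal (\<Sum>n\<in>I. indicator B (x n))"
    by (simp add: sum_ennreal[symmetric] ennreal_indicator del: sum_ennreal)
  then have "emeasure (add_atoms \<alpha> I x) B = ennreal (measure \<alpha> B + (\<Sum>n\<in>I. indicator B (x n)))"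
    using assms by (simp add: emeasure_add_atoms emeasure_alpha sum_nonneg flip: ennreal_plus)
  then show ?thesis by (rule measure_eq_emeasure_eq_ennreal[rotated]) (simp add: sum_nonneg)
qed

lemma add_atom_eq: "add_atom \<alpha> x = add_atoms \<alpha> {()} (\<lambda>_. x)"
  by (rule measure_eqI) (simp_all add: emeasure_add_atom emeasure_add_atoms)

lemma dirichlet_base_add_atom: "dirichlet_base (add_atom \<alpha> x)"
  unfolding add_atom_eq by (rule dirichlet_base_add_atoms) simp

lemma prob_algebra_add_atoms: "prob_algebra (add_atoms \<alpha> I x) = prob_algebra \<alpha>"
  by (rule prob_algebra_cong) simp

text \<open>
  The probability of a cylinder depends on the atoms only through the cells they fall into, hence through
  finitely many values.
\<close>
lemma measurable_dirichlet_process_add_atoms: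
  assumes I: "finite I"
  shows "(\<lambda>x. dirichlet_process (add_atoms \<alpha> I x)) \<in> (\<Pi>\<^sub>M n\<in>I. \<alpha>) \<rightarrow>\<^sub>M prob_algebra (prob_algebra \<alpha>)"
proof (rule measurable_prob_algebra_generated[OF sets_prob_algebra_cylinders Int_stable_cylinders cylinders_Pow])
  fix x
  interpret d: dirichlet_base "add_atoms \<alpha> I x" by (rule dirichlet_base_add_atoms[OF I])
  show "prob_space (dirichlet_process (add_atoms \<alpha> I x))" by (rule d.prob_space_dirichlet_process)
  show "sets (dirichlet_process (add_atoms \<alpha> I x)) = sets (prob_algebra \<alpha>)"
    using d.sets_dirichlet_process by (simp add: prob_algebra_add_atoms)
next
  fix \<Gamma> assume "\<Gamma> \<in> cylinders \<alpha>"
  then obtain d c H where \<Gamma>: "\<Gamma> = cylinder \<alpha> d c H" and c: "code \<alpha> d c" and H: "H \<in> sets (\<Pi>\<^sub>M i\<in>{..d}. borel)"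
    unfolding cylinders_def by blast
  have cyl: "cylinder (add_atoms \<alpha> I x) d c H = cylinder \<alpha> d c H" "code (add_atoms \<alpha> I x) d c"
    and cell: "cell (add_atoms \<alpha> I x) c i = cell \<alpha> c i" for x i
    using c measurable_cong_sets[OF sets_add_atoms refl]
    by (auto simp: cylinder_def cell_masses_def cell_def prob_algebra_add_atoms code_def)
  define g where "g v = emeasure (dirichlet_measure {..d} (\<lambda>i. measure \<alpha> (cell \<alpha> c i) + (\<Sum>n\<in>I. of_bool (v n = i)))) H" for v
  let ?m = "\<lambda>x. \<lambda>n\<in>I. c (x n)"
  have "emeasure (dirichlet_process (add_atoms \<alpha> I x)) \<Gamma> = g (?m x)" if x: "x \<in> space (\<Pi>\<^sub>M n\<in>I. \<alpha>)" for x
  proof -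
    interpret d: dirichlet_base "add_atoms \<alpha> I x" by (rule dirichlet_base_add_atoms[OF I])
    have "measure (add_atoms \<alpha> I x) (cell \<alpha> c i) = measure \<alpha> (cell \<alpha> c i) + (\<Sum>n\<in>I. of_bool (?m x n = i))" for i
    proof -
      have "indicat_real (cell \<alpha> c i) (x n) = of_bool (?m x n = i)" if "n \<in> I" for n
        using x that by (auto simp: cell_def space_PiM indicator_def PiE_iff)
      then show ?thesis using measure_add_atoms[OF I sets_cell[OF c]] by simp
    qed
    then show ?thesis
      using d.emeasure_dirichlet_process_cylinder[OF cyl(2) H] by (simp add: \<Gamma> cyl(1) cell g_def)
  qed
  moreover have "(\<lambda>x. g (?m x)) \<in> borel_measurable (\<Pi>\<^sub>M n\<in>I. \<alpha>)"
  proof (rule measurable_compose[of ?m _ "count_space (I \<rightarrow>\<^sub>E {..d})"])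
    show "?m \<in> (\<Pi>\<^sub>M n\<in>I. \<alpha>) \<rightarrow>\<^sub>M count_space (I \<rightarrow>\<^sub>E {..d})"
    proof (subst measurable_count_space_eq2)
      show "finite (I \<rightarrow>\<^sub>E {..d})" using I by (intro finite_PiE) auto
      have "?m -` {v} \<inter> space (\<Pi>\<^sub>M n\<in>I. \<alpha>) \<in> sets (\<Pi>\<^sub>M n\<in>I. \<alpha>)" if "v \<in> I \<rightarrow>\<^sub>E {..d}" for v
      proof -
        have "?m -` {v} \<inter> space (\<Pi>\<^sub>M n\<in>I. \<alpha>) = (\<Pi>\<^sub>E n\<in>I. cell \<alpha> c (v n))"
          using that by (auto simp: space_PiM PiE_iff cell_def extensional_def fun_eq_iff)
        also have "\<dots> \<in> sets (\<Pi>\<^sub>M n\<in>I. \<alpha>)" using I sets_cell[OF c] by (intro sets_PiM_I_finite) auto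
        finally show ?thesis .
      qed
      then show "?m \<in> space (\<Pi>\<^sub>M n\<in>I. \<alpha>) \<rightarrow> I \<rightarrow>\<^sub>E {..d} \<and> (\<forall>v\<in>I \<rightarrow>\<^sub>E {..d}. ?m -` {v} \<inter> space (\<Pi>\<^sub>M n\<in>I. \<alpha>) \<in> sets (\<Pi>\<^sub>M n\<in>I. \<alpha>))"
        using c by (auto simp: code_def space_PiM PiE_iff)
    qed
  qed simp
  ultimately show "(\<lambda>x. emeasure (dirichlet_process (add_atoms \<alpha> I x)) \<Gamma>) \<in> borel_measurable (\<Pi>\<^sub>M n\<in>I. \<alpha>)"
    by (subst measurable_cong) auto
qed

lemma measurable_dirichlet_process_add_atom:
  "(\<lambda>x. dirichlet_process (add_atom \<alpha> x)) \<in> \<alpha> \<rightarrow>\<^sub>M prob_algebra (prob_algebra \<alpha>)"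
proof -
  have "(\<lambda>x. \<lambda>_\<in>{()}. x) \<in> \<alpha> \<rightarrow>\<^sub>M (\<Pi>\<^sub>M n\<in>{()}. \<alpha>)" by measurable
  from measurable_compose[OF this measurable_dirichlet_process_add_atoms]
  show ?thesis
    by (simp add: add_atom_eq) (simp add: add_atoms_def)
qed

text \<open>
  A draw \<open>x\<close> from a random measure \<open>l\<close> weights the law of \<open>l\<close> by \<open>l X\<close> on the event \<open>x \<in> X\<close>. For a partition that refines
  \<open>X\<close>, this is the sum over the cells inside \<open>X\<close> of the size-biased Dirichlet laws, and a size bias by cell \<open>i\<close> adds
  a unit mass to cell \<open>i\<close>, as the atom at \<open>x\<close> does.
\<close>
lemma dirichlet_process_posterior:
  assumes F: "F \<in> borel_measurable (\<alpha> \<Otimes>\<^sub>M prob_algebra \<alpha>)"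
  shows "(\<integral>\<^sup>+l. \<integral>\<^sup>+x. F (x, l) \<partial>l \<partial>dirichlet_process \<alpha>)
       = (\<integral>\<^sup>+x. \<integral>\<^sup>+l. F (x, l) \<partial>dirichlet_process (add_atom \<alpha> x) \<partial>base)"
proof -
  let ?D = "dirichlet_process \<alpha>"
  note sD = sets_dirichlet_process
  have id: "(\<lambda>l. l) \<in> ?D \<rightarrow>\<^sub>M prob_algebra \<alpha>" using measurable_cong_sets[OF sD refl, of "prob_algebra \<alpha>"] by simp
  have K: "(\<lambda>x. dirichlet_process (add_atom \<alpha> x)) \<in> base \<rightarrow>\<^sub>M prob_algebra (prob_algebra \<alpha>)"
    using measurable_dirichlet_process_add_atom measurable_cong_sets[OF sets_base refl] by blast
  define J1 where "J1 = distr (joint_law ?D \<alpha> (\<lambda>l. l)) (\<alpha> \<Otimes>\<^sub>M prob_algebra \<alpha>) (\<lambda>(l, x). (x, l))"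
  define J2 where "J2 = joint_law base (prob_algebra \<alpha>) (\<lambda>x. dirichlet_process (add_atom \<alpha> x))"
  have s1: "sets (joint_law ?D \<alpha> (\<lambda>l. l)) = sets (prob_algebra \<alpha> \<Otimes>\<^sub>M \<alpha>)"
    using sets_joint_law[OF prob_space_dirichlet_process id] sets_pair_measure_cong[OF sD refl] by simp
  have swap: "(\<lambda>(l, x). (x, l)) \<in> joint_law ?D \<alpha> (\<lambda>l. l) \<rightarrow>\<^sub>M \<alpha> \<Otimes>\<^sub>M prob_algebra \<alpha>"
    using measurable_cong_sets[OF s1 refl, of "\<alpha> \<Otimes>\<^sub>M prob_algebra \<alpha>"] measurable_pair_swap'[of "prob_algebra \<alpha>" \<alpha>] by simp
  have sJ1: "sets J1 = sets (\<alpha> \<Otimes>\<^sub>M prob_algebra \<alpha>)" by (simp add: J1_def)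
  have sJ2: "sets J2 = sets (\<alpha> \<Otimes>\<^sub>M prob_algebra \<alpha>)"
    unfolding J2_def using sets_joint_law[OF prob_space_base K] sets_pair_measure_cong[OF sets_base refl] by simp
  have int1: "(\<integral>\<^sup>+z. f z \<partial>J1) = (\<integral>\<^sup>+l. \<integral>\<^sup>+x. f (x, l) \<partial>l \<partial>?D)" if f: "f \<in> borel_measurable (\<alpha> \<Otimes>\<^sub>M prob_algebra \<alpha>)" for f
  proof -
    have "(\<integral>\<^sup>+z. f z \<partial>J1) = (\<integral>\<^sup>+z. f (case z of (l, x) \<Rightarrow> (x, l)) \<partial>joint_law ?D \<alpha> (\<lambda>l. l))"
      unfolding J1_def by (rule nn_integral_distr[OF swap]) (simp add: f)
    also have "\<dots> = (\<integral>\<^sup>+l. \<integral>\<^sup>+x. f (case (l, x) of (l, x) \<Rightarrow> (x, l)) \<partial>l \<partial>?D)"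
    proof (rule nn_integral_joint_law[OF prob_space_dirichlet_process id])
      show "(\<lambda>z. f (case z of (l, x) \<Rightarrow> (x, l))) \<in> borel_measurable (?D \<Otimes>\<^sub>M \<alpha>)"
        using measurable_compose[OF measurable_pair_swap'[of "prob_algebra \<alpha>" \<alpha>] f]
          measurable_cong_sets[OF sets_pair_measure_cong[OF sD refl, of \<alpha>] refl, of "borel :: ennreal measure"] by simp
    qed
    finally show ?thesis by simp
  qed
  have int2: "(\<integral>\<^sup>+z. f z \<partial>J2) = (\<integral>\<^sup>+x. \<integral>\<^sup>+l. f (x, l) \<partial>dirichlet_process (add_atom \<alpha> x) \<partial>base)"
    if f: "f \<in> borel_measurable (\<alpha> \<Otimes>\<^sub>M prob_algebra \<alpha>)" for f
    unfolding J2_def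
    by (rule nn_integral_joint_law[OF prob_space_base K])
      (use f measurable_cong_sets[OF sets_pair_measure_cong[OF sets_base refl] refl] in blast)
  have "J1 = J2"
  proof (rule measure_eqI_rectangles[OF _ _ sJ1 sJ2 Int_stable_cylinders cylinders_Pow sets_prob_algebra_cylinders])
    show "prob_space J1"
      unfolding J1_def by (rule prob_space.prob_space_distr[OF prob_space_joint_law[OF prob_space_dirichlet_process id] swap])
    show "prob_space J2" unfolding J2_def by (rule prob_space_joint_law[OF prob_space_base K])
    have "code \<alpha> 0 (\<lambda>_. 0)" by (simp add: code_def)
    moreover have "space (prob_algebra \<alpha>) = cylinder \<alpha> 0 (\<lambda>_. 0) (space (\<Pi>\<^sub>M i\<in>{..0}. borel))"
      using measurable_space[OF measurable_cell_masses[OF \<open>code \<alpha> 0 (\<lambda>_. 0)\<close>]] by (auto simp: cylinder_def)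
    ultimately show "space (prob_algebra \<alpha>) \<in> cylinders \<alpha>" unfolding cylinders_def by blast
    fix X \<Gamma> assume X: "X \<in> sets \<alpha>" and "\<Gamma> \<in> cylinders \<alpha>"
    then obtain d c H where \<Gamma>: "\<Gamma> = cylinder \<alpha> d c H" and c: "code \<alpha> d c" and H: "H \<in> sets (\<Pi>\<^sub>M i\<in>{..d}. borel)"
      unfolding cylinders_def by blast
    have \<Gamma>': "\<Gamma> \<in> sets (prob_algebra \<alpha>)" unfolding \<Gamma> by (rule cylinder_in_sets[OF c H])
    define cX where "cX x = (if x \<in> X then 1 else 0 :: nat)" for x
    have cX: "code \<alpha> 1 cX" unfolding cX_def by (rule code_indicator[OF X])
    \<comment> \<open>The refinement of the partition \<open>c\<close> by \<open>X\<close>: its cells inside \<open>X\<close> are those with an odd code.\<close>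
    define e D where "e = join_code 1 cX c" and "D = 1 + (1 + 1) * d"
    have e: "code \<alpha> D e" unfolding e_def D_def by (rule code_join[OF cX c])
    define r where "r i = i div (1 + 1)" for i :: nat
    have r: "c x = r (e x)" if "x \<in> space \<alpha>" for x
      unfolding r_def e_def using join_code_div[OF cX that] .
    have odd: "x \<in> X \<longleftrightarrow> odd (e x)" if "x \<in> space \<alpha>" for x
      by (auto simp: e_def join_code_def cX_def)
    define h where "h p = (indicator H (coarsen r d D p) :: ennreal)" for p
    have h: "h \<in> borel_measurable (\<Pi>\<^sub>M i\<in>{..D}. borel)"
      unfolding h_def by (rule measurable_compose[OF measurable_coarsen borel_measurable_indicator[OF H]])
    define a where "a i = measure \<alpha> (cell \<alpha> e i)" for i
    have total: "(\<Sum>i\<le>D. a i) = mass" unfolding a_def mass_def by (rule measure_cells_sum[OF e finite_base refl])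
    interpret a: dirichlet_parameters "{..D}" a
      using mass_pos total by unfold_locales (auto simp: a_def)
    have masses: "cell_masses \<alpha> c d l = coarsen r d D (cell_masses \<alpha> e D l)" if "l \<in> space (prob_algebra \<alpha>)" for l
      using prob_algebra_finite[OF that] r by (intro cell_masses_coarsen[OF e]) auto
    have ind: "indicator \<Gamma> l = h (cell_masses \<alpha> e D l)" if "l \<in> space (prob_algebra \<alpha>)" for l
      unfolding h_def masses[OF that, symmetric] using that by (auto simp: \<Gamma> cylinder_def indicator_def)
    have X_odd: "X = {x \<in> space \<alpha>. odd (e x)}" using odd sets.sets_into_space[OF X] by auto
    have lX: "emeasure l X = (\<Sum>i | i \<le> D \<and> odd i. ennreal (cell_masses \<alpha> e D l i))" if "l \<in> space (prob_algebra \<alpha>)" for l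
    proof -
      have l: "finite_measure l" "sets l = sets \<alpha>" using prob_algebra_finite[OF that] by auto
      have "emeasure l X = ennreal (\<Sum>i | i \<le> D \<and> odd i. measure l (cell \<alpha> e i))"
        using measure_coarse_union[OF e l X_odd] finite_measure.emeasure_eq_measure[OF l(1)] by simp
      also have "\<dots> = (\<Sum>i | i \<le> D \<and> odd i. ennreal (cell_masses \<alpha> e D l i))"
        by (simp add: cell_masses_def sum_ennreal[symmetric] del: sum_ennreal)
      finally show ?thesis .
    qed
    have rect: "indicator (X \<times> \<Gamma>) \<in> borel_measurable (\<alpha> \<Otimes>\<^sub>M prob_algebra \<alpha>)"
      using X \<Gamma>' by (intro borel_measurable_indicator pair_measureI)
    have "emeasure J1 (X \<times> \<Gamma>) = (\<integral>\<^sup>+l. \<integral>\<^sup>+x. indicator (X \<times> \<Gamma>) (x, l) \<partial>l \<partial>?D)"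
      using int1[OF rect] X \<Gamma>' sJ1 by simp
    also have "\<dots> = (\<integral>\<^sup>+l. (\<Sum>i | i \<le> D \<and> odd i. ennreal (cell_masses \<alpha> e D l i) * h (cell_masses \<alpha> e D l)) \<partial>?D)"
    proof (rule nn_integral_cong)
      fix l assume "l \<in> space ?D"
      then have l: "l \<in> space (prob_algebra \<alpha>)" using sets_eq_imp_space_eq[OF sD] by simp
      have "(\<integral>\<^sup>+x. indicator (X \<times> \<Gamma>) (x, l) \<partial>l) = (\<integral>\<^sup>+x. indicator \<Gamma> l * indicator X x \<partial>l)"
        by (intro nn_integral_cong) (auto simp: indicator_def)
      also have "\<dots> = indicator \<Gamma> l * emeasure l X"
        using X prob_algebra_finite[OF l] by (intro nn_integral_cmult_indicator) auto
      finally show "(\<integral>\<^sup>+x. indicator (X \<times> \<Gamma>) (x, l) \<partial>l) = (\<Sum>i | i \<le> D \<and> odd i. ennreal (cell_masses \<alpha> e D l i) * h (cell_masses \<alpha> e D l))"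
        by (simp add: ind[OF l] lX[OF l] sum_distrib_left mult.commute)
    qed
    also have "\<dots> = (\<integral>\<^sup>+p. (\<Sum>i | i \<le> D \<and> odd i. ennreal (p i) * h p) \<partial>dirichlet_measure {..D} a)"
      unfolding a_def
    proof (rule nn_integral_dirichlet_process_cells[OF e])
      show "(\<lambda>p. \<Sum>i | i \<le> D \<and> odd i. ennreal (p i) * h p) \<in> borel_measurable (\<Pi>\<^sub>M i\<in>{..D}. borel)"
        using h by (intro borel_measurable_sum borel_measurable_times_ennreal measurable_ennreal_coordinate) auto
    qed
    also have "\<dots> = (\<Sum>i | i \<le> D \<and> odd i. \<integral>\<^sup>+p. ennreal (p i) * h p \<partial>dirichlet_measure {..D} a)"
    proof (rule nn_integral_sum)
      fix i assume "i \<in> {i. i \<le> D \<and> odd i}"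
      then have "(\<lambda>p. ennreal (p i) * h p) \<in> borel_measurable (\<Pi>\<^sub>M i\<in>{..D}. borel)"
        using h by (intro borel_measurable_times_ennreal measurable_ennreal_coordinate) auto
      then show "(\<lambda>p. ennreal (p i) * h p) \<in> borel_measurable (dirichlet_measure {..D} a)"
        using measurable_cong_sets[OF sets_dirichlet_measure refl] by blast
    qed
    also have "\<dots> = (\<Sum>i | i \<le> D \<and> odd i. ennreal (a i / mass) * (\<integral>\<^sup>+p. h p \<partial>dirichlet_measure {..D} (a(i := a i + 1))))"
      using a.nn_integral_dirichlet_size_bias[OF _ h] by (intro sum.cong) (auto simp: total)
    finally have J1: "emeasure J1 (X \<times> \<Gamma>) = \<dots>" .
    have post: "emeasure (dirichlet_process (add_atom \<alpha> x)) \<Gamma> = (\<integral>\<^sup>+p. h p \<partial>dirichlet_measure {..D} (a(e x := a (e x) + 1)))"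
      if x: "x \<in> space \<alpha>" for x
    proof -
      interpret d: dirichlet_base "add_atom \<alpha> x" by (rule dirichlet_base_add_atom)
      have cell': "cell (add_atom \<alpha> x) e i = cell \<alpha> e i" for i by (simp add: cell_def)
      have code': "code (add_atom \<alpha> x) D e" using e measurable_cong_sets[OF sets_add_atom refl] by (auto simp: code_def)
      have m: "measure (add_atom \<alpha> x) (cell \<alpha> e i) = (a(e x := a (e x) + 1)) i" for i
        using x measure_add_atoms[OF _ sets_cell[OF e], of "{()}" "\<lambda>_. x" i]
        by (auto simp: add_atom_eq a_def cell_def indicator_def)
      have pa: "prob_algebra (add_atom \<alpha> x) = prob_algebra \<alpha>" by (rule prob_algebra_cong) simp
      have sd: "sets (dirichlet_process (add_atom \<alpha> x)) = sets (prob_algebra \<alpha>)"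
        using d.sets_dirichlet_process by (simp add: pa)
      have "emeasure (dirichlet_process (add_atom \<alpha> x)) \<Gamma> = (\<integral>\<^sup>+l. indicator \<Gamma> l \<partial>dirichlet_process (add_atom \<alpha> x))"
        using \<Gamma>' sd by simp
      also have "\<dots> = (\<integral>\<^sup>+l. h (cell_masses (add_atom \<alpha> x) e D l) \<partial>dirichlet_process (add_atom \<alpha> x))"
        using sets_eq_imp_space_eq[OF sd] ind by (intro nn_integral_cong) (simp add: cell_masses_def cell')
      also have "\<dots> = (\<integral>\<^sup>+p. h p \<partial>dirichlet_measure {..D} (\<lambda>i. measure (add_atom \<alpha> x) (cell (add_atom \<alpha> x) e i)))"
        by (rule d.nn_integral_dirichlet_process_cells[OF code' h])
      finally show ?thesis by (simp only: cell' m)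
    qed
    have "emeasure J2 (X \<times> \<Gamma>) = (\<integral>\<^sup>+x. \<integral>\<^sup>+l. indicator (X \<times> \<Gamma>) (x, l) \<partial>dirichlet_process (add_atom \<alpha> x) \<partial>base)"
      using int2[OF rect] X \<Gamma>' sJ2 by simp
    also have "\<dots> = (\<integral>\<^sup>+x. (\<Sum>i | i \<le> D \<and> odd i. (\<integral>\<^sup>+p. h p \<partial>dirichlet_measure {..D} (a(i := a i + 1))) * indicator (cell \<alpha> e i) x) \<partial>base)"
    proof (rule nn_integral_cong)
      fix x assume "x \<in> space base"
      then have x: "x \<in> space \<alpha>" by simp
      have sd: "sets (dirichlet_process (add_atom \<alpha> x)) = sets (prob_algebra \<alpha>)"
        using dirichlet_base.sets_dirichlet_process[OF dirichlet_base_add_atom] prob_algebra_cong[OF sets_add_atom] by metis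
      have "(\<integral>\<^sup>+l. indicator (X \<times> \<Gamma>) (x, l) \<partial>dirichlet_process (add_atom \<alpha> x)) = (\<integral>\<^sup>+l. indicator X x * indicator \<Gamma> l \<partial>dirichlet_process (add_atom \<alpha> x))"
        by (intro nn_integral_cong) (auto simp: indicator_def)
      also have "\<dots> = indicator X x * emeasure (dirichlet_process (add_atom \<alpha> x)) \<Gamma>"
        using \<Gamma>' sd by (intro nn_integral_cmult_indicator) simp
      also have "\<dots> = indicator X x * (\<integral>\<^sup>+p. h p \<partial>dirichlet_measure {..D} (a(e x := a (e x) + 1)))"
        by (simp add: post[OF x])
      also have "\<dots> = (\<Sum>i | i \<le> D \<and> odd i. (\<integral>\<^sup>+p. h p \<partial>dirichlet_measure {..D} (a(i := a i + 1))) * indicator (cell \<alpha> e i) x)"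
      proof (cases "x \<in> X")
        case True
        have "e x \<le> D" using e x by (simp add: code_def)
        then have "(\<Sum>i | i \<le> D \<and> odd i. (\<integral>\<^sup>+p. h p \<partial>dirichlet_measure {..D} (a(i := a i + 1))) * indicator (cell \<alpha> e i) x)
          = (\<Sum>i\<in>{e x}. (\<integral>\<^sup>+p. h p \<partial>dirichlet_measure {..D} (a(i := a i + 1))) * indicator (cell \<alpha> e i) x)"
          using odd[OF x] True by (intro sum.mono_neutral_right) (auto simp: cell_def)
        then show ?thesis using True x by (simp add: cell_def)
      next
        case False
        then have "(\<Sum>i | i \<le> D \<and> odd i. (\<integral>\<^sup>+p. h p \<partial>dirichlet_measure {..D} (a(i := a i + 1))) * indicator (cell \<alpha> e i) x) = 0"
          using odd[OF x] by (intro sum.neutral) (auto simp: cell_def indicator_def)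
        then show ?thesis using False by simp
      qed
      finally show "(\<integral>\<^sup>+l. indicator (X \<times> \<Gamma>) (x, l) \<partial>dirichlet_process (add_atom \<alpha> x))
        = (\<Sum>i | i \<le> D \<and> odd i. (\<integral>\<^sup>+p. h p \<partial>dirichlet_measure {..D} (a(i := a i + 1))) * indicator (cell \<alpha> e i) x)" .
    qed
    also have "\<dots> = (\<Sum>i | i \<le> D \<and> odd i. (\<integral>\<^sup>+p. h p \<partial>dirichlet_measure {..D} (a(i := a i + 1))) * emeasure base (cell \<alpha> e i))"
      using sets_cell[OF e] by (subst nn_integral_sum) (auto intro!: sum.cong nn_integral_cmult_indicator)
    also have "\<dots> = (\<Sum>i | i \<le> D \<and> odd i. ennreal (a i / mass) * (\<integral>\<^sup>+p. h p \<partial>dirichlet_measure {..D} (a(i := a i + 1))))"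
      by (intro sum.cong refl) (simp add: emeasure_base a_def mult.commute)
    finally show "emeasure J1 (X \<times> \<Gamma>) = emeasure J2 (X \<times> \<Gamma>)" unfolding J1 by simp
  qed
  then show ?thesis using int1[OF F] int2[OF F] by simp
qed

end

section \<open>Samples from a Dirichlet process and the Polya urn\<close>

lemma nn_integral_measure_sum:
  assumes Q: "\<And>i. i \<in> I \<Longrightarrow> sets (Q i) = sets L" and f: "f \<in> borel_measurable L"
  shows "(\<integral>\<^sup>+x. f x \<partial>measure_sum L I Q) = (\<Sum>i\<in>I. \<integral>\<^sup>+x. f x \<partial>Q i)"
  using f
proof (induction rule: borel_measurable_induct)
  case (cong f g)
  have "(\<integral>\<^sup>+x. f x \<partial>measure_sum L I Q) = (\<integral>\<^sup>+x. g x \<partial>measure_sum L I Q)"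
    using cong by (intro nn_integral_cong) simp
  moreover have "(\<integral>\<^sup>+x. f x \<partial>Q i) = (\<integral>\<^sup>+x. g x \<partial>Q i)" if "i \<in> I" for i
    using cong sets_eq_imp_space_eq[OF Q[OF that]] by (intro nn_integral_cong) simp
  ultimately show ?case using cong by simp
next
  case (set A)
  then show ?case using Q by (simp add: emeasure_measure_sum)
next
  case (mult u c)
  then have "u \<in> borel_measurable (Q i)" if "i \<in> I" for i using measurable_cong_sets[OF Q[OF that] refl] by blast
  then show ?case using mult by (simp add: nn_integral_cmult sum_distrib_left)
next
  case (add u v)
  then have "u \<in> borel_measurable (Q i)" "v \<in> borel_measurable (Q i)" if "i \<in> I" for i
    using measurable_cong_sets[OF Q[OF that] refl] by blast+
  then show ?case using add by (simp add: nn_integral_add sum.distrib)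
next
  case (seq U)
  have m: "U k \<in> borel_measurable (Q i)" if "i \<in> I" for i k
    using measurable_cong_sets[OF Q[OF that] refl] seq(1) by blast
  have mc: "(\<integral>\<^sup>+x. (SUP k. U k) x \<partial>R) = (SUP k. \<integral>\<^sup>+x. U k x \<partial>R)" if "\<And>k. U k \<in> borel_measurable R" for R
    using nn_integral_monotone_convergence_SUP[OF seq(3) that] by (simp add: image_comp)
  have "(\<integral>\<^sup>+x. (SUP k. U k) x \<partial>measure_sum L I Q) = (SUP k. \<Sum>i\<in>I. \<integral>\<^sup>+x. U k x \<partial>Q i)"
  proof (subst mc)
    show "U k \<in> borel_measurable (measure_sum L I Q)" for k
      using seq(1) measurable_cong_sets[OF sets_measure_sum refl] by blast
  qed (simp add: seq)
  also have "\<dots> = (\<Sum>i\<in>I. SUP k. \<integral>\<^sup>+x. U k x \<partial>Q i)"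
    using seq(3) by (intro ennreal_SUP_sum) (auto simp: incseq_def le_fun_def intro!: nn_integral_mono)
  also have "\<dots> = (\<Sum>i\<in>I. \<integral>\<^sup>+x. (SUP k. U k) x \<partial>Q i)"
    using m by (intro sum.cong refl mc[symmetric]) auto
  finally show ?case .
qed

lemma measure_plus_eq_measure_sum:
  "sets Q = sets P \<Longrightarrow> measure_plus P Q = measure_sum P UNIV (\<lambda>b. if b then P else Q)"
  by (intro measure_eqI) (auto simp: emeasure_measure_plus emeasure_measure_sum UNIV_bool)

lemma nn_integral_measure_plus:
  assumes "sets Q = sets P" "f \<in> borel_measurable P"
  shows "(\<integral>\<^sup>+x. f x \<partial>measure_plus P Q) = (\<integral>\<^sup>+x. f x \<partial>P) + (\<integral>\<^sup>+x. f x \<partial>Q)"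
  unfolding measure_plus_eq_measure_sum[OF assms(1)]
  using assms by (subst nn_integral_measure_sum) (auto simp: UNIV_bool)

lemma nn_integral_add_atoms:
  assumes f: "f \<in> borel_measurable \<alpha>" and x: "\<And>n. n \<in> I \<Longrightarrow> x n \<in> space \<alpha>"
  shows "(\<integral>\<^sup>+z. f z \<partial>add_atoms \<alpha> I x) = (\<integral>\<^sup>+z. f z \<partial>\<alpha>) + (\<Sum>n\<in>I. f (x n))"
  unfolding add_atoms_def using assms
  by (simp add: nn_integral_measure_plus nn_integral_measure_sum nn_integral_return)

text \<open>
  The probability of a cylinder of the product is a finite product of measurable functions.
\<close>
lemma measurable_PiM_kernel:
  assumes K: "\<And>i. i \<in> I \<Longrightarrow> K i \<in> M \<rightarrow>\<^sub>M prob_algebra (N i)"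
  shows "(\<lambda>x. \<Pi>\<^sub>M i\<in>I. K i x) \<in> M \<rightarrow>\<^sub>M prob_algebra (\<Pi>\<^sub>M i\<in>I. N i)"
proof (rule measurable_prob_algebra_generated[OF sets_PiM Int_stable_prod_algebra prod_algebra_sets_into_space])
  have K': "prob_space (K i x)" "sets (K i x) = sets (N i)" if "x \<in> space M" "i \<in> I" for i x
    using measurable_space[OF K[OF that(2)] that(1)] by (auto simp: space_prob_algebra)
  fix x assume x: "x \<in> space M"
  show "prob_space (\<Pi>\<^sub>M i\<in>I. K i x)" by (intro prob_space_PiM K' x)
  show "sets (\<Pi>\<^sub>M i\<in>I. K i x) = sets (\<Pi>\<^sub>M i\<in>I. N i)" by (intro sets_PiM_cong refl K' x)
next
  have K': "prob_space (K i x)" "sets (K i x) = sets (N i)" if "x \<in> space M" "i \<in> I" for i x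
    using measurable_space[OF K[OF that(2)] that(1)] by (auto simp: space_prob_algebra)
  fix A assume "A \<in> prod_algebra I N"
  then obtain J E where A: "A = prod_emb I N J (\<Pi>\<^sub>E j\<in>J. E j)" "finite J" "J \<subseteq> I"
    and E: "\<And>i. i \<in> J \<Longrightarrow> E i \<in> sets (N i)"
    by (rule prod_algebraE) blast
  have "emeasure (\<Pi>\<^sub>M i\<in>I. K i x) A = (\<Prod>i\<in>J. emeasure (K i x) (E i))" if x: "x \<in> space M" for x
  proof -
    have "A = prod_emb I (\<lambda>i. K i x) J (\<Pi>\<^sub>E j\<in>J. E j)"
      unfolding A(1) prod_emb_def using sets_eq_imp_space_eq[OF K'(2)[OF x]] by (auto simp: PiE_iff)
    then show ?thesis using A E K' x by (subst emeasure_PiM_emb[symmetric]) auto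
  qed
  moreover have "(\<lambda>x. \<Prod>i\<in>J. emeasure (K i x) (E i)) \<in> borel_measurable M"
  proof (intro borel_measurable_prod_ennreal)
    fix i assume "i \<in> J"
    then show "(\<lambda>x. emeasure (K i x) (E i)) \<in> borel_measurable M"
      using A(3) E K by (intro measurable_emeasure_kernel[OF measurable_prob_algebra_subprob]) auto
  qed
  ultimately show "(\<lambda>x. emeasure (\<Pi>\<^sub>M i\<in>I. K i x) A) \<in> borel_measurable M"
    by (subst measurable_cong) auto
qed

lemma measurable_iid_kernel: "(\<lambda>l. \<Pi>\<^sub>M i\<in>I. l) \<in> prob_algebra L \<rightarrow>\<^sub>M prob_algebra (\<Pi>\<^sub>M i\<in>I. L)"
  by (rule measurable_PiM_kernel) simp

lemma nn_integral_iid_Suc: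
  assumes l: "l \<in> space (prob_algebra L)" and f: "f \<in> borel_measurable (\<Pi>\<^sub>M i\<in>{1..Suc n}. L)"
  shows "(\<integral>\<^sup>+x. f x \<partial>(\<Pi>\<^sub>M i\<in>{1..Suc n}. l)) = (\<integral>\<^sup>+x. \<integral>\<^sup>+z. f (x(Suc n := z)) \<partial>l \<partial>(\<Pi>\<^sub>M i\<in>{1..n}. l))"
proof -
  have l': "prob_space l" "sets l = sets L" using l by (auto simp: space_prob_algebra)
  interpret prob_space l by fact
  interpret product_sigma_finite "\<lambda>_. l" ..
  have *: "{1..Suc n} = insert (Suc n) {1..n}" by auto
  have "sets (\<Pi>\<^sub>M i\<in>{1..Suc n}. l) = sets (\<Pi>\<^sub>M i\<in>{1..Suc n}. L)" by (intro sets_PiM_cong refl l')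
  from measurable_cong_sets[OF this refl, of "borel :: ennreal measure"] f
  have "f \<in> borel_measurable (\<Pi>\<^sub>M i\<in>insert (Suc n) {1..n}. l)" unfolding * by blast
  then show ?thesis unfolding * by (intro product_nn_integral_insert) auto
qed

lemma measurable_append:
  "(\<lambda>(x, z). x(Suc n := z)) \<in> (\<Pi>\<^sub>M i\<in>{1..n}. L) \<Otimes>\<^sub>M L \<rightarrow>\<^sub>M (\<Pi>\<^sub>M i\<in>{1..Suc n}. L)"
proof -
  have *: "{1..Suc n} = insert (Suc n) {1..n}" by auto
  show ?thesis unfolding * by (rule measurable_add_dim)
qed

context dirichlet_base
begin

definition sample_law :: "nat \<Rightarrow> (nat \<Rightarrow> 'a) measure" where
  "sample_law n = dirichlet_process \<alpha> \<bind> (\<lambda>l. \<Pi>\<^sub>M i\<in>{1..n}. l)"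

lemma iid_kernel_dirichlet: "(\<lambda>l. \<Pi>\<^sub>M i\<in>I. l) \<in> dirichlet_process \<alpha> \<rightarrow>\<^sub>M prob_algebra (\<Pi>\<^sub>M i\<in>I. \<alpha>)"
  using measurable_iid_kernel measurable_cong_sets[OF sets_dirichlet_process refl] by blast

lemma sets_sample_law [measurable_cong]: "sets (sample_law n) = sets (\<Pi>\<^sub>M i\<in>{1..n}. \<alpha>)"
  unfolding sample_law_def
proof (rule sets_bind)
  show "sets (\<Pi>\<^sub>M i\<in>{1..n}. l) = sets (\<Pi>\<^sub>M i\<in>{1..n}. \<alpha>)" if "l \<in> space (dirichlet_process \<alpha>)" for l
    using measurable_space[OF iid_kernel_dirichlet[of "{1..n}"] that] by (simp add: space_prob_algebra)
qed (rule prob_space.not_empty[OF prob_space_dirichlet_process])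

lemma nn_integral_sample_law:
  assumes "f \<in> borel_measurable (\<Pi>\<^sub>M i\<in>{1..n}. \<alpha>)"
  shows "(\<integral>\<^sup>+x. f x \<partial>sample_law n) = (\<integral>\<^sup>+l. \<integral>\<^sup>+x. f x \<partial>(\<Pi>\<^sub>M i\<in>{1..n}. l) \<partial>dirichlet_process \<alpha>)"
  unfolding sample_law_def
  by (rule nn_integral_bind[OF assms measurable_prob_algebra_subprob[OF iid_kernel_dirichlet]])

lemma nn_integral_base:
  "f \<in> borel_measurable \<alpha> \<Longrightarrow> (\<integral>\<^sup>+z. f z \<partial>base) = ennreal (1 / mass) * (\<integral>\<^sup>+z. f z \<partial>\<alpha>)"
  unfolding base_def by (rule nn_integral_scale_measure)

lemma nn_integral_base_add_atoms:
  assumes I: "finite I" and x: "x \<in> space (\<Pi>\<^sub>M i\<in>I. \<alpha>)" and f: "f \<in> borel_measurable \<alpha>"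
  shows "(\<integral>\<^sup>+z. f z \<partial>dirichlet_base.base (add_atoms \<alpha> I x))
    = ennreal (1 / (mass + card I)) * ((\<integral>\<^sup>+z. f z \<partial>\<alpha>) + (\<Sum>n\<in>I. f (x n)))"
proof -
  interpret d: dirichlet_base "add_atoms \<alpha> I x" by (rule dirichlet_base_add_atoms[OF I])
  have x': "x n \<in> space \<alpha>" if "n \<in> I" for n using x that by (auto simp: space_PiM)
  then have "d.mass = mass + card I"
    unfolding d.mass_def mass_def using measure_add_atoms[OF I sets.top, of x] by simp
  moreover have "f \<in> borel_measurable (add_atoms \<alpha> I x)"
    using f measurable_cong_sets[OF sets_add_atoms refl] by blast
  ultimately show ?thesis using d.nn_integral_base nn_integral_add_atoms[where I=I and x=x, OF f x'] by simp
qed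

text \<open>The posterior formula for one draw, applied to the posterior after \<open>n\<close> draws.\<close>
lemma dirichlet_posterior_step:
  assumes F: "F \<in> borel_measurable ((\<Pi>\<^sub>M i\<in>{1..Suc n}. \<alpha>) \<Otimes>\<^sub>M prob_algebra \<alpha>)"
    and x: "x \<in> space (\<Pi>\<^sub>M i\<in>{1..n}. \<alpha>)"
  shows "(\<integral>\<^sup>+l. \<integral>\<^sup>+z. F (x(Suc n := z), l) \<partial>l \<partial>dirichlet_process (add_atoms \<alpha> {1..n} x))
     = (\<integral>\<^sup>+z. \<integral>\<^sup>+l. F (x(Suc n := z), l) \<partial>dirichlet_process (add_atoms \<alpha> {1..Suc n} (x(Suc n := z))) \<partial>dirichlet_base.base (add_atoms \<alpha> {1..n} x))"
proof -
  interpret d: dirichlet_base "add_atoms \<alpha> {1..n} x" by (rule dirichlet_base_add_atoms) simp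
  have *: "{1..Suc n} = insert (Suc n) {1..n}" by auto
  have add: "add_atoms \<alpha> {1..Suc n} (x(Suc n := z)) = add_atom (add_atoms \<alpha> {1..n} x) z" for z
    unfolding * by (rule add_atoms_insert) auto
  have "(\<lambda>p. (case (x, fst p) of (x, z) \<Rightarrow> x(Suc n := z), snd p)) \<in> \<alpha> \<Otimes>\<^sub>M prob_algebra \<alpha> \<rightarrow>\<^sub>M (\<Pi>\<^sub>M i\<in>{1..Suc n}. \<alpha>) \<Otimes>\<^sub>M prob_algebra \<alpha>"
    by (intro measurable_Pair measurable_snd measurable_compose[OF _ measurable_append] measurable_fst measurable_const x)
  from measurable_compose[OF this F]
  have "(\<lambda>p. F (x(Suc n := fst p), snd p)) \<in> borel_measurable (\<alpha> \<Otimes>\<^sub>M prob_algebra \<alpha>)" by simp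
  moreover have s: "sets (add_atoms \<alpha> {1..n} x \<Otimes>\<^sub>M prob_algebra (add_atoms \<alpha> {1..n} x)) = sets (\<alpha> \<Otimes>\<^sub>M prob_algebra \<alpha>)"
    by (intro sets_pair_measure_cong) (simp_all add: prob_algebra_add_atoms)
  ultimately have "(\<lambda>p. F (x(Suc n := fst p), snd p)) \<in> borel_measurable (add_atoms \<alpha> {1..n} x \<Otimes>\<^sub>M prob_algebra (add_atoms \<alpha> {1..n} x))"
    using measurable_cong_sets[OF s refl] by blast
  from d.dirichlet_process_posterior[OF this] show ?thesis unfolding add by simp
qed

text \<open>
  By induction: the first \<open>n\<close> draws turn the prior into the posterior after \<open>n\<close> draws, and one more draw adds its atom.
  The same computation for a function of the draws alone identifies the law of the \<open>n + 1\<close> draws.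
\<close>
theorem dirichlet_process_posterior_sample:
  assumes "F \<in> borel_measurable ((\<Pi>\<^sub>M i\<in>{1..n}. \<alpha>) \<Otimes>\<^sub>M prob_algebra \<alpha>)"
  shows "(\<integral>\<^sup>+l. \<integral>\<^sup>+x. F (x, l) \<partial>(\<Pi>\<^sub>M i\<in>{1..n}. l) \<partial>dirichlet_process \<alpha>)
       = (\<integral>\<^sup>+x. \<integral>\<^sup>+l. F (x, l) \<partial>dirichlet_process (add_atoms \<alpha> {1..n} x) \<partial>sample_law n)"
    (is "?L n F = ?R n F")
  using assms
proof (induction n arbitrary: F)
  case 0
  interpret D: prob_space "dirichlet_process \<alpha>" by (rule prob_space_dirichlet_process)
  have e: "(\<integral>\<^sup>+x. f x \<partial>(\<Pi>\<^sub>M i\<in>{}. l)) = f (\<lambda>_. undefined)" for f :: "(nat \<Rightarrow> 'a) \<Rightarrow> ennreal" and l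
    by (simp add: PiM_empty nn_integral_count_space_finite)
  define G where "G x = (\<integral>\<^sup>+l. F (x, l) \<partial>dirichlet_process \<alpha>)" for x
  have "?R 0 F = (\<integral>\<^sup>+l. \<integral>\<^sup>+x. G x \<partial>(\<Pi>\<^sub>M i\<in>{1..0}. l) \<partial>dirichlet_process \<alpha>)"
    unfolding G_def by (subst nn_integral_sample_law[symmetric]) (simp_all add: add_atoms_empty PiM_empty)
  then show ?case by (simp add: e G_def D.emeasure_space_1)
next
  case (Suc n)
  let ?D = "dirichlet_process \<alpha>"
  note F = Suc.prems
  have step: "?L (Suc n) F = (\<integral>\<^sup>+x. \<integral>\<^sup>+z. \<integral>\<^sup>+l. F (x(Suc n := z), l) \<partial>dirichlet_process (add_atoms \<alpha> {1..Suc n} (x(Suc n := z)))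
      \<partial>dirichlet_base.base (add_atoms \<alpha> {1..n} x) \<partial>sample_law n)"
    if F: "F \<in> borel_measurable ((\<Pi>\<^sub>M i\<in>{1..Suc n}. \<alpha>) \<Otimes>\<^sub>M prob_algebra \<alpha>)" for F
  proof -
    have "?L (Suc n) F = (\<integral>\<^sup>+l. \<integral>\<^sup>+x. \<integral>\<^sup>+z. F (x(Suc n := z), l) \<partial>l \<partial>(\<Pi>\<^sub>M i\<in>{1..n}. l) \<partial>?D)"
    proof (rule nn_integral_cong)
      fix l assume "l \<in> space ?D"
      then have l: "l \<in> space (prob_algebra \<alpha>)" using sets_eq_imp_space_eq[OF sets_dirichlet_process] by simp
      have "(\<lambda>x. F (x, l)) \<in> borel_measurable (\<Pi>\<^sub>M i\<in>{1..Suc n}. \<alpha>)"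
        by (rule measurable_compose[OF measurable_Pair2'[OF l] F])
      from nn_integral_iid_Suc[OF l this]
      show "(\<integral>\<^sup>+x. F (x, l) \<partial>(\<Pi>\<^sub>M i\<in>{1..Suc n}. l)) = (\<integral>\<^sup>+x. \<integral>\<^sup>+z. F (x(Suc n := z), l) \<partial>l \<partial>(\<Pi>\<^sub>M i\<in>{1..n}. l))" .
    qed
    also have "\<dots> = (\<integral>\<^sup>+l. \<integral>\<^sup>+x. (\<lambda>p. \<integral>\<^sup>+z. F ((fst p)(Suc n := z), snd p) \<partial>snd p) (x, l) \<partial>(\<Pi>\<^sub>M i\<in>{1..n}. l) \<partial>?D)" by simp
    also have "\<dots> = (\<integral>\<^sup>+x. \<integral>\<^sup>+l. (\<lambda>p. \<integral>\<^sup>+z. F ((fst p)(Suc n := z), snd p) \<partial>snd p) (x, l) \<partial>dirichlet_process (add_atoms \<alpha> {1..n} x) \<partial>sample_law n)"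
    proof (rule Suc.IH, rule borel_measurable_kernel_integral[where N=\<alpha>])
      have "(\<lambda>q. (case (fst (fst q), snd q) of (x, z) \<Rightarrow> x(Suc n := z), snd (fst q)))
          \<in> ((\<Pi>\<^sub>M i\<in>{1..n}. \<alpha>) \<Otimes>\<^sub>M prob_algebra \<alpha>) \<Otimes>\<^sub>M \<alpha> \<rightarrow>\<^sub>M (\<Pi>\<^sub>M i\<in>{1..Suc n}. \<alpha>) \<Otimes>\<^sub>M prob_algebra \<alpha>"
        by (intro measurable_Pair measurable_compose[OF _ measurable_append] measurable_snd
            measurable_compose[OF measurable_fst measurable_fst] measurable_compose[OF measurable_fst measurable_snd])
      from measurable_compose[OF this F]
      show "(\<lambda>(p, z). F ((fst p)(Suc n := z), snd p)) \<in> borel_measurable (((\<Pi>\<^sub>M i\<in>{1..n}. \<alpha>) \<Otimes>\<^sub>M prob_algebra \<alpha>) \<Otimes>\<^sub>M \<alpha>)"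
        by (simp add: split_beta')
    qed simp
    also have "\<dots> = (\<integral>\<^sup>+x. \<integral>\<^sup>+z. \<integral>\<^sup>+l. F (x(Suc n := z), l) \<partial>dirichlet_process (add_atoms \<alpha> {1..Suc n} (x(Suc n := z)))
      \<partial>dirichlet_base.base (add_atoms \<alpha> {1..n} x) \<partial>sample_law n)"
      using dirichlet_posterior_step[OF F] sets_eq_imp_space_eq[OF sets_sample_law]
      by (intro nn_integral_cong) simp
    finally show ?thesis .
  qed
  define G where "G x = (\<integral>\<^sup>+l. F (x, l) \<partial>dirichlet_process (add_atoms \<alpha> {1..Suc n} x))" for x
  have G: "G \<in> borel_measurable (\<Pi>\<^sub>M i\<in>{1..Suc n}. \<alpha>)"
    unfolding G_def by (rule borel_measurable_kernel_integral[OF _ measurable_dirichlet_process_add_atoms]) (use F in simp_all)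
  have "?R (Suc n) F = ?L (Suc n) (\<lambda>p. G (fst p))"
    using nn_integral_sample_law[OF G] by (simp add: G_def)
  also have "\<dots> = (\<integral>\<^sup>+x. \<integral>\<^sup>+z. \<integral>\<^sup>+l. G (x(Suc n := z)) \<partial>dirichlet_process (add_atoms \<alpha> {1..Suc n} (x(Suc n := z)))
      \<partial>dirichlet_base.base (add_atoms \<alpha> {1..n} x) \<partial>sample_law n)"
    by (subst step) (use measurable_compose[OF measurable_fst G] in simp_all)
  also have "\<dots> = (\<integral>\<^sup>+x. \<integral>\<^sup>+z. G (x(Suc n := z)) \<partial>dirichlet_base.base (add_atoms \<alpha> {1..n} x) \<partial>sample_law n)"
  proof (intro nn_integral_cong)
    fix x z
    interpret P: prob_space "dirichlet_process (add_atoms \<alpha> {1..Suc n} (x(Suc n := z)))"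
      by (rule dirichlet_base.prob_space_dirichlet_process, rule dirichlet_base_add_atoms) simp
    show "(\<integral>\<^sup>+l. G (x(Suc n := z)) \<partial>dirichlet_process (add_atoms \<alpha> {1..Suc n} (x(Suc n := z)))) = G (x(Suc n := z))"
      using P.emeasure_space_1 by simp
  qed
  also have "\<dots> = ?L (Suc n) F" unfolding step[OF F] G_def ..
  finally show ?case by simp
qed

text \<open>
  The Blackwell--MacQueen urn: given \<open>n\<close> draws, the next one is drawn from the posterior mean, which is the normalised
  parameter with \<open>n\<close> atoms added.
\<close>
theorem nn_integral_sample_law_Suc:
  assumes G: "G \<in> borel_measurable (\<Pi>\<^sub>M i\<in>{1..Suc n}. \<alpha>)"
  shows "(\<integral>\<^sup>+x. G x \<partial>sample_law (Suc n))
    = (\<integral>\<^sup>+x. ennreal (1 / (mass + n)) * ((\<integral>\<^sup>+z. G (x(Suc n := z)) \<partial>\<alpha>) + (\<Sum>i=1..n. G (x(Suc n := x i)))) \<partial>sample_law n)"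
proof -
  let ?D = "dirichlet_process \<alpha>"
  have app: "(\<lambda>z. G (x(Suc n := z))) \<in> borel_measurable \<alpha>" if "x \<in> space (\<Pi>\<^sub>M i\<in>{1..n}. \<alpha>)" for x
    using measurable_compose[OF measurable_compose[OF measurable_Pair1'[OF that] measurable_append] G] by simp
  define F where "F p = (\<integral>\<^sup>+z. G ((fst p)(Suc n := z)) \<partial>snd p)" for p
  have F: "F \<in> borel_measurable ((\<Pi>\<^sub>M i\<in>{1..n}. \<alpha>) \<Otimes>\<^sub>M prob_algebra \<alpha>)"
    unfolding F_def
  proof (rule borel_measurable_kernel_integral[where N=\<alpha>])
    have "(\<lambda>q. case (fst (fst q), snd q) of (x, z) \<Rightarrow> x(Suc n := z)) \<in> ((\<Pi>\<^sub>M i\<in>{1..n}. \<alpha>) \<Otimes>\<^sub>M prob_algebra \<alpha>) \<Otimes>\<^sub>M \<alpha> \<rightarrow>\<^sub>M (\<Pi>\<^sub>M i\<in>{1..Suc n}. \<alpha>)"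
      by (intro measurable_compose[OF _ measurable_append] measurable_Pair measurable_snd measurable_compose[OF measurable_fst measurable_fst])
    from measurable_compose[OF this G]
    show "(\<lambda>(p, z). G ((fst p)(Suc n := z))) \<in> borel_measurable (((\<Pi>\<^sub>M i\<in>{1..n}. \<alpha>) \<Otimes>\<^sub>M prob_algebra \<alpha>) \<Otimes>\<^sub>M \<alpha>)"
      by (simp add: split_beta')
  qed simp
  have "(\<integral>\<^sup>+x. G x \<partial>sample_law (Suc n)) = (\<integral>\<^sup>+l. \<integral>\<^sup>+x. F (x, l) \<partial>(\<Pi>\<^sub>M i\<in>{1..n}. l) \<partial>?D)"
    unfolding nn_integral_sample_law[OF G] F_def
    using nn_integral_iid_Suc[OF _ G] sets_eq_imp_space_eq[OF sets_dirichlet_process]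
    by (intro nn_integral_cong) simp
  also have "\<dots> = (\<integral>\<^sup>+x. \<integral>\<^sup>+l. F (x, l) \<partial>dirichlet_process (add_atoms \<alpha> {1..n} x) \<partial>sample_law n)"
    by (rule dirichlet_process_posterior_sample[OF F])
  also have "\<dots> = (\<integral>\<^sup>+x. ennreal (1 / (mass + n)) * ((\<integral>\<^sup>+z. G (x(Suc n := z)) \<partial>\<alpha>) + (\<Sum>i=1..n. G (x(Suc n := x i)))) \<partial>sample_law n)"
  proof (rule nn_integral_cong)
    fix x assume "x \<in> space (sample_law n)"
    then have x: "x \<in> space (\<Pi>\<^sub>M i\<in>{1..n}. \<alpha>)" using sets_eq_imp_space_eq[OF sets_sample_law] by simp
    interpret d: dirichlet_base "add_atoms \<alpha> {1..n} x" by (rule dirichlet_base_add_atoms) simp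
    have "(\<integral>\<^sup>+l. F (x, l) \<partial>dirichlet_process (add_atoms \<alpha> {1..n} x))
        = (\<integral>\<^sup>+l. \<integral>\<^sup>+z. G (fst (x(Suc n := z), l)) \<partial>l \<partial>dirichlet_process (add_atoms \<alpha> {1..n} x))"
      by (simp add: F_def)
    also have "\<dots> = (\<integral>\<^sup>+z. \<integral>\<^sup>+l. G (fst (x(Suc n := z), l)) \<partial>dirichlet_process (add_atoms \<alpha> {1..Suc n} (x(Suc n := z))) \<partial>d.base)"
      by (rule dirichlet_posterior_step[where F="\<lambda>p. G (fst p)", OF measurable_compose[OF measurable_fst G] x])
    also have "\<dots> = (\<integral>\<^sup>+z. G (x(Suc n := z)) \<partial>d.base)"
    proof (rule nn_integral_cong)
      fix z
      interpret P: prob_space "dirichlet_process (add_atoms \<alpha> {1..Suc n} (x(Suc n := z)))"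
        by (rule dirichlet_base.prob_space_dirichlet_process, rule dirichlet_base_add_atoms) simp
      show "(\<integral>\<^sup>+l. G (fst (x(Suc n := z), l)) \<partial>dirichlet_process (add_atoms \<alpha> {1..Suc n} (x(Suc n := z)))) = G (x(Suc n := z))"
        using P.emeasure_space_1 by simp
    qed
    also have "\<dots> = ennreal (1 / (mass + n)) * ((\<integral>\<^sup>+z. G (x(Suc n := z)) \<partial>\<alpha>) + (\<Sum>i=1..n. G (x(Suc n := x i))))"
      using nn_integral_base_add_atoms[OF _ x app[OF x]] by simp
    finally show "(\<integral>\<^sup>+l. F (x, l) \<partial>dirichlet_process (add_atoms \<alpha> {1..n} x)) = \<dots>" .
  qed
  finally show ?thesis .
qed

end

section \<open>Countable families of basic sets for the Prohorov topology\<close>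

definition basic_set :: "nat \<Rightarrow> ('s::metric_space set \<times> real) set \<Rightarrow> 's measure set" where
  "basic_set n J = {p \<in> space (prob_algebra borel). \<forall>(F, r)\<in>J. r < measure p (\<Union>d\<in>F. ball d (1 / Suc n))}"

lemma topspace_prohorov: "topspace prohorov_topology = space (prob_algebra borel)"
proof -
  interpret Metric_space "space (prob_algebra (borel :: 'a measure))" prohorov by (rule Metric_space_prohorov)
  show ?thesis unfolding prohorov_topology_def by (rule topspace_mtopology)
qed

text \<open>
  One of the two inequalities in the Prohorov metric implies the other: apply it to the complement of the
  \<open>e\<close>-neighbourhood of a set.
\<close>
lemma prohorov_le:
  fixes p q :: "'s::metric_space measure"
  assumes pq: "p \<in> space (prob_algebra borel)" "q \<in> space (prob_algebra borel)" and e: "0 < e"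
    and le: "\<And>A. A \<in> sets borel \<Longrightarrow> measure p A \<le> measure q (\<Union>a\<in>A. ball a e) + e"
  shows "prohorov p q \<le> e"
proof -
  interpret p: prob_space p using pq by (simp add: space_prob_algebra)
  interpret q: prob_space q using pq by (simp add: space_prob_algebra)
  have s: "sets p = sets borel" "sets q = sets borel" using pq by (simp_all add: space_prob_algebra)
  have sp: "space p = UNIV" "space q = UNIV" using s[THEN sets_eq_imp_space_eq] by simp_all
  have o: "(\<Union>a\<in>A. ball a e) \<in> sets borel" for A :: "'s set" by (intro borel_open open_UN) auto
  have "measure q A \<le> measure p (\<Union>a\<in>A. ball a e) + e" if A: "A \<in> sets borel" for A
  proof -
    define C where "C = - (\<Union>a\<in>A. ball a e)"
    have C: "C \<in> sets borel" unfolding C_def by (rule borel_comp[OF o])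
    have "measure p C \<le> measure q (\<Union>c\<in>C. ball c e) + e" by (rule le[OF C])
    also have "measure q (\<Union>c\<in>C. ball c e) \<le> measure q (- A)"
    proof (rule q.finite_measure_mono)
      show "(\<Union>c\<in>C. ball c e) \<subseteq> - A"
        by (auto simp: C_def) (metis dist_commute)
      show "- A \<in> sets q" using A s by (simp add: borel_comp)
    qed
    also have "measure q (- A) = 1 - measure q A"
      using q.prob_compl[of A] A s sp by (simp add: Compl_eq_Diff_UNIV)
    also have "measure p C = 1 - measure p (\<Union>a\<in>A. ball a e)"
      using p.prob_compl[of "\<Union>a\<in>A. ball a e"] o s sp by (simp add: C_def Compl_eq_Diff_UNIV)
    finally show ?thesis by simp
  qed
  then have "e \<in> {e. 0 < e \<and> (\<forall>A\<in>sets borel. measure p A \<le> measure q (\<Union>a\<in>A. ball a e) + e \<and>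
      measure q A \<le> measure p (\<Union>a\<in>A. ball a e) + e)}" using e le by blast
  then show ?thesis
    unfolding prohorov_def using pq by (simp, intro cInf_lower) (auto intro!: bdd_belowI[of _ 0])
qed

lemma finite_balls_cover:
  fixes p :: "'s::metric_space measure"
  assumes p: "p \<in> space (prob_algebra borel)" and D: "countable D" "\<And>x. \<exists>d\<in>D. dist d x < e" and e: "0 < e"
  shows "\<exists>F. finite F \<and> F \<subseteq> D \<and> 1 - e < measure p (\<Union>d\<in>F. ball d e)"
proof -
  interpret p: prob_space p using p by (simp add: space_prob_algebra)
  have s: "sets p = sets borel" using p by (simp add: space_prob_algebra)
  have "D \<noteq> {}" using D(2) by blast
  define U where "U n = (\<Union>d\<in>from_nat_into D ` {..n}. ball d e)" for n
  have U: "U n \<in> sets p" for n unfolding U_def s by (intro borel_open open_UN) auto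
  have "(\<Union>n. U n) = UNIV"
  proof (intro equalityI subsetI UNIV_I)
    fix x
    obtain d where d: "d \<in> D" "dist d x < e" using D(2) by blast
    then obtain n where "from_nat_into D n = d" using from_nat_into_surj[OF D(1)] by blast
    then have "x \<in> U n" using d by (auto simp: U_def)
    then show "x \<in> (\<Union>n. U n)" by blast
  qed
  moreover have "incseq U" unfolding U_def by (intro incseq_SucI UN_mono image_mono) auto
  ultimately have "(\<lambda>n. measure p (U n)) \<longlonglongrightarrow> measure p UNIV"
    using p.finite_Lim_measure_incseq[of U] U by auto
  moreover have "measure p UNIV = 1"
    using p.prob_space sets_eq_imp_space_eq[OF s] by simp
  ultimately have "\<forall>\<^sub>F n in sequentially. 1 - e < measure p (U n)"
    using e by (auto intro: order_tendstoD)
  then obtain n where "1 - e < measure p (U n)" by (auto simp: eventually_sequentially)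
  then show ?thesis
    using from_nat_into[OF \<open>D \<noteq> {}\<close>] unfolding U_def
    by (intro exI[of _ "from_nat_into D ` {..n}"]) auto
qed

text \<open>
  Up to mass \<open>e\<close>, a measure \<open>p\<close> lives on finitely many balls of radius \<open>e\<close> around points of a countable dense set. If \<open>q\<close>
  gives each union of these balls at least its \<open>p\<close>-mass minus \<open>e\<close>, then \<open>q\<close> is at distance at most \<open>2 e\<close> from \<open>p\<close>.
  Rational lower bounds on the masses of such unions leave only countably many conditions.
\<close>
lemma prohorov_basic_sets:
  obtains \<B> :: "'s::{metric_space, second_countable_topology} measure set set"
  where "countable \<B>" "\<B> \<subseteq> sets (prob_algebra borel)"
    "\<And>U p. openin prohorov_topology U \<Longrightarrow> p \<in> U \<Longrightarrow> \<exists>B\<in>\<B>. p \<in> B \<and> B \<subseteq> U"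
proof -
  let ?M = "space (prob_algebra (borel :: 's measure))"
  interpret m: Metric_space ?M prohorov by (rule Metric_space_prohorov)
  obtain D :: "'s set" where D: "countable D" "\<And>X. open X \<Longrightarrow> X \<noteq> {} \<Longrightarrow> \<exists>d\<in>D. d \<in> X"
    using countable_dense_exists by blast
  define \<J> where "\<J> = {J :: ('s set \<times> real) set. finite J \<and> J \<subseteq> {F. finite F \<and> F \<subseteq> D} \<times> \<rat>}"
  define \<B> where "\<B> = (\<Union>n. basic_set n ` \<J>)"
  have "countable ({F. finite F \<and> F \<subseteq> D} \<times> \<rat>)"
    by (rule countable_SIGMA[OF countable_Collect_finite_subset[OF D(1)] countable_rat])
  then have "countable \<J>" unfolding \<J>_def by (rule countable_Collect_finite_subset)
  then have "countable \<B>" unfolding \<B>_def by (intro countable_UN countable_image) auto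
  moreover have "\<B> \<subseteq> sets (prob_algebra borel)"
  proof
    fix B assume "B \<in> \<B>"
    then obtain n J where B: "B = basic_set n J" and J: "finite J" by (auto simp: \<B>_def \<J>_def)
    have "{p \<in> ?M. r < measure p (\<Union>d\<in>F. ball d (1 / Suc n))} \<in> sets (prob_algebra borel)" for F :: "'s set" and r
    proof -
      have "(\<lambda>p. measure p (\<Union>d\<in>F. ball d (1 / Suc n))) \<in> borel_measurable (prob_algebra borel)"
        by (intro measurable_measure_prob_algebra borel_open open_UN) auto
      then show ?thesis by measurable
    qed
    then show "B \<in> sets (prob_algebra borel)"
      unfolding B basic_set_def using J
      by (subst split_beta', intro sets.sets_Collect_finite_All) auto
  qed
  moreover have "\<exists>B\<in>\<B>. p \<in> B \<and> B \<subseteq> U" if U: "openin prohorov_topology U" and p: "p \<in> U" for U p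
  proof -
    have pM: "p \<in> ?M" using openin_subset[OF U] p by (auto simp: topspace_prohorov)
    obtain \<delta> where \<delta>: "0 < \<delta>" "m.mball p \<delta> \<subseteq> U"
      using U[unfolded prohorov_topology_def m.openin_mtopology, THEN conjunct2, rule_format, OF p] by auto
    obtain n where "inverse (real (Suc n)) < \<delta> / 2" using reals_Archimedean[of "\<delta> / 2"] \<delta>(1) by auto
    then have n: "2 * (1 / Suc n) < \<delta>" by (simp add: field_simps)
    define e where "e = 1 / real (Suc n)"
    have e: "0 < e" "2 * e < \<delta>" using n by (simp_all add: e_def)
    have "\<exists>d\<in>D. dist d x < e" for x
      using D(2)[of "ball x e"] e by (auto simp: dist_commute)
    from finite_balls_cover[OF pM D(1) this e(1)]
    obtain F0 where F0: "finite F0" "F0 \<subseteq> D" "1 - e < measure p (\<Union>d\<in>F0. ball d e)" by blast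
    define U where "U F = (\<Union>d\<in>F. ball d e)" for F :: "'s set"
    have Ub: "U F \<in> sets borel" for F unfolding U_def by (intro borel_open open_UN) auto
    have "\<exists>r\<in>\<rat>. measure p (U F) - e < r \<and> r < measure p (U F)" for F
      using Rats_dense_in_real[of "measure p (U F) - e" "measure p (U F)"] e by auto
    then obtain r where r: "\<And>F. r F \<in> \<rat>" "\<And>F. measure p (U F) - e < r F" "\<And>F. r F < measure p (U F)"
      by metis
    define J where "J = (\<lambda>F. (F, r F)) ` Pow F0"
    have "J \<in> \<J>" unfolding \<J>_def J_def using F0 r(1) by (auto intro: finite_subset)
    then have "basic_set n J \<in> \<B>" by (auto simp: \<B>_def)
    moreover have "p \<in> basic_set n J"
      using r(3) pM by (auto simp: basic_set_def J_def U_def e_def)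
    moreover have "q \<in> m.mball p \<delta>" if q: "q \<in> basic_set n J" for q
    proof -
      have qM: "q \<in> ?M" using q by (simp add: basic_set_def)
      have qr: "r F < measure q (U F)" if "F \<subseteq> F0" for F
        using q that by (auto simp: basic_set_def J_def U_def e_def)
      interpret p: prob_space p using pM by (simp add: space_prob_algebra)
      interpret q: prob_space q using qM by (simp add: space_prob_algebra)
      have s: "sets p = sets borel" "sets q = sets borel" using pM qM by (simp_all add: space_prob_algebra)
      have sp: "space p = UNIV" using s(1)[THEN sets_eq_imp_space_eq] by simp
      have "prohorov p q \<le> 2 * e"
      proof (rule prohorov_le[OF pM qM])
        fix A :: "'s set" assume A: "A \<in> sets borel"
        \<comment> \<open>The balls that meet \<open>A\<close> cover \<open>A\<close> up to mass \<open>e\<close> and stay in its \<open>2 e\<close>-neighbourhood.\<close>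
        define F where "F = {d \<in> F0. ball d e \<inter> A \<noteq> {}}"
        have F: "F \<subseteq> F0" by (auto simp: F_def)
        have "measure p A \<le> measure p (U F \<union> (UNIV - U F0))"
        proof (rule p.finite_measure_mono)
          show "A \<subseteq> U F \<union> (UNIV - U F0)" by (auto simp: U_def F_def)
          show "U F \<union> (UNIV - U F0) \<in> sets p" using Ub s by auto
        qed
        also have "\<dots> \<le> measure p (U F) + measure p (UNIV - U F0)"
          using Ub s by (intro measure_Un_le) auto
        also have "measure p (UNIV - U F0) = 1 - measure p (U F0)"
          using p.prob_compl[of "U F0"] Ub s sp by simp
        also have "\<dots> < e" using F0(3) by (simp add: U_def)
        finally have "measure p A \<le> measure p (U F) + e" by simp
        also have "\<dots> \<le> measure q (U F) + 2 * e" using r(2)[of F] qr[OF F] by simp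
        also have "measure q (U F) \<le> measure q (\<Union>a\<in>A. ball a (2 * e))"
        proof (rule q.finite_measure_mono)
          show "U F \<subseteq> (\<Union>a\<in>A. ball a (2 * e))"
          proof
            fix x assume "x \<in> U F"
            then obtain d a where "dist d x < e" "a \<in> A" "dist d a < e" by (auto simp: U_def F_def)
            then have "dist a x < 2 * e" using dist_triangle[of a x d] by (simp add: dist_commute)
            then show "x \<in> (\<Union>a\<in>A. ball a (2 * e))" using \<open>a \<in> A\<close> by auto
          qed
          show "(\<Union>a\<in>A. ball a (2 * e)) \<in> sets q" unfolding s by (intro borel_open open_UN) auto
        qed
        finally show "measure p A \<le> measure q (\<Union>a\<in>A. ball a (2 * e)) + 2 * e" by simp
      qed (use e in auto)
      then show ?thesis using pM qM e by (simp add: m.in_mball)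
    qed
    ultimately show ?thesis using \<delta>(2) by blast
  qed
  ultimately show ?thesis using that by blast
qed

lemma M1_power_basic_sets:
  obtains \<C> :: "(nat \<Rightarrow> 's::{metric_space, second_countable_topology} measure) set set"
  where "countable \<C>" "\<C> \<subseteq> sets (\<Pi>\<^sub>M m\<in>{1..M}. prob_algebra borel)"
    "\<And>U p. openin (M1_power M) U \<Longrightarrow> p \<in> U \<Longrightarrow> \<exists>C\<in>\<C>. p \<in> C \<and> C \<subseteq> U"
proof -
  obtain \<B> :: "'s measure set set" where B: "countable \<B>" "\<B> \<subseteq> sets (prob_algebra borel)"
    "\<And>U p. openin prohorov_topology U \<Longrightarrow> p \<in> U \<Longrightarrow> \<exists>B\<in>\<B>. p \<in> B \<and> B \<subseteq> U"
    using prohorov_basic_sets by blast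
  define \<C> where "\<C> = (\<lambda>B. \<Pi>\<^sub>E m\<in>{1..M}. B m) ` ({1..M} \<rightarrow>\<^sub>E \<B>)"
  have "countable \<C>" unfolding \<C>_def by (intro countable_image countable_PiE B) auto
  moreover have "\<C> \<subseteq> sets (\<Pi>\<^sub>M m\<in>{1..M}. prob_algebra borel)"
    unfolding \<C>_def using B(2) by (auto intro!: sets_PiM_I_finite)
  moreover have "\<exists>C\<in>\<C>. p \<in> C \<and> C \<subseteq> U" if U: "openin (M1_power M) U" and p: "p \<in> U" for U p
  proof -
    obtain W where W: "\<And>i. i \<in> {1..M} \<Longrightarrow> openin prohorov_topology (W i)" "p \<in> Pi\<^sub>E {1..M} W" "Pi\<^sub>E {1..M} W \<subseteq> U"
    proof -
      from U[unfolded openin_product_topology_alt, rule_format, OF p]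
      obtain W where "\<forall>i\<in>{1..M}. openin prohorov_topology (W i)" "p \<in> Pi\<^sub>E {1..M} W" "Pi\<^sub>E {1..M} W \<subseteq> U"
        by (elim exE conjE)
      then show ?thesis by (intro that[of W]) blast+
    qed
    have "\<exists>B\<in>\<B>. p i \<in> B \<and> B \<subseteq> W i" if "i \<in> {1..M}" for i
      using B(3)[OF W(1)[OF that], of "p i"] W(2) that by (auto simp: PiE_iff)
    then obtain b where b: "\<And>i. i \<in> {1..M} \<Longrightarrow> b i \<in> \<B> \<and> p i \<in> b i \<and> b i \<subseteq> W i" by metis
    have "(\<Pi>\<^sub>E m\<in>{1..M}. b m) \<in> \<C>"
      unfolding \<C>_def by (intro image_eqI[of _ _ "restrict b {1..M}"]) (use b in \<open>auto intro!: PiE_cong\<close>)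
    moreover have "p \<in> (\<Pi>\<^sub>E m\<in>{1..M}. b m)" using b W(2) by (auto simp: PiE_iff)
    moreover have "(\<Pi>\<^sub>E m\<in>{1..M}. b m) \<subseteq> U"
      by (rule order_trans[OF PiE_mono W(3)]) (use b in blast)
    ultimately show ?thesis by blast
  qed
  ultimately show ?thesis using that by blast
qed

lemma topspace_M1_power: "topspace (M1_power M) = space (\<Pi>\<^sub>M m\<in>{1..M}. prob_algebra borel)"
  by (simp add: topspace_prohorov space_PiM)

lemma sets_borel_of: "sets (borel_of X) = sigma_sets (topspace X) {U. openin X U}"
  and space_borel_of: "space (borel_of X) = topspace X"
  unfolding borel_of_def using openin_subset[of X]
  by (auto simp: space_measure_of_conv intro!: sets_measure_of)

text \<open>
  The Borel sets of the Prohorov topology are thus measurable for the \<open>\<sigma>\<close>-algebra generated by the evaluations.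
\<close>
lemma openin_M1_power_measurable:
  fixes U :: "(nat \<Rightarrow> 's::{metric_space, second_countable_topology} measure) set"
  assumes U: "openin (M1_power M) U"
  shows "U \<in> sets (\<Pi>\<^sub>M m\<in>{1..M}. prob_algebra borel)"
proof -
  obtain \<C> :: "(nat \<Rightarrow> 's measure) set set" where C: "countable \<C>" "\<C> \<subseteq> sets (\<Pi>\<^sub>M m\<in>{1..M}. prob_algebra borel)"
    "\<And>U p. openin (M1_power M) U \<Longrightarrow> p \<in> U \<Longrightarrow> \<exists>C\<in>\<C>. p \<in> C \<and> C \<subseteq> U"
    using M1_power_basic_sets by blast
  have "U = \<Union>{C\<in>\<C>. C \<subseteq> U}" using C(3)[OF U] by blast
  moreover have "\<dots> \<in> sets (\<Pi>\<^sub>M m\<in>{1..M}. prob_algebra borel)"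
    using C(1,2) by (intro sets.countable_Union) (auto intro: countable_subset)
  ultimately show ?thesis by simp
qed

lemma borel_of_M1_power_subset:
  "sets (borel_of (M1_power M)) \<subseteq> sets (\<Pi>\<^sub>M m\<in>{1..M}. prob_algebra (borel :: 's::{metric_space, second_countable_topology} measure))"
  unfolding sets_borel_of topspace_M1_power
  using openin_M1_power_measurable by (intro sets.sigma_sets_subset) blast

section \<open>Weighted averages and the portmanteau argument\<close>

definition weighted_average :: "(nat \<Rightarrow> real) \<Rightarrow> (nat \<Rightarrow> real) \<Rightarrow> nat \<Rightarrow> real" where
  "weighted_average V f K = (\<Sum>k=1..K. V k * f k) / (\<Sum>k=1..K. V k)"

lemma weighted_average_mono:
  assumes "\<And>k. k \<ge> 1 \<Longrightarrow> 0 \<le> V k" "\<And>k. k \<ge> 1 \<Longrightarrow> f k \<le> g k"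
  shows "weighted_average V f K \<le> weighted_average V g K"
  unfolding weighted_average_def using assms
  by (intro divide_right_mono sum_mono mult_left_mono sum_nonneg) auto

lemma weighted_average_uminus: "weighted_average V (\<lambda>k. - f k) K = - weighted_average V f K"
  by (simp add: weighted_average_def sum_negf)

lemma weighted_average_affine:
  assumes "(\<Sum>k=1..K. V k) \<noteq> 0"
  shows "weighted_average V (\<lambda>k. c * f k + b) K = c * weighted_average V f K + b"
proof -
  have "(\<Sum>k=1..K. V k * (c * f k + b)) = c * (\<Sum>k=1..K. V k * f k) + b * (\<Sum>k=1..K. V k)"
    by (simp add: algebra_simps sum.distrib sum_distrib_left)
  then show ?thesis using assms by (simp add: weighted_average_def add_divide_distrib)
qed

lemma weighted_average_sum: "weighted_average V (\<lambda>k. \<Sum>i\<in>I. f i k) K = (\<Sum>i\<in>I. weighted_average V (f i) K)"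
  unfolding weighted_average_def sum_divide_distrib[symmetric] sum_distrib_left by (subst sum.swap) simp

lemma card_levels:
  assumes "0 \<le> x" "x \<le> real n"
  shows "real (card {i\<in>{1..n}. real i < x}) \<le> x" "x \<le> real (card {i\<in>{1..n}. real i < x}) + 1"
proof -
  define c where "c = nat (\<lceil>x\<rceil> - 1)"
  have "{i\<in>{1..n}. real i < x} = {1..c}"
    using assms unfolding c_def by (auto simp: less_ceiling_iff nat_le_iff) linarith+
  then have card: "card {i\<in>{1..n}. real i < x} = c" by simp
  show "real (card {i\<in>{1..n}. real i < x}) \<le> x" "x \<le> real (card {i\<in>{1..n}. real i < x}) + 1"
    unfolding card c_def using assms by linarith+
qed

text \<open>
  A discrete layer-cake formula: up to \<open>1 / n\<close>, a number in the unit interval is the proportion of the levels \<open>i / n\<close>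
  that lie below it.
\<close>
lemma level_sum_bounds:
  assumes "0 \<le> g" "g \<le> 1" "0 < n"
  shows "(\<Sum>i=1..n. of_bool (real i / real n < g)) / real n \<le> g"
    and "g \<le> (\<Sum>i=1..n. of_bool (real i / real n < g)) / real n + 1 / real n"
proof -
  have "(\<Sum>i=1..n. of_bool (real i / real n < g) :: real) = real (card {i\<in>{1..n}. real i < real n * g})"
    using assms by (simp add: divide_less_eq mult.commute Int_def flip: sum.inter_filter)
  moreover have "0 \<le> real n * g" "real n * g \<le> real n" using assms by (auto intro: mult_left_le)
  ultimately show "(\<Sum>i=1..n. of_bool (real i / real n < g)) / real n \<le> g"
    "g \<le> (\<Sum>i=1..n. of_bool (real i / real n < g)) / real n + 1 / real n"
    using card_levels[of "real n * g" n] assms(3) by (auto simp: field_simps)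
qed

text \<open>
  A weighted sequence of points whose weighted frequencies converge to those of \<open>Q\<close> on finite unions of members of a
  countable family \<open>\<C>\<close> of measurable sets from which every open set is assembled.
\<close>
locale weighted_points =
  fixes X :: "'a topology" and Q :: "'a measure" and \<C> :: "'a set set"
    and V :: "nat \<Rightarrow> real" and z :: "nat \<Rightarrow> 'a"
  assumes prob: "prob_space Q" and space_Q: "space Q = topspace X"
    and countable_C: "countable \<C>" and sets_C: "\<C> \<subseteq> sets Q"
    and basis: "\<And>U p. openin X U \<Longrightarrow> p \<in> U \<Longrightarrow> \<exists>C\<in>\<C>. p \<in> C \<and> C \<subseteq> U"
    and V_nonneg: "\<And>k. k \<ge> 1 \<Longrightarrow> 0 \<le> V k" and z_space: "\<And>k. k \<ge> 1 \<Longrightarrow> z k \<in> topspace X"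
    and V_pos: "\<forall>\<^sub>F K in sequentially. 0 < (\<Sum>k=1..K. V k)"
    and converges: "\<And>J. finite J \<Longrightarrow> J \<subseteq> \<C> \<Longrightarrow>
      (\<lambda>K. weighted_average V (\<lambda>k. indicator (\<Union>J) (z k)) K) \<longlonglongrightarrow> measure Q (\<Union>J)"
begin

sublocale prob_space Q by (rule prob)

text \<open>
  An open set is a countable union of members of \<open>\<C>\<close>; a finite part of that union already carries almost all of its mass,
  and there the frequencies converge.
\<close>
lemma open_lower_bound:
  assumes U: "openin X U" and \<delta>: "0 < \<delta>"
  shows "\<forall>\<^sub>F K in sequentially. prob U - \<delta> < weighted_average V (\<lambda>k. indicator U (z k)) K"
proof -
  define \<D> where "\<D> = {C\<in>\<C>. C \<subseteq> U}"
  have U_eq: "U = \<Union>\<D>" using basis[OF U] by (auto simp: \<D>_def)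
  have D: "countable \<D>" "\<D> \<subseteq> sets Q" using countable_C sets_C by (auto simp: \<D>_def intro: countable_subset)
  have "\<exists>J. finite J \<and> J \<subseteq> \<D> \<and> prob U - \<delta> < prob (\<Union>J)"
  proof (cases "\<D> = {}")
    case True
    then show ?thesis using U_eq \<delta> by (intro exI[of _ "{}"]) auto
  next
    case False
    define W where "W n = \<Union>(from_nat_into \<D> ` {..n})" for n
    have in_D: "from_nat_into \<D> i \<in> \<D>" for i by (rule from_nat_into[OF False])
    have "(\<Union>n. W n) = U"
    proof
      show "(\<Union>n. W n) \<subseteq> U" using in_D unfolding W_def U_eq by blast
      show "U \<subseteq> (\<Union>n. W n)"
      proof
        fix p assume "p \<in> U"
        then obtain C where "C \<in> \<D>" "p \<in> C" unfolding U_eq by blast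
        then obtain i where "from_nat_into \<D> i = C" using from_nat_into_surj[OF D(1)] by blast
        then have "p \<in> W i" using \<open>p \<in> C\<close> by (auto simp: W_def)
        then show "p \<in> (\<Union>n. W n)" by blast
      qed
    qed
    moreover have "incseq W" unfolding W_def by (intro incseq_SucI Union_mono image_mono) auto
    moreover have "range W \<subseteq> sets Q" unfolding W_def using in_D D(2) by auto
    ultimately have "(\<lambda>n. prob (W n)) \<longlonglongrightarrow> prob U" using finite_Lim_measure_incseq[of W] by simp
    then have "\<forall>\<^sub>F n in sequentially. prob U - \<delta> < prob (W n)" using \<delta> by (intro order_tendstoD) auto
    then obtain n where "prob U - \<delta> < prob (W n)" by (auto simp: eventually_sequentially)
    then show ?thesis using in_D unfolding W_def by (intro exI[of _ "from_nat_into \<D> ` {..n}"]) auto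
  qed
  then obtain J where J: "finite J" "J \<subseteq> \<D>" "prob U - \<delta> < prob (\<Union>J)" by blast
  have "J \<subseteq> \<C>" "\<Union>J \<subseteq> U" using J(2) by (auto simp: \<D>_def)
  have "\<forall>\<^sub>F K in sequentially. prob U - \<delta> < weighted_average V (\<lambda>k. indicator (\<Union>J) (z k)) K"
    using converges[OF J(1) \<open>J \<subseteq> \<C>\<close>] J(3) by (rule order_tendstoD)
  then show ?thesis
  proof eventually_elim
    case (elim K)
    also have "weighted_average V (\<lambda>k. indicator (\<Union>J) (z k)) K \<le> weighted_average V (\<lambda>k. indicator U (z k)) K"
      using \<open>\<Union>J \<subseteq> U\<close> by (intro weighted_average_mono V_nonneg) (auto simp: indicator_def)
    finally show ?case .
  qed
qed

text \<open>
  The layer-cake formula reduces the claim to the sets \<open>{p. a < g p}\<close>, and these to their interiors, which carry the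
  same mass. For continuous \<open>g\<close> the hypothesis \<open>int\<close> is immediate; it is stated in this form so that functions
  continuous almost everywhere are covered as well.
\<close>
lemma unit_lower_bound:
  assumes g [measurable]: "g \<in> borel_measurable Q" and g01: "\<And>p. p \<in> topspace X \<Longrightarrow> 0 \<le> g p \<and> g p \<le> 1"
    and int: "\<And>a. prob {p\<in>space Q. a < g p} \<le> prob (X interior_of {p\<in>topspace X. a < g p})"
    and \<delta>: "0 < \<delta>"
  shows "\<forall>\<^sub>F K in sequentially. (\<integral>p. g p \<partial>Q) - \<delta> < weighted_average V (\<lambda>k. g (z k)) K"
proof -
  obtain n0 where "inverse (real (Suc n0)) < \<delta> / 2" using reals_Archimedean[of "\<delta> / 2"] \<delta> by auto
  define n where "n = Suc n0"
  have n: "0 < n" "1 / real n < \<delta> / 2" using \<open>inverse _ < _\<close> by (simp_all add: n_def inverse_eq_divide)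
  define S where "S i = {p\<in>topspace X. real i / real n < g p}" for i
  have S [measurable]: "S i \<in> sets Q" for i unfolding S_def space_Q[symmetric] by measurable
  have "\<forall>\<^sub>F K in sequentially. \<forall>i\<in>{1..n}. prob (S i) - \<delta> / 2 < weighted_average V (\<lambda>k. indicator (S i) (z k)) K"
  proof (intro eventually_ball_finite ballI)
    fix i
    have "\<forall>\<^sub>F K in sequentially. prob (X interior_of S i) - \<delta> / 2 < weighted_average V (\<lambda>k. indicator (X interior_of S i) (z k)) K"
      using \<delta> by (intro open_lower_bound openin_interior_of) auto
    then show "\<forall>\<^sub>F K in sequentially. prob (S i) - \<delta> / 2 < weighted_average V (\<lambda>k. indicator (S i) (z k)) K"
    proof eventually_elim
      case (elim K)
      have "prob (S i) \<le> prob (X interior_of S i)" using int unfolding S_def space_Q by simp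
      moreover have "weighted_average V (\<lambda>k. indicator (X interior_of S i) (z k)) K \<le> weighted_average V (\<lambda>k. indicator (S i) (z k)) K"
        using interior_of_subset[of X "S i"] by (intro weighted_average_mono V_nonneg) (auto simp: indicator_def)
      ultimately show ?case using elim by linarith
    qed
  qed simp
  then show ?thesis
  proof eventually_elim
    case (elim K)
    have lev: "(\<Sum>i=1..n. indicator (S i) p) / real n \<le> g p" "g p \<le> (\<Sum>i=1..n. indicator (S i) p) / real n + 1 / real n"
      if "p \<in> topspace X" for p
      using level_sum_bounds[of "g p" n] g01[OF that] n(1) that by (auto simp: S_def indicator_def of_bool_def)
    have iS: "integrable Q (indicat_real (S i))" for i
      by (rule integrable_real_indicator) (auto simp: emeasure_eq_measure)
    have "(\<integral>p. g p \<partial>Q) \<le> (\<integral>p. (\<Sum>i=1..n. indicator (S i) p) / real n + 1 / real n \<partial>Q)"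
    proof (rule integral_mono)
      show "integrable Q g"
        by (rule integrable_const_bound[where B=1]) (use g01 space_Q in auto)
      show "integrable Q (\<lambda>p. (\<Sum>i=1..n. indicat_real (S i) p) / real n + 1 / real n)"
        using iS by (intro Bochner_Integration.integrable_add integrable_divide_zero Bochner_Integration.integrable_sum integrable_const)
    qed (use lev space_Q in auto)
    also have "\<dots> = (\<Sum>i=1..n. prob (S i)) / real n + 1 / real n"
      using iS by (simp add: prob_space)
    also have "(\<Sum>i=1..n. prob (S i)) \<le> (\<Sum>i=1..n. weighted_average V (\<lambda>k. indicator (S i) (z k)) K + \<delta> / 2)"
    proof (rule sum_mono)
      fix i assume "i \<in> {1..n}"
      with elim have "prob (S i) - \<delta> / 2 < weighted_average V (\<lambda>k. indicator (S i) (z k)) K" by blast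
      then show "prob (S i) \<le> weighted_average V (\<lambda>k. indicator (S i) (z k)) K + \<delta> / 2" by linarith
    qed
    also have "\<dots> = (\<Sum>i=1..n. weighted_average V (\<lambda>k. indicator (S i) (z k)) K) + real n * (\<delta> / 2)"
      by (simp add: sum.distrib)
    also have "(\<Sum>i=1..n. weighted_average V (\<lambda>k. indicator (S i) (z k)) K)
        = weighted_average V (\<lambda>k. \<Sum>i=1..n. indicator (S i) (z k)) K"
      by (rule weighted_average_sum[symmetric])
    finally have 1: "(\<integral>p. g p \<partial>Q) \<le> weighted_average V (\<lambda>k. \<Sum>i=1..n. indicator (S i) (z k)) K / real n + \<delta> / 2 + 1 / real n"
      using n(1) by (simp add: add_divide_distrib divide_right_mono)
    have "weighted_average V (\<lambda>k. \<Sum>i=1..n. indicator (S i) (z k)) K / real n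
        = weighted_average V (\<lambda>k. (\<Sum>i=1..n. indicator (S i) (z k)) / real n) K"
      by (simp add: weighted_average_def sum_divide_distrib[symmetric] mult.commute)
    also have "\<dots> \<le> weighted_average V (\<lambda>k. g (z k)) K"
      using lev(1) z_space by (intro weighted_average_mono V_nonneg) auto
    finally show ?case using 1 n(2) by linarith
  qed
qed

text \<open>
  An affine change of scale maps the range of \<open>h\<close> into the unit interval.
\<close>
lemma bounded_lower_bound:
  assumes h [measurable]: "h \<in> borel_measurable Q" and C: "\<And>p. p \<in> topspace X \<Longrightarrow> \<bar>h p\<bar> \<le> C"
    and int: "\<And>a. prob {p\<in>space Q. a < h p} \<le> prob (X interior_of {p\<in>topspace X. a < h p})"
    and \<delta>: "0 < \<delta>"
  shows "\<forall>\<^sub>F K in sequentially. (\<integral>p. h p \<partial>Q) - \<delta> < weighted_average V (\<lambda>k. h (z k)) K"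
proof -
  define c where "c = 2 * (\<bar>C\<bar> + 1)"
  have c: "0 < c" by (simp add: c_def)
  define g where "g p = 1 / c * h p + 1 / 2" for p
  have "integrable Q h"
    by (rule integrable_const_bound[where B=C]) (use C space_Q in auto)
  then have ig: "(\<integral>p. g p \<partial>Q) = 1 / c * (\<integral>p. h p \<partial>Q) + 1 / 2" by (simp add: g_def prob_space)
  have "\<forall>\<^sub>F K in sequentially. (\<integral>p. g p \<partial>Q) - \<delta> / c < weighted_average V (\<lambda>k. g (z k)) K"
  proof (rule unit_lower_bound)
    show "g \<in> borel_measurable Q" unfolding g_def by measurable
    show "0 \<le> g p \<and> g p \<le> 1" if "p \<in> topspace X" for p
      using C[OF that] c by (auto simp: g_def c_def field_simps)
    have "a < g p \<longleftrightarrow> (a - 1 / 2) * c < h p" for a p using c by (simp add: g_def field_simps)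
    then show "prob {p\<in>space Q. a < g p} \<le> prob (X interior_of {p\<in>topspace X. a < g p})" for a
      using int[of "(a - 1 / 2) * c"] by simp
    show "0 < \<delta> / c" using \<delta> c by simp
  qed
  with V_pos show ?thesis
  proof eventually_elim
    case (elim K)
    then have "weighted_average V (\<lambda>k. g (z k)) K = 1 / c * weighted_average V (\<lambda>k. h (z k)) K + 1 / 2"
      unfolding g_def by (intro weighted_average_affine) simp
    with elim(2) ig have "1 / c * (\<integral>p. h p \<partial>Q) - \<delta> / c < 1 / c * weighted_average V (\<lambda>k. h (z k)) K" by simp
    then have "((\<integral>p. h p \<partial>Q) - \<delta>) / c < weighted_average V (\<lambda>k. h (z k)) K / c" by (simp add: diff_divide_distrib)
    then show ?case using c by (simp add: divide_less_cancel)
  qed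
qed

text \<open>The lower bounds for \<open>h\<close> and \<open>- h\<close> together are convergence.\<close>
theorem weighted_average_tendsto:
  assumes h [measurable]: "h \<in> borel_measurable Q" and C: "\<And>p. p \<in> topspace X \<Longrightarrow> \<bar>h p\<bar> \<le> C"
    and upper: "\<And>a. prob {p\<in>space Q. a < h p} \<le> prob (X interior_of {p\<in>topspace X. a < h p})"
    and lower: "\<And>a. prob {p\<in>space Q. h p < a} \<le> prob (X interior_of {p\<in>topspace X. h p < a})"
  shows "(\<lambda>K. weighted_average V (\<lambda>k. h (z k)) K) \<longlonglongrightarrow> (\<integral>p. h p \<partial>Q)"
proof (rule tendstoI)
  fix \<delta> :: real assume \<delta>: "0 < \<delta>"
  have 1: "\<forall>\<^sub>F K in sequentially. (\<integral>p. h p \<partial>Q) - \<delta> < weighted_average V (\<lambda>k. h (z k)) K"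
    by (rule bounded_lower_bound[OF h C upper \<delta>])
  have "\<forall>\<^sub>F K in sequentially. (\<integral>p. - h p \<partial>Q) - \<delta> < weighted_average V (\<lambda>k. - h (z k)) K"
  proof (rule bounded_lower_bound)
    show "prob {p\<in>space Q. a < - h p} \<le> prob (X interior_of {p\<in>topspace X. a < - h p})" for a
      using lower[of "- a"] by (simp add: less_minus_iff)
  qed (use C \<delta> in auto)
  with 1 show "\<forall>\<^sub>F K in sequentially. dist (weighted_average V (\<lambda>k. h (z k)) K) (\<integral>p. h p \<partial>Q) < \<delta>"
    by eventually_elim (simp add: weighted_average_uminus dist_real_def abs_less_iff)
qed

end

section \<open>A strong law for bounded variables\<close>

text \<open>
  By Hoeffding's inequality, deviations of the mean by \<open>e\<close> have geometrically decaying probabilities, so the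
  Borel--Cantelli lemma leaves only finitely many of them.
\<close>
theorem (in prob_space) bounded_strong_law:
  fixes X :: "nat \<Rightarrow> 'a \<Rightarrow> real"
  assumes indep: "indep_vars (\<lambda>_. borel) X {1..}"
    and bounds: "\<And>k \<omega>. k \<ge> 1 \<Longrightarrow> \<omega> \<in> space M \<Longrightarrow> 0 \<le> X k \<omega> \<and> X k \<omega> \<le> 1"
    and mean: "\<And>k. k \<ge> 1 \<Longrightarrow> expectation (X k) = m"
  shows "AE \<omega> in M. (\<lambda>K. (\<Sum>k=1..K. X k \<omega>) / K) \<longlonglongrightarrow> m"
proof -
  have X [measurable]: "X k \<in> borel_measurable M" if "k \<ge> 1" for k
    using indep that unfolding indep_vars_def by auto
  define S where "S K \<omega> = (\<Sum>k=1..K. X k \<omega>)" for K :: nat and \<omega>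
  have S [measurable]: "S K \<in> borel_measurable M" for K unfolding S_def by (intro borel_measurable_sum X) auto
  define A where "A e K = {\<omega>\<in>space M. K > 0 \<and> \<bar>S K \<omega> - real K * m\<bar> \<ge> e * real K}" for e :: real and K :: nat
  have A [measurable]: "A e K \<in> sets M" for e K unfolding A_def by measurable
  have le: "prob (A e K) \<le> 2 * exp (- 2 * e\<^sup>2) ^ K" if e: "0 < e" for e K
  proof (cases "K = 0")
    case True
    then show ?thesis by (simp add: A_def)
  next
    case False
    have ind: "indep_vars (\<lambda>_. borel) X {1..K}" by (rule indep_vars_subset[OF indep]) auto
    interpret H: Hoeffding_ineq M "{1..K}" X "\<lambda>_. 0" "\<lambda>_. 1" "real K * m"
    proof unfold_locales
      show "indep_vars (\<lambda>_. borel) X {1..K}" by (rule ind)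
      show "AE x in M. X i x \<in> {0..1}" if "i \<in> {1..K}" for i
        using bounds that by (intro AE_I2) auto
      have "(\<Sum>i\<in>{1..K}. expectation (X i)) = real K * m" using mean by simp
      then show "real K * m \<equiv> \<Sum>i\<in>{1..K}. expectation (X i)" by simp
    qed auto
    have "prob {x\<in>space M. \<bar>(\<Sum>i\<in>{1..K}. X i x) - real K * m\<bar> \<ge> e * real K}
        \<le> 2 * exp (- 2 * (e * real K)\<^sup>2 / (\<Sum>i\<in>{1..K}. (1 - 0)\<^sup>2))"
      using e False by (intro H.Hoeffding_ineq_abs_ge) auto
    also have "- 2 * (e * real K)\<^sup>2 / (\<Sum>i\<in>{1..K}. (1 - 0)\<^sup>2) = real K * (- 2 * e\<^sup>2)"
      using False by (simp add: power2_eq_square)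
    finally show ?thesis unfolding A_def S_def exp_of_nat_mult using False by simp
  qed
  have "AE \<omega> in M. \<forall>j. \<forall>\<^sub>F K in sequentially. \<omega> \<in> space M - A (inverse (real (Suc j))) K"
  proof (subst AE_all_countable, intro allI borel_cantelli_AE1)
    fix j
    define e where "e = inverse (real (Suc j))"
    have e: "0 < e" by (simp add: e_def)
    then have "norm (exp (- 2 * e\<^sup>2)) < 1" by simp
    then have "summable (\<lambda>K. 2 * exp (- 2 * e\<^sup>2) ^ K)" by (intro summable_mult summable_geometric)
    then have "summable (\<lambda>K. prob (A e K))"
      by (rule summable_comparison_test'[where N=0]) (use le[OF e] in \<open>simp add: measure_nonneg\<close>)
    then show "summable (\<lambda>K. prob (A (inverse (real (Suc j))) K))" by (simp add: e_def)
  qed (auto simp: emeasure_eq_measure)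
  then show ?thesis
  proof eventually_elim
    case (elim \<omega>)
    show "(\<lambda>K. (\<Sum>k=1..K. X k \<omega>) / K) \<longlonglongrightarrow> m"
    proof (rule tendstoI)
      fix e :: real assume "0 < e"
      then obtain j where j: "inverse (real (Suc j)) < e" using reals_Archimedean by blast
      have "\<forall>\<^sub>F K in sequentially. \<omega> \<in> space M - A (inverse (real (Suc j))) K" using elim by blast
      then show "\<forall>\<^sub>F K in sequentially. dist ((\<Sum>k=1..K. X k \<omega>) / real K) m < e"
        using eventually_gt_at_top[of 0]
      proof eventually_elim
        case (elim K)
        then have "\<bar>S K \<omega> - real K * m\<bar> < inverse (real (Suc j)) * real K" by (auto simp: A_def)
        moreover have "dist (S K \<omega> / real K) m = \<bar>S K \<omega> - real K * m\<bar> / real K"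
        proof -
          have "S K \<omega> / real K - m = (S K \<omega> - real K * m) / real K" using elim by (simp add: field_simps)
          then show ?thesis by (simp add: dist_real_def)
        qed
        ultimately have "dist (S K \<omega> / real K) m < inverse (real (Suc j))" using elim by (simp add: divide_less_eq)
        then show ?case using j by (simp add: S_def)
      qed
    qed
  qed
qed

section \<open>Conditional laws and independent rows\<close>

lemma subalgebra_vimage:
  assumes "Z \<in> M \<rightarrow>\<^sub>M L"
  shows "subalgebra M (vimage_algebra (space M) Z L)"
  unfolding subalgebra_def using assms
  by (auto simp: sets_vimage_algebra2 measurable_space[OF assms] intro: measurable_sets)

text \<open>
  For the indicator of a rectangle this is the defining property of the conditional expectation, integrated
  over an event of the conditioning \<open>\<sigma>\<close>-algebra; rectangles determine the joint law.
\<close>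
theorem cond_law_nn_integral:
  assumes M: "prob_space M" and law: "has_cond_law M X L Z L' K"
    and F: "F \<in> borel_measurable (L' \<Otimes>\<^sub>M L)"
  shows "(\<integral>\<^sup>+\<omega>. F (Z \<omega>, X \<omega>) \<partial>M) = (\<integral>\<^sup>+\<omega>. \<integral>\<^sup>+x. F (Z \<omega>, x) \<partial>K \<omega> \<partial>M)"
proof -
  interpret prob_space M by fact
  let ?S = "vimage_algebra (space M) Z L'"
  have X: "X \<in> M \<rightarrow>\<^sub>M L" and Z: "Z \<in> M \<rightarrow>\<^sub>M L'" and K': "K \<in> ?S \<rightarrow>\<^sub>M prob_algebra L"
    and cond: "\<And>B. B \<in> sets L \<Longrightarrow> AE \<omega> in M. real_cond_exp M ?S (indicat_real (X -` B \<inter> space M)) \<omega> = measure (K \<omega>) B"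
    using law unfolding has_cond_law_def by auto
  have sub: "subalgebra M ?S" by (rule subalgebra_vimage[OF Z])
  interpret S: finite_measure_subalgebra M ?S by unfold_locales (rule sub)
  have K: "K \<in> M \<rightarrow>\<^sub>M prob_algebra L" by (rule measurable_from_subalg[OF sub K'])
  have Kp: "prob_space (K \<omega>)" "sets (K \<omega>) = sets L" if "\<omega> \<in> space M" for \<omega>
    using measurable_space[OF K that] by (auto simp: space_prob_algebra)
  define P1 where "P1 = distr M (L' \<Otimes>\<^sub>M L) (\<lambda>\<omega>. (Z \<omega>, X \<omega>))"
  define P2 where "P2 = distr (joint_law M L K) (L' \<Otimes>\<^sub>M L) (\<lambda>p. (Z (fst p), snd p))"
  have m1: "(\<lambda>\<omega>. (Z \<omega>, X \<omega>)) \<in> M \<rightarrow>\<^sub>M L' \<Otimes>\<^sub>M L" using X Z by simp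
  have m2': "(\<lambda>p. (Z (fst p), snd p)) \<in> M \<Otimes>\<^sub>M L \<rightarrow>\<^sub>M L' \<Otimes>\<^sub>M L"
    by (intro measurable_Pair measurable_compose[OF measurable_fst Z] measurable_snd)
  have m2: "(\<lambda>p. (Z (fst p), snd p)) \<in> joint_law M L K \<rightarrow>\<^sub>M L' \<Otimes>\<^sub>M L"
    using m2' measurable_cong_sets[OF sets_joint_law[OF M K] refl] by blast
  have i1: "(\<integral>\<^sup>+p. f p \<partial>P1) = (\<integral>\<^sup>+\<omega>. f (Z \<omega>, X \<omega>) \<partial>M)" if "f \<in> borel_measurable (L' \<Otimes>\<^sub>M L)" for f
    unfolding P1_def by (rule nn_integral_distr[OF m1]) (simp add: that)
  have i2: "(\<integral>\<^sup>+p. f p \<partial>P2) = (\<integral>\<^sup>+\<omega>. \<integral>\<^sup>+x. f (Z \<omega>, x) \<partial>K \<omega> \<partial>M)" if f: "f \<in> borel_measurable (L' \<Otimes>\<^sub>M L)" for f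
  proof -
    have "(\<integral>\<^sup>+p. f p \<partial>P2) = (\<integral>\<^sup>+p. f (Z (fst p), snd p) \<partial>joint_law M L K)"
      unfolding P2_def by (rule nn_integral_distr[OF m2]) (simp add: f)
    also have "\<dots> = (\<integral>\<^sup>+\<omega>. \<integral>\<^sup>+x. f (Z (fst (\<omega>, x)), snd (\<omega>, x)) \<partial>K \<omega> \<partial>M)"
      by (rule nn_integral_joint_law[OF M K measurable_compose[OF m2' f]])
    finally show ?thesis by simp
  qed
  have "P1 = P2"
  proof (rule measure_eqI_rectangles[where M=L' and N=L and G="sets L"])
    show "prob_space P1" unfolding P1_def by (rule prob_space_distr[OF m1])
    show "prob_space P2" unfolding P2_def by (rule prob_space.prob_space_distr[OF prob_space_joint_law[OF M K] m2])
    show "sets L = sigma_sets (space L) (sets L)" by (rule sets.sigma_sets_eq[symmetric])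
    fix C B assume C: "C \<in> sets L'" and B: "B \<in> sets L"
    have CB: "indicator (C \<times> B) \<in> borel_measurable (L' \<Otimes>\<^sub>M L)" using C B by (intro borel_measurable_indicator pair_measureI)
    define E where "E = X -` B \<inter> space M"
    define G where "G = Z -` C \<inter> space M"
    have E: "E \<in> sets M" unfolding E_def by (rule measurable_sets[OF X B])
    have G: "G \<in> sets ?S" unfolding G_def using C by (rule in_vimage_algebra)
    have GM: "G \<in> sets M" unfolding G_def by (rule measurable_sets[OF Z C])
    have mK: "(\<lambda>\<omega>. measure (K \<omega>) B) \<in> borel_measurable M"
      by (rule measurable_compose[OF K measurable_measure_prob_algebra[OF B]])
    have "(\<integral>\<omega>\<in>G. indicat_real E \<omega> \<partial>M) = (\<integral>\<omega>\<in>G. real_cond_exp M ?S (indicat_real E) \<omega> \<partial>M)"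
      using E by (intro S.real_cond_exp_intA G integrable_real_indicator) (auto simp: emeasure_eq_measure)
    also have "\<dots> = (\<integral>\<omega>\<in>G. measure (K \<omega>) B \<partial>M)"
      unfolding set_lebesgue_integral_def
      using cond[OF B] mK GM by (intro integral_cong_AE) (auto simp: E_def elim: eventually_mono)
    finally have eq: "measure M (G \<inter> E) = (\<integral>\<omega>. indicat_real G \<omega> * measure (K \<omega>) B \<partial>M)"
      using E GM by (simp add: set_lebesgue_integral_def indicator_inter_arith[symmetric])
    have "emeasure P1 (C \<times> B) = (\<integral>\<^sup>+p. indicator (C \<times> B) p \<partial>P1)" using C B by (simp add: P1_def)
    also have "\<dots> = (\<integral>\<^sup>+\<omega>. indicator (G \<inter> E) \<omega> \<partial>M)"
      unfolding i1[OF CB] by (intro nn_integral_cong) (auto simp: G_def E_def indicator_def)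
    also have "\<dots> = ennreal (measure M (G \<inter> E))" using E GM by (simp add: emeasure_eq_measure)
    also have "\<dots> = (\<integral>\<^sup>+\<omega>. ennreal (indicat_real G \<omega> * measure (K \<omega>) B) \<partial>M)"
      unfolding eq
    proof (rule nn_integral_eq_integral[symmetric])
      show "integrable M (\<lambda>\<omega>. indicat_real G \<omega> * measure (K \<omega>) B)"
        using mK GM Kp by (intro integrable_const_bound[where B=1])
          (auto simp: indicator_def intro!: prob_space.prob_le_1)
    qed auto
    also have "\<dots> = (\<integral>\<^sup>+\<omega>. \<integral>\<^sup>+x. indicator (C \<times> B) (Z \<omega>, x) \<partial>K \<omega> \<partial>M)"
    proof (rule nn_integral_cong)
      fix \<omega> assume w: "\<omega> \<in> space M"
      interpret Kw: prob_space "K \<omega>" by (rule Kp(1)[OF w])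
      have "(\<integral>\<^sup>+x. indicator (C \<times> B) (Z \<omega>, x) \<partial>K \<omega>) = (\<integral>\<^sup>+x. indicator G \<omega> * indicator B x \<partial>K \<omega>)"
        using w by (intro nn_integral_cong) (auto simp: indicator_def G_def)
      also have "\<dots> = indicator G \<omega> * emeasure (K \<omega>) B"
        using B Kp(2)[OF w] by (intro nn_integral_cmult_indicator) simp
      finally show "ennreal (indicat_real G \<omega> * measure (K \<omega>) B) = (\<integral>\<^sup>+x. indicator (C \<times> B) (Z \<omega>, x) \<partial>K \<omega>)"
        by (simp add: Kw.emeasure_eq_measure indicator_def)
    qed
    also have "\<dots> = emeasure P2 (C \<times> B)" unfolding i2[OF CB, symmetric] using C B by (simp add: P2_def)
    finally show "emeasure P1 (C \<times> B) = emeasure P2 (C \<times> B)" .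
  qed (auto simp: P1_def P2_def Int_stable_def dest!: sets.sets_into_space)
  then show ?thesis using i1[OF F] i2[OF F] by simp
qed

text \<open>
  In a product measure on an array, the rows are independent, as they depend on disjoint sets of coordinates.
\<close>
lemma emeasure_independent_rows:
  fixes p :: "nat \<Rightarrow> 'b measure" and M N :: nat
  assumes p: "\<And>i. i \<in> I \<Longrightarrow> p i \<in> space (prob_algebra L)"
    and sub: "{1..M} \<subseteq> I" "{1..N} \<subseteq> J"
    and A: "\<And>m. m \<in> {1..M} \<Longrightarrow> A m \<in> sets (\<Pi>\<^sub>M j\<in>{1..N}. L)"
  shows "emeasure (\<Pi>\<^sub>M (i, j)\<in>I \<times> J. p i) {x \<in> space (\<Pi>\<^sub>M ij\<in>I \<times> J. L). \<forall>m\<in>{1..M}. (\<lambda>j\<in>{1..N}. x (m, j)) \<in> A m}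
    = (\<Prod>m\<in>{1..M}. emeasure (\<Pi>\<^sub>M j\<in>{1..N}. p m) (A m))"
proof (cases "M = 0")
  case True
  have pp: "prob_space (case ij of (i, j) \<Rightarrow> p i)" "sets (case ij of (i, j) \<Rightarrow> p i) = sets L" if "ij \<in> I \<times> J" for ij
    using p that by (auto simp: space_prob_algebra)
  interpret prob_space "\<Pi>\<^sub>M (i, j)\<in>I \<times> J. p i" by (rule prob_space_PiM) (use pp in auto)
  have "sets (\<Pi>\<^sub>M (i, j)\<in>I \<times> J. p i) = sets (\<Pi>\<^sub>M ij\<in>I \<times> J. L)" by (rule sets_PiM_cong[OF refl pp(2)])
  from sets_eq_imp_space_eq[OF this] show ?thesis using True emeasure_space_1 by simp
next
  case False
  let ?P = "\<Pi>\<^sub>M (i, j)\<in>I \<times> J. p i"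
  let ?p = "\<lambda>ij. case ij of (i, j) \<Rightarrow> p i"
  have pp: "prob_space (?p ij)" "sets (?p ij) = sets L" if "ij \<in> I \<times> J" for ij
    using p that by (auto simp: space_prob_algebra)
  interpret prob_space ?P by (rule prob_space_PiM) (use pp in auto)
  have sP: "sets ?P = sets (\<Pi>\<^sub>M ij\<in>I \<times> J. L)" by (rule sets_PiM_cong[OF refl pp(2)])
  have spP: "space ?P = space (\<Pi>\<^sub>M ij\<in>I \<times> J. L)" by (rule sets_eq_imp_space_eq[OF sP])
  have row: "sets (\<Pi>\<^sub>M j\<in>{1..N}. p m) = sets (\<Pi>\<^sub>M j\<in>{1..N}. L)" if "m \<in> {1..M}" for m
    using p[of m] that sub(1) by (intro sets_PiM_cong) (auto simp: space_prob_algebra)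
  define R where "R m x = (\<lambda>j\<in>{1..N}. x (m, j))" for m and x :: "nat \<times> nat \<Rightarrow> 'b"
  have distr_R: "distr ?P (\<Pi>\<^sub>M j\<in>{1..N}. p m) (R m) = (\<Pi>\<^sub>M j\<in>{1..N}. p m)" if m: "m \<in> {1..M}" for m
  proof -
    have "distr (Pi\<^sub>M (I \<times> J) ?p) (\<Pi>\<^sub>M j\<in>{1..N}. ?p (m, j)) (\<lambda>\<omega>. \<lambda>n\<in>{1..N}. \<omega> (m, n)) = (\<Pi>\<^sub>M j\<in>{1..N}. ?p (m, j))"
      using sub m by (intro distr_PiM_reindex pp(1)) (auto simp: inj_on_def)
    then show ?thesis by (simp add: R_def[abs_def])
  qed
  have R: "R m \<in> ?P \<rightarrow>\<^sub>M (\<Pi>\<^sub>M j\<in>{1..N}. L)" if m: "m \<in> {1..M}" for m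
  proof -
    have "R m \<in> (\<Pi>\<^sub>M ij\<in>I \<times> J. L) \<rightarrow>\<^sub>M (\<Pi>\<^sub>M j\<in>{1..N}. L)"
      unfolding R_def using sub m by (intro measurable_restrict measurable_component_singleton) auto
    then show ?thesis using measurable_cong_sets[OF sP refl] by blast
  qed
  have coord: "(\<lambda>x. x ij) \<in> ?P \<rightarrow>\<^sub>M ?p ij" if "ij \<in> I \<times> J" for ij
    by (rule measurable_component_singleton[OF that])
  have "I \<times> J \<noteq> {} \<Longrightarrow> indep_vars ?p (\<lambda>ij x. x ij) (I \<times> J)"
  proof (subst indep_vars_iff_distr_eq_PiM')
    have "distr ?P ?P (\<lambda>x. \<lambda>ij\<in>I \<times> J. x ij) = distr ?P ?P (\<lambda>x. x)"
      by (intro distr_cong refl) (auto simp: space_PiM PiE_restrict)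
    also have "\<dots> = ?P" by (simp add: distr_id2)
    also have "\<dots> = Pi\<^sub>M (I \<times> J) (\<lambda>ij. distr ?P (?p ij) (\<lambda>x. x ij))"
      by (intro PiM_cong refl distr_PiM_component[symmetric] pp(1))
    finally show "distr ?P ?P (\<lambda>x. \<lambda>ij\<in>I \<times> J. x ij) = Pi\<^sub>M (I \<times> J) (\<lambda>ij. distr ?P (?p ij) (\<lambda>x. x ij))" .
  qed (auto intro: coord)
  then have "indep_vars ?p (\<lambda>ij x. x ij) (I \<times> J)"
    by (cases "I = {} \<or> J = {}") (auto simp: indep_vars_def indep_sets_def)
  then have "indep_vars (\<lambda>m. Pi\<^sub>M ({m} \<times> {1..N}) ?p) (\<lambda>m x. restrict (\<lambda>ij. x ij) ({m} \<times> {1..N})) {1..M}"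
    using sub by (intro indep_vars_restrict) (auto simp: disjoint_family_on_def)
  then have "indep_vars (\<lambda>m. \<Pi>\<^sub>M j\<in>{1..N}. p m) (\<lambda>m x. (\<lambda>y. \<lambda>j\<in>{1..N}. y (m, j)) (restrict (\<lambda>ij. x ij) ({m} \<times> {1..N}))) {1..M}"
  proof (rule indep_vars_compose2)
    fix m
    have "(\<lambda>y. \<lambda>j\<in>{1..N}. y (m, j)) \<in> Pi\<^sub>M ({m} \<times> {1..N}) ?p \<rightarrow>\<^sub>M (\<Pi>\<^sub>M j\<in>{1..N}. ?p (m, j))"
      by (intro measurable_restrict measurable_component_singleton) auto
    then show "(\<lambda>y. \<lambda>j\<in>{1..N}. y (m, j)) \<in> Pi\<^sub>M ({m} \<times> {1..N}) ?p \<rightarrow>\<^sub>M (\<Pi>\<^sub>M j\<in>{1..N}. p m)" by simp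
  qed
  moreover have "(\<lambda>m x. (\<lambda>y. \<lambda>j\<in>{1..N}. y (m, j)) (restrict (\<lambda>ij. x ij) ({m} \<times> {1..N}))) = R"
    by (auto simp: R_def fun_eq_iff)
  ultimately have ind: "indep_vars (\<lambda>m. \<Pi>\<^sub>M j\<in>{1..N}. p m) R {1..M}" by simp
  have A': "A m \<in> sets (\<Pi>\<^sub>M j\<in>{1..N}. p m)" if "m \<in> {1..M}" for m using A[OF that] row[OF that] by simp
  have "{x \<in> space (\<Pi>\<^sub>M ij\<in>I \<times> J. L). \<forall>m\<in>{1..M}. (\<lambda>j\<in>{1..N}. x (m, j)) \<in> A m} = (\<Inter>m\<in>{1..M}. R m -` A m \<inter> space ?P)"
    using False by (auto simp: R_def spP)
  then have "emeasure ?P {x \<in> space (\<Pi>\<^sub>M ij\<in>I \<times> J. L). \<forall>m\<in>{1..M}. (\<lambda>j\<in>{1..N}. x (m, j)) \<in> A m} = ennreal (prob (\<Inter>m\<in>{1..M}. R m -` A m \<inter> space ?P))"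
    by (simp add: emeasure_eq_measure)
  also have "prob (\<Inter>m\<in>{1..M}. R m -` A m \<inter> space ?P) = (\<Prod>m\<in>{1..M}. prob (R m -` A m \<inter> space ?P))"
    by (rule indep_varsD_finite[OF ind]) (use False A' in auto)
  also have "ennreal \<dots> = (\<Prod>m\<in>{1..M}. emeasure ?P (R m -` A m \<inter> space ?P))"
    by (simp add: prod_ennreal[symmetric] emeasure_eq_measure)
  also have "\<dots> = (\<Prod>m\<in>{1..M}. emeasure (\<Pi>\<^sub>M j\<in>{1..N}. p m) (A m))"
  proof (rule prod.cong[OF refl])
    fix m assume m: "m \<in> {1..M}"
    have "R m \<in> ?P \<rightarrow>\<^sub>M (\<Pi>\<^sub>M j\<in>{1..N}. p m)"
      using R[OF m] measurable_cong_sets[OF refl row[OF m], of ?P] by blast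
    from emeasure_distr[OF this A'[OF m]] show "emeasure ?P (R m -` A m \<inter> space ?P) = emeasure (\<Pi>\<^sub>M j\<in>{1..N}. p m) (A m)"
      unfolding distr_R[OF m] by simp
  qed
  finally show ?thesis .
qed

section \<open>Hit-weighted steps of the urn\<close>

text \<open>
  Two Dirichlet processes occur: the inner one (prefix \<open>I\<close>) on \<open>S\<close> with parameter \<open>\<epsilon>\<rho>\<close>, whose law \<open>cluster_law\<close> governs a single
  random measure \<open>\<mu>\<^sub>i\<close>, and the outer one (prefix \<open>O\<close>) on \<open>M\<^sub>1\<close> with parameter \<open>\<kappa>\<close> times that law.
\<close>
locale nested_parameters =
  fixes \<kappa> \<epsilon> :: real and \<rho> :: "'s::polish_space measure"
  assumes \<kappa>: "0 < \<kappa>" and \<epsilon>: "0 < \<epsilon>" and \<rho>: "\<rho> \<in> space (prob_algebra borel)"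
begin

definition "atom_base = scale_measure (ennreal \<epsilon>) \<rho>"
definition "cluster_law = dirichlet_process atom_base"
definition "cluster_base = scale_measure (ennreal \<kappa>) cluster_law"

abbreviation M1 :: "'s measure measure" where "M1 \<equiv> prob_algebra borel"

lemma dirichlet_base_scale:
  fixes p :: "'z measure"
  assumes "prob_space p" "0 < c"
  shows "dirichlet_base (scale_measure (ennreal c) p)" "dirichlet_base.mass (scale_measure (ennreal c) p) = c"
proof -
  interpret prob_space p by fact
  have sp: "space (scale_measure (ennreal c) p) = space p" by (rule sets_eq_imp_space_eq) simp
  have e: "emeasure (scale_measure (ennreal c) p) (space p) = ennreal c" by (simp add: emeasure_space_1)
  have m: "measure (scale_measure (ennreal c) p) (space p) = c" using e assms(2) by (simp add: measure_def)
  show b: "dirichlet_base (scale_measure (ennreal c) p)"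
    by (rule dirichlet_base.intro) (use e m sp assms(2) in \<open>auto intro!: finite_measureI\<close>)
  then interpret b: dirichlet_base "scale_measure (ennreal c) p" .
  show "b.mass = c" using m sp by (simp add: b.mass_def)
qed

lemma prob_space_\<rho>: "prob_space \<rho>" and sets_\<rho>: "sets \<rho> = sets borel"
  using \<rho> by (auto simp: space_prob_algebra)

sublocale I: dirichlet_base atom_base
  unfolding atom_base_def by (rule dirichlet_base_scale(1)[OF prob_space_\<rho> \<epsilon>])

lemma sets_atom_base: "sets atom_base = sets borel" by (simp add: atom_base_def sets_\<rho>)

lemma prob_algebra_atom_base: "prob_algebra atom_base = M1" by (rule prob_algebra_cong[OF sets_atom_base])

lemma sets_cluster_law: "sets cluster_law = sets M1"
  unfolding cluster_law_def using I.sets_dirichlet_process by (simp add: prob_algebra_atom_base)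

lemma prob_space_cluster_law: "prob_space cluster_law"
  unfolding cluster_law_def by (rule I.prob_space_dirichlet_process)

sublocale O: dirichlet_base cluster_base
  unfolding cluster_base_def by (rule dirichlet_base_scale(1)[OF prob_space_cluster_law \<kappa>])

lemma mass_cluster_base: "O.mass = \<kappa>"
  unfolding cluster_base_def using dirichlet_base_scale(2)[OF prob_space_cluster_law \<kappa>] by auto

lemma sets_cluster_base: "sets cluster_base = sets M1" by (simp add: cluster_base_def sets_cluster_law)

lemma measurable_cluster_base: "(cluster_base \<rightarrow>\<^sub>M L) = (M1 \<rightarrow>\<^sub>M L)" for L :: "'z measure"
  by (rule measurable_cong_sets[OF sets_cluster_base refl])

lemma sets_PiM_cluster_base: "sets (\<Pi>\<^sub>M i\<in>I. cluster_base) = sets (\<Pi>\<^sub>M i\<in>I. M1)"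
  by (intro sets_PiM_cong refl sets_cluster_base)

lemma measurable_PiM_cluster_base: "((\<Pi>\<^sub>M i\<in>I. cluster_base) \<rightarrow>\<^sub>M L) = ((\<Pi>\<^sub>M i\<in>I. M1) \<rightarrow>\<^sub>M L)" for L :: "'z measure"
  by (rule measurable_cong_sets[OF sets_PiM_cluster_base refl])

text \<open>
  Draws from the outer process are the measures \<open>\<mu>\<^sub>1, \<dots>, \<mu>\<^sub>n\<close>; draws from the inner one are the entries of a row.
\<close>
abbreviation urn :: "nat \<Rightarrow> (nat \<Rightarrow> 's measure) measure" where "urn \<equiv> O.sample_law"

abbreviation sample :: "nat \<Rightarrow> (nat \<Rightarrow> 's) measure" where "sample \<equiv> I.sample_law"

lemma nn_integral_urn_Suc:
  assumes "G \<in> borel_measurable (\<Pi>\<^sub>M i\<in>{1..Suc n}. M1)"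
  shows "(\<integral>\<^sup>+x. G x \<partial>urn (Suc n))
    = (\<integral>\<^sup>+x. ennreal (1 / (\<kappa> + n)) * ((\<integral>\<^sup>+z. G (x(Suc n := z)) \<partial>cluster_base) + (\<Sum>i=1..n. G (x(Suc n := x i)))) \<partial>urn n)"
  using O.nn_integral_sample_law_Suc[of G n] assms unfolding measurable_PiM_cluster_base mass_cluster_base by blast

lemma nn_integral_urn_0: "f \<in> borel_measurable (\<Pi>\<^sub>M i\<in>{1..0}. M1) \<Longrightarrow> (\<integral>\<^sup>+x. f x \<partial>urn 0) = f (\<lambda>_. undefined)"
proof -
  assume f: "f \<in> borel_measurable (\<Pi>\<^sub>M i\<in>{1..0}. M1)"
  interpret D: prob_space "dirichlet_process cluster_base" by (rule O.prob_space_dirichlet_process)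
  have "(\<integral>\<^sup>+x. f x \<partial>urn 0) = (\<integral>\<^sup>+l. \<integral>\<^sup>+x. f x \<partial>(\<Pi>\<^sub>M i\<in>{1..0}. l) \<partial>dirichlet_process cluster_base)"
    using f unfolding measurable_PiM_cluster_base[symmetric] by (rule O.nn_integral_sample_law)
  then show ?thesis
    by (simp add: PiM_empty nn_integral_count_space_finite D.emeasure_space_1)
qed

lemma add_atoms_atom_base:
  fixes N :: nat
  shows
  "measure_plus (scale_measure (ennreal \<epsilon>) \<rho>) (measure_sum borel {1..N} (\<lambda>n. return borel (x n))) = add_atoms atom_base {1..N} x"
proof -
  have 1: "return borel y = return atom_base y" for y by (rule return_cong) (simp add: sets_atom_base)
  have 2: "measure_sum borel I R = measure_sum atom_base I R" for I :: "nat set" and R :: "nat \<Rightarrow> 's measure"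
    unfolding measure_sum_def by (simp add: sets_atom_base sets_eq_imp_space_eq[OF sets_atom_base])
  show ?thesis unfolding add_atoms_def atom_base_def[symmetric] 1 2 ..
qed

text \<open>The likelihood of \<open>u\<close> when a row of \<open>N\<close> entries drawn from it is observed to lie in \<open>A\<close>.\<close>
definition hit :: "nat \<Rightarrow> (nat \<Rightarrow> 's) set \<Rightarrow> 's measure \<Rightarrow> ennreal" where
  "hit N A u = emeasure (\<Pi>\<^sub>M j\<in>{1..N}. u) A"

lemma measurable_hit: "A \<in> sets (\<Pi>\<^sub>M j\<in>{1..N}. borel) \<Longrightarrow> hit N A \<in> borel_measurable M1"
  unfolding hit_def
  by (rule measurable_emeasure_kernel[OF measurable_prob_algebra_subprob[OF measurable_iid_kernel]])

lemma sets_PiM_atom_base: "sets (\<Pi>\<^sub>M i\<in>I. atom_base) = sets (\<Pi>\<^sub>M i\<in>I. borel)"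
  by (intro sets_PiM_cong refl sets_atom_base)

lemma sets_sample: "sets (sample N) = sets (\<Pi>\<^sub>M i\<in>{1..N}. borel)"
  using I.sets_sample_law sets_PiM_atom_base by simp

lemma prob_space_sample: "prob_space (sample N)"
  unfolding I.sample_law_def by (rule prob_space.prob_space_bind[OF I.prob_space_dirichlet_process])
    (auto intro!: AE_I2 I.iid_kernel_dirichlet[THEN measurable_prob_algebra_subprob] dest: measurable_space[OF I.iid_kernel_dirichlet] simp: space_prob_algebra)

lemma measurable_posterior_kernel:
  fixes N :: nat
  shows
  "(\<lambda>x. dirichlet_process (add_atoms atom_base {1..N} x)) \<in> (\<Pi>\<^sub>M i\<in>{1..N}. borel) \<rightarrow>\<^sub>M prob_algebra M1"
  using I.measurable_dirichlet_process_add_atoms[OF finite_atLeastAtMost, of 1 N] measurable_cong_sets[OF sets_PiM_atom_base refl]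
  unfolding prob_algebra_atom_base by blast

lemma prob_space_row:
  assumes "u \<in> space M1"
  shows "prob_space (\<Pi>\<^sub>M j\<in>I. u)" "sets (\<Pi>\<^sub>M j\<in>I. u) = sets (\<Pi>\<^sub>M j\<in>I. borel)"
  using measurable_space[OF measurable_iid_kernel assms, of I] by (auto simp: space_prob_algebra)

text \<open>
  To weight a fresh measure \<open>v\<close> by \<open>v\<^sup>N(A)\<close> is to draw a row from \<open>v\<close> and keep the event that it lies in \<open>A\<close>; the
  posterior formula then exchanges the order in which \<open>v\<close> and its row are drawn.
\<close>
lemma nn_integral_hit_cluster_base:
  assumes A: "A \<in> sets (\<Pi>\<^sub>M j\<in>{1..N}. borel)" and g: "g \<in> borel_measurable M1"
  shows "(\<integral>\<^sup>+v. g v * hit N A v \<partial>cluster_base)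
    = ennreal \<kappa> * (\<integral>\<^sup>+x. (\<integral>\<^sup>+v. g v \<partial>dirichlet_process (add_atoms atom_base {1..N} x)) * indicator A x \<partial>sample N)"
proof -
  have sD: "sets (dirichlet_process (add_atoms atom_base {1..N} x)) = sets M1" for x
    using dirichlet_base.sets_dirichlet_process[OF I.dirichlet_base_add_atoms, of "{1..N}" x] I.prob_algebra_add_atoms[of "{1..N}" x]
    by (simp add: prob_algebra_atom_base)
  have gm: "g \<in> borel_measurable cluster_law" using g measurable_cong_sets[OF sets_cluster_law refl] by blast
  have hm: "hit N A \<in> borel_measurable cluster_law"
    using measurable_hit[OF A] measurable_cong_sets[OF sets_cluster_law refl] by blast
  have "(\<integral>\<^sup>+v. g v * hit N A v \<partial>cluster_base) = ennreal \<kappa> * (\<integral>\<^sup>+v. g v * hit N A v \<partial>cluster_law)"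
    unfolding cluster_base_def using gm hm by (intro nn_integral_scale_measure) simp
  also have "(\<integral>\<^sup>+v. g v * hit N A v \<partial>cluster_law) = (\<integral>\<^sup>+v. \<integral>\<^sup>+x. (\<lambda>(x, v). g v * indicator A x) (x, v) \<partial>(\<Pi>\<^sub>M j\<in>{1..N}. v) \<partial>dirichlet_process atom_base)"
    unfolding cluster_law_def
  proof (rule nn_integral_cong)
    fix v assume "v \<in> space (dirichlet_process atom_base)"
    then have v: "v \<in> space M1" using sets_eq_imp_space_eq[OF sets_cluster_law] by (simp add: cluster_law_def)
    show "g v * hit N A v = (\<integral>\<^sup>+x. (\<lambda>(x, v). g v * indicator A x) (x, v) \<partial>(\<Pi>\<^sub>M j\<in>{1..N}. v))"
      using A prob_space_row(2)[OF v, of "{1..N}"] by (simp add: hit_def nn_integral_cmult_indicator)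
  qed
  also have "\<dots> = (\<integral>\<^sup>+x. \<integral>\<^sup>+v. (\<lambda>(x, v). g v * indicator A x) (x, v) \<partial>dirichlet_process (add_atoms atom_base {1..N} x) \<partial>sample N)"
  proof (rule I.dirichlet_process_posterior_sample)
    have "A \<in> sets (\<Pi>\<^sub>M i\<in>{1..N}. atom_base)" using A unfolding sets_PiM_atom_base .
    then have "(\<lambda>p. indicator A (fst p) :: ennreal) \<in> borel_measurable ((\<Pi>\<^sub>M i\<in>{1..N}. atom_base) \<Otimes>\<^sub>M prob_algebra atom_base)"
      by (intro measurable_compose[OF measurable_fst borel_measurable_indicator])
    moreover have "(\<lambda>p. g (snd p)) \<in> borel_measurable ((\<Pi>\<^sub>M i\<in>{1..N}. atom_base) \<Otimes>\<^sub>M prob_algebra atom_base)"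
      using g by (intro measurable_compose[OF measurable_snd]) (simp add: prob_algebra_atom_base)
    ultimately show "(\<lambda>(x, v). g v * indicator A x) \<in> borel_measurable ((\<Pi>\<^sub>M i\<in>{1..N}. atom_base) \<Otimes>\<^sub>M prob_algebra atom_base)"
      unfolding split_beta' by (intro borel_measurable_times_ennreal)
  qed
  also have "\<dots> = (\<integral>\<^sup>+x. (\<integral>\<^sup>+v. g v \<partial>dirichlet_process (add_atoms atom_base {1..N} x)) * indicator A x \<partial>sample N)"
  proof (rule nn_integral_cong)
    fix x
    have "g \<in> borel_measurable (dirichlet_process (add_atoms atom_base {1..N} x))"
      using g measurable_cong_sets[OF sD refl] by blast
    then show "(\<integral>\<^sup>+v. (\<lambda>(x, v). g v * indicator A x) (x, v) \<partial>dirichlet_process (add_atoms atom_base {1..N} x))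
      = (\<integral>\<^sup>+v. g v \<partial>dirichlet_process (add_atoms atom_base {1..N} x)) * indicator A x"
      by (simp add: nn_integral_multc)
  qed
  finally show ?thesis .
qed

text \<open>
  The right side is one urn step, up to its normalisation, with each candidate weighted by its hit probability. The simulation
  kernel is this measure divided by its total mass, so multiplying by the total weight restores it.
\<close>
lemma nn_integral_simulation_kernel:
  assumes A: "A \<in> sets (\<Pi>\<^sub>M j\<in>{1..N}. borel)" and g: "g \<in> borel_measurable M1"
    and m: "1 \<le> m" and u: "\<And>i. i \<in> {1..<m} \<Longrightarrow> u i \<in> space M1"
    and t: "\<And>i. i \<in> {1..<m} \<Longrightarrow> t i = measure (\<Pi>\<^sub>M j\<in>{1..N}. u i) A" "t m = \<kappa> * measure (sample N) A"
    and prob: "prob_space (simulation_kernel \<epsilon> \<rho> N (uniform_measure (sample N) A) m t u)"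
  shows "ennreal (\<Sum>i=1..m. t i) * (\<integral>\<^sup>+v. g v \<partial>simulation_kernel \<epsilon> \<rho> N (uniform_measure (sample N) A) m t u)
    = (\<integral>\<^sup>+v. g v * hit N A v \<partial>cluster_base) + (\<Sum>i\<in>{1..<m}. g (u i) * hit N A (u i))"
proof -
  let ?D = "\<lambda>x. dirichlet_process (add_atoms atom_base {1..N} x)"
  define \<nu> where "\<nu> = uniform_measure (sample N) A"
  have s\<nu>: "sets \<nu> = sets (\<Pi>\<^sub>M i\<in>{1..N}. borel)" by (simp add: \<nu>_def sets_sample)
  have K: "?D \<in> \<nu> \<rightarrow>\<^sub>M prob_algebra M1"
    using measurable_posterior_kernel[of N] measurable_cong_sets[OF s\<nu> refl] by blast
  have space_\<nu>: "space \<nu> \<noteq> {}"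
    using sets_eq_imp_space_eq[OF s\<nu>] by (simp add: space_PiM PiE_eq_empty_iff)
  have sD: "sets (?D x) = sets M1" if "x \<in> space \<nu>" for x
    using measurable_space[OF K that] by (simp add: space_prob_algebra)
  have sB: "sets (\<nu> \<bind> ?D) = sets M1" by (rule sets_bind[OF sD space_\<nu>])
  interpret sN: prob_space "sample N" by (rule prob_space_sample)
  have t_nonneg: "0 \<le> t i" if "i \<in> {1..m}" for i
    using t \<kappa> that by (cases "i = m") auto
  have kernel: "simulation_kernel \<epsilon> \<rho> N \<nu> m t u = scale_measure (ennreal (1 / (\<Sum>i=1..m. t i)))
      (measure_plus (scale_measure (ennreal (t m)) (\<nu> \<bind> ?D))
        (measure_sum M1 {1..<m} (\<lambda>i. scale_measure (ennreal (t i)) (return M1 (u i)))))"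
    unfolding simulation_kernel_def add_atoms_atom_base ..
  have gB: "g \<in> borel_measurable (\<nu> \<bind> ?D)" using g measurable_cong_sets[OF sB refl] by blast
  have gS: "g \<in> borel_measurable (measure_plus (scale_measure (ennreal (t m)) (\<nu> \<bind> ?D))
        (measure_sum M1 {1..<m} (\<lambda>i. scale_measure (ennreal (t i)) (return M1 (u i)))))"
  proof -
    have "sets (measure_plus (scale_measure (ennreal (t m)) (\<nu> \<bind> ?D))
        (measure_sum M1 {1..<m} (\<lambda>i. scale_measure (ennreal (t i)) (return M1 (u i))))) = sets M1"
      unfolding sets_measure_plus sets_scale_measure by (rule sB)
    from measurable_cong_sets[OF this refl] g show ?thesis by blast
  qed
  have int: "(\<integral>\<^sup>+v. g v \<partial>simulation_kernel \<epsilon> \<rho> N \<nu> m t u) = ennreal (1 / (\<Sum>i=1..m. t i)) *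
      (ennreal (t m) * (\<integral>\<^sup>+v. g v \<partial>(\<nu> \<bind> ?D)) + (\<Sum>i\<in>{1..<m}. ennreal (t i) * g (u i)))"
  proof -
    have "(\<integral>\<^sup>+v. g v \<partial>simulation_kernel \<epsilon> \<rho> N \<nu> m t u) = ennreal (1 / (\<Sum>i=1..m. t i)) *
      (\<integral>\<^sup>+v. g v \<partial>measure_plus (scale_measure (ennreal (t m)) (\<nu> \<bind> ?D))
        (measure_sum M1 {1..<m} (\<lambda>i. scale_measure (ennreal (t i)) (return M1 (u i)))))"
      unfolding kernel by (rule nn_integral_scale_measure[OF gS])
    also have "(\<integral>\<^sup>+v. g v \<partial>measure_plus (scale_measure (ennreal (t m)) (\<nu> \<bind> ?D))
        (measure_sum M1 {1..<m} (\<lambda>i. scale_measure (ennreal (t i)) (return M1 (u i)))))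
      = (\<integral>\<^sup>+v. g v \<partial>scale_measure (ennreal (t m)) (\<nu> \<bind> ?D))
        + (\<integral>\<^sup>+v. g v \<partial>measure_sum M1 {1..<m} (\<lambda>i. scale_measure (ennreal (t i)) (return M1 (u i))))"
    proof (rule nn_integral_measure_plus)
      show "sets (measure_sum M1 {1..<m} (\<lambda>i. scale_measure (ennreal (t i)) (return M1 (u i)))) = sets (scale_measure (ennreal (t m)) (\<nu> \<bind> ?D))"
        unfolding sets_measure_sum sets_scale_measure sB ..
      show "g \<in> borel_measurable (scale_measure (ennreal (t m)) (\<nu> \<bind> ?D))"
        using gB measurable_cong_sets[OF sets_scale_measure refl] by blast
    qed
    also have "(\<integral>\<^sup>+v. g v \<partial>measure_sum M1 {1..<m} (\<lambda>i. scale_measure (ennreal (t i)) (return M1 (u i))))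
      = (\<Sum>i\<in>{1..<m}. \<integral>\<^sup>+v. g v \<partial>scale_measure (ennreal (t i)) (return M1 (u i)))"
      using g by (intro nn_integral_measure_sum) simp_all
    also have "\<dots> = (\<Sum>i\<in>{1..<m}. ennreal (t i) * g (u i))"
      using g u by (intro sum.cong refl) (simp add: nn_integral_scale_measure nn_integral_return)
    also have "(\<integral>\<^sup>+v. g v \<partial>scale_measure (ennreal (t m)) (\<nu> \<bind> ?D)) = ennreal (t m) * (\<integral>\<^sup>+v. g v \<partial>(\<nu> \<bind> ?D))"
      by (rule nn_integral_scale_measure[OF gB])
    finally show ?thesis .
  qed
  have "(\<Sum>i=1..m. t i) \<noteq> 0"
  proof
    \<comment> \<open>Division by zero gives zero, so the kernel would be the zero measure.\<close>
    assume 0: "(\<Sum>i=1..m. t i) = 0"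
    interpret prob_space "simulation_kernel \<epsilon> \<rho> N \<nu> m t u" using prob by (simp add: \<nu>_def)
    have "emeasure (simulation_kernel \<epsilon> \<rho> N \<nu> m t u) X = 0" for X unfolding kernel 0 by simp
    then show False using emeasure_space_1 by simp
  qed
  moreover have "0 \<le> (\<Sum>i=1..m. t i)" by (intro sum_nonneg t_nonneg)
  ultimately have S: "ennreal (\<Sum>i=1..m. t i) * (ennreal (1 / (\<Sum>i=1..m. t i)) * X) = X" for X
    by (simp add: mult.assoc[symmetric] ennreal_mult'[symmetric])
  have gD: "(\<lambda>x. \<integral>\<^sup>+v. g v \<partial>?D x) \<in> borel_measurable (sample N)"
  proof -
    have "(\<lambda>(x, v). g v) \<in> borel_measurable ((\<Pi>\<^sub>M i\<in>{1..N}. borel) \<Otimes>\<^sub>M M1)"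
      using measurable_compose[OF measurable_snd g] by (simp add: split_beta')
    from borel_measurable_kernel_integral[OF this measurable_posterior_kernel[of N]]
    show ?thesis using measurable_cong_sets[OF sets_sample refl] by blast
  qed
  have "(\<integral>\<^sup>+v. g v \<partial>(\<nu> \<bind> ?D)) = (\<integral>\<^sup>+x. \<integral>\<^sup>+v. g v \<partial>?D x \<partial>\<nu>)"
    by (rule nn_integral_bind[OF g measurable_prob_algebra_subprob[OF K]])
  also have "\<dots> = (\<integral>\<^sup>+x. (\<integral>\<^sup>+v. g v \<partial>?D x) * indicator A x \<partial>sample N) / emeasure (sample N) A"
    unfolding \<nu>_def using A gD by (intro nn_integral_uniform_measure) (simp_all add: sets_sample)
  finally have B: "(\<integral>\<^sup>+v. g v \<partial>(\<nu> \<bind> ?D)) = \<dots>" .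
  have "ennreal (t m) * (\<integral>\<^sup>+v. g v \<partial>(\<nu> \<bind> ?D)) = (\<integral>\<^sup>+v. g v * hit N A v \<partial>cluster_base)"
  proof (cases "measure (sample N) A = 0")
    case True
    then have "A \<in> null_sets (sample N)" using A by (simp add: null_sets_def sets_sample sN.emeasure_eq_measure)
    then have "(\<integral>\<^sup>+x. (\<integral>\<^sup>+v. g v \<partial>?D x) * indicator A x \<partial>sample N) = 0"
      by (rule nn_integral_null_set)
    then show ?thesis using True by (simp add: nn_integral_hit_cluster_base[OF A g] t)
  next
    case False
    then have "ennreal (t m) * (X / emeasure (sample N) A) = ennreal \<kappa> * X" for X
    proof -
      have "0 < measure (sample N) A" using False by (simp add: zero_less_measure_iff)
      then have "X * ennreal (measure (sample N) A) / ennreal (measure (sample N) A) = X"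
        by (intro mult_divide_eq_ennreal) simp_all
      then show ?thesis
        using \<kappa> unfolding t sN.emeasure_eq_measure
        by (simp add: ennreal_mult mult.assoc ennreal_times_divide[symmetric]) (simp add: ennreal_times_divide mult.commute)
    qed
    then show ?thesis unfolding B nn_integral_hit_cluster_base[OF A g] .
  qed
  moreover have "ennreal (t i) * g (u i) = g (u i) * hit N A (u i)" if i: "i \<in> {1..<m}" for i
    using prob_space_row(1)[OF u[OF i], of "{1..N}"] t(1)[OF i]
    by (simp add: hit_def finite_measure.emeasure_eq_measure[OF prob_space.finite_measure] mult.commute)
  ultimately show ?thesis unfolding int[unfolded \<nu>_def] S by (simp add: \<nu>_def)
qed

end

lemma (in nested_parameters) measurable_hit_coordinate:
  assumes "i \<in> I" and A: "A \<in> sets (\<Pi>\<^sub>M j\<in>{1..N}. borel)"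
  shows "(\<lambda>x. hit N A (x i)) \<in> borel_measurable (\<Pi>\<^sub>M i\<in>I. M1)"
  by (rule measurable_compose[of "\<lambda>x. x i" _ M1, OF _ measurable_hit[OF A]])
    (rule measurable_component_singleton[OF assms(1)])

section \<open>The law of the nested Dirichlet process and its rows\<close>

locale nested_model = nested_parameters \<kappa> \<epsilon> \<rho> + prob_space \<Omega>
  for \<kappa> \<epsilon> and \<rho> :: "'s::polish_space measure" and \<Omega> :: "'w measure" +
  fixes \<pi> :: "'w \<Rightarrow> 's measure measure" and \<mu> :: "nat \<Rightarrow> 'w \<Rightarrow> 's measure" and \<xi> :: "nat \<Rightarrow> nat \<Rightarrow> 'w \<Rightarrow> 's"
  assumes nested: "nested_dirichlet_process \<Omega> \<kappa> \<epsilon> \<rho> \<pi> \<mu> \<xi>"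
begin

lemma \<pi>: "\<pi> \<in> \<Omega> \<rightarrow>\<^sub>M prob_algebra M1"
  and distr_\<pi>: "distr \<Omega> (prob_algebra M1) \<pi> = dirichlet_process cluster_base"
  and law_\<mu>: "has_cond_law \<Omega> (\<lambda>\<omega>. \<lambda>i\<in>{1..}. \<mu> i \<omega>) (\<Pi>\<^sub>M i\<in>{1..}. M1) \<pi> (prob_algebra M1) (\<lambda>\<omega>. \<Pi>\<^sub>M i\<in>{1..}. \<pi> \<omega>)"
  and law_\<xi>: "has_cond_law \<Omega> (\<lambda>\<omega>. \<lambda>(i, j)\<in>{1..} \<times> {1..}. \<xi> i j \<omega>) (\<Pi>\<^sub>M ij\<in>{1..} \<times> {1..}. borel)
       (\<lambda>\<omega>. (\<pi> \<omega>, \<lambda>i\<in>{1..}. \<mu> i \<omega>)) (prob_algebra M1 \<Otimes>\<^sub>M (\<Pi>\<^sub>M i\<in>{1..}. M1))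
       (\<lambda>\<omega>. \<Pi>\<^sub>M (i, j)\<in>{1..} \<times> {1..}. \<mu> i \<omega>)"
  using nested unfolding nested_dirichlet_process_def cluster_base_def cluster_law_def atom_base_def by auto

lemma measurable_\<mu>_all: "(\<lambda>\<omega>. \<lambda>i\<in>{1..}. \<mu> i \<omega>) \<in> \<Omega> \<rightarrow>\<^sub>M (\<Pi>\<^sub>M i\<in>{1..}. M1)"
  using law_\<mu> unfolding has_cond_law_def by blast

lemma measurable_restrict_initial:
  "(\<lambda>x. restrict x {1..n}) \<in> (\<Pi>\<^sub>M i\<in>{1..}. M1) \<rightarrow>\<^sub>M (\<Pi>\<^sub>M i\<in>{1..n::nat}. M1)"
  by (rule measurable_restrict_subset) auto

definition initial :: "nat \<Rightarrow> 'w \<Rightarrow> nat \<Rightarrow> 's measure" where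
  "initial n \<omega> = (\<lambda>m\<in>{1..n}. \<mu> m \<omega>)"

lemma initial_restrict: "initial n \<omega> = restrict (\<lambda>i\<in>{1..}. \<mu> i \<omega>) {1..n}"
  by (auto simp: initial_def fun_eq_iff)

lemma measurable_initial: "initial n \<in> \<Omega> \<rightarrow>\<^sub>M (\<Pi>\<^sub>M i\<in>{1..n}. M1)"
  unfolding initial_restrict[abs_def] by (rule measurable_compose[OF measurable_\<mu>_all measurable_restrict_initial])

lemma \<mu>_space: "\<omega> \<in> space \<Omega> \<Longrightarrow> i \<ge> 1 \<Longrightarrow> \<mu> i \<omega> \<in> space M1"
  using measurable_space[OF measurable_\<mu>_all, of \<omega>] by (auto simp: space_PiM PiE_iff)

text \<open>Given \<open>\<pi>\<close> the \<open>\<mu>\<^sub>i\<close> are independent draws from it, and \<open>\<pi>\<close> is a Dirichlet process: this is the urn.\<close>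
lemma nn_integral_initial:
  assumes G: "G \<in> borel_measurable (\<Pi>\<^sub>M i\<in>{1..n}. M1)"
  shows "(\<integral>\<^sup>+\<omega>. G (initial n \<omega>) \<partial>\<Omega>) = (\<integral>\<^sup>+x. G x \<partial>urn n)"
proof -
  have "(\<integral>\<^sup>+\<omega>. G (initial n \<omega>) \<partial>\<Omega>) = (\<integral>\<^sup>+\<omega>. (\<lambda>p. G (restrict (snd p) {1..n})) (\<pi> \<omega>, \<lambda>i\<in>{1..}. \<mu> i \<omega>) \<partial>\<Omega>)"
    by (simp add: initial_restrict)
  also have "\<dots> = (\<integral>\<^sup>+\<omega>. \<integral>\<^sup>+x. (\<lambda>p. G (restrict (snd p) {1..n})) (\<pi> \<omega>, x) \<partial>(\<Pi>\<^sub>M i\<in>{1..}. \<pi> \<omega>) \<partial>\<Omega>)"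
    by (rule cond_law_nn_integral[OF prob_space_axioms law_\<mu>])
      (rule measurable_compose[OF measurable_snd measurable_compose[OF measurable_restrict_initial G]])
  also have "\<dots> = (\<integral>\<^sup>+\<omega>. \<integral>\<^sup>+x. G x \<partial>(\<Pi>\<^sub>M i\<in>{1..n}. \<pi> \<omega>) \<partial>\<Omega>)"
  proof (rule nn_integral_cong)
    fix \<omega> assume "\<omega> \<in> space \<Omega>"
    then have "\<pi> \<omega> \<in> space (prob_algebra M1)" by (rule measurable_space[OF \<pi>])
    then have p: "prob_space (\<pi> \<omega>)" "sets (\<pi> \<omega>) = sets M1" by (auto simp: space_prob_algebra)
    interpret product_prob_space "\<lambda>_. \<pi> \<omega>" "{1::nat..}"
      using p(1) by (simp add: product_prob_space_def product_prob_space_axioms_def product_sigma_finite_def prob_space_imp_sigma_finite)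
    have d: "distr (\<Pi>\<^sub>M i\<in>{1..}. \<pi> \<omega>) (\<Pi>\<^sub>M i\<in>{1..n}. \<pi> \<omega>) (\<lambda>x. restrict x {1..n}) = (\<Pi>\<^sub>M i\<in>{1..n}. \<pi> \<omega>)"
      by (rule distr_PiM_restrict_finite) auto
    have G': "G \<in> borel_measurable (\<Pi>\<^sub>M i\<in>{1..n}. \<pi> \<omega>)"
      using G measurable_cong_sets[OF sets_PiM_cong[OF refl p(2)] refl] by blast
    have "(\<lambda>x. restrict x {1..n}) \<in> (\<Pi>\<^sub>M i\<in>{1..}. \<pi> \<omega>) \<rightarrow>\<^sub>M (\<Pi>\<^sub>M i\<in>{1..n}. \<pi> \<omega>)"
      by (rule measurable_restrict_subset) auto
    then have "(\<integral>\<^sup>+x. G x \<partial>distr (\<Pi>\<^sub>M i\<in>{1..}. \<pi> \<omega>) (\<Pi>\<^sub>M i\<in>{1..n}. \<pi> \<omega>) (\<lambda>x. restrict x {1..n}))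
      = (\<integral>\<^sup>+x. G (restrict x {1..n}) \<partial>(\<Pi>\<^sub>M i\<in>{1..}. \<pi> \<omega>))"
      by (rule nn_integral_distr) (subst measurable_distr_eq1, rule G')
    then show "(\<integral>\<^sup>+x. (\<lambda>p. G (restrict (snd p) {1..n})) (\<pi> \<omega>, x) \<partial>(\<Pi>\<^sub>M i\<in>{1..}. \<pi> \<omega>)) = (\<integral>\<^sup>+x. G x \<partial>(\<Pi>\<^sub>M i\<in>{1..n}. \<pi> \<omega>))"
      unfolding d by simp
  qed
  also have "\<dots> = (\<integral>\<^sup>+l. \<integral>\<^sup>+x. G x \<partial>(\<Pi>\<^sub>M i\<in>{1..n}. l) \<partial>distr \<Omega> (prob_algebra M1) \<pi>)"
  proof (rule nn_integral_distr[OF \<pi>, symmetric])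
    have "(\<lambda>(l, x). G x) \<in> borel_measurable (prob_algebra M1 \<Otimes>\<^sub>M (\<Pi>\<^sub>M i\<in>{1..n}. M1))"
      using measurable_compose[OF measurable_snd G] by (simp add: split_beta')
    from borel_measurable_kernel_integral[OF this measurable_iid_kernel]
    show "(\<lambda>l. \<integral>\<^sup>+x. G x \<partial>(\<Pi>\<^sub>M i\<in>{1..n}. l)) \<in> borel_measurable (distr \<Omega> (prob_algebra M1) \<pi>)" by simp
  qed
  also have "\<dots> = (\<integral>\<^sup>+x. G x \<partial>urn n)"
    unfolding distr_\<pi> using G unfolding measurable_PiM_cluster_base[symmetric]
    by (rule O.nn_integral_sample_law[symmetric])
  finally show ?thesis .
qed

lemma measurable_\<xi>: "(\<lambda>\<omega>. \<lambda>(i, j)\<in>{1..} \<times> {1..}. \<xi> i j \<omega>) \<in> \<Omega> \<rightarrow>\<^sub>M (\<Pi>\<^sub>M ij\<in>{1..} \<times> {1..}. borel)"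
  using law_\<xi> unfolding has_cond_law_def by blast

lemma row_coordinates: "1 \<le> m \<Longrightarrow> row \<xi> m N \<omega> = (\<lambda>j\<in>{1..N}. (\<lambda>(i, j)\<in>{1..} \<times> {1..}. \<xi> i j \<omega>) (m, j))"
  by (auto simp: row_def fun_eq_iff)

lemma measurable_row: "1 \<le> m \<Longrightarrow> row \<xi> m N \<in> \<Omega> \<rightarrow>\<^sub>M (\<Pi>\<^sub>M j\<in>{1..N}. borel)"
proof -
  assume m: "1 \<le> m"
  then have "row \<xi> m N = (\<lambda>\<omega>. \<lambda>j\<in>{1..N}. (\<lambda>(i, j)\<in>{1..} \<times> {1..}. \<xi> i j \<omega>) (m, j))"
    by (intro ext row_coordinates)
  moreover have "(\<lambda>\<omega>. \<lambda>j\<in>{1..N}. (\<lambda>(i, j)\<in>{1..} \<times> {1..}. \<xi> i j \<omega>) (m, j)) \<in> \<Omega> \<rightarrow>\<^sub>M (\<Pi>\<^sub>M j\<in>{1..N}. borel)"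
    by (intro measurable_restrict measurable_compose[OF measurable_\<xi>, of "\<lambda>x. x (m, j)" for j] measurable_component_singleton)
      (use m in auto)
  ultimately show ?thesis by simp
qed

text \<open>
  Given the \<open>\<mu>\<^sub>i\<close>, the rows are independent, and row \<open>m\<close> lies in \<open>A\<^sub>m\<close> with the hit probability of \<open>\<mu>\<^sub>m\<close>.
\<close>
lemma nn_integral_initial_rows:
  assumes f: "f \<in> borel_measurable (\<Pi>\<^sub>M i\<in>{1..M}. M1)"
    and A: "\<And>m. m \<in> {1..M} \<Longrightarrow> A m \<in> sets (\<Pi>\<^sub>M j\<in>{1..N}. borel)"
  shows "(\<integral>\<^sup>+\<omega>. f (initial M \<omega>) * indicator {\<omega>\<in>space \<Omega>. \<forall>m\<in>{1..M}. row \<xi> m N \<omega> \<in> A m} \<omega> \<partial>\<Omega>)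
    = (\<integral>\<^sup>+x. f x * (\<Prod>m\<in>{1..M}. hit N (A m) (x m)) \<partial>urn M)"
proof -
  let ?K = "{1..} \<times> {1..} :: (nat \<times> nat) set"
  define R where "R = {x \<in> space (\<Pi>\<^sub>M ij\<in>?K. (borel :: 's measure)). \<forall>m\<in>{1..M}. (\<lambda>j\<in>{1..N}. x (m, j)) \<in> A m}"
  have R: "R \<in> sets (\<Pi>\<^sub>M ij\<in>?K. borel)"
  proof -
    have "{x \<in> space (\<Pi>\<^sub>M ij\<in>?K. (borel :: 's measure)). (\<lambda>j\<in>{1..N}. x (m, j)) \<in> A m} \<in> sets (\<Pi>\<^sub>M ij\<in>?K. borel)"
      if m: "m \<in> {1..M}" for m
    proof -
      have "(\<lambda>x. \<lambda>j\<in>{1..N}. x (m, j)) \<in> (\<Pi>\<^sub>M ij\<in>?K. (borel :: 's measure)) \<rightarrow>\<^sub>M (\<Pi>\<^sub>M j\<in>{1..N}. borel)"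
        using m by (intro measurable_restrict measurable_component_singleton) auto
      from measurable_sets[OF this A[OF m]] show ?thesis by (simp add: vimage_def Int_def conj_commute)
    qed
    then show ?thesis unfolding R_def by (intro sets.sets_Collect_finite_All) auto
  qed
  define F where "F p = f (restrict (snd (fst p)) {1..M}) * indicator R (snd p)" for p :: "('s measure measure \<times> (nat \<Rightarrow> 's measure)) \<times> (nat \<times> nat \<Rightarrow> 's)"
  have F: "F \<in> borel_measurable ((prob_algebra M1 \<Otimes>\<^sub>M (\<Pi>\<^sub>M i\<in>{1..}. M1)) \<Otimes>\<^sub>M (\<Pi>\<^sub>M ij\<in>?K. borel))"
    unfolding F_def
    by (intro borel_measurable_times_ennreal measurable_compose[OF measurable_snd borel_measurable_indicator[OF R]]
        measurable_compose[OF measurable_compose[OF measurable_fst measurable_compose[OF measurable_snd measurable_restrict_initial]] f])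
  have "(\<integral>\<^sup>+\<omega>. f (initial M \<omega>) * indicator {\<omega>\<in>space \<Omega>. \<forall>m\<in>{1..M}. row \<xi> m N \<omega> \<in> A m} \<omega> \<partial>\<Omega>)
      = (\<integral>\<^sup>+\<omega>. F ((\<pi> \<omega>, \<lambda>i\<in>{1..}. \<mu> i \<omega>), \<lambda>(i, j)\<in>?K. \<xi> i j \<omega>) \<partial>\<Omega>)"
  proof (rule nn_integral_cong)
    fix \<omega> assume w: "\<omega> \<in> space \<Omega>"
    have "(\<lambda>(i, j)\<in>?K. \<xi> i j \<omega>) \<in> R \<longleftrightarrow> (\<forall>m\<in>{1..M}. row \<xi> m N \<omega> \<in> A m)"
      unfolding R_def using measurable_space[OF measurable_\<xi> w] by (auto simp: row_coordinates)
    then show "f (initial M \<omega>) * indicator {\<omega>\<in>space \<Omega>. \<forall>m\<in>{1..M}. row \<xi> m N \<omega> \<in> A m} \<omega>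
      = F ((\<pi> \<omega>, \<lambda>i\<in>{1..}. \<mu> i \<omega>), \<lambda>(i, j)\<in>?K. \<xi> i j \<omega>)"
      using w by (simp add: F_def initial_restrict indicator_def)
  qed
  also have "\<dots> = (\<integral>\<^sup>+\<omega>. \<integral>\<^sup>+x. F ((\<pi> \<omega>, \<lambda>i\<in>{1..}. \<mu> i \<omega>), x) \<partial>(\<Pi>\<^sub>M (i, j)\<in>?K. \<mu> i \<omega>) \<partial>\<Omega>)"
    by (rule cond_law_nn_integral[OF prob_space_axioms law_\<xi> F])
  also have "\<dots> = (\<integral>\<^sup>+\<omega>. (\<lambda>x. f x * (\<Prod>m\<in>{1..M}. hit N (A m) (x m))) (initial M \<omega>) \<partial>\<Omega>)"
  proof (rule nn_integral_cong)
    fix \<omega> assume w: "\<omega> \<in> space \<Omega>"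
    have s: "sets (\<Pi>\<^sub>M (i, j)\<in>?K. \<mu> i \<omega>) = sets (\<Pi>\<^sub>M ij\<in>?K. borel)"
      using \<mu>_space[OF w] by (intro sets_PiM_cong) (auto simp: space_prob_algebra)
    have "(\<integral>\<^sup>+x. F ((\<pi> \<omega>, \<lambda>i\<in>{1..}. \<mu> i \<omega>), x) \<partial>(\<Pi>\<^sub>M (i, j)\<in>?K. \<mu> i \<omega>))
        = f (initial M \<omega>) * emeasure (\<Pi>\<^sub>M (i, j)\<in>?K. \<mu> i \<omega>) R"
      unfolding F_def using R s by (simp add: initial_restrict nn_integral_cmult_indicator)
    also have "emeasure (\<Pi>\<^sub>M (i, j)\<in>?K. \<mu> i \<omega>) R = (\<Prod>m\<in>{1..M}. emeasure (\<Pi>\<^sub>M j\<in>{1..N}. \<mu> m \<omega>) (A m))"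
      unfolding R_def using \<mu>_space[OF w] by (intro emeasure_independent_rows A) auto
    also have "(\<Prod>m\<in>{1..M}. emeasure (\<Pi>\<^sub>M j\<in>{1..N}. \<mu> m \<omega>) (A m)) = (\<Prod>m\<in>{1..M}. hit N (A m) (initial M \<omega> m))"
      by (intro prod.cong) (auto simp: hit_def initial_def)
    finally show "(\<integral>\<^sup>+x. F ((\<pi> \<omega>, \<lambda>i\<in>{1..}. \<mu> i \<omega>), x) \<partial>(\<Pi>\<^sub>M (i, j)\<in>?K. \<mu> i \<omega>))
      = (\<lambda>x. f x * (\<Prod>m\<in>{1..M}. hit N (A m) (x m))) (initial M \<omega>)" .
  qed
  also have "\<dots> = (\<integral>\<^sup>+x. f x * (\<Prod>m\<in>{1..M}. hit N (A m) (x m)) \<partial>urn M)"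
    using f A by (intro nn_integral_initial borel_measurable_times_ennreal borel_measurable_prod_ennreal measurable_hit_coordinate) auto
  finally show ?thesis .
qed

text \<open>
  The first urn draw \<open>\<mu>\<^sub>1\<close> has law \<open>\<D>(\<epsilon>\<rho>)\<close>, so a row drawn from it is a sample from the inner Dirichlet process.
\<close>
lemma row_law_eq_sample: "row_law \<Omega> \<xi> N = sample N"
proof (rule measure_eqI)
  show "sets (row_law \<Omega> \<xi> N) = sets (sample N)" by (simp add: row_law_def sets_sample)
  fix A assume "A \<in> sets (row_law \<Omega> \<xi> N)"
  then have A: "A \<in> sets (\<Pi>\<^sub>M j\<in>{1..N}. borel)" by (simp add: row_law_def)
  have ev: "{\<omega>\<in>space \<Omega>. \<forall>m\<in>{1..1}. row \<xi> m N \<omega> \<in> A} = row \<xi> 1 N -` A \<inter> space \<Omega>" by auto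
  have evm: "row \<xi> 1 N -` A \<inter> space \<Omega> \<in> sets \<Omega>" by (rule measurable_sets[OF measurable_row A]) simp
  have "emeasure (row_law \<Omega> \<xi> N) A = emeasure \<Omega> (row \<xi> 1 N -` A \<inter> space \<Omega>)"
    unfolding row_law_def by (rule emeasure_distr[OF measurable_row A]) simp
  also have "\<dots> = (\<integral>\<^sup>+\<omega>. (\<lambda>_. 1) (initial 1 \<omega>) * indicator {\<omega>\<in>space \<Omega>. \<forall>m\<in>{1..1}. row \<xi> m N \<omega> \<in> A} \<omega> \<partial>\<Omega>)"
    unfolding ev using evm by simp
  also have "\<dots> = (\<integral>\<^sup>+x. (\<lambda>_. 1) x * (\<Prod>m\<in>{1..1}. hit N A (x m)) \<partial>urn 1)"
    using A by (intro nn_integral_initial_rows) auto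
  also have "\<dots> = (\<integral>\<^sup>+x. hit N A (x (Suc 0)) \<partial>urn (Suc 0))" by simp
  also have "\<dots> = (\<integral>\<^sup>+x. ennreal (1 / \<kappa>) * (\<integral>\<^sup>+z. hit N A z \<partial>cluster_base) \<partial>urn 0)"
  proof -
    have "(\<lambda>x. hit N A (x (Suc 0))) \<in> borel_measurable (\<Pi>\<^sub>M i\<in>{1..Suc 0}. M1)"
      by (rule measurable_hit_coordinate[OF _ A]) simp
    from nn_integral_urn_Suc[OF this] show ?thesis by simp
  qed
  also have "\<dots> = ennreal (1 / \<kappa>) * (\<integral>\<^sup>+z. hit N A z \<partial>cluster_base)"
    by (rule nn_integral_urn_0) simp
  also have "(\<integral>\<^sup>+z. hit N A z \<partial>cluster_base) = ennreal \<kappa> * (\<integral>\<^sup>+x. (\<integral>\<^sup>+v. 1 \<partial>dirichlet_process (add_atoms atom_base {1..N} x)) * indicator A x \<partial>sample N)"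
    using nn_integral_hit_cluster_base[OF A, of "\<lambda>_. 1"] by simp
  also have "(\<integral>\<^sup>+x. (\<integral>\<^sup>+v. 1 \<partial>dirichlet_process (add_atoms atom_base {1..N} x)) * indicator A x \<partial>sample N) = (\<integral>\<^sup>+x. indicator A x \<partial>sample N)"
  proof (rule nn_integral_cong)
    fix x
    interpret D: prob_space "dirichlet_process (add_atoms atom_base {1..N} x)"
      by (rule dirichlet_base.prob_space_dirichlet_process[OF I.dirichlet_base_add_atoms]) simp
    show "(\<integral>\<^sup>+v. 1 \<partial>dirichlet_process (add_atoms atom_base {1..N} x)) * indicator A x = (indicator A x :: ennreal)"
      using D.emeasure_space_1 by simp
  qed
  also have "\<dots> = emeasure (sample N) A" using A by (simp add: sets_sample)
  finally show "emeasure (row_law \<Omega> \<xi> N) A = emeasure (sample N) A"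
    using \<kappa> by (simp add: mult.assoc[symmetric] ennreal_mult'[symmetric])
qed

end

section \<open>The weighted simulation as a likelihood ratio\<close>

locale simulation = nested_model \<kappa> \<epsilon> \<rho> \<Omega> \<pi> \<mu> \<xi>
  for \<kappa> \<epsilon> and \<rho> :: "'s::polish_space measure" and \<Omega> :: "'w measure" and \<pi> \<mu> \<xi> +
  fixes A :: "nat \<Rightarrow> (nat \<Rightarrow> 's) set" and M N :: nat and Y :: "'w \<Rightarrow> nat \<Rightarrow> 't" and T :: "'t set"
    and t :: "nat \<Rightarrow> nat \<Rightarrow> 'w \<Rightarrow> real" and u :: "nat \<Rightarrow> 'w \<Rightarrow> 's measure"
  assumes A: "\<And>m. m \<in> {1..M} \<Longrightarrow> A m \<in> sets (\<Pi>\<^sub>M j\<in>{1..N}. borel)"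
    and sim: "weighted_simulation \<Omega> \<kappa> \<epsilon> \<rho> (sample N) A M N Y T t u"
begin

definition U :: "nat \<Rightarrow> 'w \<Rightarrow> nat \<Rightarrow> 's measure" where
  "U n \<omega> = (\<lambda>i\<in>{1..n}. u i \<omega>)"

text \<open>
  The sum \<open>\<Sum>\<^sub>i t\<^sub>m\<^sub>i\<close>, and below it the partial product of the total weight, as functions of the simulated measures alone: in this form they can be
  integrated against the urn.
\<close>
definition step_weight :: "nat \<Rightarrow> (nat \<Rightarrow> 's measure) \<Rightarrow> ennreal" where
  "step_weight m z = (\<Sum>i\<in>{1..<m}. hit N (A m) (z i)) + ennreal \<kappa> * emeasure (sample N) (A m)"

definition partial_weight :: "nat \<Rightarrow> (nat \<Rightarrow> 's measure) \<Rightarrow> ennreal" where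
  "partial_weight n z = (\<Prod>m\<in>{1..n}. ennreal (1 / (\<kappa> + real m - 1)) * step_weight m z)"

lemma weights:
  assumes "m \<in> {1..M}" "\<omega> \<in> space \<Omega>"
  shows "i \<in> {1..<m} \<Longrightarrow> t m i \<omega> = measure (\<Pi>\<^sub>M j\<in>{1..N}. u i \<omega>) (A m)"
    "t m m \<omega> = \<kappa> * measure (sample N) (A m)"
  using sim assms unfolding weighted_simulation_def by auto

lemma law_u:
  assumes "m \<in> {1..M}"
  shows "has_cond_law \<Omega> (u m) M1 (\<lambda>\<omega>. \<lambda>i\<in>{1..<m}. u i \<omega>) (\<Pi>\<^sub>M i\<in>{1..<m}. M1)
    (\<lambda>\<omega>. simulation_kernel \<epsilon> \<rho> N (uniform_measure (sample N) (A m)) m (\<lambda>i. t m i \<omega>) (\<lambda>i. u i \<omega>))"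
  using sim assms unfolding weighted_simulation_def by blast

lemma u_measurable: "m \<in> {1..M} \<Longrightarrow> u m \<in> \<Omega> \<rightarrow>\<^sub>M M1"
  using law_u unfolding has_cond_law_def by blast

lemma u_space: "m \<in> {1..M} \<Longrightarrow> \<omega> \<in> space \<Omega> \<Longrightarrow> u m \<omega> \<in> space M1"
  by (rule measurable_space[OF u_measurable])

lemma U_measurable: "n \<le> M \<Longrightarrow> U n \<in> \<Omega> \<rightarrow>\<^sub>M (\<Pi>\<^sub>M i\<in>{1..n}. M1)"
  unfolding U_def by (intro measurable_restrict u_measurable) auto

text \<open>
  Each \<open>t\<^sub>m\<^sub>i\<close> with \<open>i < m\<close> is a probability, and \<open>t\<^sub>m\<^sub>m \<le> \<kappa>\<close>. So all factors of the total weight lie in the unit interval,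
  and the strong law for bounded variables applies to it.
\<close>
lemma weight_bounds:
  assumes m: "m \<in> {1..M}" and w: "\<omega> \<in> space \<Omega>"
  shows "0 \<le> (\<Sum>i=1..m. t m i \<omega>)" "(\<Sum>i=1..m. t m i \<omega>) \<le> \<kappa> + real m - 1"
proof -
  interpret S: prob_space "sample N" by (rule prob_space_sample)
  have *: "(\<Sum>i=1..m. t m i \<omega>) = (\<Sum>i\<in>{1..<m}. t m i \<omega>) + t m m \<omega>"
    using m by (simp add: sum.last_plus atLeastLessThanSuc_atLeastAtMost[symmetric] sum.atLeastLessThan_Suc add.commute)
  have b: "0 \<le> t m i \<omega> \<and> t m i \<omega> \<le> 1" if i: "i \<in> {1..<m}" for i
    unfolding weights(1)[OF m w i] using u_space[of i \<omega>] w i m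
    by (auto intro!: prob_space.prob_le_1 prob_space_row)
  have "0 \<le> t m m \<omega>" "t m m \<omega> \<le> \<kappa>"
    unfolding weights(2)[OF m w] using \<kappa> by (auto intro: mult_left_le)
  moreover have "(\<Sum>i\<in>{1..<m}. t m i \<omega>) \<le> real (m - 1)"
    using sum_bounded_above[of "{1..<m}" "\<lambda>i. t m i \<omega>" 1] b by simp
  moreover have "0 \<le> (\<Sum>i\<in>{1..<m}. t m i \<omega>)" using b by (intro sum_nonneg) auto
  ultimately show "0 \<le> (\<Sum>i=1..m. t m i \<omega>)" "(\<Sum>i=1..m. t m i \<omega>) \<le> \<kappa> + real m - 1"
    using m unfolding * by (auto simp: of_nat_diff)
qed

lemma total_weight_bounds:
  assumes w: "\<omega> \<in> space \<Omega>"
  shows "0 \<le> total_weight \<kappa> M t \<omega>" "total_weight \<kappa> M t \<omega> \<le> 1"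
proof -
  have *: "0 \<le> 1 / (\<kappa> + real m - 1) * (\<Sum>i=1..m. t m i \<omega>) \<and> 1 / (\<kappa> + real m - 1) * (\<Sum>i=1..m. t m i \<omega>) \<le> 1"
    if m: "m \<in> {1..M}" for m
  proof -
    have "0 < \<kappa> + real m - 1" using m \<kappa> by simp
    then show ?thesis using weight_bounds[OF m w] by (simp add: divide_le_eq)
  qed
  show "0 \<le> total_weight \<kappa> M t \<omega>" unfolding total_weight_def using * by (intro prod_nonneg) blast
  show "total_weight \<kappa> M t \<omega> \<le> 1" unfolding total_weight_def using * by (intro prod_le_1) blast
qed

lemma step_weight_eq:
  assumes m: "m \<in> {1..M}" and w: "\<omega> \<in> space \<Omega>" and n: "m \<le> Suc n"
  shows "step_weight m (U n \<omega>) = ennreal (\<Sum>i=1..m. t m i \<omega>)"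
proof -
  interpret S: prob_space "sample N" by (rule prob_space_sample)
  have *: "(\<Sum>i=1..m. t m i \<omega>) = (\<Sum>i\<in>{1..<m}. t m i \<omega>) + t m m \<omega>"
    using m by (simp add: sum.last_plus atLeastLessThanSuc_atLeastAtMost[symmetric] sum.atLeastLessThan_Suc add.commute)
  have h: "hit N (A m) (U n \<omega> i) = ennreal (t m i \<omega>) \<and> 0 \<le> t m i \<omega>" if i: "i \<in> {1..<m}" for i
  proof -
    have "u i \<omega> \<in> space M1" using u_space[of i \<omega>] w i m by auto
    then show ?thesis
      using i n prob_space_row(1)[of "u i \<omega>" "{1..N}"]
      by (simp add: hit_def U_def weights(1)[OF m w i] finite_measure.emeasure_eq_measure[OF prob_space.finite_measure])
  qed
  have "(\<Sum>i\<in>{1..<m}. hit N (A m) (U n \<omega> i)) = ennreal (\<Sum>i\<in>{1..<m}. t m i \<omega>)"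
    using h by (subst sum_ennreal[symmetric]) (auto intro!: sum.cong)
  moreover have "ennreal \<kappa> * emeasure (sample N) (A m) = ennreal (t m m \<omega>)"
    using \<kappa> by (simp add: weights(2)[OF m w] S.emeasure_eq_measure ennreal_mult)
  moreover have "0 \<le> t m m \<omega>" using \<kappa> by (simp add: weights(2)[OF m w])
  moreover have "0 \<le> (\<Sum>i\<in>{1..<m}. t m i \<omega>)" using h by (intro sum_nonneg) blast
  ultimately show ?thesis unfolding * by (simp add: step_weight_def ennreal_plus)
qed

lemma total_weight_eq: "\<omega> \<in> space \<Omega> \<Longrightarrow> ennreal (total_weight \<kappa> M t \<omega>) = partial_weight M (U M \<omega>)"
proof -
  assume w: "\<omega> \<in> space \<Omega>"
  have "0 \<le> 1 / (\<kappa> + real m - 1) * (\<Sum>i=1..m. t m i \<omega>)" if m: "m \<in> {1..M}" for m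
    using weight_bounds(1)[OF m w] m \<kappa> by (intro mult_nonneg_nonneg) auto
  then have "ennreal (total_weight \<kappa> M t \<omega>) = (\<Prod>m\<in>{1..M}. ennreal (1 / (\<kappa> + real m - 1) * (\<Sum>i=1..m. t m i \<omega>)))"
    unfolding total_weight_def by (intro prod_ennreal[symmetric])
  also have "\<dots> = partial_weight M (U M \<omega>)"
    unfolding partial_weight_def
  proof (rule prod.cong[OF refl])
    fix m assume m: "m \<in> {1..M}"
    then show "ennreal (1 / (\<kappa> + real m - 1) * (\<Sum>i=1..m. t m i \<omega>)) = ennreal (1 / (\<kappa> + real m - 1)) * step_weight m (U M \<omega>)"
    proof (subst step_weight_eq[OF m w])
      have "0 \<le> 1 / (\<kappa> + real m - 1)" using m \<kappa> by simp
      then show "ennreal (1 / (\<kappa> + real m - 1) * (\<Sum>i=1..m. t m i \<omega>)) = ennreal (1 / (\<kappa> + real m - 1)) * ennreal (\<Sum>i=1..m. t m i \<omega>)"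
        by (rule ennreal_mult')
    qed (use m in auto)
  qed
  finally show ?thesis .
qed

lemma measurable_step_weight:
  assumes "m \<in> {1..M}" "m \<le> Suc n"
  shows "step_weight m \<in> borel_measurable (\<Pi>\<^sub>M i\<in>{1..n}. M1)"
  unfolding step_weight_def using assms A
  by (intro borel_measurable_add borel_measurable_sum borel_measurable_const measurable_hit_coordinate) auto

lemma measurable_partial_weight:
  assumes "n \<le> M" "n \<le> Suc k"
  shows "partial_weight n \<in> borel_measurable (\<Pi>\<^sub>M i\<in>{1..k}. M1)"
  unfolding partial_weight_def using assms
  by (intro borel_measurable_prod_ennreal borel_measurable_times_ennreal borel_measurable_const measurable_step_weight) auto

lemma partial_weight_update: "partial_weight (Suc n) (z(Suc n := v)) = partial_weight n z * (ennreal (1 / (\<kappa> + real n)) * step_weight (Suc n) z)"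
proof -
  have s: "step_weight m (z(Suc n := v)) = step_weight m z" if "m \<le> Suc n" for m
    unfolding step_weight_def using that by (intro arg_cong2[where f="(+)"] sum.cong refl) auto
  have "{1..Suc n} = insert (Suc n) {1..n}" by auto
  then have "partial_weight (Suc n) (z(Suc n := v)) = (ennreal (1 / (\<kappa> + real n)) * step_weight (Suc n) z) *
      (\<Prod>m\<in>{1..n}. ennreal (1 / (\<kappa> + real m - 1)) * step_weight m (z(Suc n := v)))"
    unfolding partial_weight_def by (simp add: s)
  also have "(\<Prod>m\<in>{1..n}. ennreal (1 / (\<kappa> + real m - 1)) * step_weight m (z(Suc n := v))) = partial_weight n z"
    unfolding partial_weight_def by (intro prod.cong refl) (simp add: s)
  finally show ?thesis by (simp only: mult.commute)
qed

lemma append_measurable: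
  "z \<in> space (\<Pi>\<^sub>M i\<in>{1..n}. M1) \<Longrightarrow> f \<in> borel_measurable (\<Pi>\<^sub>M i\<in>{1..Suc n}. M1) \<Longrightarrow> (\<lambda>v. f (z(Suc n := v))) \<in> borel_measurable M1"
  using measurable_compose[OF measurable_compose[OF measurable_Pair1' measurable_append]] by simp

text \<open>
  Both sides are built by the same recursion. On the left, a step multiplies the weight by \<open>\<Sum>\<^sub>i t\<^sub>m\<^sub>i / (\<kappa> + m - 1)\<close> and
  draws from the simulation kernel; on the right, an urn step is weighted by the hit probability. These
  two operations are the same by \<open>nn_integral_simulation_kernel\<close>.
\<close>
theorem nn_integral_partial_weight:
  assumes "n \<le> M" "f \<in> borel_measurable (\<Pi>\<^sub>M i\<in>{1..n}. M1)"
  shows "(\<integral>\<^sup>+\<omega>. partial_weight n (U n \<omega>) * f (U n \<omega>) \<partial>\<Omega>)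
    = (\<integral>\<^sup>+x. (\<Prod>m\<in>{1..n}. hit N (A m) (x m)) * f x \<partial>urn n)"
  using assms
proof (induction n arbitrary: f)
  case 0
  have "U 0 \<omega> = (\<lambda>_. undefined)" for \<omega> by (auto simp: U_def)
  then show ?case
    using nn_integral_urn_0[OF 0(2)] by (simp add: partial_weight_def emeasure_space_1)
next
  case (Suc n)
  let ?m = "Suc n"
  have n: "n \<le> M" and m: "?m \<in> {1..M}" using Suc.prems by auto
  note f = Suc.prems(2)
  let ?K = "\<lambda>\<omega>. simulation_kernel \<epsilon> \<rho> N (uniform_measure (sample N) (A ?m)) ?m (\<lambda>i. t ?m i \<omega>) (\<lambda>i. u i \<omega>)"
  have idx: "{1..<?m} = {1..n}" by auto
  have law: "has_cond_law \<Omega> (u ?m) M1 (U n) (\<Pi>\<^sub>M i\<in>{1..n}. M1) ?K"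
    using law_u[OF m] unfolding idx U_def[abs_def] .
  have Kprob: "prob_space (?K \<omega>)" and Ksets: "sets (?K \<omega>) = sets M1" if "\<omega> \<in> space \<Omega>" for \<omega>
  proof -
    have "?K \<in> vimage_algebra (space \<Omega>) (U n) (\<Pi>\<^sub>M i\<in>{1..n}. M1) \<rightarrow>\<^sub>M prob_algebra M1"
      using law unfolding has_cond_law_def by blast
    from measurable_space[OF this, of \<omega>] that show "prob_space (?K \<omega>)" "sets (?K \<omega>) = sets M1"
      by (auto simp: space_prob_algebra)
  qed
  have app: "(\<lambda>p. (fst p)(?m := snd p)) \<in> (\<Pi>\<^sub>M i\<in>{1..n}. M1) \<Otimes>\<^sub>M M1 \<rightarrow>\<^sub>M (\<Pi>\<^sub>M i\<in>{1..?m}. M1)"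
    using measurable_append[of n M1] by (simp add: split_beta')
  define F where "F p = partial_weight ?m ((fst p)(?m := snd p)) * f ((fst p)(?m := snd p))" for p
  have F: "F \<in> borel_measurable ((\<Pi>\<^sub>M i\<in>{1..n}. M1) \<Otimes>\<^sub>M M1)"
    unfolding F_def using Suc.prems(1)
    by (intro borel_measurable_times_ennreal measurable_compose[OF app] measurable_partial_weight f) auto
  \<comment> \<open>The function \<open>f\<close> averaged over one hit-weighted urn step from \<open>z\<close>.\<close>
  define h where "h z = ennreal (1 / (\<kappa> + real n)) *
    ((\<integral>\<^sup>+v. f (z(?m := v)) * hit N (A ?m) v \<partial>cluster_base) + (\<Sum>i\<in>{1..<?m}. f (z(?m := z i)) * hit N (A ?m) (z i)))" for z
  interpret C: finite_measure cluster_base by (rule O.finite_base)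
  have h: "h \<in> borel_measurable (\<Pi>\<^sub>M i\<in>{1..n}. M1)"
    unfolding h_def
  proof (intro borel_measurable_times_ennreal borel_measurable_add borel_measurable_const borel_measurable_sum)
    have "(\<lambda>p. f ((fst p)(?m := snd p)) * hit N (A ?m) (snd p)) \<in> borel_measurable ((\<Pi>\<^sub>M i\<in>{1..n}. M1) \<Otimes>\<^sub>M M1)"
      by (intro borel_measurable_times_ennreal measurable_compose[OF app f] measurable_compose[OF measurable_snd measurable_hit] A m)
    then have "(\<lambda>(z, v). f (z(?m := v)) * hit N (A ?m) v) \<in> borel_measurable ((\<Pi>\<^sub>M i\<in>{1..n}. M1) \<Otimes>\<^sub>M cluster_base)"
      using measurable_cong_sets[OF sets_pair_measure_cong[OF refl sets_cluster_base] refl] by (simp add: split_beta') blast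
    then show "(\<lambda>z. \<integral>\<^sup>+v. f (z(?m := v)) * hit N (A ?m) v \<partial>cluster_base) \<in> borel_measurable (\<Pi>\<^sub>M i\<in>{1..n}. M1)"
      by (rule C.borel_measurable_nn_integral)
    fix i assume i: "i \<in> {1..<?m}"
    have "(\<lambda>z. (z, z i)) \<in> (\<Pi>\<^sub>M i\<in>{1..n}. M1) \<rightarrow>\<^sub>M (\<Pi>\<^sub>M i\<in>{1..n}. M1) \<Otimes>\<^sub>M M1"
      using i by (intro measurable_Pair measurable_ident measurable_component_singleton) auto
    from measurable_compose[OF measurable_compose[OF this app] f]
    show "(\<lambda>z. f (z(?m := z i))) \<in> borel_measurable (\<Pi>\<^sub>M i\<in>{1..n}. M1)" by (simp only: fst_conv snd_conv)
    show "(\<lambda>z. hit N (A ?m) (z i)) \<in> borel_measurable (\<Pi>\<^sub>M i\<in>{1..n}. M1)"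
      using i by (intro measurable_hit_coordinate A m) auto
  qed
  have "(\<integral>\<^sup>+\<omega>. partial_weight ?m (U ?m \<omega>) * f (U ?m \<omega>) \<partial>\<Omega>) = (\<integral>\<^sup>+\<omega>. F (U n \<omega>, u ?m \<omega>) \<partial>\<Omega>)"
  proof (rule nn_integral_cong)
    fix \<omega>
    have "U ?m \<omega> = (U n \<omega>)(?m := u ?m \<omega>)" by (auto simp: U_def fun_eq_iff le_Suc_eq)
    then show "partial_weight ?m (U ?m \<omega>) * f (U ?m \<omega>) = F (U n \<omega>, u ?m \<omega>)" by (simp add: F_def)
  qed
  also have "\<dots> = (\<integral>\<^sup>+\<omega>. \<integral>\<^sup>+v. F (U n \<omega>, v) \<partial>?K \<omega> \<partial>\<Omega>)"
    by (rule cond_law_nn_integral[OF prob_space_axioms law F])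
  also have "\<dots> = (\<integral>\<^sup>+\<omega>. partial_weight n (U n \<omega>) * h (U n \<omega>) \<partial>\<Omega>)"
  proof (rule nn_integral_cong)
    fix \<omega> assume w: "\<omega> \<in> space \<Omega>"
    define g where "g v = f ((U n \<omega>)(?m := v))" for v
    have g: "g \<in> borel_measurable M1"
      unfolding g_def by (rule append_measurable[OF measurable_space[OF U_measurable[OF n] w] f])
    then have gK: "g \<in> borel_measurable (?K \<omega>)" using measurable_cong_sets[OF Ksets[OF w] refl] by blast
    have "(\<integral>\<^sup>+v. F (U n \<omega>, v) \<partial>?K \<omega>)
        = (\<integral>\<^sup>+v. partial_weight n (U n \<omega>) * (ennreal (1 / (\<kappa> + real n)) * step_weight ?m (U n \<omega>)) * g v \<partial>?K \<omega>)"
      by (simp add: F_def g_def partial_weight_update)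
    also have "\<dots> = partial_weight n (U n \<omega>) * (ennreal (1 / (\<kappa> + real n)) * (step_weight ?m (U n \<omega>) * (\<integral>\<^sup>+v. g v \<partial>?K \<omega>)))"
      using gK by (simp add: nn_integral_cmult mult.assoc)
    also have "step_weight ?m (U n \<omega>) * (\<integral>\<^sup>+v. g v \<partial>?K \<omega>)
        = (\<integral>\<^sup>+v. g v * hit N (A ?m) v \<partial>cluster_base) + (\<Sum>i\<in>{1..<?m}. g (u i \<omega>) * hit N (A ?m) (u i \<omega>))"
      unfolding step_weight_eq[OF m w order_refl]
    proof (rule nn_integral_simulation_kernel[OF A[OF m] g])
      show "prob_space (?K \<omega>)" by (rule Kprob[OF w])
    qed (use weights[OF m w] u_space[OF _ w] m in auto)
    also have "(\<Sum>i\<in>{1..<?m}. g (u i \<omega>) * hit N (A ?m) (u i \<omega>)) = (\<Sum>i\<in>{1..<?m}. g (U n \<omega> i) * hit N (A ?m) (U n \<omega> i))"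
      by (intro sum.cong) (auto simp: U_def)
    finally show "(\<integral>\<^sup>+v. F (U n \<omega>, v) \<partial>?K \<omega>) = partial_weight n (U n \<omega>) * h (U n \<omega>)"
      unfolding h_def g_def .
  qed
  also have "\<dots> = (\<integral>\<^sup>+x. (\<Prod>m\<in>{1..n}. hit N (A m) (x m)) * h x \<partial>urn n)"
    by (rule Suc.IH[OF n h])
  also have "\<dots> = (\<integral>\<^sup>+x. (\<Prod>m\<in>{1..?m}. hit N (A m) (x m)) * f x \<partial>urn ?m)"
  proof -
    define G where "G x = (\<Prod>m\<in>{1..?m}. hit N (A m) (x m)) * f x" for x
    have G: "G \<in> borel_measurable (\<Pi>\<^sub>M i\<in>{1..?m}. M1)"
      unfolding G_def using Suc.prems(1) A
      by (intro borel_measurable_times_ennreal borel_measurable_prod_ennreal measurable_hit_coordinate f) auto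
    have G_up: "G (x(?m := z)) = (\<Prod>m\<in>{1..n}. hit N (A m) (x m)) * (f (x(?m := z)) * hit N (A ?m) z)" for x z
    proof -
      have "{1..?m} = insert ?m {1..n}" by auto
      then have "(\<Prod>m\<in>{1..?m}. hit N (A m) ((x(?m := z)) m)) = hit N (A ?m) z * (\<Prod>m\<in>{1..n}. hit N (A m) ((x(?m := z)) m))"
        by simp
      also have "(\<Prod>m\<in>{1..n}. hit N (A m) ((x(?m := z)) m)) = (\<Prod>m\<in>{1..n}. hit N (A m) (x m))"
        by (intro prod.cong) auto
      finally show ?thesis unfolding G_def by (simp only: mult_ac)
    qed
    have "(\<integral>\<^sup>+x. G x \<partial>urn ?m) = (\<integral>\<^sup>+x. ennreal (1 / (\<kappa> + n)) * ((\<integral>\<^sup>+z. G (x(?m := z)) \<partial>cluster_base) + (\<Sum>i=1..n. G (x(?m := x i)))) \<partial>urn n)"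
      by (rule nn_integral_urn_Suc[OF G])
    also have "\<dots> = (\<integral>\<^sup>+x. (\<Prod>m\<in>{1..n}. hit N (A m) (x m)) * h x \<partial>urn n)"
    proof (rule nn_integral_cong)
      fix x assume "x \<in> space (urn n)"
      then have x: "x \<in> space (\<Pi>\<^sub>M i\<in>{1..n}. M1)"
        using sets_eq_imp_space_eq[OF O.sets_sample_law[of n]] sets_eq_imp_space_eq[OF sets_PiM_cluster_base[of "{1..n}"]] by simp
      have "(\<lambda>z. f (x(?m := z)) * hit N (A ?m) z) \<in> borel_measurable cluster_base"
        unfolding measurable_cluster_base by (intro borel_measurable_times_ennreal append_measurable[OF x f] measurable_hit A m)
      then have "(\<integral>\<^sup>+z. G (x(?m := z)) \<partial>cluster_base) = (\<Prod>m\<in>{1..n}. hit N (A m) (x m)) * (\<integral>\<^sup>+z. f (x(?m := z)) * hit N (A ?m) z \<partial>cluster_base)"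
        unfolding G_up by (rule nn_integral_cmult)
      moreover have "(\<Sum>i=1..n. G (x(?m := x i))) = (\<Prod>m\<in>{1..n}. hit N (A m) (x m)) * (\<Sum>i\<in>{1..<?m}. f (x(?m := x i)) * hit N (A ?m) (x i))"
        unfolding G_up idx by (rule sum_distrib_left[symmetric])
      ultimately show "ennreal (1 / (\<kappa> + n)) * ((\<integral>\<^sup>+z. G (x(?m := z)) \<partial>cluster_base) + (\<Sum>i=1..n. G (x(?m := x i))))
        = (\<Prod>m\<in>{1..n}. hit N (A m) (x m)) * h x"
        unfolding h_def by (simp only: distrib_left mult_ac)
    qed
    finally show ?thesis by (simp only: G_def)
  qed
  finally show ?case .
qed

text \<open>
  Unbiasedness of the weighted simulation: both sides are integrals over the hit-weighted urn.
\<close>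
corollary expectation_total_weight:
  assumes B: "B \<in> sets (\<Pi>\<^sub>M i\<in>{1..M}. M1)"
  shows "expectation (\<lambda>\<omega>. total_weight \<kappa> M t \<omega> * indicator B (U M \<omega>))
    = prob {\<omega>\<in>space \<Omega>. initial M \<omega> \<in> B \<and> (\<forall>m\<in>{1..M}. row \<xi> m N \<omega> \<in> A m)}"
proof -
  let ?E = "{\<omega>\<in>space \<Omega>. \<forall>m\<in>{1..M}. row \<xi> m N \<omega> \<in> A m}"
  have row: "{\<omega>\<in>space \<Omega>. row \<xi> m N \<omega> \<in> A m} \<in> events" if "m \<in> {1..M}" for m
    using measurable_sets[OF measurable_row A[OF that]] that by (simp add: vimage_def Int_def conj_commute)
  then have E: "?E \<in> events" by (intro sets.sets_Collect_finite_All) auto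
  have BE: "{\<omega>\<in>space \<Omega>. initial M \<omega> \<in> B \<and> (\<forall>m\<in>{1..M}. row \<xi> m N \<omega> \<in> A m)} = (initial M -` B \<inter> space \<Omega>) \<inter> ?E"
    by auto
  have BEm: "(initial M -` B \<inter> space \<Omega>) \<inter> ?E \<in> events" by (intro sets.Int E measurable_sets[OF measurable_initial B])
  have "(\<integral>\<^sup>+\<omega>. ennreal (total_weight \<kappa> M t \<omega> * indicator B (U M \<omega>)) \<partial>\<Omega>)
      = (\<integral>\<^sup>+\<omega>. partial_weight M (U M \<omega>) * indicator B (U M \<omega>) \<partial>\<Omega>)"
    using total_weight_bounds by (intro nn_integral_cong) (simp add: total_weight_eq[symmetric] ennreal_mult ennreal_indicator)
  also have "\<dots> = (\<integral>\<^sup>+x. (\<Prod>m\<in>{1..M}. hit N (A m) (x m)) * indicator B x \<partial>urn M)"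
    using B by (intro nn_integral_partial_weight) auto
  also have "\<dots> = (\<integral>\<^sup>+\<omega>. indicator B (initial M \<omega>) * indicator ?E \<omega> \<partial>\<Omega>)"
    using nn_integral_initial_rows[where f="indicator B" and M=M and N=N and A=A] A B by (simp add: mult.commute)
  also have "\<dots> = (\<integral>\<^sup>+\<omega>. indicator ((initial M -` B \<inter> space \<Omega>) \<inter> ?E) \<omega> \<partial>\<Omega>)"
    by (intro nn_integral_cong) (auto simp: indicator_def)
  also have "\<dots> = ennreal (prob ((initial M -` B \<inter> space \<Omega>) \<inter> ?E))"
    using BEm by (simp add: emeasure_eq_measure)
  finally have "(\<integral>\<^sup>+\<omega>. ennreal (total_weight \<kappa> M t \<omega> * indicator B (U M \<omega>)) \<partial>\<Omega>) = ennreal (prob ((initial M -` B \<inter> space \<Omega>) \<inter> ?E))" .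
  moreover have "(\<lambda>\<omega>. total_weight \<kappa> M t \<omega> * indicator B (U M \<omega>)) \<in> borel_measurable \<Omega>"
  proof (subst measurable_cong)
    show "total_weight \<kappa> M t \<omega> * indicator B (U M \<omega>) = enn2real (partial_weight M (U M \<omega>)) * indicator B (U M \<omega>)" if "\<omega> \<in> space \<Omega>" for \<omega>
      using total_weight_eq[OF that] total_weight_bounds(1)[OF that] by (metis enn2real_ennreal)
    show "(\<lambda>\<omega>. enn2real (partial_weight M (U M \<omega>)) * indicator B (U M \<omega>)) \<in> borel_measurable \<Omega>"
      by (intro borel_measurable_times measurable_compose[OF U_measurable[OF order_refl] borel_measurable_indicator[OF B]]
          measurable_compose[OF measurable_compose[OF U_measurable[OF order_refl] measurable_partial_weight] borel_measurable_enn2real]) auto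
  qed
  ultimately show ?thesis
    using total_weight_bounds unfolding BE by (subst integral_eq_nn_integral) (auto intro!: AE_I2)
qed

end

section \<open>Weak convergence of weighted empirical measures\<close>

lemma nn_integral_weighted_empirical:
  assumes f: "f \<in> borel_measurable L" and z: "\<And>k. k \<ge> 1 \<Longrightarrow> z k \<in> space L"
  shows "(\<integral>\<^sup>+x. f x \<partial>weighted_empirical L V z K) = ennreal (1 / (\<Sum>k=1..K. V k)) * (\<Sum>k=1..K. ennreal (V k) * f (z k))"
proof -
  have "(\<integral>\<^sup>+x. f x \<partial>weighted_empirical L V z K) = ennreal (1 / (\<Sum>k=1..K. V k)) *
      (\<integral>\<^sup>+x. f x \<partial>measure_sum L {1..K} (\<lambda>k. scale_measure (ennreal (V k)) (return L (z k))))"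
    unfolding weighted_empirical_def
    using f measurable_cong_sets[OF sets_measure_sum refl] by (intro nn_integral_scale_measure) blast
  also have "(\<integral>\<^sup>+x. f x \<partial>measure_sum L {1..K} (\<lambda>k. scale_measure (ennreal (V k)) (return L (z k))))
      = (\<Sum>k=1..K. \<integral>\<^sup>+x. f x \<partial>scale_measure (ennreal (V k)) (return L (z k)))"
    using f by (intro nn_integral_measure_sum) simp_all
  also have "\<dots> = (\<Sum>k=1..K. ennreal (V k) * f (z k))"
    using f z by (intro sum.cong refl) (simp add: nn_integral_scale_measure nn_integral_return)
  finally show ?thesis .
qed

lemma sets_weighted_empirical: "sets (weighted_empirical L V z K) = sets L"
  by (simp add: weighted_empirical_def)

lemma space_weighted_empirical: "space (weighted_empirical L V z K) = space L"
  by (rule sets_eq_imp_space_eq[OF sets_weighted_empirical])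

lemma weighted_empirical_prob:
  assumes z: "\<And>k. k \<ge> 1 \<Longrightarrow> z k \<in> space L" and V: "\<And>k. k \<ge> 1 \<Longrightarrow> 0 \<le> V k" "0 < (\<Sum>k=1..K. V k)"
  shows "weighted_empirical L V z K \<in> space (prob_algebra L)"
proof -
  have "emeasure (weighted_empirical L V z K) (space L) = (\<integral>\<^sup>+x. 1 \<partial>weighted_empirical L V z K)"
    by (simp add: space_weighted_empirical)
  also have "\<dots> = ennreal (1 / (\<Sum>k=1..K. V k)) * (\<Sum>k=1..K. ennreal (V k) * 1)"
    by (rule nn_integral_weighted_empirical[OF _ z]) simp_all
  also have "(\<Sum>k=1..K. ennreal (V k) * 1) = ennreal (\<Sum>k=1..K. V k)"
    using V(1) by (subst sum_ennreal[symmetric]) auto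
  also have "ennreal (1 / (\<Sum>k=1..K. V k)) * \<dots> = 1" using V(2) by (simp add: ennreal_mult'[symmetric])
  finally have "prob_space (weighted_empirical L V z K)"
    by (intro prob_spaceI) (simp add: space_weighted_empirical)
  then show ?thesis by (simp add: space_prob_algebra sets_weighted_empirical)
qed

lemma integral_weighted_empirical:
  assumes f: "f \<in> borel_measurable L" and C: "\<And>x. x \<in> space L \<Longrightarrow> \<bar>f x\<bar> \<le> C"
    and z: "\<And>k. k \<ge> 1 \<Longrightarrow> z k \<in> space L" and V: "\<And>k. k \<ge> 1 \<Longrightarrow> 0 \<le> V k" "0 < (\<Sum>k=1..K. V k)"
  shows "(\<integral>x. f x \<partial>weighted_empirical L V z K) = weighted_average V (\<lambda>k. f (z k)) K"
proof -
  let ?W = "weighted_empirical L V z K"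
  interpret prob_space ?W using weighted_empirical_prob[OF z V] by (simp add: space_prob_algebra)
  have fW: "f \<in> borel_measurable ?W" using f measurable_cong_sets[OF sets_weighted_empirical refl] by blast
  have int: "integrable ?W f"
    by (rule integrable_const_bound[where B=C]) (use C fW space_weighted_empirical[of L V z K] in auto)
  have fC: "0 \<le> f (z k) + C" if "k \<ge> 1" for k using C[OF z[OF that]] by linarith
  have "(\<integral>x. f x + C \<partial>?W) = enn2real (\<integral>\<^sup>+x. ennreal (f x + C) \<partial>?W)"
  proof (rule integral_eq_nn_integral)
    show "AE x in ?W. 0 \<le> f x + C"
      using C space_weighted_empirical[of L V z K] by (intro AE_I2) (fastforce simp: abs_le_iff)
  qed (use fW in simp)
  also have "(\<integral>\<^sup>+x. ennreal (f x + C) \<partial>?W) = ennreal (1 / (\<Sum>k=1..K. V k)) * (\<Sum>k=1..K. ennreal (V k) * ennreal (f (z k) + C))"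
    using f by (intro nn_integral_weighted_empirical z) simp_all
  also have "(\<Sum>k=1..K. ennreal (V k) * ennreal (f (z k) + C)) = (\<Sum>k=1..K. ennreal (V k * (f (z k) + C)))"
    using V(1) by (intro sum.cong refl) (simp add: ennreal_mult')
  also have "\<dots> = ennreal (\<Sum>k=1..K. V k * (f (z k) + C))"
    using V(1) fC by (intro sum_ennreal) simp
  also have "ennreal (1 / (\<Sum>k=1..K. V k)) * \<dots> = ennreal (weighted_average V (\<lambda>k. f (z k) + C) K)"
    using V(2) by (simp add: weighted_average_def ennreal_mult'[symmetric])
  also have "enn2real \<dots> = weighted_average V (\<lambda>k. f (z k) + C) K"
    using V fC by (intro enn2real_ennreal) (auto simp: weighted_average_def intro!: divide_nonneg_pos sum_nonneg)
  also have "\<dots> = weighted_average V (\<lambda>k. f (z k)) K + C"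
    using weighted_average_affine[of V K 1 "\<lambda>k. f (z k)" C] V(2) by simp
  finally show ?thesis using int by (simp add: prob_space)
qed

lemma continuous_map_borel_of_measurable:
  assumes "continuous_map Y euclideanreal g"
  shows "g \<in> borel_measurable (borel_of Y)"
proof (rule borel_measurableI)
  fix S :: "real set" assume "open S"
  then have "openin Y {x \<in> topspace Y. g x \<in> S}"
    using assms by (intro openin_continuous_map_preimage[OF assms]) simp
  moreover have "g -` S \<inter> space (borel_of Y) = {x \<in> topspace Y. g x \<in> S}" by (auto simp: space_borel_of)
  ultimately show "g -` S \<inter> space (borel_of Y) \<in> sets (borel_of Y)"
    unfolding sets_borel_of by (auto intro: sigma_sets.Basic)
qed

text \<open>
  The mapping theorem, for maps \<open>\<Phi>\<close> such that the preimages of open sets are open up to null sets: a bounded continuous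
  function of \<open>\<Phi>\<close> then satisfies the hypotheses of the portmanteau argument.
\<close>
lemma (in weighted_points) weakly_converges_image:
  assumes \<Phi>: "\<Phi> \<in> Q \<rightarrow>\<^sub>M borel_of Y"
    and cont: "\<And>W. openin Y W \<Longrightarrow> prob {p\<in>space Q. \<Phi> p \<in> W} \<le> prob (X interior_of {p\<in>topspace X. \<Phi> p \<in> W})"
  shows "weakly_converges Y (weighted_empirical (borel_of Y) V (\<lambda>k. \<Phi> (z k))) (distr Q (borel_of Y) \<Phi>)"
  unfolding weakly_converges_def
proof (intro conjI allI impI; (elim conjE)?)
  show "distr Q (borel_of Y) \<Phi> \<in> space (prob_algebra (borel_of Y))"
    using prob_space_distr[OF \<Phi>] by (simp add: space_prob_algebra)
  have z: "\<Phi> (z k) \<in> space (borel_of Y)" if "k \<ge> 1" for k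
    using measurable_space[OF \<Phi>] z_space[OF that] space_Q by simp
  show "\<forall>\<^sub>F K in sequentially. weighted_empirical (borel_of Y) V (\<lambda>k. \<Phi> (z k)) K \<in> space (prob_algebra (borel_of Y))"
    using V_pos by eventually_elim (rule weighted_empirical_prob[OF z V_nonneg])
  fix g assume g: "continuous_map Y euclideanreal g" and "bounded (g ` topspace Y)"
  then obtain C where C: "\<And>y. y \<in> topspace Y \<Longrightarrow> \<bar>g y\<bar> \<le> C" by (auto simp: bounded_iff)
  have gm: "g \<in> borel_measurable (borel_of Y)" by (rule continuous_map_borel_of_measurable[OF g])
  have \<Phi>_space: "\<Phi> p \<in> topspace Y" if "p \<in> topspace X" for p
    using measurable_space[OF \<Phi>, of p] that by (simp add: space_Q space_borel_of)
  have lev: "prob {p\<in>space Q. g (\<Phi> p) \<in> S} \<le> prob (X interior_of {p\<in>topspace X. g (\<Phi> p) \<in> S})" if "open S" for S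
  proof -
    have "openin Y {y \<in> topspace Y. g y \<in> S}"
      using that by (intro openin_continuous_map_preimage[OF g]) simp
    from cont[OF this] show ?thesis using \<Phi>_space by (simp add: space_Q cong: conj_cong)
  qed
  have "(\<lambda>K. weighted_average V (\<lambda>k. g (\<Phi> (z k))) K) \<longlonglongrightarrow> (\<integral>p. g (\<Phi> p) \<partial>Q)"
  proof (rule weighted_average_tendsto)
    show "(\<lambda>p. g (\<Phi> p)) \<in> borel_measurable Q" by (rule measurable_compose[OF \<Phi> gm])
    show "\<bar>g (\<Phi> p)\<bar> \<le> C" if "p \<in> topspace X" for p using C[OF \<Phi>_space[OF that]] .
    show "prob {p\<in>space Q. a < g (\<Phi> p)} \<le> prob (X interior_of {p\<in>topspace X. a < g (\<Phi> p)})" for a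
      using lev[of "{a<..}"] by simp
    show "prob {p\<in>space Q. g (\<Phi> p) < a} \<le> prob (X interior_of {p\<in>topspace X. g (\<Phi> p) < a})" for a
      using lev[of "{..<a}"] by simp
  qed
  then have "(\<lambda>K. weighted_average V (\<lambda>k. g (\<Phi> (z k))) K) \<longlonglongrightarrow> (\<integral>y. g y \<partial>distr Q (borel_of Y) \<Phi>)"
    by (simp add: integral_distr[OF \<Phi> gm])
  moreover have "\<forall>\<^sub>F K in sequentially. weighted_average V (\<lambda>k. g (\<Phi> (z k))) K = (\<integral>y. g y \<partial>weighted_empirical (borel_of Y) V (\<lambda>k. \<Phi> (z k)) K)"
    using V_pos
  proof eventually_elim
    case (elim K)
    then show ?case using C z V_nonneg by (intro integral_weighted_empirical[symmetric, where C=C] gm) (auto simp: space_borel_of)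
  qed
  ultimately show "(\<lambda>K. \<integral>y. g y \<partial>weighted_empirical (borel_of Y) V (\<lambda>k. \<Phi> (z k)) K) \<longlonglongrightarrow> (\<integral>y. g y \<partial>distr Q (borel_of Y) \<Phi>)"
    by (rule Lim_transform_eventually)
qed

lemma borel_of_euclidean: "borel_of (euclidean :: 'b::topological_space topology) = borel"
  unfolding borel_of_def borel_def by simp

lemma measurable_borel_of_M1_power:
  fixes f :: "'w \<Rightarrow> nat \<Rightarrow> 's::{metric_space, second_countable_topology} measure"
  assumes "f \<in> N \<rightarrow>\<^sub>M (\<Pi>\<^sub>M m\<in>{1..M}. prob_algebra borel)"
  shows "f \<in> N \<rightarrow>\<^sub>M borel_of (M1_power M)"
proof (rule measurableI)
  show "f x \<in> space (borel_of (M1_power M))" if "x \<in> space N" for x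
    using measurable_space[OF assms that] unfolding space_borel_of topspace_M1_power .
  show "f -` B \<inter> space N \<in> sets N" if "B \<in> sets (borel_of (M1_power M))" for B
    using measurable_sets[OF assms] that borel_of_M1_power_subset by blast
qed

lemma (in prob_space) measure_conditional_law:
  assumes Z: "Z \<in> M \<rightarrow>\<^sub>M L" and E: "E \<in> events" "0 < prob E" and B: "B \<in> sets L"
  shows "measure (distr (uniform_measure M E) L Z) B = prob (E \<inter> (Z -` B \<inter> space M)) / prob E"
proof -
  have Z': "Z \<in> uniform_measure M E \<rightarrow>\<^sub>M L" using Z measurable_cong_sets[OF sets_uniform_measure refl] by blast
  have "measure (distr (uniform_measure M E) L Z) B = measure (uniform_measure M E) (Z -` B \<inter> space M)"
    using measure_distr[OF Z' B] by simp
  also have "\<dots> = prob (E \<inter> (Z -` B \<inter> space M)) / prob E"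
    using E measurable_sets[OF Z B] by (intro measure_uniform_measure) (auto simp: emeasure_eq_measure)
  finally show ?thesis .
qed

text \<open>
  Apply the strong law to \<open>V\<^sub>k 1\<^sub>B(z\<^sub>k)\<close> for the countably many finite unions \<open>B\<close> of members of \<open>\<C>\<close> and for the whole space. The
  whole space gives the limit \<open>P(E)\<close> of the denominators, and dividing yields the conditional law given \<open>E\<close>.
\<close>
lemma (in prob_space) AE_weighted_points:
  fixes V :: "nat \<Rightarrow> 'a \<Rightarrow> real" and z :: "nat \<Rightarrow> 'a \<Rightarrow> 'c" and X :: "'c topology"
  assumes Z: "Z \<in> M \<rightarrow>\<^sub>M L" and E: "E \<in> events" "0 < prob E"
    and L: "space L = topspace X" and C: "countable \<C>" "\<C> \<subseteq> sets L"
    and basis: "\<And>U p. openin X U \<Longrightarrow> p \<in> U \<Longrightarrow> \<exists>C\<in>\<C>. p \<in> C \<and> C \<subseteq> U"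
    and V: "\<And>k \<omega>. k \<ge> 1 \<Longrightarrow> \<omega> \<in> space M \<Longrightarrow> 0 \<le> V k \<omega> \<and> V k \<omega> \<le> 1"
    and z: "\<And>k \<omega>. k \<ge> 1 \<Longrightarrow> \<omega> \<in> space M \<Longrightarrow> z k \<omega> \<in> space L"
    and indep: "\<And>B. B \<in> sets L \<Longrightarrow> indep_vars (\<lambda>_. borel) (\<lambda>k \<omega>. V k \<omega> * indicator B (z k \<omega>)) {1..}"
    and mean: "\<And>B k. B \<in> sets L \<Longrightarrow> k \<ge> 1 \<Longrightarrow> expectation (\<lambda>\<omega>. V k \<omega> * indicator B (z k \<omega>)) = prob (E \<inter> (Z -` B \<inter> space M))"
  shows "AE \<omega> in M. weighted_points X (distr (uniform_measure M E) L Z) \<C> (\<lambda>k. V k \<omega>) (\<lambda>k. z k \<omega>)"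
proof -
  define Q where "Q = distr (uniform_measure M E) L Z"
  have E0: "emeasure M E \<noteq> 0" "emeasure M E \<noteq> \<infinity>" using E by (auto simp: emeasure_eq_measure)
  have Z': "Z \<in> uniform_measure M E \<rightarrow>\<^sub>M L" using Z measurable_cong_sets[OF sets_uniform_measure refl] by blast
  have prob_Q: "prob_space Q"
    unfolding Q_def by (rule prob_space.prob_space_distr[OF prob_space_uniform_measure[OF E0] Z'])
  have Q: "measure Q B = prob (E \<inter> (Z -` B \<inter> space M)) / prob E" if "B \<in> sets L" for B
    unfolding Q_def by (rule measure_conditional_law[OF Z E that])
  define \<U> where "\<U> = insert (space L) (Union ` {J. finite J \<and> J \<subseteq> \<C>})"
  have cU: "countable \<U>" unfolding \<U>_def using countable_Collect_finite_subset[OF C(1)] by auto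
  have UL: "\<U> \<subseteq> sets L" unfolding \<U>_def using C(2) by (auto intro!: sets.finite_Union)
  have "AE \<omega> in M. \<forall>B\<in>\<U>. (\<lambda>K. (\<Sum>k=1..K. V k \<omega> * indicator B (z k \<omega>)) / real K) \<longlonglongrightarrow> prob (E \<inter> (Z -` B \<inter> space M))"
  proof (subst AE_ball_countable[OF cU], intro ballI)
    fix B assume "B \<in> \<U>"
    then have B: "B \<in> sets L" using UL by auto
    show "AE \<omega> in M. (\<lambda>K. (\<Sum>k=1..K. V k \<omega> * indicator B (z k \<omega>)) / real K) \<longlonglongrightarrow> prob (E \<inter> (Z -` B \<inter> space M))"
      by (rule bounded_strong_law[OF indep[OF B] _ mean[OF B]]) (use V in \<open>auto simp: indicator_def\<close>)
  qed
  then show ?thesis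
    using AE_space
  proof eventually_elim
    case (elim \<omega>)
    have conv: "(\<lambda>K. (\<Sum>k=1..K. V k \<omega> * indicator B (z k \<omega>)) / real K) \<longlonglongrightarrow> prob (E \<inter> (Z -` B \<inter> space M))" if "B \<in> \<U>" for B
      using elim(1) that by blast
    have "E \<inter> (Z -` space L \<inter> space M) = E"
      using sets.sets_into_space[OF E(1)] measurable_space[OF Z] by auto
    moreover have "(\<Sum>k=1..K. V k \<omega> * indicator (space L) (z k \<omega>)) = (\<Sum>k=1..K. V k \<omega>)" for K
      using z[OF _ elim(2)] by (intro sum.cong) auto
    ultimately have total: "(\<lambda>K. (\<Sum>k=1..K. V k \<omega>) / real K) \<longlonglongrightarrow> prob E"
      using conv[of "space L"] by (simp add: \<U>_def)
    have avg: "(\<lambda>K. weighted_average (\<lambda>k. V k \<omega>) (\<lambda>k. indicator B (z k \<omega>)) K) \<longlonglongrightarrow> measure Q B" if B: "B \<in> \<U>" for B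
    proof -
      have "(\<lambda>K. ((\<Sum>k=1..K. V k \<omega> * indicator B (z k \<omega>)) / real K) / ((\<Sum>k=1..K. V k \<omega>) / real K)) \<longlonglongrightarrow> prob (E \<inter> (Z -` B \<inter> space M)) / prob E"
        using E(2) by (intro tendsto_divide conv[OF B] total) simp
      also have "prob (E \<inter> (Z -` B \<inter> space M)) / prob E = measure Q B" using Q UL B by auto
      finally have "(\<lambda>K. ((\<Sum>k=1..K. V k \<omega> * indicator B (z k \<omega>)) / real K) / ((\<Sum>k=1..K. V k \<omega>) / real K)) \<longlonglongrightarrow> measure Q B" .
      moreover have "\<forall>\<^sub>F K in sequentially. ((\<Sum>k=1..K. V k \<omega> * indicator B (z k \<omega>)) / real K) / ((\<Sum>k=1..K. V k \<omega>) / real K)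
          = weighted_average (\<lambda>k. V k \<omega>) (\<lambda>k. indicator B (z k \<omega>)) K"
        using eventually_gt_at_top[of 0] by eventually_elim (simp add: weighted_average_def)
      ultimately show ?thesis by (rule Lim_transform_eventually)
    qed
    show ?case unfolding Q_def[symmetric]
    proof (rule weighted_points.intro)
      show "prob_space Q" by (rule prob_Q)
      show "space Q = topspace X" by (simp add: Q_def L)
      show "\<C> \<subseteq> sets Q" using C(2) by (simp add: Q_def)
      show "0 \<le> V k \<omega>" if "k \<ge> 1" for k using V[OF that elim(2)] by blast
      show "z k \<omega> \<in> topspace X" if "k \<ge> 1" for k using z[OF that elim(2)] L by simp
      have "\<forall>\<^sub>F K in sequentially. 0 < (\<Sum>k=1..K. V k \<omega>) / real K" using total E(2) by (rule order_tendstoD)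
      then show "\<forall>\<^sub>F K in sequentially. 0 < (\<Sum>k=1..K. V k \<omega>)"
        by eventually_elim (auto simp: zero_less_divide_iff)
      show "(\<lambda>K. weighted_average (\<lambda>k. V k \<omega>) (\<lambda>k. indicator (\<Union>J) (z k \<omega>)) K) \<longlonglongrightarrow> measure Q (\<Union>J)"
        if "finite J" "J \<subseteq> \<C>" for J
        using that by (intro avg) (auto simp: \<U>_def)
    qed (use C(1) basis in auto)
  qed
qed

section \<open>Convergence of the weighted simulations\<close>

theorem theorem4p1:
  fixes \<Omega> :: "'w measure"
    and \<kappa> \<epsilon> :: real
    and \<rho> :: "'s::polish_space measure"
    and \<pi> :: "'w \<Rightarrow> 's measure measure"
    and \<mu> :: "nat \<Rightarrow> 'w \<Rightarrow> 's measure"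
    and \<xi> :: "nat \<Rightarrow> nat \<Rightarrow> 'w \<Rightarrow> 's"
    and M N :: nat
    and T :: "'t set"
    and \<phi> :: "nat \<Rightarrow> (nat \<Rightarrow> 's) \<Rightarrow> 't"
    and y :: "nat \<Rightarrow> 't"
    and t :: "nat \<Rightarrow> nat \<Rightarrow> nat \<Rightarrow> 'w \<Rightarrow> real"
    and u :: "nat \<Rightarrow> nat \<Rightarrow> 'w \<Rightarrow> 's measure"
  assumes "prob_space \<Omega>"
    and "\<kappa> > 0" and "\<epsilon> > 0"
    and "\<rho> \<in> space (prob_algebra borel)"
    and "nested_dirichlet_process \<Omega> \<kappa> \<epsilon> \<rho> \<pi> \<mu> \<xi>"
    and "M \<ge> 1" and "N \<ge> 1"
    and "countable T"
    and "\<And>m. m \<in> {1..M} \<Longrightarrow> \<phi> m \<in> (\<Pi>\<^sub>M j\<in>{1..N}. borel) \<rightarrow>\<^sub>M count_space T"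
    and "y \<in> {1..M} \<rightarrow>\<^sub>E T"
    and "\<P>(\<omega> in \<Omega>. observation \<phi> \<xi> M N \<omega> = y) > 0"
    and "\<And>k. k \<ge> 1 \<Longrightarrow>
           weighted_simulation \<Omega> \<kappa> \<epsilon> \<rho> (row_law \<Omega> \<xi> N) (obs_set \<phi> N y) M N
             (observation \<phi> \<xi> M N) T (t k) (u k)"
    and "prob_space.indep_vars \<Omega> (\<lambda>k. simulation_space M) (\<lambda>k. simulation_pair M (t k) (u k)) {1..}"
  shows
    "(AE \<omega> in \<Omega>.
        weakly_converges (M1_power M)
          (weighted_empirical (borel_of (M1_power M))
             (\<lambda>k. total_weight \<kappa> M (t k) \<omega>) (\<lambda>k. \<lambda>m\<in>{1..M}. u k m \<omega>))
          (distr (uniform_measure \<Omega> {\<omega>\<in>space \<Omega>. observation \<phi> \<xi> M N \<omega> = y})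
             (borel_of (M1_power M)) (\<lambda>\<omega>. \<lambda>m\<in>{1..M}. \<mu> m \<omega>)))
     \<and> (\<forall>\<Phi> :: (nat \<Rightarrow> 's measure) \<Rightarrow> 'b::metric_space.
          \<Phi> \<in> borel_of (M1_power M) \<rightarrow>\<^sub>M borel \<and>
          \<P>(\<omega> in \<Omega>. (\<lambda>m\<in>{1..M}. \<mu> m \<omega>)
              \<notin> {p \<in> topspace (M1_power M). \<not> topcontinuous_at (M1_power M) euclidean \<Phi> p}
            \<bar> observation \<phi> \<xi> M N \<omega> = y) = 1 \<longrightarrow>
          (AE \<omega> in \<Omega>.
             weakly_converges euclidean
               (weighted_empirical borel
                  (\<lambda>k. total_weight \<kappa> M (t k) \<omega>) (\<lambda>k. \<Phi> (\<lambda>m\<in>{1..M}. u k m \<omega>)))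
               (distr (uniform_measure \<Omega> {\<omega>\<in>space \<Omega>. observation \<phi> \<xi> M N \<omega> = y})
                  borel (\<lambda>\<omega>. \<Phi> (\<lambda>m\<in>{1..M}. \<mu> m \<omega>)))))"
proof -
  interpret nested_model \<kappa> \<epsilon> \<rho> \<Omega> \<pi> \<mu> \<xi>
    using assms(1-5) by (simp add: nested_model_def nested_parameters_def nested_model_axioms_def)
  let ?L = "\<Pi>\<^sub>M m\<in>{1..M}. prob_algebra (borel :: 's measure)"
  let ?X = "M1_power M :: (nat \<Rightarrow> 's measure) topology"
  define A where "A = obs_set \<phi> N y"
  define E where "E = {\<omega>\<in>space \<Omega>. observation \<phi> \<xi> M N \<omega> = y}"
  have A: "A m \<in> sets (\<Pi>\<^sub>M j\<in>{1..N}. borel)" if m: "m \<in> {1..M}" for m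
  proof -
    have "y m \<in> T" using assms(10) m by auto
    then show ?thesis unfolding A_def obs_set_def by (intro measurable_sets[OF assms(9)[OF m]]) simp
  qed
  have row_A: "row \<xi> m N \<omega> \<in> A m \<longleftrightarrow> \<phi> m (row \<xi> m N \<omega>) = y m" if "m \<in> {1..M}" "\<omega> \<in> space \<Omega>" for m \<omega>
    using measurable_space[OF measurable_row] that by (auto simp: A_def obs_set_def)
  have obs: "observation \<phi> \<xi> M N \<omega> = y \<longleftrightarrow> (\<forall>m\<in>{1..M}. row \<xi> m N \<omega> \<in> A m)" if w: "\<omega> \<in> space \<Omega>" for \<omega>
  proof -
    have "observation \<phi> \<xi> M N \<omega> = y \<longleftrightarrow> (\<forall>m\<in>{1..M}. \<phi> m (row \<xi> m N \<omega>) = y m)"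
      using assms(10) by (auto simp: observation_def fun_eq_iff PiE_iff extensional_def)
    then show ?thesis using row_A[OF _ w] by simp
  qed
  have E_rows: "E = {\<omega>\<in>space \<Omega>. \<forall>m\<in>{1..M}. row \<xi> m N \<omega> \<in> A m}"
    unfolding E_def using obs by auto
  have E: "E \<in> events"
  proof -
    have "{\<omega>\<in>space \<Omega>. row \<xi> m N \<omega> \<in> A m} \<in> events" if "m \<in> {1..M}" for m
      using measurable_sets[OF measurable_row A[OF that]] that by (simp add: vimage_def Int_def conj_commute)
    then show ?thesis unfolding E_rows by (intro sets.sets_Collect_finite_All) auto
  qed
  have E_pos: "0 < prob E" using assms(11) by (simp add: E_def)
  have sim: "simulation \<kappa> \<epsilon> \<rho> \<Omega> \<pi> \<mu> \<xi> A M N (observation \<phi> \<xi> M N) T (t k) (u k)" if "k \<ge> 1" for k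
    using assms(12)[OF that] A nested_model_axioms
    by (simp add: simulation_def simulation_axioms_def row_law_eq_sample A_def)
  define V where "V k \<omega> = total_weight \<kappa> M (t k) \<omega>" for k \<omega>
  define z where "z k \<omega> = (\<lambda>m\<in>{1..M}. u k m \<omega>)" for k \<omega>
  have z_U: "z k \<omega> = simulation.U (u k) M \<omega>" if "k \<ge> 1" for k \<omega>
    unfolding z_def simulation.U_def[OF sim[OF that]] ..
  obtain \<C> :: "(nat \<Rightarrow> 's measure) set set" where C: "countable \<C>" "\<C> \<subseteq> sets ?L"
    and basis: "\<And>W p. openin ?X W \<Longrightarrow> p \<in> W \<Longrightarrow> \<exists>C\<in>\<C>. p \<in> C \<and> C \<subseteq> W"
    using M1_power_basic_sets by blast
  define Q where "Q = distr (uniform_measure \<Omega> E) ?L (initial M)"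
  have init': "initial M \<in> uniform_measure \<Omega> E \<rightarrow>\<^sub>M ?L"
    using measurable_initial measurable_cong_sets[OF sets_uniform_measure refl] by blast
  have points: "AE \<omega> in \<Omega>. weighted_points ?X Q \<C> (\<lambda>k. V k \<omega>) (\<lambda>k. z k \<omega>)"
    unfolding Q_def
  proof (rule AE_weighted_points[OF measurable_initial E E_pos topspace_M1_power[symmetric] C basis])
    show "0 \<le> V k \<omega> \<and> V k \<omega> \<le> 1" if "k \<ge> 1" "\<omega> \<in> space \<Omega>" for k \<omega>
      unfolding V_def using simulation.total_weight_bounds[OF sim[OF that(1)] that(2)] by blast
    show "z k \<omega> \<in> space ?L" if "k \<ge> 1" "\<omega> \<in> space \<Omega>" for k \<omega>
      unfolding z_U[OF that(1)] by (rule measurable_space[OF simulation.U_measurable[OF sim[OF that(1)] order_refl] that(2)])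
    show "indep_vars (\<lambda>_. borel) (\<lambda>k \<omega>. V k \<omega> * indicator B (z k \<omega>)) {1..}" if B: "B \<in> sets ?L" for B
    proof -
      \<comment> \<open>The weighted indicator as a function of the simulation pair, from which it inherits independence in \<open>k\<close>.\<close>
      define g where "g p = (\<Prod>m=1..M. 1 / (\<kappa> + real m - 1) * (\<Sum>i=1..m. fst p (m, i))) * indicator B (snd p)"
        for p :: "(nat \<times> nat \<Rightarrow> real) \<times> (nat \<Rightarrow> 's measure)"
      have "(\<lambda>p. fst p (m, i)) \<in> borel_measurable (simulation_space M :: ((nat \<times> nat \<Rightarrow> real) \<times> (nat \<Rightarrow> 's measure)) measure)"
        if "m \<in> {1..M}" "i \<in> {1..m}" for m i
        unfolding simulation_space_def
        by (rule measurable_compose[OF measurable_fst, of "\<lambda>x. x (m, i)"]) (rule measurable_component_singleton, use that in auto)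
      moreover have "(\<lambda>p. indicat_real B (snd p)) \<in> borel_measurable (simulation_space M)"
        unfolding simulation_space_def by (rule measurable_compose[OF measurable_snd borel_measurable_indicator[OF B]])
      ultimately have g: "g \<in> borel_measurable (simulation_space M)"
        unfolding g_def by (intro borel_measurable_times borel_measurable_prod borel_measurable_sum borel_measurable_const)
      have "indep_vars (\<lambda>_. borel) (\<lambda>k \<omega>. g (simulation_pair M (t k) (u k) \<omega>)) {1..}"
        by (rule indep_vars_compose2[OF assms(13)]) (rule g)
      moreover have "g (simulation_pair M (t k) (u k) \<omega>) = V k \<omega> * indicator B (z k \<omega>)" for k \<omega>
        unfolding g_def simulation_pair_def V_def z_def total_weight_def by simp
      ultimately show ?thesis by simp
    qed
    show "expectation (\<lambda>\<omega>. V k \<omega> * indicator B (z k \<omega>)) = prob (E \<inter> (initial M -` B \<inter> space \<Omega>))"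
      if B: "B \<in> sets ?L" and k: "k \<ge> 1" for B k
    proof -
      have "E \<inter> (initial M -` B \<inter> space \<Omega>) = {\<omega>\<in>space \<Omega>. initial M \<omega> \<in> B \<and> (\<forall>m\<in>{1..M}. row \<xi> m N \<omega> \<in> A m)}"
        unfolding E_rows by auto
      then show ?thesis
        unfolding V_def z_U[OF k] using simulation.expectation_total_weight[OF sim[OF k] B] by simp
    qed
  qed
  have space_Q: "space Q = topspace ?X" unfolding Q_def topspace_M1_power by simp
  have prob_Q: "measure Q B = prob (E \<inter> (initial M -` B \<inter> space \<Omega>)) / prob E" if B: "B \<in> sets ?L" for B
    unfolding Q_def by (rule measure_conditional_law[OF measurable_initial E E_pos B])
  have id_X: "(\<lambda>p. p) \<in> Q \<rightarrow>\<^sub>M borel_of ?X"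
    by (rule measurable_borel_of_M1_power) (simp add: Q_def)
  show ?thesis
  proof (intro conjI allI impI)
    have Q_id: "distr Q (borel_of ?X) (\<lambda>p. p) = distr (uniform_measure \<Omega> E) (borel_of ?X) (\<lambda>\<omega>. \<lambda>m\<in>{1..M}. \<mu> m \<omega>)"
      unfolding Q_def using id_X[unfolded Q_def] init'
      by (subst distr_distr) (auto simp: comp_def initial_def[abs_def])
    show "AE \<omega> in \<Omega>. weakly_converges ?X
          (weighted_empirical (borel_of ?X) (\<lambda>k. total_weight \<kappa> M (t k) \<omega>) (\<lambda>k. \<lambda>m\<in>{1..M}. u k m \<omega>))
          (distr (uniform_measure \<Omega> {\<omega>\<in>space \<Omega>. observation \<phi> \<xi> M N \<omega> = y})
             (borel_of ?X) (\<lambda>\<omega>. \<lambda>m\<in>{1..M}. \<mu> m \<omega>))"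
      using points
    proof eventually_elim
      case (elim \<omega>)
      interpret P: weighted_points ?X Q \<C> "\<lambda>k. V k \<omega>" "\<lambda>k. z k \<omega>" by (rule elim)
      have "weakly_converges ?X (weighted_empirical (borel_of ?X) (\<lambda>k. V k \<omega>) (\<lambda>k. z k \<omega>)) (distr Q (borel_of ?X) (\<lambda>p. p))"
      proof (rule P.weakly_converges_image[OF id_X])
        fix W assume W: "openin ?X W"
        then have "{p\<in>topspace ?X. p \<in> W} = W" using openin_subset[OF W] by blast
        then show "P.prob {p\<in>space Q. p \<in> W} \<le> P.prob (?X interior_of {p\<in>topspace ?X. p \<in> W})"
          using W by (simp add: space_Q interior_of_openin)
      qed
      then show ?case unfolding Q_id V_def z_def E_def .
    qed
  next
    fix \<Phi> :: "(nat \<Rightarrow> 's measure) \<Rightarrow> 'b"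
    let ?D = "{p \<in> topspace ?X. \<not> topcontinuous_at ?X euclidean \<Phi> p}"
    assume *: "\<Phi> \<in> borel_of ?X \<rightarrow>\<^sub>M borel \<and>
          \<P>(\<omega> in \<Omega>. (\<lambda>m\<in>{1..M}. \<mu> m \<omega>) \<notin> ?D \<bar> observation \<phi> \<xi> M N \<omega> = y) = 1"
    have \<Phi>: "\<Phi> \<in> Q \<rightarrow>\<^sub>M borel_of euclidean"
      unfolding borel_of_euclidean using measurable_compose[OF id_X conjunct1[OF *]] by simp
    have \<Phi>L: "\<Phi> \<in> ?L \<rightarrow>\<^sub>M borel"
      using \<Phi> unfolding borel_of_euclidean Q_def by simp
    define G where "G = {\<omega>\<in>space \<Omega>. initial M \<omega> \<notin> ?D \<and> observation \<phi> \<xi> M N \<omega> = y}"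
    have PG: "prob G = prob E"
      using conjunct2[OF *] E_pos unfolding cond_prob_def E_def[symmetric] G_def initial_def[symmetric]
      by (simp add: field_simps)
    \<comment> \<open>The discontinuity set itself is not known to be measurable, but a non-measurable \<open>G\<close> would be assigned probability zero.\<close>
    then have G: "G \<in> events" using E_pos measure_notin_sets by fastforce
    have GE: "G \<subseteq> E" by (auto simp: G_def E_def)
    have null: "prob (E - G) = 0" using finite_measure_Diff[OF E G GE] PG by simp
    have cont: "measure Q {p\<in>space Q. \<Phi> p \<in> W} \<le> measure Q (?X interior_of {p\<in>topspace ?X. \<Phi> p \<in> W})"
      if "openin euclidean W" for W
    proof -
      let ?W = "{p\<in>topspace ?X. \<Phi> p \<in> W}"
      have W: "open W" using that by simp
      have WL: "?W \<in> sets ?L"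
        using measurable_sets[OF \<Phi>L, of W] W unfolding topspace_M1_power by (simp add: vimage_def Int_def conj_commute)
      have IL: "?X interior_of ?W \<in> sets ?L" by (rule openin_M1_power_measurable) simp
      \<comment> \<open>A point of continuity in the preimage of an open set is an interior point of the preimage.\<close>
      have interior: "p \<in> ?X interior_of ?W" if p: "p \<in> ?W" "p \<notin> ?D" for p
      proof -
        have "topcontinuous_at ?X euclidean \<Phi> p" using p by auto
        then have "openin euclidean W \<and> \<Phi> p \<in> W \<longrightarrow> (\<exists>S. openin ?X S \<and> p \<in> S \<and> (\<forall>q\<in>S. \<Phi> q \<in> W))"
          unfolding topcontinuous_at_def by (elim conjE) (erule spec)
        then obtain S where S: "openin ?X S" "p \<in> S" "\<forall>q\<in>S. \<Phi> q \<in> W"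
          using p(1) W by auto
        then have "S \<subseteq> ?W" using openin_subset[OF S(1)] by blast
        with S show ?thesis by (auto simp: interior_of_def)
      qed
      have "E \<inter> (initial M -` ?W \<inter> space \<Omega>) \<subseteq> (E \<inter> (initial M -` (?X interior_of ?W) \<inter> space \<Omega>)) \<union> (E - G)"
        using interior by (auto simp: E_def G_def)
      then have "prob (E \<inter> (initial M -` ?W \<inter> space \<Omega>)) \<le> prob ((E \<inter> (initial M -` (?X interior_of ?W) \<inter> space \<Omega>)) \<union> (E - G))"
        using E G measurable_sets[OF measurable_initial IL] by (intro finite_measure_mono) auto
      also have "\<dots> \<le> prob (E \<inter> (initial M -` (?X interior_of ?W) \<inter> space \<Omega>)) + prob (E - G)"
        using E G measurable_sets[OF measurable_initial IL] by (intro measure_Un_le) auto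
      finally have "prob (E \<inter> (initial M -` ?W \<inter> space \<Omega>)) \<le> prob (E \<inter> (initial M -` (?X interior_of ?W) \<inter> space \<Omega>))"
        using null by simp
      then show ?thesis
        unfolding space_Q prob_Q[OF WL] prob_Q[OF IL] using E_pos by (simp add: divide_right_mono)
    qed
    have Q_\<Phi>: "distr Q (borel_of euclidean) \<Phi> = distr (uniform_measure \<Omega> E) borel (\<lambda>\<omega>. \<Phi> (\<lambda>m\<in>{1..M}. \<mu> m \<omega>))"
      unfolding Q_def borel_of_euclidean using \<Phi>L init'
      by (subst distr_distr) (auto simp: comp_def initial_def[abs_def])
    show "AE \<omega> in \<Omega>. weakly_converges euclidean
               (weighted_empirical borel (\<lambda>k. total_weight \<kappa> M (t k) \<omega>) (\<lambda>k. \<Phi> (\<lambda>m\<in>{1..M}. u k m \<omega>)))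
               (distr (uniform_measure \<Omega> {\<omega>\<in>space \<Omega>. observation \<phi> \<xi> M N \<omega> = y})
                  borel (\<lambda>\<omega>. \<Phi> (\<lambda>m\<in>{1..M}. \<mu> m \<omega>)))"
      using points
    proof eventually_elim
      case (elim \<omega>)
      interpret P: weighted_points ?X Q \<C> "\<lambda>k. V k \<omega>" "\<lambda>k. z k \<omega>" by (rule elim)
      have "weakly_converges euclidean (weighted_empirical (borel_of euclidean) (\<lambda>k. V k \<omega>) (\<lambda>k. \<Phi> (z k \<omega>))) (distr Q (borel_of euclidean) \<Phi>)"
        by (rule P.weakly_converges_image[OF \<Phi> cont])
      then show ?case
        unfolding Q_\<Phi> unfolding V_def z_def E_def borel_of_euclidean .
    qed
  qed
qed

end
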